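(* Let $A$ be an $(n-2)\times n$ integer matrix of rank $n-2$ with columns $a_1,\dots,a_n$ such that some $w\in\mathbb Q^{n-2}$ satisfies $w\cdot a_i=1$ for all $i$, and let $B$ be an $n\times2$ integer matrix with rows $b_1,\dots,b_n$ whose columns form a $\mathbb Z$-basis of $\ker_{\mathbb Z}(A)$. Assume $b_i\neq0$ for all $i$. Then the Newton polygon of the $A$-discriminant $D_A$ is the image of the polygon $Q_B$ under the affine isomorphism $v\mapsto(\overline v^{(1)},\dots,\overline v^{(n)})$.
   Context: A-discriminant: for $x\in(\mathbb C^* )^n$ let $f=\sum_{i=1}^n x_it^{a_i}$ (Laurent polynomial in $t_1,\dots,t_{n-2}$). If the closure of the set of $x$ for which $f$ has a multiple root in $(\mathbb C^* )^{n-2}$ is a hypersurface, $D_A$ is its irreducible defining polynomial in $\mathbb Z[x_1,\dots,x_n]$; otherwise $D_A=1$. The Newton polygon is the convex hull of exponent vectors of monomials of $D_A$. For $b,u\in\mathbb R^2$, $\det(b,u)=b_1u_2-b_2u_1$. A line through the origin is relevant if it contains two rows $b_r,b_s$ pointing in opposite directions; for a relevant line with primitive vector $v$, write the rows on it as $\lambda_jv$ ($\lambda_j\in\mathbb Z$), orient $v$ so that $\alpha_v=\sum_j\lambda_j\ge0$, and set $b_v=\alpha_vv$ (the sum of the rows on the line). $Q_B$ is the lattice polygon (unique up to translation) whose boundary, traversed counterclockwise, consists, as directed edges in counterclockwise cyclic order of direction, of all nonzero vectors $b_v$ ($v$ relevant) together with all rows $b_i$ not lying on a relevant line. For $i=1,\dots,n$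 let $\nu_i=\min\{\det(b_i,u):u\in Q_B\}$ and, for a lattice point $v\in Q_B$, $\overline v^{(i)}=\det(b_i,v)-\nu_i$. *)

theory Defs
  imports "HOL-Analysis.Analysis" "HOL-Library.Poly_Mapping" "HOL-Library.Multiset"
    "HOL-Computational_Algebra.Factorial_Ring"
begin

text \<open>A polynomial in Z[x_i : i in 'n] (resp. C[...]) is a finitely supported map from
  exponent vectors ('n =>0 nat) to coefficients; the ring structure is the one from
  HOL-Library.Poly_Mapping (convolution product).\<close>

definition mpoly_eval :: "(('n::finite \<Rightarrow>\<^sub>0 nat) \<Rightarrow>\<^sub>0 complex) \<Rightarrow> complex^'n \<Rightarrow> complex" where
  "mpoly_eval p x = (\<Sum>m\<in>Poly_Mapping.keys p. Poly_Mapping.lookup p m * (\<Prod>i\<in>UNIV. (x$i) ^ Poly_Mapping.lookup m i))"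

definition mpoly_zero_set :: "(('n::finite \<Rightarrow>\<^sub>0 nat) \<Rightarrow>\<^sub>0 complex) \<Rightarrow> (complex^'n) set" where
  "mpoly_zero_set p = {x. mpoly_eval p x = 0}"

definition int_to_cpoly :: "(('n::finite \<Rightarrow>\<^sub>0 nat) \<Rightarrow>\<^sub>0 int) \<Rightarrow> (('n \<Rightarrow>\<^sub>0 nat) \<Rightarrow>\<^sub>0 complex)" where
  "int_to_cpoly p = Poly_Mapping.map of_int p"

definition mpoly_nonconstant :: "(('n::finite \<Rightarrow>\<^sub>0 nat) \<Rightarrow>\<^sub>0 'a::zero) \<Rightarrow> bool" where
  "mpoly_nonconstant p \<longleftrightarrow> (\<exists>m\<in>Poly_Mapping.keys p. m \<noteq> 0)"

definition newton_polygon :: "(('n::finite \<Rightarrow>\<^sub>0 nat) \<Rightarrow>\<^sub>0 int) \<Rightarrow> (real^'n) set" where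
  "newton_polygon p = convex hull ((\<lambda>m. \<chi> i. real (Poly_Mapping.lookup m i)) ` Poly_Mapping.keys p)"

definition laurent_f :: "int^'n::finite^'m::finite \<Rightarrow> complex^'n \<Rightarrow> complex^'m \<Rightarrow> complex" where
  "laurent_f A x t = (\<Sum>i\<in>UNIV. x$i * (\<Prod>j\<in>UNIV. (t$j) powi (A$j$i)))"

definition has_multiple_root :: "int^'n::finite^'m::finite \<Rightarrow> complex^'n \<Rightarrow> bool" where
  "has_multiple_root A x \<longleftrightarrow>
     (\<exists>t::complex^'m. (\<forall>j. t$j \<noteq> 0) \<and> laurent_f A x t = 0 \<and>
        (\<forall>j. deriv (\<lambda>s. laurent_f A x (\<chi> k. if k = j then s else t$k)) (t$j) = 0))"

definition disc_locus :: "int^'n::finite^'m::finite \<Rightarrow> (complex^'n) set" where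
  "disc_locus A = {x. (\<forall>i. x$i \<noteq> 0) \<and> has_multiple_root A x}"

definition is_hypersurface :: "(complex^'n::finite) set \<Rightarrow> bool" where
  "is_hypersurface V \<longleftrightarrow> (\<exists>p. mpoly_nonconstant p \<and> mpoly_zero_set p = V)"

text \<open>D_A: an irreducible integer polynomial defining the closure of the locus (unique up to
  sign, which does not affect the Newton polygon), or 1 if the closure is not a hypersurface.\<close>
definition A_discriminant :: "int^'n::finite^'m::finite \<Rightarrow> ('n \<Rightarrow>\<^sub>0 nat) \<Rightarrow>\<^sub>0 int" where
  "A_discriminant A =
     (if is_hypersurface (closure (disc_locus A))
      then (SOME D. irreducible D \<and> mpoly_zero_set (int_to_cpoly D) = closure (disc_locus A))
      else 1)"

text \<open>Points of R^2 are represented as complex numbers; row b_i = (B$i$1, B$i$2).\<close>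

definition row_c :: "int^2^'n \<Rightarrow> 'n \<Rightarrow> complex" where
  "row_c B i = Complex (of_int (B$i$1)) (of_int (B$i$2))"

definition det2 :: "complex \<Rightarrow> complex \<Rightarrow> real" where
  "det2 b u = Re b * Im u - Im b * Re u"

definition on_relevant_line :: "int^2^'n::finite \<Rightarrow> 'n \<Rightarrow> bool" where
  "on_relevant_line B i \<longleftrightarrow>
     (\<exists>r s. row_c B r \<noteq> 0 \<and> row_c B s \<noteq> 0 \<and>
        det2 (row_c B i) (row_c B r) = 0 \<and> det2 (row_c B i) (row_c B s) = 0 \<and>
        (\<exists>c::real. c > 0 \<and> row_c B s = - (of_real c * row_c B r)))"

definition relevant_lines :: "int^2^'n::finite \<Rightarrow> 'n set set" where
  "relevant_lines B = {{j. det2 (row_c B i) (row_c B j) = 0} | i. on_relevant_line B i}"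

definition QB_edges :: "int^2^'n::finite \<Rightarrow> complex multiset" where
  "QB_edges B =
     filter_mset (\<lambda>v. v \<noteq> 0) (image_mset (\<lambda>L. \<Sum>j\<in>L. row_c B j) (mset_set (relevant_lines B)))
     + image_mset (row_c B) (mset_set {i. \<not> on_relevant_line B i})"

text \<open>Q_B: the polygon whose counterclockwise boundary consists of these edge vectors in
  counterclockwise order of direction (i.e. sorted by argument); its vertices are the partial
  sums of the sorted edge list (defined up to translation; this fixes one translate).\<close>
definition Q_B :: "int^2^'n::finite \<Rightarrow> complex set" where
  "Q_B B = (let es = (SOME es. mset es = QB_edges B \<and> sorted (map Arg es))
            in convex hull {sum_list (take k es) | k. k \<le> length es})"

definition nu :: "int^2^'n::finite \<Rightarrow> 'n \<Rightarrow> real" where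
  "nu B i = Inf ((\<lambda>u. det2 (row_c B i) u) ` Q_B B)"

definition bar_map :: "int^2^'n::finite \<Rightarrow> complex \<Rightarrow> real^'n" where
  "bar_map B v = (\<chi> i. det2 (row_c B i) v - nu B i)"

end

theory Submission
  imports Defs "HOL-Complex_Analysis.Complex_Analysis" "HOL-Computational_Algebra.Polynomial_Factorial"
    "HOL-Computational_Algebra.Fundamental_Theorem_Algebra"
begin

no_notation fps_nth (infixl "$" 75)

text \<open>Modulo the torus acting through the rows of \<open>A\<close>, the discriminant locus is the plane curve with
  the Horn--Kapranov parametrization \<open>\<psi>\<^sub>k(l) = \<Prod>\<^sub>i (b\<^sub>i \<cdot> l)^b\<^sub>i\<^sub>k\<close>, \<open>k = 1, 2\<close>, so the polygon of
  \<open>D\<^sub>A\<close> is an affine image of that of the irreducible equation \<open>P\<^sub>0\<close> of this curve. Two facts determine the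
  latter up to translation. Its width in the direction \<open>w\<close> is the number of torus points of the
  curve on a generic coset of a one-parameter subgroup; pulled back along the parametrization, whose
  logarithmic Gauss map is its inverse, this becomes a root count giving the sum over all lines of
  the positive part of \<open>det(b\<^sub>v, w)\<close>, which is the width of \<open>Q\<^sub>B\<close>. And each edge direction
  of \<open>P\<^sub>0\<close> is the direction of some \<open>b\<^sub>v\<close>, since the parameter of a point escaping to infinity must approach
  a zero of one of the linear forms. If all line sums vanish, the parametrization is constant,
  the locus has codimension two, and both polygons are points.\<close>

text \<open>Widths see a polygon only up to central symmetrization. The edge directions remove this
  ambiguity because \<open>QB_edges\<close> never contains two opposite directions, which is what
  merging the rows of a relevant line achieves. The remaining translation is harmless:
  \<open>D\<close> is built with least exponent 0 in every variable, and subtracting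
  \<open>nu\<close> is the same normalization. A sum b_v is an inner normal of an edge of the
  polygon of \<open>P0\<close>, but an edge of \<open>Q_B\<close>; the quarter turn between the two
  is hidden in \<open>det2\<close>. That the columns of \<open>B\<close> are a basis over the
  integers enters through a dual basis: the fibres of (\<open>phi1\<close>, \<open>phi2\<close>) on
  the torus are then single orbits, and the map has a section. As \<open>A_discriminant\<close>
  picks any irreducible polynomial with the right zero set, two things are needed: the zero set of
  \<open>D\<close> is exactly the Euclidean closure of the locus, including its points on coordinate
  hyperplanes, and every integer polynomial vanishing on the locus is a multiple of
  \<open>D\<close>. Irreducibility and dimension arguments are carried by the identity theorem on
  complex lines and by Hurwitz's theorem.\<close>

section \<open>Analytic tools: identity theorem on lines, stability of zeros, independence of
  characters\<close>

lemma holomorphic_mult_eq_0: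
  assumes "open S" "connected S" "f holomorphic_on S" "g holomorphic_on S"
    and prod0: "\<And>z. z \<in> S \<Longrightarrow> f z * g z = 0"
    and a: "a \<in> S" "f a \<noteq> 0" and b: "b \<in> S"
  shows "g b = 0"
proof -
  have "continuous_on S f"
    using assms holomorphic_on_imp_continuous_on by blast
  then obtain e where e: "e > 0" "\<And>y. dist a y < e \<Longrightarrow> f y \<noteq> 0"
    using continuous_on_open_avoid[of S f a 0] assms by metis
  have lim: "a islimpt (ball a e \<inter> S)"
    using e(1) a(1) \<open>open S\<close> by (intro interior_limit_point) (auto simp: interior_open)
  show ?thesis
    by (rule analytic_continuation[OF assms(4,1,2) _ a(1) lim _ b]) (use e prod0 in force)+
qed

text \<open>Holomorphy along complex lines is all that the multivariate arguments below need.\<close>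

definition line_dom :: "(complex^'n) set \<Rightarrow> bool" where
  "line_dom G \<longleftrightarrow> (\<forall>x\<in>G. \<forall>y\<in>G. open {s. x + s *s (y - x) \<in> G} \<and> connected {s. x + s *s (y - x) \<in> G})"

definition line_hol :: "(complex^'n) set \<Rightarrow> (complex^'n \<Rightarrow> complex) \<Rightarrow> bool" where
  "line_hol G f \<longleftrightarrow> (\<forall>x\<in>G. \<forall>y\<in>G. (\<lambda>s. f (x + s *s (y - x))) holomorphic_on {s. x + s *s (y - x) \<in> G})"

lemma line_dom_UNIV [simp]: "line_dom UNIV"
  by (simp add: line_dom_def connected_UNIV)

text \<open>The complex line through \<open>x\<close> and \<open>y\<close> meets \<open>G\<close> in
  a domain containing the parameters 0 and 1, so the one-variable statement applies. This is the
  form in which irreducibility of parametrized sets is used.\<close>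

lemma line_hol_mult_eq_0:
  assumes "line_dom G" "line_hol G f" "line_hol G g" "\<And>z. z \<in> G \<Longrightarrow> f z * g z = 0"
    and "x \<in> G" "f x \<noteq> 0" "y \<in> G"
  shows "g y = 0"
proof -
  let ?S = "{s. x + s *s (y - x) \<in> G}"
  have "(\<lambda>s. g (x + s *s (y - x))) 1 = 0"
    by (rule holomorphic_mult_eq_0[of ?S "\<lambda>s. f (x + s *s (y - x))" _ 0])
       (use assms in \<open>auto simp: line_dom_def line_hol_def\<close>)
  then show ?thesis by simp
qed

lemma line_hol_const [intro, simp]: "line_hol G (\<lambda>_. c)"
  by (simp add: line_hol_def)
lemma line_hol_coord [intro, simp]: "line_hol G (\<lambda>x. x $ i)"
  by (auto simp: line_hol_def intro!: holomorphic_intros)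
lemma line_hol_add [intro]: "line_hol G f \<Longrightarrow> line_hol G g \<Longrightarrow> line_hol G (\<lambda>x. f x + g x)"
  by (auto simp: line_hol_def intro!: holomorphic_intros)
lemma line_hol_diff [intro]: "line_hol G f \<Longrightarrow> line_hol G g \<Longrightarrow> line_hol G (\<lambda>x. f x - g x)"
  by (auto simp: line_hol_def intro!: holomorphic_intros)
lemma line_hol_mult [intro]: "line_hol G f \<Longrightarrow> line_hol G g \<Longrightarrow> line_hol G (\<lambda>x. f x * g x)"
  by (auto simp: line_hol_def intro!: holomorphic_intros)
lemma line_hol_power [intro]: "line_hol G f \<Longrightarrow> line_hol G (\<lambda>x. f x ^ k)"
  by (auto simp: line_hol_def intro!: holomorphic_intros)
lemma line_hol_powi [intro]:
  "line_hol G f \<Longrightarrow> (\<And>x. x \<in> G \<Longrightarrow> f x \<noteq> 0) \<Longrightarrow> line_hol G (\<lambda>x. f x powi k)"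
  by (auto simp: line_hol_def intro!: holomorphic_intros)
lemma line_hol_sum [intro]: "(\<And>i. i \<in> I \<Longrightarrow> line_hol G (f i)) \<Longrightarrow> line_hol G (\<lambda>x. \<Sum>i\<in>I. f i x)"
  by (auto simp: line_hol_def intro!: holomorphic_intros)
lemma line_hol_prod [intro]: "(\<And>i. i \<in> I \<Longrightarrow> line_hol G (f i)) \<Longrightarrow> line_hol G (\<lambda>x. \<Prod>i\<in>I. f i x)"
  by (auto simp: line_hol_def intro!: holomorphic_intros)

text \<open>Without zero divisors, finitely many open conditions that can be met one at a time can
  be met together; generic points and directions are chosen this way.\<close>

lemma line_hol_prod_nonzero:
  assumes "line_dom G" "finite I" "G \<noteq> {}" "\<And>i. i \<in> I \<Longrightarrow> line_hol G (f i)"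
    and "\<And>i. i \<in> I \<Longrightarrow> \<exists>x\<in>G. f i x \<noteq> 0"
  shows "\<exists>x\<in>G. (\<Prod>i\<in>I. f i x) \<noteq> 0"
  using assms(2,4,5)
proof (induction I)
  case empty
  then show ?case using \<open>G \<noteq> {}\<close> by auto
next
  case (insert i I)
  obtain x where x: "x \<in> G" "(\<Prod>i\<in>I. f i x) \<noteq> 0" using insert by auto
  obtain y where y: "y \<in> G" "f i y \<noteq> 0" using insert.prems(2)[of i] by auto
  show ?case
  proof (rule ccontr)
    assume "\<not> ?thesis"
    then have "(\<Prod>i\<in>I. f i z) * f i z = 0" if "z \<in> G" for z
      using that insert.hyps by (simp add: mult.commute)
    then have "f i y = 0"
      by (intro line_hol_mult_eq_0[of G "\<lambda>z. \<Prod>i\<in>I. f i z" "f i" x y] line_hol_prod)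
         (use assms(1) x y insert.prems in auto)
    with y show False by simp
  qed
qed

text \<open>If the zero \<open>z0\<close> did not persist, parameters tending to \<open>x0\<close>
  would give functions without zeros near \<open>z0\<close> that converge locally uniformly to the
  nonconstant \<open>F x0\<close>, against Hurwitz. Multiple zeros are allowed, and mere continuity
  in the parameter suffices.\<close>

lemma root_near:
  fixes F :: "'a::metric_space \<Rightarrow> complex \<Rightarrow> complex"
  assumes cont: "continuous_on (U \<times> V) (\<lambda>p. F (fst p) (snd p))"
    and hol: "\<And>x. x \<in> U \<Longrightarrow> F x holomorphic_on V"
    and V: "open V" "connected V" and x0: "x0 \<in> U" and z0: "z0 \<in> V" "F x0 z0 = 0"
    and nz: "z1 \<in> V" "F x0 z1 \<noteq> 0" and e: "e > 0"
  shows "\<exists>d>0. \<forall>x\<in>U. dist x x0 < d \<longrightarrow> (\<exists>z\<in>V. dist z z0 < e \<and> F x z = 0)"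
proof (rule ccontr)
  assume contra: "\<not> ?thesis"
  have "\<exists>x\<in>U. dist x x0 < 1 / real (Suc n) \<and> (\<forall>z\<in>V. dist z z0 < e \<longrightarrow> F x z \<noteq> 0)" for n
  proof (rule ccontr)
    assume "\<not> ?thesis"
    then have "\<forall>x\<in>U. dist x x0 < 1 / real (Suc n) \<longrightarrow> (\<exists>z\<in>V. dist z z0 < e \<and> F x z = 0)"
      by blast
    then show False using contra by (metis of_nat_0_less_iff zero_less_Suc zero_less_divide_1_iff)
  qed
  then obtain X where X: "\<And>n. X n \<in> U" "\<And>n. dist (X n) x0 < 1 / real (Suc n)"
    "\<And>n z. z \<in> V \<Longrightarrow> dist z z0 < e \<Longrightarrow> F (X n) z \<noteq> 0" by metis
  have lim: "X \<longlonglongrightarrow> x0"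
  proof (rule metric_LIMSEQ_I)
    fix r :: real assume "r > 0"
    then obtain N where N: "1 / real (Suc N) < r" using nat_approx_posE by blast
    show "\<exists>no. \<forall>n\<ge>no. dist (X n) x0 < r"
    proof (intro exI allI impI)
      fix n assume "n \<ge> N"
      then have "1 / real (Suc n) \<le> 1 / real (Suc N)" by (simp add: frac_le)
      then show "dist (X n) x0 < r" using X(2)[of n] N by linarith
    qed
  qed
  obtain e' where e': "e' > 0" "ball z0 e' \<subseteq> V" "e' \<le> e"
    using V(1) z0(1) e by (meson min.cobounded1 min.cobounded2 openE subset_ball subset_trans min_less_iff_conj)
  let ?S = "ball z0 e'"
  have holx0: "F x0 holomorphic_on ?S" using hol[OF x0] e' holomorphic_on_subset by blast
  have "F x0 z0 \<noteq> 0"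
  proof (rule Hurwitz_no_zeros[of ?S "\<lambda>n. F (X n)" "F x0" z0])
    show "open ?S" "connected ?S" by auto
    show "F (X n) holomorphic_on ?S" for n using hol[OF X(1)] e' holomorphic_on_subset by blast
    show "F x0 holomorphic_on ?S" by fact
    show "z0 \<in> ?S" using e' by simp
    show "F (X n) z \<noteq> 0" if "z \<in> ?S" for z n
      using X(3)[of z n] that e' by (auto simp: dist_commute)
    show "\<not> F x0 constant_on ?S"
    proof
      assume "F x0 constant_on ?S"
      then obtain k where "\<And>z. z \<in> ?S \<Longrightarrow> F x0 z = k" unfolding constant_on_def by blast
      then have c: "\<And>z. z \<in> ?S \<Longrightarrow> F x0 z = 0"
        using z0(2) e'(1) by (metis centre_in_ball)
      have lim: "z0 islimpt ?S" using e'(1) by (intro interior_limit_point) auto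
      have "F x0 z1 = 0"
        using analytic_continuation[of "F x0" V ?S z0 z1] hol[OF x0] V e'(2) z0(1) lim c nz(1) by blast
      then show False using nz by simp
    qed
    show "uniform_limit K (\<lambda>n. F (X n)) (F x0) sequentially" if K: "compact K" "K \<subseteq> ?S" for K
    proof -
      \<comment> \<open>A convergent sequence together with its limit is compact, so joint
        continuity becomes uniform on its product with \<open>K\<close>.\<close>
      let ?C = "insert x0 (range X)"
      have "compact ?C"
        using compactin_sequence_with_limit[of euclidean X x0 "range X"] lim by simp
      then have "compact (?C \<times> K)" using K compact_Times by blast
      moreover have "?C \<times> K \<subseteq> U \<times> V" using X(1) x0 K e' by auto
      ultimately have uc: "uniformly_continuous_on (?C \<times> K) (\<lambda>p. F (fst p) (snd p))"
        using compact_uniformly_continuous continuous_on_subset[OF cont] by blast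
      show ?thesis
      proof (rule uniform_limitI)
        fix r :: real assume "r > 0"
        then obtain d where d: "d > 0" "\<And>p p'. p \<in> ?C \<times> K \<Longrightarrow> p' \<in> ?C \<times> K \<Longrightarrow> dist p' p < d \<Longrightarrow>
          dist (F (fst p') (snd p')) (F (fst p) (snd p)) < r"
          using uc unfolding uniformly_continuous_on_def by metis
        have "\<forall>\<^sub>F n in sequentially. dist (X n) x0 < d" using lim d(1) by (simp add: tendstoD)
        then show "\<forall>\<^sub>F n in sequentially. \<forall>z\<in>K. dist (F (X n) z) (F x0 z) < r"
        proof eventually_elim
          case (elim n)
          show ?case
          proof
            fix z assume "z \<in> K"
            then show "dist (F (X n) z) (F x0 z) < r"
              using d(2)[of "(x0, z)" "(X n, z)"] elim by (auto simp: dist_Pair_Pair)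
          qed
        qed
      qed
    qed
  qed
  then show False using z0 by simp
qed

text \<open>Dedekind's argument: translating a relation by \<open>t0\<close> and subtracting
  \<open>ch j t0\<close> times the original removes the term \<open>j\<close> and keeps every term
  whose character differs from \<open>ch j\<close> at \<open>t0\<close>.\<close>

lemma characters_independent:
  fixes ch :: "'i \<Rightarrow> 'a \<Rightarrow> complex" and m :: "'a \<Rightarrow> 'a \<Rightarrow> 'a"
  assumes "finite X"
    and closed: "\<And>s t. s \<in> T \<Longrightarrow> t \<in> T \<Longrightarrow> m s t \<in> T" and "T \<noteq> {}"
    and mult: "\<And>i s t. i \<in> X \<Longrightarrow> s \<in> T \<Longrightarrow> t \<in> T \<Longrightarrow> ch i (m s t) = ch i s * ch i t"
    and nz: "\<And>i t. i \<in> X \<Longrightarrow> t \<in> T \<Longrightarrow> ch i t \<noteq> 0"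
    and dist: "\<And>i j. i \<in> X \<Longrightarrow> j \<in> X \<Longrightarrow> i \<noteq> j \<Longrightarrow> \<exists>t\<in>T. ch i t \<noteq> ch j t"
    and rel: "\<And>t. t \<in> T \<Longrightarrow> (\<Sum>i\<in>X. c i * ch i t) = 0"
  shows "\<forall>i\<in>X. c i = 0"
  using assms(1) mult nz dist rel
proof (induction X arbitrary: c)
  case empty
  then show ?case by simp
next
  case (insert j X)
  have c0: "c i = 0" if i: "i \<in> X" for i
  proof -
    obtain t0 where t0: "t0 \<in> T" "ch i t0 \<noteq> ch j t0" using insert.prems(3)[of i j] i insert.hyps by auto
    have "\<forall>i\<in>X. c i * (ch i t0 - ch j t0) = 0"
    proof (rule insert.IH)
      fix t assume t: "t \<in> T"
      have "(\<Sum>i\<in>insert j X. c i * ch i (m t0 t)) - ch j t0 * (\<Sum>i\<in>insert j X. c i * ch i t) = 0"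
        using insert.prems(4)[OF closed[OF t0(1) t]] insert.prems(4)[OF t] by simp
      moreover have "(\<Sum>i\<in>insert j X. c i * ch i (m t0 t)) = (\<Sum>i\<in>insert j X. c i * ch i t0 * ch i t)"
        by (intro sum.cong refl) (simp only: insert.prems(1)[OF _ t0(1) t] mult.assoc)
      ultimately have "(\<Sum>i\<in>insert j X. c i * (ch i t0 - ch j t0) * ch i t) = 0"
        by (simp only: sum_distrib_left sum_subtractf[symmetric] algebra_simps)
      then show "(\<Sum>i\<in>X. c i * (ch i t0 - ch j t0) * ch i t) = 0"
        using insert.hyps by simp
    qed (use insert.prems in auto)
    then show ?thesis using t0 i by auto
  qed
  moreover obtain t where t: "t \<in> T" using \<open>T \<noteq> {}\<close> by auto
  have "c j * ch j t = 0" using insert.prems(4)[OF t] insert.hyps c0 by simp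
  then have "c j = 0" using insert.prems(2)[OF _ t, of j] by simp
  ultimately show ?case by simp
qed

section \<open>Integer polynomials in n variables as functions\<close>

definition mon :: "('n::finite \<Rightarrow>\<^sub>0 nat) \<Rightarrow> complex^'n \<Rightarrow> complex" where
  "mon m x = (\<Prod>i\<in>UNIV. (x$i) ^ Poly_Mapping.lookup m i)"

definition ieval :: "(('n::finite \<Rightarrow>\<^sub>0 nat) \<Rightarrow>\<^sub>0 int) \<Rightarrow> complex^'n \<Rightarrow> complex" where
  "ieval p x = (\<Sum>m\<in>Poly_Mapping.keys p. of_int (Poly_Mapping.lookup p m) * mon m x)"

lemma keys_int_to_cpoly [simp]: "Poly_Mapping.keys (int_to_cpoly p) = Poly_Mapping.keys p"
  unfolding int_to_cpoly_def by transfer auto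

lemma lookup_int_to_cpoly [simp]:
  "Poly_Mapping.lookup (int_to_cpoly p) m = of_int (Poly_Mapping.lookup p m)"
  unfolding int_to_cpoly_def by transfer (auto simp: when_def)

lemma mpoly_eval_int_to_cpoly: "mpoly_eval (int_to_cpoly p) x = ieval p x"
  by (simp add: mpoly_eval_def ieval_def mon_def)

lemma mpoly_eval_mon: "mpoly_eval p x = (\<Sum>m\<in>Poly_Mapping.keys p. Poly_Mapping.lookup p m * mon m x)"
  by (simp add: mpoly_eval_def mon_def)

lemma mon_add: "mon (m + m') x = mon m x * mon m' x"
  by (simp add: mon_def lookup_add power_add prod.distrib)

lemma mon_0 [simp]: "mon 0 x = 1" by (simp add: mon_def)

lemma ieval_superset:
  assumes "finite S" "Poly_Mapping.keys p \<subseteq> S"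
  shows "ieval p x = (\<Sum>m\<in>S. of_int (Poly_Mapping.lookup p m) * mon m x)"
  unfolding ieval_def by (rule sum.mono_neutral_left) (use assms in \<open>auto simp: in_keys_iff\<close>)

lemma ieval_add: "ieval (p + q) x = ieval p x + ieval q x"
proof -
  let ?S = "Poly_Mapping.keys p \<union> Poly_Mapping.keys q"
  have "ieval (p + q) x = (\<Sum>m\<in>?S. of_int (Poly_Mapping.lookup (p+q) m) * mon m x)"
    by (rule ieval_superset) (use keys_add[of p q] in auto)
  also have "\<dots> = (\<Sum>m\<in>?S. of_int (Poly_Mapping.lookup p m) * mon m x) + (\<Sum>m\<in>?S. of_int (Poly_Mapping.lookup q m) * mon m x)"
    by (simp add: lookup_add algebra_simps sum.distrib)
  also have "\<dots> = ieval p x + ieval q x"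
    by (simp add: ieval_superset[of ?S p] ieval_superset[of ?S q])
  finally show ?thesis .
qed

lemma ieval_0 [simp]: "ieval 0 x = 0" by (simp add: ieval_def)

lemma ieval_single [simp]: "ieval (Poly_Mapping.single m c) x = of_int c * mon m x"
  by (auto simp: ieval_def)

lemma ieval_1 [simp]: "ieval 1 x = 1" by (simp add: ieval_def)

lemma ieval_sum: "ieval (sum f A) x = (\<Sum>a\<in>A. ieval (f a) x)"
  by (induction A rule: infinite_finite_induct) (auto simp: ieval_add)

lemma ieval_uminus: "ieval (- p) x = - ieval p x"
  using ieval_add[of p "-p" x] by (simp add: add_eq_0_iff)

lemma poly_mapping_sum_single:
  "p = (\<Sum>m\<in>Poly_Mapping.keys p. Poly_Mapping.single m (Poly_Mapping.lookup p m))"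
  by (rule poly_mapping_eqI) (auto simp: lookup_sum lookup_single when_def in_keys_iff)

lemma ieval_mult: "ieval (p * q) x = ieval p x * ieval q x"
proof -
  have "p * q = (\<Sum>m\<in>Poly_Mapping.keys p. \<Sum>m'\<in>Poly_Mapping.keys q.
      Poly_Mapping.single m (Poly_Mapping.lookup p m) * Poly_Mapping.single m' (Poly_Mapping.lookup q m'))"
    by (subst poly_mapping_sum_single[of p], subst poly_mapping_sum_single[of q])
       (simp only: sum_distrib_left sum_distrib_right, rule sum.swap)
  then have "ieval (p * q) x = (\<Sum>m\<in>Poly_Mapping.keys p. \<Sum>m'\<in>Poly_Mapping.keys q.
      (of_int (Poly_Mapping.lookup p m) * mon m x) * (of_int (Poly_Mapping.lookup q m') * mon m' x))"
    by (simp add: ieval_sum mult_single mon_add algebra_simps)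
  also have "\<dots> = ieval p x * ieval q x"
    by (simp add: ieval_def sum_distrib_left sum_distrib_right mult.assoc) (rule sum.swap)
  finally show ?thesis .
qed

lemma line_hol_mon: "line_hol G (mon m)"
  unfolding mon_def[abs_def] by (intro line_hol_prod line_hol_power line_hol_coord)
lemma line_hol_ieval: "line_hol G (ieval p)"
  unfolding ieval_def[abs_def] by (intro line_hol_sum line_hol_mult line_hol_const line_hol_mon)
lemma continuous_on_mon [continuous_intros]:
  "continuous_on S g \<Longrightarrow> continuous_on S (\<lambda>x. mon m (g x))"
  unfolding mon_def by (intro continuous_intros)
lemma continuous_on_ieval [continuous_intros]:
  "continuous_on S g \<Longrightarrow> continuous_on S (\<lambda>x. ieval p (g x))"
  unfolding ieval_def by (intro continuous_intros)

lemma mon_nz: "(\<And>i. x$i \<noteq> 0) \<Longrightarrow> mon m x \<noteq> 0"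
  by (simp add: mon_def)

lemma mon_distinct:
  assumes "m \<noteq> m'"
  shows "\<exists>x. (\<forall>i. x$i \<noteq> 0) \<and> mon m x \<noteq> mon m' x"
proof -
  obtain i where i: "Poly_Mapping.lookup m i \<noteq> Poly_Mapping.lookup m' i"
    using assms poly_mapping_eqI by metis
  let ?x = "\<chi> k. if k = i then 2 else (1::complex)"
  have "mon m ?x = 2 ^ Poly_Mapping.lookup m i" for m
    unfolding mon_def by (subst prod.remove[of _ i]) auto
  moreover have "(2::complex) ^ Poly_Mapping.lookup m i \<noteq> 2 ^ Poly_Mapping.lookup m' i"
  proof
    assume "(2::complex) ^ Poly_Mapping.lookup m i = 2 ^ Poly_Mapping.lookup m' i"
    then have "of_nat (2 ^ Poly_Mapping.lookup m i) = (of_nat (2 ^ Poly_Mapping.lookup m' i) :: complex)" by simp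
    then have "2 ^ Poly_Mapping.lookup m i = (2 ^ Poly_Mapping.lookup m' i :: nat)" by (simp only: of_nat_eq_iff)
    then show False using i by simp
  qed
  ultimately show ?thesis by (intro exI[of _ ?x]) auto
qed

lemma mon_independent:
  assumes "finite X" "\<And>x::complex^'n::finite. (\<forall>i. x$i \<noteq> 0) \<Longrightarrow> (\<Sum>m\<in>X. c m * mon m x) = 0"
  shows "\<forall>m\<in>X. c m = 0"
proof (rule characters_independent[of X "{x::complex^'n. \<forall>i. x$i \<noteq> 0}" "\<lambda>x y. \<chi> i. x$i * y$i" mon])
  have "(\<chi> i. 1) \<in> {x::complex^'n. \<forall>i. x$i \<noteq> 0}" by simp
  then show "{x::complex^'n. \<forall>i. x$i \<noteq> 0} \<noteq> {}" by blast
  show "mon i (\<chi> i. s $ i * t $ i) = mon i s * mon i t" for i and s t :: "complex^'n"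
    by (simp add: mon_def power_mult_distrib prod.distrib)
  show "mon i t \<noteq> 0" if "t \<in> {x::complex^'n. \<forall>i. x$i \<noteq> 0}" for i t
    using that by (intro mon_nz) auto
qed (use assms mon_distinct in auto)

lemma ieval_eq_0_imp_eq_0:
  assumes "\<And>x. (\<forall>i. x$i \<noteq> 0) \<Longrightarrow> ieval p x = 0"
  shows "p = 0"
proof -
  have "\<forall>m\<in>Poly_Mapping.keys p. (of_int (Poly_Mapping.lookup p m) :: complex) = 0"
    by (rule mon_independent) (use assms in \<open>auto simp: ieval_def\<close>)
  then show ?thesis by (intro poly_mapping_eqI) (auto simp: in_keys_iff)
qed

text \<open>Monomials are distinct characters of the torus. Polynomial identities are therefore
  checked on torus points only, where Laurent monomials make sense.\<close>

lemma ieval_inject: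
  assumes "\<And>x. (\<forall>i. x$i \<noteq> 0) \<Longrightarrow> ieval p x = ieval q x"
  shows "p = q"
  using ieval_eq_0_imp_eq_0[of "p - q"] assms ieval_add[of p "-q"] by (simp add: ieval_uminus)

text \<open>Fraction-free elimination: one equation \<open>j\<close> with pivot
  \<open>M i0 j\<close> is removed at a time, so the coefficients stay integral.\<close>

lemma int_linear_dependence:
  fixes M :: "'i \<Rightarrow> 'j \<Rightarrow> int"
  assumes "finite J" "finite I" "card J < card I"
  shows "\<exists>c. (\<exists>i\<in>I. c i \<noteq> 0) \<and> (\<forall>j\<in>J. (\<Sum>i\<in>I. c i * M i j) = 0)"
  using assms
proof (induction J arbitrary: I M)
  case empty
  then show ?case by (intro exI[of _ "\<lambda>_. 1"]) (auto simp: card_gt_0_iff)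
next
  case (insert j J)
  show ?case
  proof (cases "\<forall>i\<in>I. M i j = 0")
    case True
    have "card J < card I" using insert by simp
    then obtain c where "\<exists>i\<in>I. c i \<noteq> 0" "\<forall>j\<in>J. (\<Sum>i\<in>I. c i * M i j) = 0"
      using insert.IH[OF insert.prems(1), of M] by blast
    then show ?thesis using True by (intro exI[of _ c]) auto
  next
    case False
    then obtain i0 where i0: "i0 \<in> I" "M i0 j \<noteq> 0" by auto
    let ?I = "I - {i0}"
    let ?M = "\<lambda>i k. M i0 j * M i k - M i j * M i0 k"
    have "card J < card ?I" using insert i0 by simp
    then obtain c where c: "\<exists>i\<in>?I. c i \<noteq> 0" "\<forall>k\<in>J. (\<Sum>i\<in>?I. c i * ?M i k) = 0"
      using insert.IH[OF finite_Diff[OF insert.prems(1)], of "{i0}" ?M] by blast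
    \<comment> \<open>The coefficient at the pivot row is forced by equation \<open>j\<close>; the
      others are scaled by the pivot to avoid a division.\<close>
    let ?c = "\<lambda>i. if i = i0 then - (\<Sum>i\<in>?I. c i * M i j) else M i0 j * c i"
    have split: "(\<Sum>i\<in>I. ?c i * M i k) = (\<Sum>i\<in>?I. c i * ?M i k)" for k
    proof -
      have "(\<Sum>i\<in>I. ?c i * M i k) = - (\<Sum>i\<in>?I. c i * M i j) * M i0 k + (\<Sum>i\<in>?I. ?c i * M i k)"
        using sum.remove[OF insert.prems(1) i0(1), of "\<lambda>i. ?c i * M i k"] by simp
      also have "(\<Sum>i\<in>?I. ?c i * M i k) = (\<Sum>i\<in>?I. M i0 j * c i * M i k)"
        by (intro sum.cong) auto
      also have "- (\<Sum>i\<in>?I. c i * M i j) * M i0 k + \<dots> =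
          (\<Sum>i\<in>?I. M i0 j * c i * M i k) - (\<Sum>i\<in>?I. c i * M i j * M i0 k)"
        by (simp add: sum_distrib_right)
      also have "\<dots> = (\<Sum>i\<in>?I. M i0 j * c i * M i k - c i * M i j * M i0 k)"
        by (rule sum_subtractf[symmetric])
      also have "\<dots> = (\<Sum>i\<in>?I. c i * ?M i k)"
        by (intro sum.cong refl) (simp add: algebra_simps)
      finally show ?thesis .
    qed
    have "(\<Sum>i\<in>I. ?c i * M i k) = 0" if "k \<in> insert j J" for k
      unfolding split using that c(2) by (auto simp: algebra_simps)
    moreover have "\<exists>i\<in>I. ?c i \<noteq> 0" using c(1) i0 by auto
    ultimately show ?thesis by (intro exI[of _ ?c] conjI ballI)
  qed
qed

section \<open>Integer polynomials in two variables\<close>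

definition ip1 :: "int poly \<Rightarrow> complex \<Rightarrow> complex" where
  "ip1 c a = poly (map_poly of_int c) a"

text \<open>The outer variable of the nested polynomial is the second coordinate. The nesting gives
  pseudo-division in that variable and unique factorization over the integers.\<close>

definition eval2 :: "int poly poly \<Rightarrow> complex \<Rightarrow> complex \<Rightarrow> complex" where
  "eval2 P a b = poly (map_poly (\<lambda>c. ip1 c a) P) b"

lemma ip1_0 [simp]: "ip1 0 a = 0" by (simp add: ip1_def)
lemma ip1_pCons [simp]: "ip1 (pCons c p) a = of_int c + a * ip1 p a"
  by (simp add: ip1_def map_poly_pCons)
lemma ip1_1 [simp]: "ip1 1 a = 1" by (simp add: one_pCons)
lemma ip1_add [simp]: "ip1 (p + q) a = ip1 p a + ip1 q a"
  by (induction p q rule: poly_induct2) (auto simp: algebra_simps)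
lemma ip1_smult [simp]: "ip1 (smult c p) a = of_int c * ip1 p a"
  by (induction p) (auto simp: algebra_simps)
lemma ip1_mult [simp]: "ip1 (p * q) a = ip1 p a * ip1 q a"
  by (induction p) (auto simp: algebra_simps)

lemma eval2_0 [simp]: "eval2 0 a b = 0" by (simp add: eval2_def)
lemma eval2_pCons [simp]: "eval2 (pCons c P) a b = ip1 c a + b * eval2 P a b"
  by (simp add: eval2_def map_poly_pCons)
lemma eval2_1 [simp]: "eval2 1 a b = 1" by (simp add: one_pCons)
lemma eval2_add [simp]: "eval2 (P + Q) a b = eval2 P a b + eval2 Q a b"
  by (induction P Q rule: poly_induct2) (auto simp: algebra_simps)
lemma eval2_smult [simp]: "eval2 (smult c P) a b = ip1 c a * eval2 P a b"
  by (induction P) (auto simp: algebra_simps)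
lemma eval2_mult [simp]: "eval2 (P * Q) a b = eval2 P a b * eval2 Q a b"
  by (induction P) (auto simp: algebra_simps)
lemma eval2_uminus [simp]: "eval2 (- P) a b = - eval2 P a b"
  using eval2_add[of P "-P" a b] by (simp add: add_eq_0_iff)
lemma eval2_diff [simp]: "eval2 (P - Q) a b = eval2 P a b - eval2 Q a b"
  using eval2_add[of P "-Q" a b] by simp
lemma eval2_power [simp]: "eval2 (P ^ n) a b = eval2 P a b ^ n"
  by (induction n) auto
lemma eval2_prod [simp]: "eval2 (\<Prod>i\<in>I. P i) a b = (\<Prod>i\<in>I. eval2 (P i) a b)"
  by (induction I rule: infinite_finite_induct) auto
lemma eval2_sum [simp]: "eval2 (\<Sum>i\<in>I. P i) a b = (\<Sum>i\<in>I. eval2 (P i) a b)"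
  by (induction I rule: infinite_finite_induct) auto

lemma map_poly_of_int_eq_0: "map_poly (of_int :: int \<Rightarrow> complex) r = 0 \<longleftrightarrow> r = 0"
  by (auto simp: poly_eq_iff coeff_map_poly)

lemma finite_ip1_roots: "r \<noteq> 0 \<Longrightarrow> finite {a. ip1 r a = 0}"
  unfolding ip1_def by (intro poly_roots_finite) (simp add: map_poly_of_int_eq_0)

text \<open>Exponent pairs follow the order of the coordinates, opposite to the nesting of the
  coefficients.\<close>

definition cf :: "int poly poly \<Rightarrow> nat \<times> nat \<Rightarrow> int" where
  "cf P k = coeff (coeff P (snd k)) (fst k)"

definition supp2 :: "int poly poly \<Rightarrow> (nat \<times> nat) set" where
  "supp2 P = {k. cf P k \<noteq> 0}"

lemma supp2_bound: "\<exists>N. supp2 P \<subseteq> {..N} \<times> {..N} \<and> degree P \<le> N \<and> (\<forall>j. degree (coeff P j) \<le> N)"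
proof -
  define N where "N = degree P + (\<Sum>j\<le>degree P. degree (coeff P j))"
  have 1: "degree (coeff P j) \<le> N" for j
  proof (cases "j \<le> degree P")
    case True
    then have "degree (coeff P j) \<le> (\<Sum>j\<le>degree P. degree (coeff P j))"
      by (intro member_le_sum) auto
    then show ?thesis by (simp add: N_def)
  qed (simp add: coeff_eq_0)
  have "k \<in> {..N} \<times> {..N}" if "k \<in> supp2 P" for k
  proof -
    have nz: "coeff (coeff P (snd k)) (fst k) \<noteq> 0" using that by (simp add: supp2_def cf_def)
    then have "fst k \<le> degree (coeff P (snd k))" "coeff P (snd k) \<noteq> 0" by (auto intro: le_degree)
    then show ?thesis using 1[of "snd k"] le_degree[of P "snd k"] by (auto simp: N_def mem_Times_iff)
  qed
  then show ?thesis using 1 by (intro exI[of _ N]) (auto simp: N_def)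
qed

lemma finite_supp2 [simp]: "finite (supp2 P)"
  using supp2_bound[of P] finite_subset by blast

lemma supp2_eq_empty [simp]: "supp2 P = {} \<longleftrightarrow> P = 0"
  by (auto simp: supp2_def cf_def poly_eq_iff)

lemma poly_sum_atMost:
  fixes p :: "complex poly"
  assumes "degree p \<le> N" shows "poly p x = (\<Sum>i\<le>N. coeff p i * x ^ i)"
  unfolding poly_altdef by (rule sum.mono_neutral_left) (use assms in \<open>auto simp: coeff_eq_0\<close>)

lemma degree_map_poly_leq: "f 0 = 0 \<Longrightarrow> degree (map_poly f p) \<le> degree p"
  by (rule degree_le) (simp add: coeff_map_poly coeff_eq_0)

lemma eval2_sum_superset:
  assumes "finite S" "supp2 P \<subseteq> S"
  shows "eval2 P a b = (\<Sum>k\<in>S. of_int (cf P k) * a ^ fst k * b ^ snd k)"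
proof -
  obtain N where N: "supp2 P \<subseteq> {..N} \<times> {..N}" "degree P \<le> N" "\<And>j. degree (coeff P j) \<le> N"
    using supp2_bound by blast
  have "degree (map_poly (\<lambda>c. ip1 c a) P) \<le> N"
    using degree_map_poly_leq[of "\<lambda>c. ip1 c a" P] N(2) by simp
  from poly_sum_atMost[OF this] have "eval2 P a b = (\<Sum>j\<le>N. ip1 (coeff P j) a * b ^ j)"
    unfolding eval2_def by (simp add: coeff_map_poly)
  also have "\<dots> = (\<Sum>j\<le>N. \<Sum>i\<le>N. of_int (cf P (i,j)) * a ^ i * b ^ j)"
  proof (intro sum.cong refl)
    fix j
    have "degree (map_poly (of_int :: int \<Rightarrow> complex) (coeff P j)) \<le> N"
      using degree_map_poly_leq[of "of_int :: int \<Rightarrow> complex" "coeff P j"] N(3)[of j] by simp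
    from poly_sum_atMost[OF this] have "ip1 (coeff P j) a = (\<Sum>i\<le>N. of_int (cf P (i,j)) * a ^ i)"
      unfolding ip1_def by (simp add: coeff_map_poly cf_def)
    then show "ip1 (coeff P j) a * b ^ j = (\<Sum>i\<le>N. of_int (cf P (i,j)) * a ^ i * b ^ j)"
      by (simp add: sum_distrib_right)
  qed
  also have "\<dots> = (\<Sum>k\<in>{..N} \<times> {..N}. of_int (cf P k) * a ^ fst k * b ^ snd k)"
    by (subst sum.swap) (simp add: sum.cartesian_product case_prod_beta)
  also have "\<dots> = (\<Sum>k\<in>supp2 P. of_int (cf P k) * a ^ fst k * b ^ snd k)"
    by (rule sum.mono_neutral_right) (use N in \<open>auto simp: supp2_def\<close>)
  also have "\<dots> = (\<Sum>k\<in>S. of_int (cf P k) * a ^ fst k * b ^ snd k)"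
    by (rule sum.mono_neutral_left) (use assms in \<open>auto simp: supp2_def\<close>)
  finally show ?thesis .
qed

lemmas eval2_supp = eval2_sum_superset[OF finite_supp2 subset_refl]

text \<open>A nonzero element \<open>M\<close> of least degree in the ideal of \<open>P\<close> and
  \<open>G\<close> divides both up to factors in the first variable. As \<open>P\<close> is prime
  and does not divide \<open>G\<close>, it must divide the cofactor \<open>q\<close>; then
  \<open>M\<close> divides a nonzero constant and has degree 0.\<close>

lemma prime_bezout:
  fixes P G :: "int poly poly"
  assumes P: "prime_elem P" "degree P > 0" and G: "\<not> P dvd G"
  shows "\<exists>U V r. r \<noteq> 0 \<and> U * P + V * G = [:r:]"
proof -
  define J where "J = {U * P + V * G | U V. True}"
  have J_diff: "X - Y \<in> J" if "X \<in> J" "Y \<in> J" for X Y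
  proof -
    from that obtain U V U' V' where "X = U * P + V * G" "Y = U' * P + V' * G" unfolding J_def by blast
    then have "X - Y = (U - U') * P + (V - V') * G" by (simp add: algebra_simps)
    then show ?thesis unfolding J_def by blast
  qed
  have J_mult: "H * X \<in> J" if "X \<in> J" for X H
  proof -
    from that obtain U V where "X = U * P + V * G" unfolding J_def by blast
    then have "H * X = (H * U) * P + (H * V) * G" by (simp add: algebra_simps)
    then show ?thesis unfolding J_def by blast
  qed
  have "P = 1 * P + 0 * G" "G = 0 * P + 1 * G" by auto
  then have PJ: "P \<in> J" and GJ: "G \<in> J" unfolding J_def by blast+
  have "P \<noteq> 0" using P by auto
  then obtain M where M: "M \<in> J" "M \<noteq> 0" "\<And>X. X \<in> J \<Longrightarrow> X \<noteq> 0 \<Longrightarrow> degree M \<le> degree X"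
    using ex_has_least_nat[of "\<lambda>X. X \<in> J \<and> X \<noteq> 0" P degree] PJ by blast
  have red: "\<exists>a q. a \<noteq> 0 \<and> smult a X = M * q" if X: "X \<in> J" for X
  proof -
    obtain a q where aq: "a \<noteq> 0" "smult a X = M * q + pseudo_mod X M"
      using pseudo_mod(1)[OF M(2)] by blast
    have "pseudo_mod X M = [:a:] * X - q * M" using aq(2) by (simp add: algebra_simps)
    then have "pseudo_mod X M \<in> J" using J_diff[OF J_mult[OF X, of "[:a:]"] J_mult[OF M(1), of q]] by simp
    then have "pseudo_mod X M = 0" using M(3) pseudo_mod(2)[OF M(2), of X] by force
    then show ?thesis using aq by auto
  qed
  obtain c q where cq: "c \<noteq> 0" "smult c P = M * q" using red[OF PJ] by blast
  obtain c' q' where cq': "c' \<noteq> 0" "smult c' G = M * q'" using red[OF GJ] by blast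
  have notdvd: "\<not> P dvd [:r:]" if "r \<noteq> 0" for r
    using P(2) that dvd_imp_degree_le[of P "[:r:]"] by auto
  have "P dvd M * q" using cq(2) by (metis dvd_smult dvd_refl)
  then have "P dvd M \<or> P dvd q" using P(1) prime_elem_dvd_multD by blast
  moreover have "\<not> P dvd M"
  proof
    assume "P dvd M"
    then have "P dvd [:c':] * G" using cq'(2) by simp
    then show False using P(1) prime_elem_dvd_multD notdvd[OF cq'(1)] G by blast
  qed
  ultimately obtain q2 where q2: "q = P * q2" by (auto elim: dvdE)
  then have "P * [:c:] = P * (M * q2)" using cq(2) by (simp add: algebra_simps)
  then have cM: "[:c:] = M * q2" using \<open>P \<noteq> 0\<close> mult_cancel_left by blast
  then have "M * q2 \<noteq> 0" using cq(1) by (metis pCons_eq_0_iff)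
  then have "degree M + degree q2 = degree [:c:]" unfolding cM by (subst degree_mult_eq) auto
  then have "degree M = 0" by simp
  then obtain r where r: "M = [:r:]" using degree_eq_zeroE by blast
  from M(1) obtain U V where "M = U * P + V * G" unfolding J_def by blast
  then have "U * P + V * G = [:r:]" "r \<noteq> 0" using r M(2) by auto
  then show ?thesis by blast
qed

text \<open>Otherwise all coefficients of \<open>P\<close> vanish at \<open>c\<close>, and an
  integer polynomial \<open>q\<close> of least degree vanishing at \<open>c\<close> divides each of
  them up to an integer. Clearing these integers contradicts primality of \<open>P\<close>, whose
  degree in the second variable is positive.\<close>

lemma prime_fiber_nonzero:
  assumes P: "prime_elem P" "degree P > 0"
  shows "\<exists>b. eval2 P c b \<noteq> 0"
proof (rule ccontr)
  assume "\<not> ?thesis"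
  then have "map_poly (\<lambda>p. ip1 p c) P = 0"
    unfolding eval2_def by (metis poly_all_0_iff_0)
  then have root: "ip1 (coeff P k) c = 0" for k
    by (metis coeff_0 coeff_map_poly ip1_0)
  have "P \<noteq> 0" using P by auto
  then have "\<exists>q. q \<noteq> 0 \<and> ip1 q c = 0" using root[of "degree P"] by (intro exI[of _ "lead_coeff P"]) auto
  then obtain q where q: "q \<noteq> 0" "ip1 q c = 0" "\<And>p. p \<noteq> 0 \<Longrightarrow> ip1 p c = 0 \<Longrightarrow> degree q \<le> degree p"
    using ex_has_least_nat[of "\<lambda>q. q \<noteq> 0 \<and> ip1 q c = 0" _ degree] by blast
  have dq: "degree q > 0"
  proof (rule ccontr)
    assume "\<not> degree q > 0"
    then obtain a where "q = [:a:]" using degree_eq_zeroE by blast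
    then show False using q by simp
  qed
  have "\<exists>a. a \<noteq> 0 \<and> q dvd smult a (coeff P k)" for k
  proof -
    obtain a h where ah: "a \<noteq> 0" "smult a (coeff P k) = q * h + pseudo_mod (coeff P k) q"
      using pseudo_mod(1)[OF q(1)] by blast
    then have "of_int a * ip1 (coeff P k) c = ip1 (q * h + pseudo_mod (coeff P k) q) c"
      by (metis ip1_smult)
    then have "ip1 (pseudo_mod (coeff P k) q) c = 0" using root[of k] q by simp
    then have "pseudo_mod (coeff P k) q = 0"
      using q(3) pseudo_mod(2)[OF q(1), of "coeff P k"] by force
    then show ?thesis using ah by auto
  qed
  then obtain a where a: "\<And>k. a k \<noteq> 0" "\<And>k. q dvd smult (a k) (coeff P k)" by metis
  define A where "A = (\<Prod>k\<le>degree P. a k)"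
  have "A \<noteq> 0" using a by (simp add: A_def)
  have "q dvd smult A (coeff P k)" for k
  proof (cases "k \<le> degree P")
    case True
    then have "a k dvd A" unfolding A_def by (intro dvd_prodI) auto
    then obtain t where "A = a k * t" by (elim dvdE)
    then have "smult A (coeff P k) = smult t (smult (a k) (coeff P k))" by (simp add: mult.commute)
    then show ?thesis using a(2)[of k] by (metis dvd_smult)
  qed (simp add: coeff_eq_0)
  then have "[:q:] dvd smult [:A:] P" by (simp add: const_poly_dvd_iff)
  then obtain H where H: "smult [:A:] P = [:q:] * H" by (elim dvdE)
  have "P dvd [:q:] * H" unfolding H[symmetric] by (rule dvd_smult) simp
  then have "P dvd [:q:] \<or> P dvd H" using P(1) prime_elem_dvd_multD by blast
  moreover have "\<not> P dvd [:q:]" using P(2) q(1) dvd_imp_degree_le[of P "[:q:]"] by auto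
  ultimately obtain H' where "H = P * H'" by (auto elim: dvdE)
  then have "P * [:[:A:]:] = P * ([:q:] * H')" using H by (simp add: algebra_simps)
  then have "[:[:A:]:] = [:q:] * H'" using \<open>P \<noteq> 0\<close> mult_cancel_left by blast
  then have "coeff [:[:A:]:] 0 = coeff ([:q:] * H') 0" by simp
  then have "[:A:] = q * coeff H' 0" by simp
  then have "q dvd [:A:]" by (metis dvd_triv_left)
  then have "degree q \<le> 0" using \<open>A \<noteq> 0\<close> dvd_imp_degree_le[of q "[:A:]"] by auto
  then show False using dq by simp
qed

lemma finite_fiber:
  assumes "prime_elem P" "degree P > 0"
  shows "finite {b. eval2 P c b = 0}"
proof -
  obtain b where "eval2 P c b \<noteq> 0" using prime_fiber_nonzero[OF assms] by blast
  then have "map_poly (\<lambda>p. ip1 p c) P \<noteq> 0" unfolding eval2_def by auto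
  then show ?thesis unfolding eval2_def by (rule poly_roots_finite)
qed

text \<open>The Bezout element leaves finitely many first coordinates, and over each of them the
  curve has a finite fibre.\<close>

lemma finite_common_zeros:
  assumes "prime_elem P" "degree P > 0" "\<not> P dvd G"
  shows "finite {y. eval2 P (fst y) (snd y) = 0 \<and> eval2 G (fst y) (snd y) = 0}"
proof -
  obtain U V r where r: "r \<noteq> 0" "U * P + V * G = [:r:]" using prime_bezout[OF assms] by blast
  have "ip1 r a = 0" if "eval2 P a b = 0" "eval2 G a b = 0" for a b
  proof -
    have "eval2 (U * P + V * G) a b = 0" using that by simp
    then show ?thesis unfolding r by simp
  qed
  then have "{y. eval2 P (fst y) (snd y) = 0 \<and> eval2 G (fst y) (snd y) = 0} \<subseteq>
    Sigma {a. ip1 r a = 0} (\<lambda>a. {b. eval2 P a b = 0})" by auto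
  moreover have "finite (Sigma {a. ip1 r a = 0} (\<lambda>a. {b. eval2 P a b = 0}))"
    using finite_ip1_roots[OF r(1)] finite_fiber[OF assms(1,2)] by (intro finite_SigmaI) auto
  ultimately show ?thesis using finite_subset by blast
qed

text \<open>The Euler operators \<open>a d/da\<close> and \<open>b d/db\<close>: they multiply each
  coefficient by an exponent and so give the logarithmic gradient without leaving the integer
  polynomials.\<close>

definition dlog1 :: "int poly poly \<Rightarrow> int poly poly" where
  "dlog1 P = map_poly (\<lambda>c. pCons 0 (pderiv c)) P"
definition dlog2 :: "int poly poly \<Rightarrow> int poly poly" where
  "dlog2 P = pCons 0 (pderiv P)"

lemma cf_dlog1: "cf (dlog1 P) k = int (fst k) * cf P k"
  by (cases "fst k") (auto simp: cf_def dlog1_def coeff_map_poly coeff_pderiv)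
lemma cf_dlog2: "cf (dlog2 P) k = int (snd k) * cf P k"
  by (cases "snd k") (auto simp: cf_def dlog2_def coeff_pderiv of_nat_poly algebra_simps)

lemma eval2_dlog1: "eval2 (dlog1 P) a b = (\<Sum>k\<in>supp2 P. of_int (cf P k) * of_nat (fst k) * a ^ fst k * b ^ snd k)"
proof -
  have "supp2 (dlog1 P) \<subseteq> supp2 P" by (auto simp: supp2_def cf_dlog1)
  then show ?thesis
    unfolding eval2_sum_superset[OF finite_supp2 \<open>supp2 (dlog1 P) \<subseteq> supp2 P\<close>]
    by (intro sum.cong refl) (simp add: cf_dlog1)
qed
lemma eval2_dlog2: "eval2 (dlog2 P) a b = (\<Sum>k\<in>supp2 P. of_int (cf P k) * of_nat (snd k) * a ^ fst k * b ^ snd k)"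
proof -
  have "supp2 (dlog2 P) \<subseteq> supp2 P" by (auto simp: supp2_def cf_dlog2)
  then show ?thesis
    unfolding eval2_sum_superset[OF finite_supp2 \<open>supp2 (dlog2 P) \<subseteq> supp2 P\<close>]
    by (intro sum.cong refl) (simp add: cf_dlog2)
qed

lemma has_field_derivative_log_power:
  fixes f :: "complex \<Rightarrow> complex"
  assumes "(f has_field_derivative f s * \<alpha>) (at s)"
  shows "((\<lambda>s. f s ^ n) has_field_derivative f s ^ n * (of_nat n * \<alpha>)) (at s)"
proof (cases n)
  case (Suc m)
  show ?thesis unfolding Suc
    using DERIV_power_Suc[OF assms, of m] by (simp add: algebra_simps)
qed simp

lemma eval2_has_field_derivative:
  assumes f: "(f has_field_derivative f s * \<alpha>) (at s)" and g: "(g has_field_derivative g s * \<beta>) (at s)"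
  shows "((\<lambda>s. eval2 P (f s) (g s)) has_field_derivative
    eval2 (dlog1 P) (f s) (g s) * \<alpha> + eval2 (dlog2 P) (f s) (g s) * \<beta>) (at s)"
proof -
  have "((\<lambda>s. of_int (cf P k) * (f s ^ fst k * g s ^ snd k)) has_field_derivative
    of_int (cf P k) * (f s ^ fst k * g s ^ snd k) * (of_nat (fst k) * \<alpha> + of_nat (snd k) * \<beta>)) (at s)" for k
    by (rule DERIV_cong[OF DERIV_cmult[OF DERIV_mult[OF has_field_derivative_log_power[OF f] has_field_derivative_log_power[OF g]]]])
       (simp add: algebra_simps)
  then have "((\<lambda>s. \<Sum>k\<in>supp2 P. of_int (cf P k) * (f s ^ fst k * g s ^ snd k)) has_field_derivative
    (\<Sum>k\<in>supp2 P. of_int (cf P k) * (f s ^ fst k * g s ^ snd k) * (of_nat (fst k) * \<alpha> + of_nat (snd k) * \<beta>))) (at s)"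
    by (intro DERIV_sum)
  then show ?thesis
    by (simp add: eval2_supp[of P] eval2_dlog1 eval2_dlog2 sum_distrib_left sum_distrib_right sum.distrib algebra_simps)
qed

section \<open>One-variable Laurent polynomials and faces of a support\<close>

text \<open>Dividing by the lowest power leaves a nonzero constant term, so no zero is moved to 0.
  Injectivity of \<open>e\<close> keeps the terms from cancelling.\<close>

lemma laurent_as_poly:
  fixes e :: "'k \<Rightarrow> int" and c :: "'k \<Rightarrow> complex"
  assumes K: "finite K" "K \<noteq> {}" "inj_on e K" "\<And>k. k \<in> K \<Longrightarrow> c k \<noteq> 0"
  shows "\<exists>p. (\<forall>z. z \<noteq> 0 \<longrightarrow> (\<Sum>k\<in>K. c k * z powi e k) = z powi Min (e ` K) * poly p z) \<and>
    poly p 0 \<noteq> 0 \<and> (card K \<ge> 2 \<longrightarrow> degree p > 0)"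
proof -
  define m where "m = Min (e ` K)"
  define p where "p = (\<Sum>k\<in>K. monom (c k) (nat (e k - m)))"
  have m: "m \<le> e k" if "k \<in> K" for k using that K by (simp add: m_def)
  have "m \<in> e ` K" unfolding m_def using K by (intro Min_in) auto
  then obtain k0 where k0: "k0 \<in> K" "e k0 = m" by auto
  have co: "coeff p (nat (e k - m)) = c k" if "k \<in> K" for k
  proof -
    have "coeff p (nat (e k - m)) = (\<Sum>k'\<in>K. if k' = k then c k else 0)"
      unfolding p_def coeff_sum
    proof (intro sum.cong refl)
      fix k' assume k': "k' \<in> K"
      have "nat (e k' - m) = nat (e k - m) \<longleftrightarrow> k' = k"
        using m[OF k'] m[OF that] K(3) k' that by (auto simp: inj_on_def)
      then show "coeff (monom (c k') (nat (e k' - m))) (nat (e k - m)) = (if k' = k then c k else 0)"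
        by auto
    qed
    then show ?thesis using K that by simp
  qed
  show ?thesis
  proof (intro exI[of _ p] conjI allI impI)
    show "(\<Sum>k\<in>K. c k * z powi e k) = z powi Min (e ` K) * poly p z" if "z \<noteq> 0" for z :: complex
    proof -
      have "c k * z powi e k = z powi m * (c k * z ^ nat (e k - m))" if "k \<in> K" for k
      proof -
        have "z powi e k = z powi (m + (e k - m))" by simp
        also have "\<dots> = z powi m * z powi (e k - m)" using \<open>z \<noteq> 0\<close> by (subst power_int_add) auto
        also have "z powi (e k - m) = z ^ nat (e k - m)" using m[OF that] by (simp add: power_int_def)
        finally show ?thesis by simp
      qed
      then have "(\<Sum>k\<in>K. c k * z powi e k) = (\<Sum>k\<in>K. z powi m * (c k * z ^ nat (e k - m)))"
        by (rule sum.cong[OF refl])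
      then show ?thesis by (simp add: p_def poly_sum poly_monom sum_distrib_left m_def)
    qed
    show "poly p 0 \<noteq> 0" using co[OF k0(1)] k0 K(4) by (simp add: poly_0_coeff_0)
    assume "card K \<ge> 2"
    then have "\<not> K \<subseteq> {k0}" using card_mono[of "{k0}" K] by auto
    then obtain k1 where k1: "k1 \<in> K" "k1 \<noteq> k0" by auto
    then have "e k1 \<noteq> m" using k0 K(3) by (auto simp: inj_on_def)
    then have "nat (e k1 - m) > 0" using m[OF k1(1)] by simp
    moreover have "nat (e k1 - m) \<le> degree p" using co[OF k1(1)] K(4)[OF k1(1)] by (intro le_degree) auto
    ultimately show "degree p > 0" by simp
  qed
qed

lemma laurent_finite_zeros:
  fixes e :: "'k \<Rightarrow> int" and c :: "'k \<Rightarrow> complex"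
  assumes "finite K" "K \<noteq> {}" "inj_on e K" "\<And>k. k \<in> K \<Longrightarrow> c k \<noteq> 0"
  shows "finite {z. z \<noteq> 0 \<and> (\<Sum>k\<in>K. c k * z powi e k) = 0}"
proof -
  let ?F = "\<lambda>z. \<Sum>k\<in>K. c k * z powi e k"
  obtain p where p: "(\<forall>z. z \<noteq> 0 \<longrightarrow> ?F z = z powi Min (e ` K) * poly p z) \<and> poly p 0 \<noteq> 0 \<and> (card K \<ge> 2 \<longrightarrow> degree p > 0)"
    using laurent_as_poly[OF assms] by (rule exE)
  have "{z. z \<noteq> 0 \<and> ?F z = 0} \<subseteq> {z. poly p z = 0}"
  proof (intro subsetI CollectI)
    fix z assume "z \<in> {z. z \<noteq> 0 \<and> ?F z = 0}"
    then have "z \<noteq> 0" "z powi Min (e ` K) * poly p z = 0" using conjunct1[OF p] by force+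
    then show "poly p z = 0" by simp
  qed
  moreover have "p \<noteq> 0" using conjunct2[OF p] by auto
  ultimately show ?thesis using poly_roots_finite finite_subset by blast
qed

lemma laurent_zero_exists:
  fixes e :: "'k \<Rightarrow> int" and c :: "'k \<Rightarrow> complex"
  assumes "finite K" "card K \<ge> 2" "inj_on e K" "\<And>k. k \<in> K \<Longrightarrow> c k \<noteq> 0"
  shows "\<exists>z. z \<noteq> 0 \<and> (\<Sum>k\<in>K. c k * z powi e k) = 0"
proof -
  let ?F = "\<lambda>z. \<Sum>k\<in>K. c k * z powi e k"
  have "K \<noteq> {}" using assms(2) by auto
  obtain p where p: "(\<forall>z. z \<noteq> 0 \<longrightarrow> ?F z = z powi Min (e ` K) * poly p z) \<and> poly p 0 \<noteq> 0 \<and> (card K \<ge> 2 \<longrightarrow> degree p > 0)"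
    using laurent_as_poly[OF assms(1) \<open>K \<noteq> {}\<close> assms(3,4)] by (rule exE)
  have p0: "poly p 0 \<noteq> 0" using conjunct2[OF p] by (rule conjunct1)
  have "degree p > 0" using mp[OF conjunct2[OF conjunct2[OF p]] assms(2)] .
  then obtain z where z: "poly p z = 0" using alg_closed_imp_poly_has_root[of p] by auto
  have "z \<noteq> 0" using z p0 by (cases "z = 0") simp_all
  have "?F z = z powi Min (e ` K) * poly p z" using mp[OF spec[OF conjunct1[OF p], of z] \<open>z \<noteq> 0\<close>] .
  then have "?F z = 0" unfolding z by simp
  with \<open>z \<noteq> 0\<close> show ?thesis by (intro exI[of _ z] conjI)
qed

lemma supp2_nz: "k \<in> supp2 P \<Longrightarrow> cf P k \<noteq> 0"
  by (simp add: supp2_def)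

text \<open>\<open>wt\<close> pairs an exponent with w, and \<open>pw\<close> pairs it with the
  perpendicular vector (w2, -w1); for nonzero w the two together determine the exponent.\<close>

definition wt :: "int \<Rightarrow> int \<Rightarrow> nat \<times> nat \<Rightarrow> int" where
  "wt w1 w2 k = w1 * int (fst k) + w2 * int (snd k)"
definition pw :: "int \<Rightarrow> int \<Rightarrow> nat \<times> nat \<Rightarrow> int" where
  "pw w1 w2 k = w2 * int (fst k) - w1 * int (snd k)"
definition hmin :: "int \<Rightarrow> int \<Rightarrow> int poly poly \<Rightarrow> int" where
  "hmin w1 w2 P = Min (wt w1 w2 ` supp2 P)"
definition hmax :: "int \<Rightarrow> int \<Rightarrow> int poly poly \<Rightarrow> int" where
  "hmax w1 w2 P = Max (wt w1 w2 ` supp2 P)"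
text \<open>For fixed \<open>\<zeta>\<close>, the pair (\<open>cu1\<close>, \<open>cu2\<close>) runs
  through the coset of the one-parameter subgroup \<open>\<tau>\<close> to
  (\<open>\<tau>\<close>^w1, \<open>\<tau>\<close>^w2) that contains the point
  (\<open>\<zeta>\<close>^w2, \<open>\<zeta>\<close>^(-w1)).\<close>

definition cu1 :: "int \<Rightarrow> int \<Rightarrow> complex \<Rightarrow> complex \<Rightarrow> complex" where
  "cu1 w1 w2 \<zeta> \<tau> = \<zeta> powi w2 * \<tau> powi w1"
definition cu2 :: "int \<Rightarrow> int \<Rightarrow> complex \<Rightarrow> complex \<Rightarrow> complex" where
  "cu2 w1 w2 \<zeta> \<tau> = \<zeta> powi (- w1) * \<tau> powi w2"
text \<open>The coefficient of \<open>\<tau>\<close>^h after restriction to this coset; for extremal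
  \<open>h\<close> it is an edge polynomial. \<open>Fpoly\<close> is the restriction divided by the
  lowest power of \<open>\<tau>\<close>.\<close>

definition face :: "int \<Rightarrow> int \<Rightarrow> int poly poly \<Rightarrow> int \<Rightarrow> complex \<Rightarrow> complex" where
  "face w1 w2 P h \<zeta> = (\<Sum>k\<in>{k\<in>supp2 P. wt w1 w2 k = h}. of_int (cf P k) * \<zeta> powi pw w1 w2 k)"
definition Fpoly :: "int \<Rightarrow> int \<Rightarrow> int poly poly \<Rightarrow> complex \<Rightarrow> complex poly" where
  "Fpoly w1 w2 P \<zeta> = (\<Sum>k\<in>supp2 P. monom (of_int (cf P k) * \<zeta> powi pw w1 w2 k) (nat (wt w1 w2 k - hmin w1 w2 P)))"

lemma hmin_le: "k \<in> supp2 P \<Longrightarrow> hmin w1 w2 P \<le> wt w1 w2 k"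
  by (simp add: hmin_def)
lemma hmax_ge: "k \<in> supp2 P \<Longrightarrow> wt w1 w2 k \<le> hmax w1 w2 P"
  by (simp add: hmax_def)
lemma hmin_in: "P \<noteq> 0 \<Longrightarrow> \<exists>k\<in>supp2 P. wt w1 w2 k = hmin w1 w2 P"
proof -
  assume "P \<noteq> 0"
  then have "hmin w1 w2 P \<in> wt w1 w2 ` supp2 P" unfolding hmin_def by (intro Min_in) auto
  then show ?thesis by auto
qed
lemma hmax_in: "P \<noteq> 0 \<Longrightarrow> \<exists>k\<in>supp2 P. wt w1 w2 k = hmax w1 w2 P"
proof -
  assume "P \<noteq> 0"
  then have "hmax w1 w2 P \<in> wt w1 w2 ` supp2 P" unfolding hmax_def by (intro Max_in) auto
  then show ?thesis by auto
qed

lemma curve_monomial: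
  assumes "\<zeta> \<noteq> 0" "\<tau> \<noteq> 0"
  shows "cu1 w1 w2 \<zeta> \<tau> ^ fst k * cu2 w1 w2 \<zeta> \<tau> ^ snd k = \<zeta> powi pw w1 w2 k * \<tau> powi wt w1 w2 k"
proof -
  have pw: "\<zeta> powi pw w1 w2 k = \<zeta> powi (w2 * int (fst k)) * \<zeta> powi (- w1 * int (snd k))"
    using assms power_int_add[of \<zeta> "w2 * int (fst k)" "- w1 * int (snd k)"] by (simp add: pw_def)
  have wt: "\<tau> powi wt w1 w2 k = \<tau> powi (w1 * int (fst k)) * \<tau> powi (w2 * int (snd k))"
    using assms power_int_add[of \<tau> "w1 * int (fst k)" "w2 * int (snd k)"] by (simp add: wt_def)
  have pp: "(x powi m) ^ n = x powi (m * int n)" for x :: complex and m n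
    by (simp add: power_int_mult)
  show ?thesis unfolding pw wt cu1_def cu2_def power_mult_distrib pp by (simp add: mult_ac)
qed

lemma poly_Fpoly:
  "poly (Fpoly w1 w2 P \<zeta>) \<tau> = (\<Sum>k\<in>supp2 P. of_int (cf P k) * \<zeta> powi pw w1 w2 k * \<tau> ^ nat (wt w1 w2 k - hmin w1 w2 P))"
  by (simp add: Fpoly_def poly_sum poly_monom)

lemma eval2_curve:
  assumes "\<zeta> \<noteq> 0" "\<tau> \<noteq> 0"
  shows "eval2 P (cu1 w1 w2 \<zeta> \<tau>) (cu2 w1 w2 \<zeta> \<tau>) = \<tau> powi hmin w1 w2 P * poly (Fpoly w1 w2 P \<zeta>) \<tau>"
proof -
  have t: "\<tau> powi wt w1 w2 k = \<tau> powi hmin w1 w2 P * \<tau> ^ nat (wt w1 w2 k - hmin w1 w2 P)" if "k \<in> supp2 P" for k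
  proof -
    have "\<tau> powi wt w1 w2 k = \<tau> powi (hmin w1 w2 P + (wt w1 w2 k - hmin w1 w2 P))" by simp
    also have "\<dots> = \<tau> powi hmin w1 w2 P * \<tau> powi (wt w1 w2 k - hmin w1 w2 P)"
      using assms by (subst power_int_add) auto
    also have "\<tau> powi (wt w1 w2 k - hmin w1 w2 P) = \<tau> ^ nat (wt w1 w2 k - hmin w1 w2 P)"
      using hmin_le[OF that, of w1 w2] by (simp add: power_int_def)
    finally show ?thesis .
  qed
  have "eval2 P (cu1 w1 w2 \<zeta> \<tau>) (cu2 w1 w2 \<zeta> \<tau>) =
    (\<Sum>k\<in>supp2 P. of_int (cf P k) * (\<zeta> powi pw w1 w2 k * \<tau> powi wt w1 w2 k))"
    unfolding eval2_supp curve_monomial[OF assms, symmetric] by (simp add: mult.assoc)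
  also have "\<dots> = (\<Sum>k\<in>supp2 P. \<tau> powi hmin w1 w2 P * (of_int (cf P k) * \<zeta> powi pw w1 w2 k * \<tau> ^ nat (wt w1 w2 k - hmin w1 w2 P)))"
    by (intro sum.cong refl) (simp only: t mult_ac)
  also have "\<dots> = \<tau> powi hmin w1 w2 P * poly (Fpoly w1 w2 P \<zeta>) \<tau>"
    by (simp only: poly_Fpoly sum_distrib_left)
  finally show ?thesis .
qed

lemma coeff_Fpoly: "coeff (Fpoly w1 w2 P \<zeta>) n = face w1 w2 P (hmin w1 w2 P + int n) \<zeta>"
proof -
  have "coeff (Fpoly w1 w2 P \<zeta>) n = (\<Sum>k\<in>supp2 P. if wt w1 w2 k = hmin w1 w2 P + int n then of_int (cf P k) * \<zeta> powi pw w1 w2 k else 0)"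
    unfolding Fpoly_def coeff_sum
  proof (intro sum.cong refl)
    fix k assume "k \<in> supp2 P"
    then have "nat (wt w1 w2 k - hmin w1 w2 P) = n \<longleftrightarrow> wt w1 w2 k = hmin w1 w2 P + int n"
      using hmin_le[of k P w1 w2] by auto
    then show "coeff (monom (of_int (cf P k) * \<zeta> powi pw w1 w2 k) (nat (wt w1 w2 k - hmin w1 w2 P))) n =
         (if wt w1 w2 k = hmin w1 w2 P + int n then of_int (cf P k) * \<zeta> powi pw w1 w2 k else 0)"
      by simp
  qed
  then show ?thesis by (simp add: face_def sum.inter_filter)
qed

lemma face_eq_0: "h \<notin> wt w1 w2 ` supp2 P \<Longrightarrow> face w1 w2 P h \<zeta> = 0"
  unfolding face_def by (rule sum.neutral) auto

lemma degree_Fpoly: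
  assumes "P \<noteq> 0" "face w1 w2 P (hmax w1 w2 P) \<zeta> \<noteq> 0"
  shows "degree (Fpoly w1 w2 P \<zeta>) = nat (hmax w1 w2 P - hmin w1 w2 P)"
proof (rule antisym)
  have le: "hmin w1 w2 P \<le> hmax w1 w2 P" using hmin_in[OF assms(1)] hmax_ge by metis
  show "degree (Fpoly w1 w2 P \<zeta>) \<le> nat (hmax w1 w2 P - hmin w1 w2 P)"
  proof (intro degree_le allI impI)
    fix n assume "nat (hmax w1 w2 P - hmin w1 w2 P) < n"
    then have "hmin w1 w2 P + int n > hmax w1 w2 P" by linarith
    then have "hmin w1 w2 P + int n \<notin> wt w1 w2 ` supp2 P" using hmax_ge[of _ P w1 w2] by force
    then show "coeff (Fpoly w1 w2 P \<zeta>) n = 0" by (simp add: coeff_Fpoly face_eq_0)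
  qed
  show "nat (hmax w1 w2 P - hmin w1 w2 P) \<le> degree (Fpoly w1 w2 P \<zeta>)"
    using assms le by (intro le_degree) (simp add: coeff_Fpoly)
qed

lemma inj_on_pw:
  assumes "w1 \<noteq> 0 \<or> w2 \<noteq> 0"
  shows "inj_on (pw w1 w2) {k\<in>S. wt w1 w2 k = h}"
proof (rule inj_onI)
  fix k k' assume kk: "k \<in> {k\<in>S. wt w1 w2 k = h}" "k' \<in> {k\<in>S. wt w1 w2 k = h}" "pw w1 w2 k = pw w1 w2 k'"
  define x y where "x = int (fst k) - int (fst k')" and "y = int (snd k) - int (snd k')"
  have 1: "w1 * x + w2 * y = 0" and 2: "w2 * x - w1 * y = 0"
    using kk by (auto simp: wt_def pw_def x_def y_def algebra_simps)
  have "(w1 * w1 + w2 * w2) * x = w1 * (w1 * x + w2 * y) + w2 * (w2 * x - w1 * y)" by (simp add: algebra_simps)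
  then have "(w1 * w1 + w2 * w2) * x = 0" using 1 2 by simp
  moreover have "(w1 * w1 + w2 * w2) * y = w2 * (w1 * x + w2 * y) - w1 * (w2 * x - w1 * y)" by (simp add: algebra_simps)
  then have "(w1 * w1 + w2 * w2) * y = 0" using 1 2 by simp
  moreover have "w1 * w1 + w2 * w2 \<noteq> 0" using assms by (metis sum_squares_eq_zero_iff)
  ultimately show "k = k'" by (auto simp: x_def y_def prod_eq_iff)
qed

lemma finite_face_zeros:
  assumes "w1 \<noteq> 0 \<or> w2 \<noteq> 0" "h \<in> wt w1 w2 ` supp2 P"
  shows "finite {\<zeta>. \<zeta> \<noteq> 0 \<and> face w1 w2 P h \<zeta> = 0}"
  unfolding face_def
  by (rule laurent_finite_zeros[OF _ _ inj_on_pw[OF assms(1)]]) (use assms(2) supp2_nz in auto)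

lemma face_zero_exists:
  assumes "w1 \<noteq> 0 \<or> w2 \<noteq> 0" "k \<in> supp2 P" "k' \<in> supp2 P" "k \<noteq> k'" "wt w1 w2 k = h" "wt w1 w2 k' = h"
  shows "\<exists>\<zeta>. \<zeta> \<noteq> 0 \<and> face w1 w2 P h \<zeta> = 0"
  unfolding face_def
proof (rule laurent_zero_exists[OF _ _ inj_on_pw[OF assms(1)]])
  have "card {k, k'} \<le> card {k \<in> supp2 P. wt w1 w2 k = h}" using assms by (intro card_mono) auto
  then show "2 \<le> card {k \<in> supp2 P. wt w1 w2 k = h}" using assms(4) by simp
qed (use supp2_nz in auto)

lemma ex_nonzero_avoiding:
  assumes "finite (S :: complex set)"
  shows "\<exists>z. z \<noteq> 0 \<and> z \<notin> S"
proof -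
  have "infinite (UNIV :: complex set)" by (simp add: infinite_UNIV_char_0)
  then have "UNIV - insert 0 S \<noteq> {}" using assms by (metis finite_Diff2 finite_insert finite.emptyI)
  then show ?thesis by auto
qed

text \<open>Evaluating along the curve \<open>\<tau> \<mapsto> (\<zeta>\<^sup>p \<tau>\<^sup>r, \<zeta>\<^sup>q \<tau>\<^sup>s)\<close> turns the support function into an order of
  vanishing, which is additive.\<close>

lemma hmin_mult:
  assumes w: "w1 \<noteq> 0 \<or> w2 \<noteq> 0" and PQ: "P \<noteq> 0" "Q \<noteq> 0"
  shows "hmin w1 w2 (P * Q) = hmin w1 w2 P + hmin w1 w2 Q"
proof -
  let ?Z = "\<lambda>P. {\<zeta>. \<zeta> \<noteq> 0 \<and> face w1 w2 P (hmin w1 w2 P) \<zeta> = 0}"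
  have fin: "finite (?Z P)" if "P \<noteq> 0" for P
  proof (rule finite_face_zeros[OF w])
    show "hmin w1 w2 P \<in> wt w1 w2 ` supp2 P" using hmin_in[OF that, of w1 w2] by force
  qed
  have "P * Q \<noteq> 0" using PQ by (rule no_zero_divisors)
  then have "finite (?Z P \<union> ?Z Q \<union> ?Z (P * Q))" using fin PQ by (intro finite_UnI)
  from ex_nonzero_avoiding[OF this] obtain \<zeta> where z: "\<zeta> \<noteq> 0 \<and> \<zeta> \<notin> ?Z P \<union> ?Z Q \<union> ?Z (P * Q)" by (rule exE)
  define f g h where "f = Fpoly w1 w2 P \<zeta>" and "g = Fpoly w1 w2 Q \<zeta>" and "h = Fpoly w1 w2 (P * Q) \<zeta>"
  have nz: "poly f 0 \<noteq> 0" "poly g 0 \<noteq> 0" "poly h 0 \<noteq> 0"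
    using z by (auto simp: f_def g_def h_def poly_0_coeff_0 coeff_Fpoly)
  define a b c where "a = hmin w1 w2 P" and "b = hmin w1 w2 Q" and "c = hmin w1 w2 (P * Q)"
  have eq: "\<tau> powi c * poly h \<tau> = \<tau> powi (a + b) * poly f \<tau> * poly g \<tau>" if "\<tau> \<noteq> 0" for \<tau>
  proof -
    have "\<tau> powi c * poly h \<tau> = (\<tau> powi a * poly f \<tau>) * (\<tau> powi b * poly g \<tau>)"
      unfolding a_def b_def c_def f_def g_def h_def eval2_curve[OF conjunct1[OF z] that, symmetric] by (rule eval2_mult)
    also have "\<dots> = \<tau> powi (a + b) * poly f \<tau> * poly g \<tau>"
      using that by (subst power_int_add) (simp_all add: mult_ac)
    finally show ?thesis .
  qed
  \<comment> \<open>It is not known which of \<open>c\<close> and \<open>a + b\<close> is larger. At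
    most one of \<open>n\<close> and \<open>m\<close> is nonzero, and evaluation at 0 then forces
    both to vanish.\<close>
  define n m where "n = nat (c - (a + b))" and "m = nat (a + b - c)"
  have "\<tau> ^ n * poly h \<tau> = \<tau> ^ m * poly f \<tau> * poly g \<tau>" if "\<tau> \<noteq> 0" for \<tau>
  proof (cases "c \<ge> a + b")
    case True
    then have "\<tau> powi c = \<tau> powi (a + b) * \<tau> ^ n"
      using that power_int_add[of \<tau> "a + b" "c - (a + b)"] by (simp add: n_def power_int_def)
    then show ?thesis using eq[OF that] True that by (simp add: m_def)
  next
    case False
    then have "\<tau> powi (a + b) = \<tau> powi c * \<tau> ^ m"
      using that power_int_add[of \<tau> c "a + b - c"] by (simp add: m_def power_int_def)
    then show ?thesis using eq[OF that] False that by (simp add: n_def)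
  qed
  then have "poly (monom 1 n * h - monom 1 m * f * g) \<tau> = 0" if "\<tau> \<noteq> 0" for \<tau>
    using that by (simp add: poly_monom)
  then have "UNIV - {0} \<subseteq> {\<tau>. poly (monom 1 n * h - monom 1 m * f * g) \<tau> = 0}" by auto
  moreover have "infinite (UNIV - {0::complex})" by (simp add: infinite_UNIV_char_0)
  ultimately have "infinite {\<tau>. poly (monom 1 n * h - monom 1 m * f * g) \<tau> = 0}"
    by (metis finite_subset)
  then have "monom 1 n * h - monom 1 m * f * g = 0"
    by (metis poly_roots_finite)
  then have "poly (monom 1 n * h) 0 = poly (monom 1 m * f * g) 0" by simp
  then have "0 ^ n * poly h 0 = 0 ^ m * (poly f 0 * poly g 0)" by (simp add: poly_monom)
  note eq0 = this
  have nm: "n = 0 \<or> m = 0" unfolding n_def m_def by linarith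
  have "n = 0"
  proof (rule ccontr)
    assume "n \<noteq> 0"
    then have "m = 0" using nm by simp
    then show False using eq0 nz \<open>n \<noteq> 0\<close> by (simp add: power_0_left)
  qed
  moreover have "m = 0"
  proof (rule ccontr)
    assume "m \<noteq> 0"
    then have "n = 0" using nm by simp
    then show False using eq0 nz \<open>m \<noteq> 0\<close> by (simp add: power_0_left)
  qed
  ultimately show ?thesis unfolding n_def m_def a_def b_def c_def by linarith
qed

text \<open>At a double root the coset is tangent to the curve, that is, the logarithmic gradient is
  orthogonal to w.\<close>

lemma Fpoly_double_root:
  assumes nz: "\<zeta> \<noteq> 0" "\<tau> \<noteq> 0" and r: "poly (Fpoly w1 w2 P \<zeta>) \<tau> = 0" "poly (pderiv (Fpoly w1 w2 P \<zeta>)) \<tau> = 0"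
  shows "of_int w1 * eval2 (dlog1 P) (cu1 w1 w2 \<zeta> \<tau>) (cu2 w1 w2 \<zeta> \<tau>) +
    of_int w2 * eval2 (dlog2 P) (cu1 w1 w2 \<zeta> \<tau>) (cu2 w1 w2 \<zeta> \<tau>) = 0"
proof -
  let ?f = "\<lambda>s. cu1 w1 w2 \<zeta> s" and ?g = "\<lambda>s. cu2 w1 w2 \<zeta> s"
  have pd: "((\<lambda>s. s powi n) has_field_derivative \<tau> powi n * (of_int n / \<tau>)) (at \<tau>)" for n
    using nz by (auto intro!: derivative_eq_intros simp: power_int_diff field_simps)
  have f: "(?f has_field_derivative ?f \<tau> * (of_int w1 / \<tau>)) (at \<tau>)"
    using DERIV_cmult[OF pd, of "\<zeta> powi w2" w1] by (simp add: cu1_def[abs_def] mult.assoc)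
  have g: "(?g has_field_derivative ?g \<tau> * (of_int w2 / \<tau>)) (at \<tau>)"
    using DERIV_cmult[OF pd, of "\<zeta> powi (- w1)" w2] by (simp add: cu2_def[abs_def] mult.assoc)
  have 1: "((\<lambda>s. eval2 P (?f s) (?g s)) has_field_derivative
    eval2 (dlog1 P) (?f \<tau>) (?g \<tau>) * (of_int w1 / \<tau>) + eval2 (dlog2 P) (?f \<tau>) (?g \<tau>) * (of_int w2 / \<tau>)) (at \<tau>)"
    by (rule eval2_has_field_derivative[OF f g])
  have "((\<lambda>s. s powi hmin w1 w2 P * poly (Fpoly w1 w2 P \<zeta>) s) has_field_derivative 0) (at \<tau>)"
    using DERIV_mult[OF pd poly_DERIV[of "Fpoly w1 w2 P \<zeta>" \<tau>], of "hmin w1 w2 P"] r by simp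
  then have 2: "((\<lambda>s. eval2 P (?f s) (?g s)) has_field_derivative 0) (at \<tau>)"
    by (rule has_field_derivative_transform_within_open[of _ _ _ "- {0}"]) (use nz eval2_curve in auto)
  have "eval2 (dlog1 P) (?f \<tau>) (?g \<tau>) * (of_int w1 / \<tau>) + eval2 (dlog2 P) (?f \<tau>) (?g \<tau>) * (of_int w2 / \<tau>) = 0"
    using DERIV_unique[OF 1 2] .
  then show ?thesis using nz by (simp add: field_simps)
qed

section \<open>Polygons given by their edges\<close>

lemma det2_polar: "c \<noteq> 0 \<Longrightarrow> e \<noteq> 0 \<Longrightarrow> det2 c e = cmod c * cmod e * sin (Arg e - Arg c)"
proof -
  assume "c \<noteq> 0" "e \<noteq> 0"
  have c: "Re c = cmod c * cos (Arg c)" "Im c = cmod c * sin (Arg c)"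
    using rcis_cmod_Arg[of c] by (metis Re_rcis) (metis Im_rcis rcis_cmod_Arg)
  have e: "Re e = cmod e * cos (Arg e)" "Im e = cmod e * sin (Arg e)"
    using rcis_cmod_Arg[of e] by (metis Re_rcis) (metis Im_rcis rcis_cmod_Arg)
  show ?thesis unfolding det2_def c e sin_diff by (simp add: algebra_simps)
qed

lemma det2_add: "det2 c (x + y) = det2 c x + det2 c y"
  by (simp add: det2_def algebra_simps)
lemma det2_0 [simp]: "det2 c 0 = 0" "det2 0 c = 0"
  by (simp_all add: det2_def)
lemma det2_uminus [simp]: "det2 (- c) x = - det2 c x" "det2 c (- x) = - det2 c x"
  by (simp_all add: det2_def algebra_simps)
lemma det2_sum_list: "det2 c (sum_list xs) = (\<Sum>x\<leftarrow>xs. det2 c x)"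
  by (induction xs) (auto simp: det2_add)
lemma det2_sum: "det2 c (\<Sum>x\<in>A. f x) = (\<Sum>x\<in>A. det2 c (f x))"
  by (induction A rule: infinite_finite_induct) (auto simp: det2_add)
text \<open>A clockwise quarter turn converts determinants into inner products. In the turned
  polygon the edge coming from \<open>e\<close> has inner normal \<open>e\<close> itself.\<close>

lemma det2_inner: "det2 c v = inner c (- \<i> * v)"
  by (simp add: det2_def inner_complex_def)

text \<open>A difference of two arguments lies strictly between -2 pi and 2 pi; this and the next
  three lemmas read off the sign of its sine on the four intervals of length pi.\<close>

lemma det2_nonneg: "0 \<le> Arg e - Arg c \<Longrightarrow> Arg e - Arg c \<le> pi \<Longrightarrow> 0 \<le> det2 c e"
  by (cases "c = 0"; cases "e = 0") (auto simp: det2_polar sin_ge_zero)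
lemma det2_nonneg': "Arg e - Arg c \<le> - pi \<Longrightarrow> 0 \<le> det2 c e"
proof (cases "c = 0 \<or> e = 0")
  case False
  assume "Arg e - Arg c \<le> - pi"
  then have "0 \<le> Arg e - Arg c + 2 * pi" "Arg e - Arg c + 2 * pi \<le> pi"
    using Arg_bounded[of e] Arg_bounded[of c] by auto
  then have "0 \<le> sin (Arg e - Arg c + 2 * pi)" by (rule sin_ge_zero)
  then show ?thesis using False by (simp add: det2_polar)
qed auto
lemma det2_nonpos: "- pi \<le> Arg e - Arg c \<Longrightarrow> Arg e - Arg c \<le> 0 \<Longrightarrow> det2 c e \<le> 0"
proof (cases "c = 0 \<or> e = 0")
  case False
  assume "- pi \<le> Arg e - Arg c" "Arg e - Arg c \<le> 0"
  then have "0 \<le> sin (- (Arg e - Arg c))" by (intro sin_ge_zero) auto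
  then have "sin (Arg e - Arg c) \<le> 0" by (metis neg_0_le_iff_le sin_minus)
  then show ?thesis using False by (simp add: det2_polar mult_nonneg_nonpos)
qed auto
lemma det2_nonpos': "Arg e - Arg c \<ge> pi \<Longrightarrow> det2 c e \<le> 0"
proof (cases "c = 0 \<or> e = 0")
  case False
  assume "Arg e - Arg c \<ge> pi"
  then have "0 \<le> 2 * pi - (Arg e - Arg c)" "2 * pi - (Arg e - Arg c) \<le> pi"
    using Arg_bounded[of e] Arg_bounded[of c] by auto
  then have "0 \<le> sin (2 * pi - (Arg e - Arg c))" by (rule sin_ge_zero)
  then have "sin (Arg e - Arg c) \<le> 0" by (simp add: sin_2pi_minus)
  then show ?thesis using False by (simp add: det2_polar mult_nonneg_nonpos)
qed auto

lemma takeWhile_filter_sorted: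
  "sorted (map Arg xs) \<Longrightarrow> takeWhile (\<lambda>e. Arg e \<le> x) xs = filter (\<lambda>e. Arg e \<le> x) xs"
proof (induction xs)
  case (Cons a xs)
  show ?case
  proof (cases "Arg a \<le> x")
    case True
    with Cons show ?thesis by simp
  next
    case False
    with Cons.prems have "filter (\<lambda>e. Arg e \<le> x) xs = []" by (intro filter_False) auto
    with False show ?thesis by simp
  qed
qed simp

lemma dropWhile_sorted:
  "sorted (map Arg xs) \<Longrightarrow> e \<in> set (dropWhile (\<lambda>e. Arg e \<le> x) xs) \<Longrightarrow> Arg e > x"
  by (induction xs) (auto split: if_splits)

locale polygon =
  fixes es :: "complex list"
  assumes sorted_es: "sorted (map Arg es)" and nz_es: "0 \<notin> set es" and sum_es: "sum_list es = 0"
begin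

definition verts where "verts = {sum_list (take k es) | k. k \<le> length es}"
definition Q where "Q = convex hull verts"
text \<open>The vertex reached after all edges of argument at most \<open>Arg c\<close>. It
  minimizes \<open>det2 c\<close>: just before it the edges decrease this functional, just after it
  they increase it.\<close>

definition T where "T c = sum_list (takeWhile (\<lambda>e. Arg e \<le> Arg c) es)"

lemma finite_verts: "finite verts"
proof -
  have "verts = (\<lambda>k. sum_list (take k es)) ` {..length es}" by (auto simp: verts_def)
  then show ?thesis by simp
qed

lemma T_in_verts: "T c \<in> verts"
proof -
  have "takeWhile (\<lambda>e. Arg e \<le> Arg c) es = take (length (takeWhile (\<lambda>e. Arg e \<le> Arg c) es)) es"
    by (rule takeWhile_eq_take)
  then show ?thesis unfolding verts_def T_def
    using length_takeWhile_le[of "\<lambda>e. Arg e \<le> Arg c" es] by (metis (mono_tags, lifting) mem_Collect_eq)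
qed

lemma takeWhile_filter: "takeWhile (\<lambda>e. Arg e \<le> x) es = filter (\<lambda>e. Arg e \<le> x) es"
  using takeWhile_filter_sorted[OF sorted_es] .

lemma split_es:
  "es = takeWhile (\<lambda>e. Arg e \<le> x) es @ dropWhile (\<lambda>e. Arg e \<le> x) es"
  "\<And>e. e \<in> set (takeWhile (\<lambda>e. Arg e \<le> x) es) \<Longrightarrow> Arg e \<le> x"
  "\<And>e. e \<in> set (dropWhile (\<lambda>e. Arg e \<le> x) es) \<Longrightarrow> Arg e > x"
proof -
  show "es = takeWhile (\<lambda>e. Arg e \<le> x) es @ dropWhile (\<lambda>e. Arg e \<le> x) es" by simp
  show "\<And>e. e \<in> set (takeWhile (\<lambda>e. Arg e \<le> x) es) \<Longrightarrow> Arg e \<le> x" by (auto dest: set_takeWhileD)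
  show "\<And>e. e \<in> set (dropWhile (\<lambda>e. Arg e \<le> x) es) \<Longrightarrow> Arg e > x" by (rule dropWhile_sorted[OF sorted_es])
qed

text \<open>The edges between the two vertices contribute with one sign unless they reach more than
  half a turn away from \<open>c\<close>. In that case the complementary boundary path has the
  required sign, and the two paths are compared through the total sum 0.\<close>

lemma T_minimal_vert:
  assumes "v \<in> verts"
  shows "det2 c (T c) \<le> det2 c v"
proof -
  define \<gamma> where "\<gamma> = Arg c"
  define d where "d xs = (\<Sum>x\<leftarrow>xs. det2 c x)" for xs :: "complex list"
  have d_app: "d (xs @ ys) = d xs + d ys" for xs ys by (simp add: d_def)
  have d_nonneg: "0 \<le> d xs" if "\<And>x. x \<in> set xs \<Longrightarrow> 0 \<le> det2 c x" for xs
    unfolding d_def using that by (intro sum_list_nonneg) auto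
  have d_nonpos: "d xs \<le> 0" if "\<And>x. x \<in> set xs \<Longrightarrow> det2 c x \<le> 0" for xs
    unfolding d_def using that by (intro sum_list_nonpos) auto
  obtain k where k: "k \<le> length es" "v = sum_list (take k es)" using assms by (auto simp: verts_def)
  define p r where "p = take k es" and "r = drop k es"
  define xs ys where "xs = takeWhile (\<lambda>e. Arg e \<le> \<gamma>) es" and "ys = dropWhile (\<lambda>e. Arg e \<le> \<gamma>) es"
  have pr: "es = p @ r" by (simp add: p_def r_def)
  have xy: "es = xs @ ys" by (simp add: xs_def ys_def)
  have xs: "Arg e \<le> \<gamma>" if "e \<in> set xs" for e using split_es(2)[of e \<gamma>] that by (simp add: xs_def)
  have ys: "Arg e > \<gamma>" if "e \<in> set ys" for e using split_es(3)[of e \<gamma>] that by (simp add: ys_def)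
  have tot: "d es = 0" using det2_sum_list[of c es] sum_es by (simp add: d_def)
  have Tc: "det2 c (T c) = d xs" by (simp add: T_def det2_sum_list d_def xs_def \<gamma>_def)
  have v: "det2 c v = d p" by (simp add: k det2_sum_list d_def p_def)
  have srt: "\<And>a b. a \<in> set p \<Longrightarrow> b \<in> set r \<Longrightarrow> Arg a \<le> Arg b"
    using sorted_es unfolding pr by (auto simp: sorted_append)
  have g: "- pi < \<gamma>" "\<gamma> \<le> pi" using Arg_bounded[of c] by (auto simp: \<gamma>_def)
  have b: "- pi < Arg e" "Arg e \<le> pi" for e using Arg_bounded[of e] by auto
  consider us where "xs = p @ us" "r = us @ ys" | us where "p = xs @ us" "ys = us @ r"
    using pr xy by (metis append_eq_append_conv2)
  then show ?thesis
  proof cases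
    case 1
    have "d us \<le> 0"
    proof (cases "\<exists>e\<in>set us. Arg e < \<gamma> - pi")
      case True
      then obtain e where e: "e \<in> set us" "Arg e < \<gamma> - pi" by auto
      have "0 \<le> d p"
      proof (rule d_nonneg, rule det2_nonneg')
        fix x assume "x \<in> set p"
        then have "Arg x \<le> Arg e" using srt[of x e] e 1 by simp
        then show "Arg x - Arg c \<le> - pi" using e by (simp add: \<gamma>_def)
      qed
      moreover have "0 \<le> d ys"
      proof (rule d_nonneg, rule det2_nonneg)
        fix x assume "x \<in> set ys"
        then show "0 \<le> Arg x - Arg c" "Arg x - Arg c \<le> pi" using ys[of x] e(2) b[of x] b[of e] by (auto simp: \<gamma>_def)
      qed
      ultimately show ?thesis using tot unfolding xy 1(1) d_app by linarith
    next
      case False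
      show ?thesis
      proof (rule d_nonpos, rule det2_nonpos)
        fix x assume x: "x \<in> set us"
        then show "- pi \<le> Arg x - Arg c" using False by (force simp: \<gamma>_def)
        show "Arg x - Arg c \<le> 0" using xs[of x] 1 x by (simp add: \<gamma>_def)
      qed
    qed
    then show ?thesis unfolding Tc v 1(1) d_app by simp
  next
    case 2
    have "0 \<le> d us"
    proof (cases "\<exists>e\<in>set us. Arg e > \<gamma> + pi")
      case True
      then obtain e where e: "e \<in> set us" "Arg e > \<gamma> + pi" by auto
      have "d r \<le> 0"
      proof (rule d_nonpos, rule det2_nonpos')
        fix x assume "x \<in> set r"
        then have "Arg e \<le> Arg x" using srt[of e x] e 2 by simp
        then show "Arg x - Arg c \<ge> pi" using e by (simp add: \<gamma>_def)
      qed
      moreover have "d xs \<le> 0"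
      proof (rule d_nonpos, rule det2_nonpos)
        fix x assume "x \<in> set xs"
        then show "- pi \<le> Arg x - Arg c" "Arg x - Arg c \<le> 0" using xs[of x] e(2) b[of x] b[of e] by (auto simp: \<gamma>_def)
      qed
      ultimately show ?thesis using tot unfolding xy 2(2) d_app by linarith
    next
      case False
      show ?thesis
      proof (rule d_nonneg, rule det2_nonneg)
        fix x assume x: "x \<in> set us"
        then show "Arg x - Arg c \<le> pi" using False by (force simp: \<gamma>_def)
        show "0 \<le> Arg x - Arg c" using ys[of x] 2 x by (simp add: \<gamma>_def)
      qed
    qed
    then show ?thesis unfolding Tc v 2(1) d_app by simp
  qed
qed

lemma T_in_Q: "T c \<in> Q"
  unfolding Q_def by (rule hull_inc) (rule T_in_verts)

lemma T_minimal:
  assumes "v \<in> Q" shows "det2 c (T c) \<le> det2 c v"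
proof -
  have "convex {v. det2 c (T c) \<le> det2 c v}"
    unfolding det2_inner[of c] by (auto simp: convex_def inner_add_right algebra_simps intro!: convex_bound_le)
  then have "Q \<subseteq> {v. det2 c (T c) \<le> det2 c v}"
    unfolding Q_def using T_minimal_vert by (intro hull_minimal) auto
  then show ?thesis using assms by auto
qed

lemma compact_Q: "compact Q" and convex_Q: "convex Q" and nonempty_Q: "Q \<noteq> {}"
  using T_in_Q unfolding Q_def
  by (auto intro: finite_imp_compact_convex_hull finite_verts convex_convex_hull)

lemma Arg_uminus_le: "c \<noteq> 0 \<Longrightarrow> Arg c \<le> 0 \<Longrightarrow> Arg (- c) = Arg c + pi"
  by (simp add: Arg_minus)

text \<open>If \<open>Arg c\<close> is at most 0, the edges between \<open>T c\<close> and
  \<open>T (- c)\<close> are those with argument in the half turn starting at \<open>Arg c\<close>,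
  exactly where \<open>det2 c\<close> can be positive. The other case exchanges \<open>c\<close> and
  \<open>- c\<close> and uses that the edges sum to 0.\<close>

lemma width:
  "- det2 c (T c) - det2 (- c) (T (- c)) = (\<Sum>e\<leftarrow>es. max 0 (det2 c e))"
proof -
  have main: "- det2 c (T c) - det2 (- c) (T (- c)) = (\<Sum>e\<leftarrow>es. max 0 (det2 c e))"
    if c: "c \<noteq> 0" "Arg c \<le> 0" for c
  proof -
    have Tsum: "det2 c (T x) = (\<Sum>e\<leftarrow>es. if Arg e \<le> Arg x then det2 c e else 0)" for x
      unfolding T_def takeWhile_filter det2_sum_list by (simp add: sum_list_map_filter')
    have "- det2 c (T c) - det2 (- c) (T (- c)) = det2 c (T (- c)) - det2 c (T c)" by simp
    also have "\<dots> = (\<Sum>e\<leftarrow>es. (if Arg e \<le> Arg (- c) then det2 c e else 0) - (if Arg e \<le> Arg c then det2 c e else 0))"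
      unfolding Tsum by (simp add: sum_list_subtractf)
    also have "\<dots> = (\<Sum>e\<leftarrow>es. max 0 (det2 c e))"
    proof (rule arg_cong[where f = sum_list], rule map_cong[OF refl])
      fix e
      have b: "- pi < Arg e" "Arg e \<le> pi" "- pi < Arg c" using Arg_bounded[of e] Arg_bounded[of c] by auto
      note mc = Arg_uminus_le[OF c]
      consider "Arg e \<le> Arg c" | "Arg c < Arg e" "Arg e \<le> Arg c + pi" | "Arg e > Arg c + pi" by linarith
      then show "(if Arg e \<le> Arg (- c) then det2 c e else 0) - (if Arg e \<le> Arg c then det2 c e else 0) = max 0 (det2 c e)"
      proof cases
        case 1
        then have "det2 c e \<le> 0" using b c by (intro det2_nonpos) auto
        moreover have "Arg e \<le> Arg (- c)" using 1 mc pi_gt_zero by linarith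
        ultimately show ?thesis using 1 by simp
      next
        case 2
        then have "0 \<le> det2 c e" by (intro det2_nonneg) auto
        then show ?thesis using 2 mc by auto
      next
        case 3
        then have "det2 c e \<le> 0" by (intro det2_nonpos') auto
        moreover have "\<not> Arg e \<le> Arg c" using 3 pi_gt_zero by linarith
        ultimately show ?thesis using 3 mc by simp
      qed
    qed
    finally show ?thesis .
  qed
  show ?thesis
  proof (cases "c = 0")
    case True
    then show ?thesis by simp
  next
    case False
    show ?thesis
    proof (cases "Arg c \<le> 0")
      case True
      then show ?thesis using main False by blast
    next
      case pos: False
      then have "Arg (- c) \<le> 0" using False Arg_bounded[of c] by (simp add: Arg_minus)
      then have "- det2 (- c) (T (- c)) - det2 c (T c) = (\<Sum>e\<leftarrow>es. max 0 (det2 (- c) e))"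
        using main[of "- c"] False by simp
      also have "\<dots> = (\<Sum>e\<leftarrow>es. max 0 (det2 c e) - det2 c e)"
        by (rule arg_cong[where f = sum_list], rule map_cong[OF refl]) auto
      also have "\<dots> = (\<Sum>e\<leftarrow>es. max 0 (det2 c e)) - det2 c (sum_list es)"
        by (simp add: sum_list_subtractf det2_sum_list)
      finally show ?thesis by (simp add: sum_es)
    qed
  qed
qed

text \<open>Off the branch cut this is continuity of \<open>Arg\<close>. Across the negative real
  axis \<open>Arg\<close> jumps between pi and -pi, but there \<open>T\<close> sums all edges on one
  side and none on the other, which is 0 both times.\<close>

lemma T_locally_constant:
  assumes c: "c \<noteq> 0" and no: "\<And>e. e \<in> set es \<Longrightarrow> Arg e \<noteq> Arg c"
  shows "\<forall>\<^sub>F c' in nhds c. T c' = T c"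
proof -
  have Tall: "T c' = 0" if "\<And>e. e \<in> set es \<Longrightarrow> Arg e \<le> Arg c'" for c'
    using that sum_es unfolding T_def by (simp add: takeWhile_eq_all_conv[THEN iffD2])
  have Tnone: "T c' = 0" if "\<And>e. e \<in> set es \<Longrightarrow> Arg e > Arg c'" for c'
    unfolding T_def takeWhile_filter using that by (subst filter_False) force+
  show ?thesis
  proof (cases "c \<in> \<real>\<^sub>\<le>\<^sub>0")
    case False
    then have lim: "(Arg \<longlongrightarrow> Arg c) (nhds c)"
      using continuous_at_Arg[of c] by (simp add: isCont_def tendsto_at_iff_tendsto_nhds)
    have "\<forall>\<^sub>F c' in nhds c. \<forall>e\<in>set es. (Arg e \<le> Arg c' \<longleftrightarrow> Arg e \<le> Arg c)"
    proof (intro eventually_ball_finite ballI)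
      fix e assume e: "e \<in> set es"
      show "\<forall>\<^sub>F c' in nhds c. (Arg e \<le> Arg c' \<longleftrightarrow> Arg e \<le> Arg c)"
      proof (cases "Arg e < Arg c")
        case True
        with order_tendstoD(1)[OF lim True] show ?thesis by (auto elim: eventually_mono)
      next
        case False
        then have "Arg c < Arg e" using no[OF e] by simp
        from order_tendstoD(2)[OF lim this] False no[OF e] show ?thesis by (auto elim: eventually_mono)
      qed
    qed simp
    then show ?thesis
    proof eventually_elim
      case (elim c')
      then show ?case unfolding T_def takeWhile_filter by (intro arg_cong[where f = sum_list] filter_cong) auto
    qed
  next
    case True
    have Ac: "Arg c = pi" using True c by (metis Arg_eq_pi complex_eq_iff complex_nonpos_Reals_iff less_eq_real_def zero_complex.simps)
    have "- c \<notin> \<real>\<^sub>\<le>\<^sub>0" using True c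
      by (auto simp: complex_nonpos_Reals_iff complex_eq_iff)
    then have "isCont Arg (- c)" by (rule continuous_at_Arg)
    then have "isCont (\<lambda>c'. Arg (- c')) c"
      using isCont_o2[of c uminus Arg] by (simp add: o_def)
    then have lim: "((\<lambda>c'. Arg (- c')) \<longlongrightarrow> Arg (- c)) (nhds c)"
      using tendsto_at_iff_tendsto_nhds[of "\<lambda>c'. Arg (- c')" c] by (simp add: isCont_def)
    have "\<not> Arg c \<le> 0" unfolding Ac using pi_gt_zero by linarith
    then have "Arg (- c) = 0" using c Ac by (simp add: Arg_minus)
    note lim = lim[unfolded this]
    have Tc: "T c = 0" using Ac Arg_bounded by (intro Tall) auto
    have "\<forall>\<^sub>F c' in nhds c. \<forall>e\<in>set es. Arg e - pi < Arg (- c') \<and> Arg (- c') < Arg e + pi"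
    proof (intro eventually_ball_finite ballI)
      fix e assume e: "e \<in> set es"
      have "Arg e - pi < 0" "0 < Arg e + pi" using no[OF e] Arg_bounded[of e] Ac by auto
      from order_tendstoD(1)[OF lim this(1)] order_tendstoD(2)[OF lim this(2)]
      show "\<forall>\<^sub>F c' in nhds c. Arg e - pi < Arg (- c') \<and> Arg (- c') < Arg e + pi"
        by eventually_elim auto
    qed simp
    moreover have "\<forall>\<^sub>F c' in nhds c. c' \<noteq> 0" using c by (rule t1_space_nhds)
    ultimately show ?thesis
    proof eventually_elim
      case (elim c')
      show ?case
      proof (cases "Arg c' \<le> 0")
        case True
        then have "Arg (- c') = Arg c' + pi" using elim by (simp add: Arg_minus)
        then show ?thesis unfolding Tc using elim by (intro Tnone) force
      next
        case False
        then have "Arg (- c') = Arg c' - pi" using elim by (simp add: Arg_minus)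
        then show ?thesis unfolding Tc using elim by (intro Tall) force
      qed
    qed
  qed
qed

end

text \<open>A slope is determined by any open set on which it is valid, so it is locally constant,
  and the punctured plane is connected.\<close>

lemma linear_if_locally_linear:
  fixes g :: "complex \<Rightarrow> real"
  assumes loc: "\<And>c. c \<noteq> 0 \<Longrightarrow> \<exists>d. \<forall>\<^sub>F c' in nhds c. g c' = inner c' d" and g0: "g 0 = 0"
  shows "\<exists>d. \<forall>c. g c = inner c d"
proof -
  obtain D where D: "\<And>c. c \<noteq> 0 \<Longrightarrow> \<forall>\<^sub>F c' in nhds c. g c' = inner c' (D c)" using loc by metis
  have uniq: "d = d'" if "\<forall>\<^sub>F c' in nhds c. inner c' d = inner c' d'" for c d d' :: complex
  proof -
    from that[unfolded eventually_nhds] obtain S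
      where "open S \<and> c \<in> S \<and> (\<forall>x\<in>S. inner x d = inner x d')" by (rule exE)
    then have S: "open S" "c \<in> S" "\<forall>x\<in>S. inner x d = inner x d'" by simp_all
    obtain r where r: "r > 0" "ball c r \<subseteq> S" using S(1,2) by (rule openE)
    have "inner v (d - d') = 0" if "norm v = 1" for v
    proof -
      have "c + (r/2) *\<^sub>R v \<in> S" using r that by (intro subsetD[OF r(2)]) (auto simp: dist_norm)
      then have "inner (c + (r/2) *\<^sub>R v) (d - d') = 0" "inner c (d - d') = 0"
        using S by (auto simp: inner_diff_right)
      then have "inner ((r/2) *\<^sub>R v) (d - d') = 0" by (simp only: inner_add_left)
      then have "(r/2) * inner v (d - d') = 0" by (simp only: inner_scaleR_left)
      then show ?thesis using r by simp
    qed
    from this[of 1] this[of \<i>] show ?thesis by (simp add: inner_complex_def complex_eq_iff)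
  qed
  have const: "D a = D b" if "a \<in> - {0}" "b \<in> - {0}" for a b
  proof (rule connected_local_const[OF _ that])
    show "connected (- {0::complex})" by (rule connected_punctured_universe) simp
    show "\<forall>a\<in>- {0}. \<forall>\<^sub>F b in at a within - {0}. D a = D b"
    proof
      fix a :: complex assume "a \<in> - {0}"
      then have "\<forall>\<^sub>F b in nhds a. \<forall>\<^sub>F c' in nhds b. g c' = inner c' (D a)"
        using D[of a] by (simp add: eventually_eventually)
      moreover have "\<forall>\<^sub>F b in nhds a. b \<noteq> 0" using \<open>a \<in> - {0}\<close> by (intro t1_space_nhds) auto
      ultimately have "\<forall>\<^sub>F b in nhds a. D a = D b"
      proof eventually_elim
        case (elim b)
        from D[OF elim(2)] elim(1) have "\<forall>\<^sub>F c' in nhds b. inner c' (D a) = inner c' (D b)"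
          by eventually_elim simp
        then show ?case by (rule uniq)
      qed
      then show "\<forall>\<^sub>F b in at a within - {0}. D a = D b"
        by (rule eventually_at_filter[THEN iffD2, OF eventually_mono]) auto
    qed
  qed
  have "g c = inner c (D 1)" for c
  proof (cases "c = 0")
    case False
    then have "g c = inner c (D c)" using eventually_nhds_x_imp_x[OF D] by simp
    then show ?thesis using const[of c 1] False by simp
  qed (simp add: g0)
  then show ?thesis by blast
qed

text \<open>A point of one set outside the other could be strictly separated from it, against the
  equal minima.\<close>

lemma convex_eq_if_support_eq:
  fixes X Y :: "complex set"
  assumes X: "compact X" "convex X" and Y: "compact Y" "convex Y"
    and XY: "\<And>c. \<exists>x\<in>X. \<exists>y\<in>Y. inner c x = inner c y \<and> (\<forall>x'\<in>X. inner c x \<le> inner c x') \<and> (\<forall>y'\<in>Y. inner c y \<le> inner c y')"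
  shows "X = Y"
proof -
  have sub: "X \<subseteq> Y" if Y: "compact Y" "convex Y"
    and XY: "\<And>c. \<exists>x\<in>X. \<exists>y\<in>Y. inner c x = inner c y \<and> (\<forall>x'\<in>X. inner c x \<le> inner c x') \<and> (\<forall>y'\<in>Y. inner c y \<le> inner c y')"
    for X Y :: "complex set"
  proof
    fix z assume z: "z \<in> X"
    show "z \<in> Y"
    proof (rule ccontr)
      assume "z \<notin> Y"
      then obtain a b where ab: "inner a z < b" "\<forall>x\<in>Y. b < inner a x"
        using separating_hyperplane_closed_point[OF Y(2) compact_imp_closed[OF Y(1)]] by blast
      obtain x y where "x \<in> X" "y \<in> Y" "inner a x = inner a y" "\<forall>x'\<in>X. inner a x \<le> inner a x'"
        using XY[of a] by blast
      then show False using ab z by force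
    qed
  qed
  have "\<exists>y\<in>Y. \<exists>x\<in>X. inner c y = inner c x \<and> (\<forall>y'\<in>Y. inner c y \<le> inner c y') \<and> (\<forall>x'\<in>X. inner c x \<le> inner c x')" for c
    using XY[of c] by metis
  then show ?thesis using sub[OF Y XY] sub[OF X] by blast
qed

lemma min_locally_linear:
  fixes K :: "complex set"
  assumes K: "finite K" "k0 \<in> K" and uniq: "\<And>k. k \<in> K \<Longrightarrow> k \<noteq> k0 \<Longrightarrow> inner c k0 < inner c k"
  shows "\<forall>\<^sub>F c' in nhds c. Min (inner c' ` K) = inner c' k0"
proof -
  have "\<forall>\<^sub>F c' in nhds c. \<forall>k\<in>K. k \<noteq> k0 \<longrightarrow> inner c' k0 < inner c' k"
  proof (intro eventually_ball_finite ballI)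
    fix k assume k: "k \<in> K"
    show "\<forall>\<^sub>F c' in nhds c. k \<noteq> k0 \<longrightarrow> inner c' k0 < inner c' k"
    proof (cases "k = k0")
      case False
      have "((\<lambda>c'. inner c' k - inner c' k0) \<longlongrightarrow> inner c k - inner c k0) (nhds c)"
        by (intro tendsto_intros filterlim_ident)
      from order_tendstoD(1)[OF this, of 0] uniq[OF k False] show ?thesis by (auto elim: eventually_mono)
    qed simp
  qed (use K in auto)
  then show ?thesis
  proof eventually_elim
    case (elim c')
    show ?case by (rule Min_eqI) (use K elim in \<open>auto intro: less_imp_le\<close>)
  qed
qed

text \<open>The difference of the two support functions is odd because the widths agree, and since no two
  edges of \<open>Q\<close> are opposite it is linear near every direction or near its opposite.\<close>

lemma (in polygon) hull_eq_translate:
  assumes K: "finite K" "K \<noteq> {}"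
    and edges: "\<And>c k k'. c \<noteq> 0 \<Longrightarrow> k \<in> K \<Longrightarrow> k' \<in> K \<Longrightarrow> k \<noteq> k' \<Longrightarrow> inner c k = Min (inner c ` K) \<Longrightarrow>
       inner c k' = Min (inner c ` K) \<Longrightarrow> \<exists>e\<in>set es. Arg e = Arg c"
    and wd: "\<And>c. Max (inner c ` K) - Min (inner c ` K) = (\<Sum>e\<leftarrow>es. max 0 (det2 c e))"
    and opp: "\<And>e e'. e \<in> set es \<Longrightarrow> e' \<in> set es \<Longrightarrow> Arg e' \<noteq> Arg (- e)"
  shows "\<exists>d. convex hull K = (\<lambda>v. - \<i> * v + d) ` Q \<and> (\<forall>c. Min (inner c ` K) = det2 c (T c) + inner c d)"
proof -
  define g where "g c = Min (inner c ` K) - det2 c (T c)" for c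
  have maxmin: "Max (inner c ` K) = - Min (inner (- c) ` K)" for c
  proof -
    have "inner (- c) ` K = uminus ` (inner c ` K)" by (auto simp: image_image)
    then have "Min (inner (- c) ` K) = - Max (inner c ` K)"
      using K minus_Max_eq_Min[of "inner c ` K"] by simp
    then show ?thesis by simp
  qed
  have odd: "g (- c) = - g c" for c
    using wd[of c] width[of c] maxmin[of c] by (simp add: g_def)
  have loc0: "\<exists>d. \<forall>\<^sub>F c' in nhds c. g c' = inner c' d" if c: "c \<noteq> 0" and no: "\<And>e. e \<in> set es \<Longrightarrow> Arg e \<noteq> Arg c" for c
  proof -
    have "Min (inner c ` K) \<in> inner c ` K" using K by (intro Min_in) auto
    then obtain k0 where k0: "k0 \<in> K" "inner c k0 = Min (inner c ` K)" by auto
    have lt: "inner c k0 < inner c k" if "k \<in> K" "k \<noteq> k0" for k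
    proof -
      have "inner c k0 \<le> inner c k" unfolding k0(2) using that K by simp
      moreover have "inner c k \<noteq> inner c k0" using edges[OF c k0(1) that(1)] that(2) k0(2) no by metis
      ultimately show ?thesis by simp
    qed
    have "\<forall>\<^sub>F c' in nhds c. T c' = T c"
      by (rule T_locally_constant[OF c]) (rule no)
    moreover have "\<forall>\<^sub>F c' in nhds c. Min (inner c' ` K) = inner c' k0"
      by (rule min_locally_linear[OF K(1) k0(1)]) (use lt in auto)
    ultimately have "\<forall>\<^sub>F c' in nhds c. g c' = inner c' (k0 - (- \<i> * T c))"
    proof eventually_elim
      case (elim c')
      then show ?case by (simp only: g_def det2_inner inner_diff_right)
    qed
    then show ?thesis by blast
  qed
  have "\<exists>d. \<forall>\<^sub>F c' in nhds c. g c' = inner c' d" if c: "c \<noteq> 0" for c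
  proof (cases "\<exists>e\<in>set es. Arg e = Arg c")
    case False
    then show ?thesis using loc0 c by blast
  next
    case True
    then obtain e where e: "e \<in> set es" "Arg e = Arg c" by auto
    then have "e \<noteq> 0" using nz_es by auto
    then have "Arg (- e) = Arg (- c)" using e c by (simp add: Arg_minus)
    then have "\<And>e'. e' \<in> set es \<Longrightarrow> Arg e' \<noteq> Arg (- c)" using opp[OF e(1)] by metis
    then obtain d where d: "\<forall>\<^sub>F c' in nhds (- c). g c' = inner c' d" using loc0[of "- c"] c by auto
    have "filterlim uminus (nhds (- c)) (nhds c)" by (intro tendsto_intros filterlim_ident)
    with d have "\<forall>\<^sub>F c' in nhds c. g (- c') = inner (- c') d" by (rule eventually_compose_filterlim)
    then have "\<forall>\<^sub>F c' in nhds c. g c' = inner c' d" by eventually_elim (simp add: odd)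
    then show ?thesis by blast
  qed
  moreover have "g 0 = 0" using K by (simp add: g_def image_constant_conv)
  ultimately obtain d where d: "\<And>c. g c = inner c d" using linear_if_locally_linear[of g] by blast
  have "convex hull K = (\<lambda>v. - \<i> * v + d) ` Q"
  proof (rule convex_eq_if_support_eq)
    show "compact (convex hull K)" using K by (simp add: finite_imp_compact_convex_hull)
    show "convex (convex hull K)" by simp
    show "compact ((\<lambda>v. - \<i> * v + d) ` Q)"
      by (intro compact_continuous_image compact_Q continuous_intros)
    have "convex ((\<lambda>x. d + x) ` (\<lambda>v. - \<i> * v) ` Q)"
      by (intro convex_translation convex_linear_image convex_Q) (auto intro!: linearI simp: algebra_simps scaleR_conv_of_real)
    then show "convex ((\<lambda>v. - \<i> * v + d) ` Q)" by (simp add: image_image add.commute)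
    fix c
    have "Min (inner c ` K) \<in> inner c ` K" using K by (intro Min_in) auto
    then obtain k0 where k0: "k0 \<in> K" "inner c k0 = Min (inner c ` K)" by auto
    have "convex {x. inner c k0 \<le> inner c x}" using convex_halfspace_ge[of "inner c k0" c] by (simp add: inner_commute)
    then have 1: "convex hull K \<subseteq> {x. inner c k0 \<le> inner c x}"
      using k0 K by (intro hull_minimal) auto
    have eq: "inner c k0 = inner c (- \<i> * T c + d)"
      using d[of c] k0(2) by (simp add: g_def det2_inner inner_add_right inner_diff_right)
    have 2: "inner c (- \<i> * T c + d) \<le> inner c (- \<i> * v + d)" if "v \<in> Q" for v
      using T_minimal[OF that, of c] by (simp add: det2_inner inner_add_right inner_diff_right)
    show "\<exists>x\<in>convex hull K. \<exists>y\<in>(\<lambda>v. - \<i> * v + d) ` Q. inner c x = inner c y \<and>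
       (\<forall>x'\<in>convex hull K. inner c x \<le> inner c x') \<and> (\<forall>y'\<in>(\<lambda>v. - \<i> * v + d) ` Q. inner c y \<le> inner c y')"
      by (rule bexI[of _ k0], rule bexI[of _ "- \<i> * T c + d"]) (use 1 2 eq k0 T_in_Q in \<open>auto intro: hull_inc\<close>)
  qed
  moreover have "\<forall>c. Min (inner c ` K) = det2 c (T c) + inner c d" using d by (simp add: g_def algebra_simps)
  ultimately show ?thesis by blast
qed

lemma ip1_power [simp]: "ip1 (p ^ n) a = ip1 p a ^ n"
  by (induction n) auto
lemma ip1_prod [simp]: "ip1 (\<Prod>i\<in>I. p i) a = (\<Prod>i\<in>I. ip1 (p i) a)"
  by (induction I rule: infinite_finite_induct) auto
lemma ip1_sum [simp]: "ip1 (\<Sum>i\<in>I. p i) a = (\<Sum>i\<in>I. ip1 (p i) a)"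
  by (induction I rule: infinite_finite_induct) auto
lemma ip1_monom [simp]: "ip1 (monom c n) a = of_int c * a ^ n"
  by (induction n) (auto simp: monom_Suc monom_0)
lemma eval2_monom [simp]: "eval2 (monom p n) a b = ip1 p a * b ^ n"
  by (induction n) (auto simp: monom_Suc monom_0)

lemma prod_powi_sum:
  fixes c :: complex
  assumes "c \<noteq> 0" shows "(\<Prod>i\<in>I. c powi f i) = c powi (\<Sum>i\<in>I. f i)"
  by (induction I rule: infinite_finite_induct) (auto simp: power_int_add assms)

lemma prod_power_int: "(\<Prod>i\<in>I. f i) powi k = (\<Prod>i\<in>I. (f i :: complex) powi k)"
  by (induction I rule: infinite_finite_induct) (auto simp: power_int_mult_distrib)

section \<open>The Horn parametrization\<close>

locale horn =
  fixes b1 b2 :: "'n::finite \<Rightarrow> int"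
  assumes row_nz: "b1 i \<noteq> 0 \<or> b2 i \<noteq> 0"
    and sum1: "(\<Sum>i\<in>UNIV. b1 i) = 0" and sum2: "(\<Sum>i\<in>UNIV. b2 i) = 0"
begin

definition lf :: "'n \<Rightarrow> complex^2 \<Rightarrow> complex" where
  "lf i l = of_int (b1 i) * l$1 + of_int (b2 i) * l$2"
definition good :: "(complex^2) set" where "good = {l. \<forall>i. lf i l \<noteq> 0}"
definition psi1 :: "complex^2 \<Rightarrow> complex" where "psi1 l = (\<Prod>i\<in>UNIV. lf i l powi b1 i)"
definition psi2 :: "complex^2 \<Rightarrow> complex" where "psi2 l = (\<Prod>i\<in>UNIV. lf i l powi b2 i)"

lemma goodD: "l \<in> good \<Longrightarrow> lf i l \<noteq> 0" by (simp add: good_def)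

lemma psi_nz: "l \<in> good \<Longrightarrow> psi1 l \<noteq> 0" "l \<in> good \<Longrightarrow> psi2 l \<noteq> 0"
  by (auto simp: psi1_def psi2_def good_def)

lemma lf_line: "lf i (x + s *s (y - x)) = lf i x + s * (lf i y - lf i x)"
  by (simp add: lf_def algebra_simps)
lemma lf_smult: "lf i (c *s x) = c * lf i x"
  by (simp add: lf_def algebra_simps)
lemma lf_add: "lf i (x + y) = lf i x + lf i y"
  by (simp add: lf_def algebra_simps)

lemma line_hol_lf: "line_hol G (lf i)"
  unfolding lf_def[abs_def] by (intro line_hol_add line_hol_mult line_hol_const line_hol_coord)

text \<open>On a line between points of \<open>good\<close> each form vanishes at most once, and the
  plane minus finitely many points is connected.\<close>

lemma line_dom_good: "line_dom good"
  unfolding line_dom_def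
proof (intro ballI)
  fix x y assume xy: "x \<in> good" "y \<in> good"
  define S where "S i = {s. lf i x + s * (lf i y - lf i x) = 0}" for i
  have "finite (S i)" for i
  proof (cases "lf i y - lf i x = 0")
    case True
    then have "S i = {}" using goodD[OF xy(1), of i] by (simp add: S_def)
    then show ?thesis by simp
  next
    case False
    have "S i \<subseteq> {- lf i x / (lf i y - lf i x)}"
    proof
      fix s assume "s \<in> S i"
      then have "s * (lf i y - lf i x) = - lf i x" by (simp add: S_def add_eq_0_iff)
      then show "s \<in> {- lf i x / (lf i y - lf i x)}" using False by (simp add: field_simps)
    qed
    then show ?thesis using finite_subset by blast
  qed
  then have fin: "finite (\<Union>i. S i)" by simp
  have "x + s *s (y - x) \<in> good \<longleftrightarrow> (\<forall>i. s \<notin> S i)" for s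
    unfolding good_def mem_Collect_eq lf_line S_def by (rule refl)
  then have eq: "{s. x + s *s (y - x) \<in> good} = UNIV - (\<Union>i. S i)" by blast
  show "open {s. x + s *s (y - x) \<in> good} \<and> connected {s. x + s *s (y - x) \<in> good}"
    unfolding eq using fin
    by (intro conjI connected_open_delete_finite open_Diff finite_imp_closed) (simp_all add: connected_UNIV)
qed

lemma good_nonempty: "\<exists>l\<in>good. l$1 \<noteq> 0 \<and> l$2 \<noteq> 0"
proof -
  \<comment> \<open>The extra index \<open>None\<close> carries the condition that both coordinates
    are nonzero.\<close>
  define f where "f k l = (case k of Some i \<Rightarrow> lf i l | None \<Rightarrow> l$1 * l$2)" for k and l :: "complex^2"
  have "\<exists>x\<in>UNIV. (\<Prod>k\<in>UNIV. f k x) \<noteq> 0"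
  proof (rule line_hol_prod_nonzero)
    show "line_hol UNIV (f k)" for k
      unfolding f_def[abs_def]
      by (cases k) (simp_all add: line_hol_lf line_hol_mult)
    show "\<exists>x\<in>UNIV. f k x \<noteq> 0" for k
    proof (cases k)
      case None
      then show ?thesis by (intro bexI[of _ "\<chi> i. 1"]) (simp_all add: f_def)
    next
      case (Some i)
      show ?thesis
      proof (cases "b1 i = 0")
        case True
        then show ?thesis using row_nz[of i] Some by (intro bexI[of _ "axis 2 1"]) (simp_all add: f_def lf_def axis_def)
      next
        case False
        then show ?thesis using Some by (intro bexI[of _ "axis 1 1"]) (simp_all add: f_def lf_def axis_def)
      qed
    qed
  qed simp_all
  then obtain x where "\<forall>k. f k x \<noteq> 0" by auto
  then have "f (Some i) x \<noteq> 0" "f None x \<noteq> 0" for i by blast+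
  then show ?thesis by (intro bexI[of _ x]) (simp_all add: f_def good_def)
qed

lemma line_hol_psi: "line_hol good psi1" "line_hol good psi2"
  unfolding psi1_def[abs_def] psi2_def[abs_def]
  by (intro line_hol_prod line_hol_powi line_hol_lf goodD, assumption)+

lemma line_hol_eval2:
  "line_hol G f \<Longrightarrow> line_hol G g \<Longrightarrow> line_hol G (\<lambda>l. eval2 P (f l) (g l))"
  unfolding eval2_supp by (intro line_hol_sum line_hol_mult line_hol_const line_hol_power)

definition van :: "int poly poly \<Rightarrow> bool" where
  "van P \<longleftrightarrow> (\<forall>l\<in>good. eval2 P (psi1 l) (psi2 l) = 0)"

lemma vanD: "van P \<Longrightarrow> l \<in> good \<Longrightarrow> eval2 P (psi1 l) (psi2 l) = 0"
  by (simp add: van_def)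

lemma good_mult_eq_0:
  assumes "line_hol good f" "line_hol good g" "\<And>l. l \<in> good \<Longrightarrow> f l * g l = 0"
  shows "(\<forall>l\<in>good. f l = 0) \<or> (\<forall>l\<in>good. g l = 0)"
proof (rule ccontr)
  assume "\<not> ?thesis"
  then obtain x y where "x \<in> good" "f x \<noteq> 0" "y \<in> good" "g y \<noteq> 0" by blast
  then show False using line_hol_mult_eq_0[OF line_dom_good assms(1,2,3), of x y] by simp
qed

lemma van_mult: "van (P * Q) \<Longrightarrow> van P \<or> van Q"
  unfolding van_def
  by (rule good_mult_eq_0) (simp_all add: line_hol_eval2 line_hol_psi)

lemma van_dvd: "van P \<Longrightarrow> P dvd Q \<Longrightarrow> van Q"
  by (auto simp: van_def elim!: dvdE)

lemma not_van_1: "\<not> van 1"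
  using good_nonempty by (auto simp: van_def)

lemma van_prod_mset: "van (prod_mset A) \<Longrightarrow> \<exists>P\<in>#A. van P"
proof (induction A)
  case empty
  then show ?case using not_van_1 by simp
next
  case (add P A)
  then have "van (P * prod_mset A)" by simp
  then show ?case using van_mult add.IH by (metis union_single_eq_member insert_noteq_member add_mset_add_single union_iff)
qed

text \<open>The exponents \<open>b1\<close> and \<open>b2\<close> sum to zero, so the
  parametrization is homogeneous of degree 0 and lives on the projective line.\<close>

lemma psi_smult:
  assumes "c \<noteq> 0" shows "psi1 (c *s l) = psi1 l" "psi2 (c *s l) = psi2 l"
proof -
  have "psi1 (c *s l) = (\<Prod>i\<in>UNIV. c powi b1 i) * psi1 l"
    unfolding psi1_def by (simp add: lf_smult power_int_mult_distrib prod.distrib)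
  then show "psi1 (c *s l) = psi1 l" by (simp add: prod_powi_sum[OF assms] sum1)
  have "psi2 (c *s l) = (\<Prod>i\<in>UNIV. c powi b2 i) * psi2 l"
    unfolding psi2_def by (simp add: lf_smult power_int_mult_distrib prod.distrib)
  then show "psi2 (c *s l) = psi2 l" by (simp add: prod_powi_sum[OF assms] sum2)
qed

lemma powi_as_quotient: "x \<noteq> 0 \<Longrightarrow> x powi k = x ^ nat k / (x :: complex) ^ nat (- k)"
  by (cases "k \<ge> 0") (auto simp: power_int_def field_simps)

text \<open>Elimination by counting: after clearing denominators, the (N+1)^2 monomials of degree at
  most N in each of \<open>psi1\<close> and \<open>psi2\<close> become polynomials of degree at most
  4DN in one parameter, and such polynomials are dependent once (N+1)^2 exceeds 4DN+1.\<close>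

lemma ex_van: "\<exists>P. P \<noteq> 0 \<and> van P"
proof -
  \<comment> \<open>The linear form \<open>lf i\<close> in the chart l = (s, 1).\<close>
  define p where "p i = [:b2 i, b1 i:]" for i
  define F1 F2 G1 G2 where "F1 = (\<Prod>i\<in>UNIV. p i ^ nat (b1 i))" and "F2 = (\<Prod>i\<in>UNIV. p i ^ nat (b2 i))"
    and "G1 = (\<Prod>i\<in>UNIV. p i ^ nat (- b1 i))" and "G2 = (\<Prod>i\<in>UNIV. p i ^ nat (- b2 i))"
  define D where "D = (\<Sum>i\<in>UNIV. nat \<bar>b1 i\<bar> + nat \<bar>b2 i\<bar>)"
  \<comment> \<open>Large enough for the count: (N+1)^2 > N^2 + 1 > 4DN + 1 since N > 4D.\<close>
  define N where "N = 4 * D + 1"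
  define M where "M k = F1 ^ fst k * G1 ^ (N - fst k) * F2 ^ snd k * G2 ^ (N - snd k)" for k
  have deg: "degree (\<Prod>i\<in>UNIV. p i ^ e i) \<le> D" if "\<And>i. e i \<le> nat \<bar>b1 i\<bar> + nat \<bar>b2 i\<bar>" for e
  proof -
    have "degree (\<Prod>i\<in>UNIV. p i ^ e i) \<le> (\<Sum>i\<in>UNIV. degree (p i ^ e i))"
      using degree_prod_sum_le[of UNIV "\<lambda>i. p i ^ e i"] by (simp add: o_def)
    also have "\<dots> \<le> (\<Sum>i\<in>UNIV. nat \<bar>b1 i\<bar> + nat \<bar>b2 i\<bar>)"
    proof (rule sum_mono)
      fix i
      have "degree (p i ^ e i) \<le> degree (p i) * e i" by (rule degree_power_le)
      also have "\<dots> \<le> 1 * e i" by (intro mult_right_mono) (simp_all add: p_def)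
      finally show "degree (p i ^ e i) \<le> nat \<bar>b1 i\<bar> + nat \<bar>b2 i\<bar>" using that[of i] by simp
    qed
    finally show ?thesis by (simp add: D_def)
  qed
  have degs: "degree F1 \<le> D" "degree F2 \<le> D" "degree G1 \<le> D" "degree G2 \<le> D"
    unfolding F1_def F2_def G1_def G2_def by (rule deg; simp; linarith)+
  have pow: "degree (q ^ a) \<le> D * N" if "degree q \<le> D" "a \<le> N" for q :: "int poly" and a
    using order_trans[OF degree_power_le[of q a] mult_le_mono[OF that]] .
  have degM: "degree (M k) \<le> 4 * (D * N)" if "k \<in> {..N} \<times> {..N}" for k
  proof -
    have k: "fst k \<le> N" "snd k \<le> N" using that by auto
    have "degree (M k) \<le> degree (F1 ^ fst k) + degree (G1 ^ (N - fst k)) + degree (F2 ^ snd k) + degree (G2 ^ (N - snd k))"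
      unfolding M_def by (intro order_trans[OF degree_mult_le] add_mono order_refl)
    also have "\<dots> \<le> D * N + D * N + D * N + D * N"
      using k by (intro add_mono pow degs) auto
    finally show ?thesis by simp
  qed
  let ?I = "{..N} \<times> {..N}"
  have "4 * (D * N) + 1 < (N + 1) * (N + 1)" by (simp add: N_def algebra_simps)
  then have "card {..4 * (D * N)} < card ?I" by (simp add: card_cartesian_product)
  from int_linear_dependence[OF _ _ this, of "\<lambda>k j. coeff (M k) j"]
  obtain c where c: "(\<exists>k\<in>?I. c k \<noteq> 0) \<and> (\<forall>j\<in>{..4 * (D * N)}. (\<Sum>k\<in>?I. c k * coeff (M k) j) = 0)"
    by auto
  define P where "P = (\<Sum>k\<in>?I. monom (monom (c k) (fst k)) (snd k))"
  have cf: "cf P k = c k" if "k \<in> ?I" for k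
  proof -
    have "cf P k = (\<Sum>k'\<in>?I. if k' = k then c k' else 0)"
      unfolding P_def cf_def coeff_sum by (intro sum.cong refl) (auto simp: prod_eq_iff)
    then show ?thesis using that by simp
  qed
  have "P \<noteq> 0"
  proof
    assume "P = 0"
    then have "cf P k = 0" for k by (simp add: cf_def)
    then show False using c cf by auto
  qed
  have M0: "(\<Sum>k\<in>?I. smult (c k) (M k)) = 0"
  proof (rule poly_eqI)
    fix j
    show "coeff (\<Sum>k\<in>?I. smult (c k) (M k)) j = coeff 0 j"
    proof (cases "j \<le> 4 * (D * N)")
      case True
      then show ?thesis using c by (simp add: coeff_sum)
    next
      case False
      have "coeff (M k) j = 0" if "k \<in> ?I" for k
        using degM[OF that] False by (intro coeff_eq_0) linarith
      then have "(\<Sum>k\<in>?I. c k * coeff (M k) j) = 0" by (intro sum.neutral ballI) simp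
      then show ?thesis by (simp add: coeff_sum)
    qed
  qed
  have main: "eval2 P (psi1 l) (psi2 l) = 0" if l: "l \<in> good" "l$2 = 1" for l
  proof -
    define s where "s = l$1"
    have ps: "ip1 (p i) s = lf i l" for i using l by (simp add: p_def lf_def s_def mult.commute add.commute)
    have nz: "lf i l \<noteq> 0" for i using goodD[OF l(1)] .
    have G: "ip1 G1 s \<noteq> 0" "ip1 G2 s \<noteq> 0" by (simp_all add: G1_def G2_def ps nz)
    have psi: "psi1 l = ip1 F1 s / ip1 G1 s" "psi2 l = ip1 F2 s / ip1 G2 s"
      unfolding psi1_def psi2_def F1_def F2_def G1_def G2_def
      by (simp_all add: ps prod_dividef[symmetric] powi_as_quotient[OF nz])
    have Mk: "ip1 (M k) s = ip1 G1 s ^ N * ip1 G2 s ^ N * (psi1 l ^ fst k * psi2 l ^ snd k)" if "k \<in> ?I" for k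
    proof -
      have "ip1 G1 s ^ N = ip1 G1 s ^ fst k * ip1 G1 s ^ (N - fst k)" "ip1 G2 s ^ N = ip1 G2 s ^ snd k * ip1 G2 s ^ (N - snd k)"
        using that by (auto simp: power_add[symmetric])
      then show ?thesis using G by (simp add: M_def psi power_divide field_simps)
    qed
    have "0 = ip1 (\<Sum>k\<in>?I. smult (c k) (M k)) s" unfolding M0 by simp
    also have "\<dots> = (\<Sum>k\<in>?I. of_int (c k) * ip1 (M k) s)" by simp
    also have "\<dots> = (\<Sum>k\<in>?I. ip1 G1 s ^ N * ip1 G2 s ^ N * (of_int (c k) * psi1 l ^ fst k * psi2 l ^ snd k))"
      by (intro sum.cong refl) (simp add: Mk mult_ac)
    also have "\<dots> = ip1 G1 s ^ N * ip1 G2 s ^ N * eval2 P (psi1 l) (psi2 l)"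
      by (simp only: sum_distrib_left[symmetric]) (simp add: P_def)
    finally show ?thesis using G by simp
  qed
  have "van P"
  proof -
    \<comment> \<open>Scaling carries the identity from the chart to all \<open>l\<close> with
      nonzero second coordinate. The factor \<open>l$2\<close> covers the rest and is then cancelled
      by the identity theorem.\<close>
    have "l$2 * eval2 P (psi1 l) (psi2 l) = 0" if l: "l \<in> good" for l
    proof (cases "l$2 = 0")
      case False
      have "(1 / l$2) *s l \<in> good" using False goodD[OF l] by (simp add: good_def lf_smult)
      from main[OF this] show ?thesis using False by (simp add: psi_smult)
    qed simp
    then have "(\<forall>l\<in>good. l$2 = 0) \<or> van P"
      unfolding van_def by (intro good_mult_eq_0 line_hol_coord line_hol_eval2 line_hol_psi)
    then show ?thesis using good_nonempty by blast
  qed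
  then show ?thesis using \<open>P \<noteq> 0\<close> by blast
qed

lemma ex_prime_van: "\<exists>P. prime_elem P \<and> van P"
proof -
  obtain P where P: "P \<noteq> 0" "van P" using ex_van by blast
  from prime_factorization_exists[OF P(1)] obtain A
    where A: "\<forall>x. x \<in># A \<longrightarrow> prime_elem x" "normalize (prod_mset A) = normalize P" by blast
  have "P dvd prod_mset A" using A(2) by (simp add: associated_iff_dvd)
  then have "van (prod_mset A)" using van_dvd P(2) by blast
  then obtain Q where "Q \<in># A" "van Q" using van_prod_mset by blast
  then show ?thesis using A(1) by blast
qed

text \<open>A line through the origin is represented by the set of indices of the rows on it, so
  that lines partition the index type.\<close>

definition lin :: "'n \<Rightarrow> 'n set" where "lin i = {j. b1 i * b2 j = b2 i * b1 j}"
definition lines :: "'n set set" where "lines = range lin"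

lemma finite_lines [simp]: "finite lines" by (simp add: lines_def)

lemma self_in_lin: "i \<in> lin i" by (simp add: lin_def mult.commute)

lemma lin_trans:
  assumes "b1 i * b2 j = b2 i * b1 j" "b1 j * b2 k = b2 j * b1 k"
  shows "b1 i * b2 k = b2 i * b1 k"
proof -
  have 1: "b1 j * (b1 i * b2 k) = b1 j * (b2 i * b1 k)"
  proof -
    have "b1 j * (b1 i * b2 k) = b1 i * (b1 j * b2 k)" by simp
    also have "\<dots> = (b1 i * b2 j) * b1 k" unfolding assms(2) by simp
    finally show ?thesis unfolding assms(1) by simp
  qed
  have 2: "b2 j * (b1 i * b2 k) = b2 j * (b2 i * b1 k)"
  proof -
    have "b2 j * (b1 i * b2 k) = (b1 i * b2 j) * b2 k" by simp
    also have "\<dots> = b2 i * (b1 j * b2 k)" unfolding assms(1) by simp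
    finally show ?thesis unfolding assms(2) by simp
  qed
  show ?thesis using row_nz[of j] 1 2 by auto
qed

lemma lin_eq: "j \<in> lin i \<Longrightarrow> lin j = lin i"
proof -
  assume "j \<in> lin i"
  then have ij: "b1 i * b2 j = b2 i * b1 j" by (simp add: lin_def)
  then have ji: "b1 j * b2 i = b2 j * b1 i" by (simp add: mult.commute)
  show ?thesis unfolding lin_def using lin_trans[OF ij] lin_trans[OF ji] by auto
qed

lemma sum_lines: "(\<Sum>L\<in>lines. \<Sum>j\<in>L. f j) = (\<Sum>j\<in>UNIV. f j)"
proof -
  have "(\<Sum>j\<in>UNIV. f j) = (\<Sum>L\<in>lin ` UNIV. \<Sum>j\<in>{j\<in>UNIV. lin j = L}. f j)"
    by (rule sum.image_gen) simp
  also have "\<dots> = (\<Sum>L\<in>lines. \<Sum>j\<in>L. f j)"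
    unfolding lines_def
  proof (rule sum.cong[OF refl])
    fix L assume "L \<in> range lin"
    then obtain i where i: "L = lin i" by auto
    have "{j\<in>UNIV. lin j = L} = L"
    proof (intro set_eqI iffI)
      fix j assume "j \<in> {j\<in>UNIV. lin j = L}"
      then show "j \<in> L" using self_in_lin[of j] by simp
    next
      fix j assume "j \<in> L"
      then have "lin j = lin i" unfolding i by (rule lin_eq)
      then show "j \<in> {j\<in>UNIV. lin j = L}" by (simp add: i)
    qed
    then show "sum f {j\<in>UNIV. lin j = L} = sum f L" by simp
  qed
  finally show ?thesis by simp
qed

text \<open>The character with exponent (w2, -w1) pulled back to the parameters. It is trivial on
  the one-parameter subgroup w and hence constant on its cosets; \<open>ee\<close> below is the
  determinant of row \<open>i\<close> and w.\<close>

definition chi :: "int \<Rightarrow> int \<Rightarrow> complex^2 \<Rightarrow> complex" where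
  "chi w1 w2 l = psi1 l powi w2 * psi2 l powi (- w1)"
definition ee :: "int \<Rightarrow> int \<Rightarrow> 'n \<Rightarrow> int" where
  "ee w1 w2 i = b1 i * w2 - b2 i * w1"

lemma chi_eq:
  assumes "l \<in> good" shows "chi w1 w2 l = (\<Prod>i\<in>UNIV. lf i l powi ee w1 w2 i)"
proof -
  have "chi w1 w2 l = (\<Prod>i\<in>UNIV. lf i l powi (b1 i * w2) * lf i l powi (b2 i * - w1))"
    unfolding chi_def psi1_def psi2_def prod_power_int prod.distrib[symmetric] by (simp only: power_int_mult)
  also have "\<dots> = (\<Prod>i\<in>UNIV. lf i l powi ee w1 w2 i)"
  proof (intro prod.cong refl)
    fix i
    show "lf i l powi (b1 i * w2) * lf i l powi (b2 i * - w1) = lf i l powi ee w1 w2 i"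
      using goodD[OF assms, of i] power_int_add[of "lf i l" "b1 i * w2" "b2 i * - w1"] by (simp add: ee_def)
  qed
  finally show ?thesis .
qed

lemma sum_ee: "(\<Sum>i\<in>UNIV. ee w1 w2 i) = 0"
  by (simp add: ee_def sum_subtractf sum_distrib_right[symmetric] sum1 sum2)

lemma sum_ee_line: "(\<Sum>j\<in>L. ee w1 w2 j) = (\<Sum>j\<in>L. b1 j) * w2 - (\<Sum>j\<in>L. b2 j) * w1"
  by (simp add: ee_def sum_subtractf sum_distrib_right)

end

locale horn_nd = horn b1 b2 for b1 b2 :: "'n::finite \<Rightarrow> int" +
  assumes nondeg: "\<exists>L\<in>lines. (\<Sum>j\<in>L. b1 j) \<noteq> 0 \<or> (\<Sum>j\<in>L. b2 j) \<noteq> 0"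
begin

lemma line_parallel:
  assumes "j \<in> lin i" shows "b1 i * b2 j = b2 i * b1 j"
  using assms by (simp add: lin_def)

lemma sum_line_parallel:
  assumes "L = lin i"
  shows "b1 i * (\<Sum>j\<in>L. b2 j) = b2 i * (\<Sum>j\<in>L. b1 j)"
  unfolding sum_distrib_left assms by (intro sum.cong refl line_parallel)

text \<open>If all line sums were parallel to \<open>w\<close>, only one of them could be nonzero, contradicting that
  they add up to zero.\<close>

lemma ex_ee_nonzero:
  assumes w: "w1 \<noteq> 0 \<or> w2 \<noteq> 0"
  shows "\<exists>L\<in>lines. (\<Sum>j\<in>L. ee w1 w2 j) \<noteq> 0"
proof (rule ccontr)
  assume "\<not> ?thesis"
  then have par: "(\<Sum>j\<in>L. b1 j) * w2 = (\<Sum>j\<in>L. b2 j) * w1" if "L \<in> lines" for L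
    using that sum_ee_line[of w1 w2 L] by auto
  obtain L0 where L0: "L0 \<in> lines" "(\<Sum>j\<in>L0. b1 j) \<noteq> 0 \<or> (\<Sum>j\<in>L0. b2 j) \<noteq> 0" using nondeg by blast
  have uniq: "L = L0" if L: "L \<in> lines" "(\<Sum>j\<in>L. b1 j) \<noteq> 0 \<or> (\<Sum>j\<in>L. b2 j) \<noteq> 0" for L
  proof -
    have key: "b1 i * w2 = b2 i * w1" if L: "L = lin i" "(\<Sum>j\<in>L. b1 j) \<noteq> 0 \<or> (\<Sum>j\<in>L. b2 j) \<noteq> 0" for L i
    proof -
      have "L \<in> lines" using L by (simp add: lines_def)
      define x y where "x = (\<Sum>j\<in>L. b1 j)" and "y = (\<Sum>j\<in>L. b2 j)"
      have 1: "x * w2 = y * w1" using par[OF \<open>L \<in> lines\<close>] by (simp add: x_def y_def)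
      have 2: "b1 i * y = b2 i * x" using sum_line_parallel[OF L(1)] by (simp add: x_def y_def)
      have "x * (b1 i * w2) = x * (b2 i * w1)"
      proof -
        have "x * (b1 i * w2) = b1 i * (x * w2)" by simp
        also have "\<dots> = (b1 i * y) * w1" unfolding 1 by simp
        finally show ?thesis unfolding 2 by simp
      qed
      moreover have "y * (b1 i * w2) = y * (b2 i * w1)"
      proof -
        have "y * (b1 i * w2) = (b1 i * y) * w2" by simp
        also have "\<dots> = b2 i * (x * w2)" unfolding 2 by simp
        finally show ?thesis unfolding 1 by simp
      qed
      moreover have "x \<noteq> 0 \<or> y \<noteq> 0" using L(2) by (simp add: x_def y_def)
      ultimately show ?thesis by auto
    qed
    obtain i where i: "L = lin i" using L(1) unfolding lines_def by blast
    obtain k where k: "L0 = lin k" using L0(1) unfolding lines_def by blast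
    have wi: "b1 i * w2 = b2 i * w1" using key[OF i L(2)] .
    have wk: "b1 k * w2 = b2 k * w1" using key[OF k L0(2)] .
    have "w1 * (b1 i * b2 k) = w1 * (b2 i * b1 k)"
    proof -
      have "w1 * (b1 i * b2 k) = b1 i * (b2 k * w1)" by simp
      also have "\<dots> = b1 k * (b1 i * w2)" unfolding wk[symmetric] by simp
      finally show ?thesis unfolding wi by (simp only: mult_ac)
    qed
    moreover have "w2 * (b1 i * b2 k) = w2 * (b2 i * b1 k)"
    proof -
      have "w2 * (b1 i * b2 k) = (b1 i * w2) * b2 k" by simp
      also have "\<dots> = b2 i * (b2 k * w1)" unfolding wi by simp
      finally show ?thesis unfolding wk[symmetric] by (simp only: mult_ac)
    qed
    ultimately have "b1 i * b2 k = b2 i * b1 k" using w by auto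
    then have "k \<in> lin i" by (simp add: lin_def)
    from lin_eq[OF this] show ?thesis unfolding i k by simp
  qed
  have "(\<Sum>j\<in>L0. b1 j) = 0"
  proof -
    have "(\<Sum>L\<in>lines - {L0}. \<Sum>j\<in>L. b1 j) = 0"
    proof (rule sum.neutral, rule ballI, rule ccontr)
      fix L assume L: "L \<in> lines - {L0}" "(\<Sum>j\<in>L. b1 j) \<noteq> 0"
      have "L = L0" by (rule uniq) (use L in simp_all)
      then show False using L(1) by simp
    qed
    then show ?thesis
      using sum.remove[OF finite_lines L0(1), of "\<lambda>L. \<Sum>j\<in>L. b1 j"] sum_lines[of b1] sum1 by simp
  qed
  moreover have "(\<Sum>j\<in>L0. b2 j) = 0"
  proof -
    have "(\<Sum>L\<in>lines - {L0}. \<Sum>j\<in>L. b2 j) = 0"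
    proof (rule sum.neutral, rule ballI, rule ccontr)
      fix L assume L: "L \<in> lines - {L0}" "(\<Sum>j\<in>L. b2 j) \<noteq> 0"
      have "L = L0" by (rule uniq) (use L in simp_all)
      then show False using L(1) by simp
    qed
    then show ?thesis
      using sum.remove[OF finite_lines L0(1), of "\<lambda>L. \<Sum>j\<in>L. b2 j"] sum_lines[of b2] sum2 by simp
  qed
  ultimately show False using L0(2) by simp
qed

end

section \<open>Degrees of characters on the parameter line, and the prime equation of the
  curve\<close>

text \<open>The product is a quotient f / g of coprime polynomials of equal degree with value
  \<open>c\<close> at infinity. A value that is not critical and differs from \<open>c\<close> is
  taken exactly as often as this degree says.\<close>

lemma card_generic_fiber:
  fixes R :: "complex set" and E :: "complex \<Rightarrow> int" and c :: complex
  assumes R: "finite R" and c: "c \<noteq> 0" and E0: "(\<Sum>r\<in>R. E r) = 0" and nz: "\<exists>r\<in>R. E r \<noteq> 0"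
  shows "\<exists>K. finite K \<and> c \<in> K \<and> (\<forall>\<kappa>. \<kappa> \<notin> K \<longrightarrow>
    int (card {s. s \<notin> R \<and> c * (\<Prod>r\<in>R. (s - r) powi E r) = \<kappa>}) = (\<Sum>r\<in>R. max 0 (E r)))"
proof -
  define f g where "f = smult c (\<Prod>r\<in>R. [:- r, 1:] ^ nat (E r))" and "g = (\<Prod>r\<in>R. [:- r, 1:] ^ nat (- E r))"
  define d where "d = (\<Sum>r\<in>R. nat (E r))"
  have dE: "int d = (\<Sum>r\<in>R. max 0 (E r))" by (simp add: d_def max_def)
  have "int d - (\<Sum>r\<in>R. int (nat (- E r))) = (\<Sum>r\<in>R. E r)"
    unfolding d_def of_nat_sum sum_subtractf[symmetric] by (intro sum.cong refl) simp
  then have "int (\<Sum>r\<in>R. nat (- E r)) = int d" unfolding E0 of_nat_sum by simp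
  then have dg: "(\<Sum>r\<in>R. nat (- E r)) = d" by (simp only: of_nat_eq_iff)
  have degp: "degree (\<Prod>r\<in>R. [:- r, 1:] ^ e r) = (\<Sum>r\<in>R. e r)" for e :: "complex \<Rightarrow> nat"
    by (subst degree_prod_eq_sum_degree) (auto simp: degree_power_eq)
  have lcp: "lead_coeff (\<Prod>r\<in>R. [:- r, 1:] ^ e r) = 1" for e :: "complex \<Rightarrow> nat"
    by (simp add: lead_coeff_prod lead_coeff_power)
  have degf: "degree f = d" using c by (simp add: f_def degp d_def)
  have degg: "degree g = d" by (simp add: g_def degp dg)
  have lcf: "coeff f d = c" using lcp[of "\<lambda>r. nat (E r)"] by (simp add: f_def degp d_def)
  have lcg: "coeff g d = 1" using lcp[of "\<lambda>r. nat (- E r)"] dg by (simp add: g_def degp)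
  have fz: "poly f s = 0 \<longleftrightarrow> (\<exists>r\<in>R. s = r \<and> E r > 0)" for s
    using c R by (auto simp: f_def poly_prod)
  have gz: "poly g s = 0 \<longleftrightarrow> (\<exists>r\<in>R. s = r \<and> E r < 0)" for s
    using R by (auto simp: g_def poly_prod)
  have f0: "f \<noteq> 0" using lcf c by auto
  have g0: "g \<noteq> 0" using lcg by auto
  \<comment> \<open>The numerator of the derivative of f / g. It is not identically zero: at a zero
    \<open>r0\<close> of \<open>f\<close>, where \<open>g\<close> does not vanish, the order of f'
    is one less than that of \<open>f\<close>.\<close>
  define W where "W = pderiv f * g - f * pderiv g"
  have "\<exists>r\<in>R. E r > 0"
  proof (rule ccontr)
    assume "\<not> ?thesis"
    then have le: "\<And>r. r \<in> R \<Longrightarrow> E r \<le> 0" by force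
    then have "\<forall>r\<in>R. E r = 0" using E0 R sum_nonneg_eq_0_iff[of R "\<lambda>r. - E r"] by (simp add: sum_negf)
    then show False using nz by blast
  qed
  then obtain r0 where r0: "r0 \<in> R" "E r0 > 0" by blast
  have W0: "W \<noteq> 0"
  proof
    assume "W = 0"
    then have eq: "pderiv f * g = f * pderiv g" by (simp add: W_def)
    have fr: "poly f r0 = 0" using r0 fz by blast
    have gr: "poly g r0 \<noteq> 0" using r0 gz by force
    have of: "order r0 f \<noteq> 0" using fr f0 by (simp add: order_root)
    have og: "order r0 g = 0" using gr by (rule order_0I)
    have "degree f > 0"
    proof (rule ccontr)
      assume "\<not> degree f > 0"
      then have "degree f = 0" by simp
      then obtain a where "f = [:a:]" by (rule degree_eq_zeroE)
      then show False using fr f0 by simp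
    qed
    then have pf: "pderiv f \<noteq> 0" by (simp add: pderiv_eq_0_iff)
    then have nz1: "pderiv f * g \<noteq> 0" using g0 by simp
    then have nz2: "f * pderiv g \<noteq> 0" unfolding eq .
    have "order r0 (pderiv f) + order r0 g = order r0 f + order r0 (pderiv g)"
      using order_mult[OF nz1, of r0] order_mult[OF nz2, of r0] unfolding eq by simp
    moreover have "order r0 f = Suc (order r0 (pderiv f))" using order_pderiv[OF f0 fr] .
    ultimately show False using og by simp
  qed
  \<comment> \<open>At \<open>c\<close> the polynomial \<open>q\<close> below would drop in degree,
    and at a value of a zero of \<open>W\<close> it would have a double root. The values on
    \<open>R\<close> are excluded too; at a pole the quotient is 0 by the convention for
    division.\<close>
  define K where "K = {0, c} \<union> (\<lambda>s. poly f s / poly g s) ` (R \<union> {s. poly W s = 0})"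
  have "finite K" using R poly_roots_finite[OF W0] by (simp add: K_def)
  moreover have "c \<in> K" by (simp add: K_def)
  moreover have "int (card {s. s \<notin> R \<and> c * (\<Prod>r\<in>R. (s - r) powi E r) = \<kappa>}) = (\<Sum>r\<in>R. max 0 (E r))"
    if \<kappa>: "\<kappa> \<notin> K" for \<kappa>
  proof -
    have k0: "\<kappa> \<noteq> 0" "\<kappa> \<noteq> c" using \<kappa> by (auto simp: K_def)
    have kq: "poly f s / poly g s \<noteq> \<kappa>" if "s \<in> R \<or> poly W s = 0" for s
      using \<kappa> that by (auto simp: K_def)
    define q where "q = f - smult \<kappa> g"
    have cq: "coeff q d \<noteq> 0" using k0 by (simp add: q_def lcf lcg)
    then have q0: "q \<noteq> 0" by auto
    have "degree q \<le> d" unfolding q_def using degf degg by (intro degree_diff_le) (auto intro: order_trans[OF degree_smult_le])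
    then have degq: "degree q = d" using cq le_degree[of q d] by simp
    have gnz: "poly g s \<noteq> 0" if "poly q s = 0" for s
    proof
      assume "poly g s = 0"
      then have "poly f s = 0" using that by (simp add: q_def)
      then show False using \<open>poly g s = 0\<close> unfolding fz gz by force
    qed
    have qz: "poly q s = 0 \<longleftrightarrow> poly g s \<noteq> 0 \<and> poly f s / poly g s = \<kappa>" for s
      using gnz[of s] by (auto simp: q_def field_simps)
    have notR: "s \<notin> R" if "poly q s = 0" for s
      using that kq[of s] unfolding qz by blast
    have val: "c * (\<Prod>r\<in>R. (s - r) powi E r) = poly f s / poly g s" if "s \<notin> R" for s
    proof -
      have "(s - r) powi E r = (s - r) ^ nat (E r) / (s - r) ^ nat (- E r)" for r
        by (cases "E r \<ge> 0") (auto simp: power_int_def field_simps)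
      then have "(\<Prod>r\<in>R. (s - r) powi E r) = (\<Prod>r\<in>R. (s - r) ^ nat (E r)) / (\<Prod>r\<in>R. (s - r) ^ nat (- E r))"
        by (simp add: prod_dividef)
      then show ?thesis by (simp add: f_def g_def poly_prod)
    qed
    have "{s. s \<notin> R \<and> c * (\<Prod>r\<in>R. (s - r) powi E r) = \<kappa>} = {s. poly q s = 0}"
    proof (intro set_eqI iffI)
      fix s assume "s \<in> {s. s \<notin> R \<and> c * (\<Prod>r\<in>R. (s - r) powi E r) = \<kappa>}"
      then have s: "s \<notin> R" "poly f s / poly g s = \<kappa>" using val[of s] by auto
      have "poly g s \<noteq> 0" using s(1) gz by blast
      then show "s \<in> {s. poly q s = 0}" using s qz by simp
    next
      fix s assume "s \<in> {s. poly q s = 0}"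
      then show "s \<in> {s. s \<notin> R \<and> c * (\<Prod>r\<in>R. (s - r) powi E r) = \<kappa>}"
        using notR[of s] qz[of s] val[of s] by auto
    qed
    moreover have "card {s. poly q s = 0} = d"
    proof -
      have "rsquarefree q"
        unfolding rsquarefree_roots
      proof (intro allI notI)
        fix s assume s: "poly q s = 0 \<and> poly (pderiv q) s = 0"
        then have 1: "poly f s = \<kappa> * poly g s" "poly (pderiv f) s = \<kappa> * poly (pderiv g) s"
          by (auto simp: q_def pderiv_diff pderiv_smult)
        then have "poly W s = 0" by (simp add: W_def)
        then show False using kq[of s] s qz[of s] by blast
      qed
      from complex_poly_decompose_rsquarefree[OF this]
      have "degree q = degree (smult (lead_coeff q) (\<Prod>z | poly q z = 0. [:- z, 1:]))" by simp
      also have "\<dots> = card {z. poly q z = 0}"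
        using q0 by (simp add: degree_prod_eq_sum_degree)
      finally show ?thesis using degq by simp
    qed
    ultimately show ?thesis using dE by simp
  qed
  ultimately show ?thesis by (intro exI[of _ K]) simp
qed

context horn_nd
begin

text \<open>The affine chart \<open>s \<mapsto> c0 + s c1\<close> of the projective line; its point at infinity \<open>c1\<close> is
  chosen off the zeros of the linear forms.\<close>

definition c1 :: "complex^2" where "c1 = (SOME l. l \<in> good \<and> l$1 \<noteq> 0 \<and> l$2 \<noteq> 0)"
definition c0 :: "complex^2" where "c0 = axis 2 1"
definition lam :: "complex \<Rightarrow> complex^2" where "lam s = c0 + s *s c1"
definition rt :: "'n \<Rightarrow> complex" where "rt i = - lf i c0 / lf i c1"

lemma c1: "c1 \<in> good" "c1$1 \<noteq> 0" "c1$2 \<noteq> 0"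
proof -
  have "\<exists>l. l \<in> good \<and> l$1 \<noteq> 0 \<and> l$2 \<noteq> 0" using good_nonempty by blast
  from someI_ex[OF this] show "c1 \<in> good" "c1$1 \<noteq> 0" "c1$2 \<noteq> 0" unfolding c1_def by blast+
qed

lemma c0: "c0$1 = 0" "c0$2 = 1"
  by (simp_all add: c0_def axis_def)

lemma lf_c1: "lf i c1 \<noteq> 0" using goodD[OF c1(1)] .

lemma lf_lam: "lf i (lam s) = lf i c1 * (s - rt i)"
  using lf_c1[of i] by (simp add: lam_def lf_add lf_smult rt_def field_simps)

lemma lam_good: "lam s \<in> good \<longleftrightarrow> s \<notin> range rt"
  unfolding good_def using lf_c1 by (auto simp: lf_lam)

lemma rt_eq: "rt i = rt j \<longleftrightarrow> lin i = lin j"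
proof -
  have "rt i = rt j \<longleftrightarrow> lf i c0 * lf j c1 = lf j c0 * lf i c1"
    using lf_c1[of i] lf_c1[of j] by (simp add: rt_def field_simps)
  also have "lf i c0 * lf j c1 - lf j c0 * lf i c1 = of_int (b2 i * b1 j - b1 i * b2 j) * c1$1"
    by (simp add: lf_def c0 algebra_simps)
  then have "lf i c0 * lf j c1 = lf j c0 * lf i c1 \<longleftrightarrow> of_int (b2 i * b1 j - b1 i * b2 j) * c1$1 = 0"
    by (metis eq_iff_diff_eq_0)
  also have "\<dots> \<longleftrightarrow> b1 i * b2 j = b2 i * b1 j"
    using c1(2) by (auto simp del: of_int_mult of_int_diff)
  also have "\<dots> \<longleftrightarrow> lin i = lin j"
  proof
    assume "b1 i * b2 j = b2 i * b1 j"
    then have "j \<in> lin i" by (simp add: lin_def)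
    from lin_eq[OF this] show "lin i = lin j" by (rule sym)
  next
    assume "lin i = lin j"
    then have "j \<in> lin i" using self_in_lin[of j] by simp
    then show "b1 i * b2 j = b2 i * b1 j" by (simp add: lin_def)
  qed
  finally show ?thesis .
qed

text \<open>Forms of the same line have the same root \<open>rt\<close>. Grouping them turns
  \<open>chi\<close> into a rational function of \<open>s\<close> whose exponents are the line sums.
  The value at \<open>c1\<close> belongs to \<open>K\<close>, so other values are attained only
  inside the chart.\<close>

lemma card_chi_fiber:
  assumes w: "w1 \<noteq> 0 \<or> w2 \<noteq> 0"
  shows "\<exists>K. finite K \<and> chi w1 w2 c1 \<in> K \<and> (\<forall>\<kappa>. \<kappa> \<notin> K \<longrightarrow>
    int (card {s. lam s \<in> good \<and> chi w1 w2 (lam s) = \<kappa>}) = (\<Sum>L\<in>lines. max 0 (\<Sum>j\<in>L. ee w1 w2 j)))"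
proof -
  define R where "R = range rt"
  define E where "E r = (\<Sum>j\<in>{j. rt j = r}. ee w1 w2 j)" for r
  have fR: "finite R" by (simp add: R_def)
  have lin_rt: "{j. rt j = rt i} = lin i" for i
    unfolding rt_eq
  proof (intro set_eqI iffI)
    fix j assume "j \<in> {j. lin j = lin i}"
    then show "j \<in> lin i" using self_in_lin[of j] by simp
  next
    fix j assume "j \<in> lin i"
    then show "j \<in> {j. lin j = lin i}" using lin_eq[of j i] by simp
  qed
  \<comment> \<open>Roots correspond bijectively to lines, which turns sums over roots into sums
    over lines.\<close>
  define h where "h r = {j. rt j = r}" for r
  have inj: "inj_on h R"
  proof (rule inj_onI)
    fix r r' assume r: "r \<in> R" "r' \<in> R" "h r = h r'"
    then obtain i where "r = rt i" by (auto simp: R_def)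
    then have "i \<in> h r" by (simp add: h_def)
    then have "i \<in> h r'" unfolding r(3) .
    then show "r = r'" using \<open>r = rt i\<close> by (simp add: h_def)
  qed
  have hR: "h ` R = lines"
    unfolding R_def lines_def image_image h_def lin_rt ..
  have sums: "(\<Sum>r\<in>R. F (E r)) = (\<Sum>L\<in>lines. F (\<Sum>j\<in>L. ee w1 w2 j))" for F :: "int \<Rightarrow> int"
    unfolding hR[symmetric] by (subst sum.reindex[OF inj]) (simp add: E_def h_def)
  have E0: "(\<Sum>r\<in>R. E r) = 0"
    using sums[of "\<lambda>x. x"] by (simp add: sum_lines sum_ee)
  have nz: "\<exists>r\<in>R. E r \<noteq> 0"
  proof -
    obtain L where L: "L \<in> lines" "(\<Sum>j\<in>L. ee w1 w2 j) \<noteq> 0" using ex_ee_nonzero[OF w] by blast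
    then obtain r where "r \<in> R" "L = h r" unfolding hR[symmetric] by blast
    then show ?thesis using L(2) by (intro bexI[of _ r]) (simp_all add: E_def h_def)
  qed
  define c where "c = chi w1 w2 c1"
  have cc: "c = (\<Prod>i\<in>UNIV. lf i c1 powi ee w1 w2 i)" unfolding c_def by (rule chi_eq[OF c1(1)])
  have c0: "c \<noteq> 0" unfolding cc using lf_c1 by simp
  have chi: "chi w1 w2 (lam s) = c * (\<Prod>r\<in>R. (s - r) powi E r)" if "s \<notin> R" for s
  proof -
    have "chi w1 w2 (lam s) = (\<Prod>i\<in>UNIV. lf i c1 powi ee w1 w2 i * (s - rt i) powi ee w1 w2 i)"
      using that by (subst chi_eq) (simp_all add: lam_good R_def lf_lam power_int_mult_distrib)
    also have "\<dots> = c * (\<Prod>i\<in>UNIV. (s - rt i) powi ee w1 w2 i)" by (simp add: prod.distrib cc)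
    also have "(\<Prod>i\<in>UNIV. (s - rt i) powi ee w1 w2 i) = (\<Prod>r\<in>rt ` UNIV. \<Prod>i\<in>{i\<in>UNIV. rt i = r}. (s - rt i) powi ee w1 w2 i)"
      by (rule prod.image_gen) simp
    also have "\<dots> = (\<Prod>r\<in>R. (s - r) powi E r)"
      unfolding R_def
    proof (intro prod.cong refl)
      fix r assume "r \<in> range rt"
      then have "s - r \<noteq> 0" using that by (auto simp: R_def)
      have "(\<Prod>i\<in>{i\<in>UNIV. rt i = r}. (s - rt i) powi ee w1 w2 i) = (\<Prod>i\<in>{i. rt i = r}. (s - r) powi ee w1 w2 i)"
        by (intro prod.cong) auto
      then show "(\<Prod>i\<in>{i\<in>UNIV. rt i = r}. (s - rt i) powi ee w1 w2 i) = (s - r) powi E r"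
        unfolding E_def using prod_powi_sum[OF \<open>s - r \<noteq> 0\<close>] by simp
    qed
    finally show ?thesis .
  qed
  have seteq: "{s. lam s \<in> good \<and> chi w1 w2 (lam s) = \<kappa>} = {s. s \<notin> R \<and> c * (\<Prod>r\<in>R. (s - r) powi E r) = \<kappa>}" for \<kappa>
    unfolding lam_good R_def[symmetric] using chi by (intro Collect_cong) auto
  show ?thesis
    using card_generic_fiber[OF fR c0 E0 nz] unfolding seteq sums[symmetric] c_def[symmetric] .
qed

lemma lines_degree_pos:
  assumes w: "w1 \<noteq> 0 \<or> w2 \<noteq> 0"
  shows "(\<Sum>L\<in>lines. max 0 (\<Sum>j\<in>L. ee w1 w2 j)) > 0"
proof -
  have "\<exists>L\<in>lines. (\<Sum>j\<in>L. ee w1 w2 j) > 0"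
  proof (rule ccontr)
    assume "\<not> ?thesis"
    then have "\<And>L. L \<in> lines \<Longrightarrow> (\<Sum>j\<in>L. ee w1 w2 j) \<le> 0" by force
    then have "\<forall>L\<in>lines. (\<Sum>j\<in>L. ee w1 w2 j) = 0"
      using sum_nonneg_eq_0_iff[of lines "\<lambda>L. - (\<Sum>j\<in>L. ee w1 w2 j)"] sum_lines[of "ee w1 w2"] sum_ee
      by (simp add: sum_negf)
    then show False using ex_ee_nonzero[OF w] by blast
  qed
  then obtain L where "L \<in> lines" "(\<Sum>j\<in>L. ee w1 w2 j) > 0" by blast
  then show ?thesis by (intro sum_pos2[of _ L]) auto
qed

text \<open>For w = (0, 1) the character is \<open>psi1\<close>. It takes all but finitely many
  values, so no nonzero polynomial in the first coordinate alone vanishes on the curve.\<close>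

lemma van_const:
  assumes "van [:r:]" shows "r = 0"
proof (rule ccontr)
  assume r: "r \<noteq> 0"
  have "(0::int) \<noteq> 0 \<or> (1::int) \<noteq> 0" by simp
  from card_chi_fiber[OF this] obtain K where "finite K \<and> chi 0 1 c1 \<in> K \<and> (\<forall>\<kappa>. \<kappa> \<notin> K \<longrightarrow>
    int (card {s. lam s \<in> good \<and> chi 0 1 (lam s) = \<kappa>}) = (\<Sum>L\<in>lines. max 0 (\<Sum>j\<in>L. ee 0 1 j)))"
    by (rule exE)
  note K = conjunct1[OF this] mp[OF spec[OF conjunct2[OF conjunct2[OF this]]]]
  have "finite (K \<union> {a. ip1 r a = 0})" using K(1) finite_ip1_roots[OF r] by simp
  then obtain \<kappa> where \<kappa>: "\<kappa> \<notin> K \<union> {a. ip1 r a = 0}"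
    using ex_nonzero_avoiding by blast
  have "int (card {s. lam s \<in> good \<and> chi 0 1 (lam s) = \<kappa>}) > 0"
    using K(2)[of \<kappa>] \<kappa> lines_degree_pos[of 0 1] by simp
  then have "{s. lam s \<in> good \<and> chi 0 1 (lam s) = \<kappa>} \<noteq> {}" by (metis card.empty of_nat_0 less_irrefl)
  then obtain s where s: "lam s \<in> good" "chi 0 1 (lam s) = \<kappa>" by blast
  then have "psi1 (lam s) = \<kappa>" by (simp add: chi_def)
  then have "ip1 r \<kappa> = 0" using vanD[OF assms s(1)] by simp
  then show False using \<kappa> by simp
qed

definition P0 :: "int poly poly" where "P0 = (SOME P. prime_elem P \<and> van P)"

lemma P0: "prime_elem P0" "van P0"
  using someI_ex[OF ex_prime_van] unfolding P0_def[symmetric] by auto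

lemma degree_P0: "degree P0 > 0"
proof (rule ccontr)
  assume "\<not> degree P0 > 0"
  then obtain r where "P0 = [:r:]" using degree_eq_zeroE by blast
  then show False using van_const P0 by (metis not_prime_elem_zero pCons_0_0)
qed

lemma P0_nz: "P0 \<noteq> 0" using degree_P0 by auto

text \<open>If \<open>P0\<close> did not divide \<open>G\<close>, a Bezout combination would be a
  nonzero polynomial in the first variable that vanishes on the curve. So the ideal of the curve is
  generated by \<open>P0\<close>.\<close>

lemma van_iff_dvd: "van G \<longleftrightarrow> P0 dvd G"
proof
  assume "P0 dvd G"
  then show "van G" using van_dvd[OF P0(2)] by blast
next
  assume G: "van G"
  show "P0 dvd G"
  proof (rule ccontr)
    assume "\<not> P0 dvd G"
    from prime_bezout[OF P0(1) degree_P0 this]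
    obtain U V r where r: "r \<noteq> 0" "U * P0 + V * G = [:r:]" by blast
    have "van (U * P0 + V * G)"
      unfolding van_def using P0(2) G by (simp add: vanD)
    then show False using van_const r by simp
  qed
qed

lemma finite_P0_common:
  assumes "\<not> van G" shows "finite {y. eval2 P0 (fst y) (snd y) = 0 \<and> eval2 G (fst y) (snd y) = 0}"
  using finite_common_zeros[OF P0(1) degree_P0] assms unfolding van_iff_dvd .

end

section \<open>The logarithmic Gauss map\<close>

lemma prod_log_derivative:
  fixes f :: "'i \<Rightarrow> complex \<Rightarrow> complex"
  assumes "finite I" "\<And>i. i \<in> I \<Longrightarrow> (f i has_field_derivative f i s * a i) (at s)"
  shows "((\<lambda>s. \<Prod>i\<in>I. f i s) has_field_derivative (\<Prod>i\<in>I. f i s) * (\<Sum>i\<in>I. a i)) (at s)"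
  using assms
proof (induction I rule: finite_induct)
  case (insert i I)
  have "((\<lambda>s. f i s * (\<Prod>i\<in>I. f i s)) has_field_derivative
      f i s * a i * (\<Prod>i\<in>I. f i s) + (\<Prod>i\<in>I. f i s) * (\<Sum>i\<in>I. a i) * f i s) (at s)"
    by (rule DERIV_mult) (use insert in simp_all)
  then show ?case using insert.hyps by (simp add: algebra_simps)
qed simp

lemma powi_log_derivative:
  fixes g :: "complex \<Rightarrow> complex"
  assumes "(g has_field_derivative g s * a) (at s)" "g s \<noteq> 0"
  shows "((\<lambda>s. g s powi n) has_field_derivative g s powi n * (of_int n * a)) (at s)"
proof -
  have "((\<lambda>s. g s powi n) has_field_derivative of_int n * g s powi (n - 1) * (g s * a)) (at s)"
    by (rule DERIV_power_int[OF assms(1)]) (use assms(2) in simp)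
  moreover have "g s powi (n - 1) * g s = g s powi n"
    using assms(2) by (simp add: power_int_diff)
  then have "of_int n * g s powi (n - 1) * (g s * a) = g s powi n * (of_int n * a)"
    by (metis (no_types, lifting) mult.assoc mult.commute)
  ultimately show ?thesis by simp
qed

definition vec2 :: "complex \<Rightarrow> complex \<Rightarrow> complex^2" where
  "vec2 a b = (\<chi> k. if k = 1 then a else b)"

lemma vec2_nth [simp]: "vec2 a b $ 1 = a" "vec2 a b $ 2 = b"
  by (simp_all add: vec2_def)

lemma vec2_eqI: "x$1 = y$1 \<Longrightarrow> x$2 = (y :: complex^2)$2 \<Longrightarrow> x = y"
  by (simp add: vec_eq_iff forall_2)

context horn_nd
begin

lemma lf_vec2 [simp]: "lf i (vec2 a b) = of_int (b1 i) * a + of_int (b2 i) * b"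
  by (simp add: lf_def)

text \<open>The logarithmic derivative of \<open>psi1\<close> at \<open>l\<close> in the direction
  \<open>y\<close>.\<close>

definition tan1 :: "complex^2 \<Rightarrow> complex^2 \<Rightarrow> complex" where
  "tan1 y l = (\<Sum>i\<in>UNIV. of_int (b1 i) * (lf i y / lf i l))"
definition tan2 :: "complex^2 \<Rightarrow> complex^2 \<Rightarrow> complex" where
  "tan2 y l = (\<Sum>i\<in>UNIV. of_int (b2 i) * (lf i y / lf i l))"

text \<open>The logarithmic differentials of \<open>psi1\<close> and \<open>psi2\<close> are annihilated by the vector \<open>l\<close> itself.\<close>

lemma tan_relation:
  assumes "l \<in> good" shows "l$1 * tan1 y l + l$2 * tan2 y l = 0"
proof -
  have "l$1 * tan1 y l + l$2 * tan2 y l = (\<Sum>i\<in>UNIV. lf i l * (lf i y / lf i l))"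
    unfolding tan1_def tan2_def sum_distrib_left sum.distrib[symmetric]
    by (intro sum.cong refl) (simp add: lf_def algebra_simps add_divide_distrib)
  also have "\<dots> = (\<Sum>i\<in>UNIV. lf i y)" using goodD[OF assms] by simp
  also have "\<dots> = of_int (\<Sum>i\<in>UNIV. b1 i) * y$1 + of_int (\<Sum>i\<in>UNIV. b2 i) * y$2"
    by (simp add: lf_def sum.distrib sum_distrib_right)
  finally show ?thesis by (simp add: sum1 sum2)
qed

lemma line_hol_tan1: "line_hol good (tan1 y)"
proof -
  have "line_hol good (\<lambda>l. \<Sum>i\<in>UNIV. of_int (b1 i) * (lf i y * lf i l powi (-1)))"
    by (intro line_hol_sum line_hol_mult line_hol_const line_hol_powi line_hol_lf goodD)
  then show ?thesis by (simp add: tan1_def[abs_def] divide_inverse power_int_minus)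
qed

lemma psi_derivative:
  assumes "l \<in> good"
  shows "((\<lambda>s. psi1 (l + s *s (y - l))) has_field_derivative psi1 l * tan1 y l) (at 0)"
    and "((\<lambda>s. psi2 (l + s *s (y - l))) has_field_derivative psi2 l * tan2 y l) (at 0)"
proof -
  have g: "((\<lambda>s. lf i l + s * (lf i y - lf i l)) has_field_derivative
    (lf i l + 0 * (lf i y - lf i l)) * ((lf i y - lf i l) / lf i l)) (at 0)" for i
    using goodD[OF assms, of i] by (auto intro!: derivative_eq_intros)
  have nz: "lf i l + 0 * (lf i y - lf i l) \<noteq> 0" for i using goodD[OF assms, of i] by simp
  have "((\<lambda>s. \<Prod>i\<in>UNIV. (lf i l + s * (lf i y - lf i l)) powi b1 i) has_field_derivative
    (\<Prod>i\<in>UNIV. (lf i l + 0 * (lf i y - lf i l)) powi b1 i) * (\<Sum>i\<in>UNIV. of_int (b1 i) * ((lf i y - lf i l) / lf i l))) (at 0)"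
    by (intro prod_log_derivative powi_log_derivative g nz finite)
  moreover have "(\<Sum>i\<in>UNIV. of_int (b1 i) * ((lf i y - lf i l) / lf i l)) = tan1 y l - of_int (\<Sum>i\<in>UNIV. b1 i)"
    unfolding tan1_def of_int_sum sum_subtractf[symmetric]
    by (intro sum.cong refl) (use goodD[OF assms] in \<open>simp add: diff_divide_distrib algebra_simps\<close>)
  ultimately show "((\<lambda>s. psi1 (l + s *s (y - l))) has_field_derivative psi1 l * tan1 y l) (at 0)"
    unfolding psi1_def lf_line by (simp add: sum1)
  have "((\<lambda>s. \<Prod>i\<in>UNIV. (lf i l + s * (lf i y - lf i l)) powi b2 i) has_field_derivative
    (\<Prod>i\<in>UNIV. (lf i l + 0 * (lf i y - lf i l)) powi b2 i) * (\<Sum>i\<in>UNIV. of_int (b2 i) * ((lf i y - lf i l) / lf i l))) (at 0)"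
    by (intro prod_log_derivative powi_log_derivative g nz finite)
  moreover have "(\<Sum>i\<in>UNIV. of_int (b2 i) * ((lf i y - lf i l) / lf i l)) = tan2 y l - of_int (\<Sum>i\<in>UNIV. b2 i)"
    unfolding tan2_def of_int_sum sum_subtractf[symmetric]
    by (intro sum.cong refl) (use goodD[OF assms] in \<open>simp add: diff_divide_distrib algebra_simps\<close>)
  ultimately show "((\<lambda>s. psi2 (l + s *s (y - l))) has_field_derivative psi2 l * tan2 y l) (at 0)"
    unfolding psi2_def lf_line by (simp add: sum2)
qed

definition gr1 :: "complex \<Rightarrow> complex \<Rightarrow> complex" where "gr1 = eval2 (dlog1 P0)"
definition gr2 :: "complex \<Rightarrow> complex \<Rightarrow> complex" where "gr2 = eval2 (dlog2 P0)"

text \<open>The derivative of the identity \<open>P0 = 0\<close> along the line from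
  \<open>l\<close> to \<open>y\<close>.\<close>

lemma gr_tan:
  assumes l: "l \<in> good" and y: "y \<in> good"
  shows "gr1 (psi1 l) (psi2 l) * tan1 y l + gr2 (psi1 l) (psi2 l) * tan2 y l = 0"
proof -
  let ?f = "\<lambda>s. psi1 (l + s *s (y - l))" and ?g = "\<lambda>s. psi2 (l + s *s (y - l))"
  have d: "((\<lambda>s. eval2 P0 (?f s) (?g s)) has_field_derivative
    gr1 (?f 0) (?g 0) * tan1 y l + gr2 (?f 0) (?g 0) * tan2 y l) (at 0)"
    unfolding gr1_def gr2_def
    by (rule eval2_has_field_derivative) (use psi_derivative[OF l, of y] in simp_all)
  have op: "open {s. l + s *s (y - l) \<in> good}" using line_dom_good l y unfolding line_dom_def by simp
  have "((\<lambda>s. 0) has_field_derivative (0::complex)) (at 0)" by simp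
  then have "((\<lambda>s. eval2 P0 (?f s) (?g s)) has_field_derivative 0) (at 0)"
    by (rule has_field_derivative_transform_within_open[OF _ op]) (use l vanD[OF P0(2)] in simp_all)
  from DERIV_unique[OF d this] show ?thesis by simp
qed

text \<open>In the chart, \<open>tan1 c1\<close> is the sum of \<open>b1 i\<close> / (s -
  \<open>rt i\<close>). At the root of a line its residue is the line sum of \<open>b1\<close>,
  which is nonzero for some line.\<close>

lemma tan1_not_zero: "\<exists>l\<in>good. tan1 c1 l \<noteq> 0"
proof (rule ccontr)
  assume "\<not> ?thesis"
  then have z: "tan1 c1 l = 0" if "l \<in> good" for l using that by simp
  have "(0::int) \<noteq> 0 \<or> (1::int) \<noteq> 0" by simp
  from ex_ee_nonzero[OF this] obtain L where L: "L \<in> lines" "(\<Sum>j\<in>L. b1 j) \<noteq> 0" by (auto simp: ee_def)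
  then obtain i0 where i0: "L = lin i0" unfolding lines_def by blast
  define \<rho> where "\<rho> = rt i0"
  \<comment> \<open>This is (s - \<open>\<rho>\<close>) times that function, with the removable
    singularity at \<open>\<rho>\<close> filled in, so its value there is the residue.\<close>
  define h where "h s = (\<Sum>i\<in>UNIV. of_int (b1 i) * (if rt i = \<rho> then 1 else (s - \<rho>) / (s - rt i)))" for s
  have ct: "isCont (\<lambda>s. if rt i = \<rho> then 1 else (s - \<rho>) / (s - rt i)) \<rho>" for i
    by (cases "rt i = \<rho>") (auto intro!: continuous_intros)
  have "isCont h \<rho>" unfolding h_def[abs_def]
    by (intro isCont_sum ballI isCont_mult continuous_const ct)
  then have "(h \<longlongrightarrow> h \<rho>) (at \<rho>)" by (simp add: isCont_def)
  moreover have "(h \<longlongrightarrow> 0) (at \<rho>)"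
  proof (rule tendsto_eventually)
    have "open (- (range rt - {\<rho>}))" by (intro open_Compl finite_imp_closed) simp
    then have "\<forall>\<^sub>F s in at \<rho>. s \<in> - (range rt - {\<rho>})" by (rule eventually_at_in_open') simp
    moreover have "\<forall>\<^sub>F s in at \<rho>. s \<noteq> \<rho>" by (rule eventually_neq_at_within)
    ultimately show "\<forall>\<^sub>F s in at \<rho>. h s = 0"
    proof eventually_elim
      case (elim s)
      then have s: "s \<notin> range rt" by auto
      then have sr: "s \<noteq> rt i" for i by blast
      have "h s = (s - \<rho>) * tan1 c1 (lam s)"
        unfolding h_def tan1_def sum_distrib_left
      proof (intro sum.cong refl)
        fix i
        show "of_int (b1 i) * (if rt i = \<rho> then 1 else (s - \<rho>) / (s - rt i)) =
          (s - \<rho>) * (of_int (b1 i) * (lf i c1 / lf i (lam s)))"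
          using elim sr[of i] lf_c1[of i] by (auto simp: lf_lam)
      qed
      also have "\<dots> = 0" using z[of "lam s"] s by (simp add: lam_good)
      finally show ?case .
    qed
  qed
  ultimately have "h \<rho> = 0" using tendsto_unique by (metis at_neq_bot)
  moreover have "h \<rho> = (\<Sum>i\<in>UNIV. if i \<in> L then of_int (b1 i) else 0)"
    unfolding h_def
  proof (intro sum.cong refl)
    fix i
    have "rt i = \<rho> \<longleftrightarrow> i \<in> L"
    proof
      assume "rt i = \<rho>"
      then show "i \<in> L" unfolding \<rho>_def rt_eq i0 using self_in_lin[of i] by simp
    next
      assume "i \<in> L"
      then show "rt i = \<rho>" unfolding \<rho>_def rt_eq i0 by (rule lin_eq)
    qed
    then show "of_int (b1 i) * (if rt i = \<rho> then 1 else (\<rho> - \<rho>) / (\<rho> - rt i)) = (if i \<in> L then of_int (b1 i) else (0::complex))"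
      by simp
  qed
  ultimately have "of_int (\<Sum>j\<in>L. b1 j) = (0::complex)" by (simp add: sum.If_cases)
  then show False using L(2) by (simp only: of_int_eq_0_iff)
qed

text \<open>Both the logarithmic gradient and \<open>l\<close> annihilate the pair
  (\<open>tan1\<close>, \<open>tan2\<close>), hence they are parallel wherever \<open>tan1\<close>
  is nonzero. The identity theorem extends this to all of \<open>good\<close>.\<close>

lemma gradient:
  assumes "l \<in> good"
  shows "gr1 (psi1 l) (psi2 l) * l$2 = gr2 (psi1 l) (psi2 l) * l$1"
proof -
  have "(\<forall>l\<in>good. gr1 (psi1 l) (psi2 l) * l$2 - gr2 (psi1 l) (psi2 l) * l$1 = 0) \<or> (\<forall>l\<in>good. tan1 c1 l = 0)"
  proof (rule good_mult_eq_0)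
    show "line_hol good (\<lambda>l. gr1 (psi1 l) (psi2 l) * l$2 - gr2 (psi1 l) (psi2 l) * l$1)"
      unfolding gr1_def gr2_def by (intro line_hol_diff line_hol_mult line_hol_eval2 line_hol_psi line_hol_coord)
    show "line_hol good (tan1 c1)" by (rule line_hol_tan1)
    fix l assume l: "l \<in> good"
    define x y u v where "x = gr1 (psi1 l) (psi2 l)" and "y = gr2 (psi1 l) (psi2 l)" and "u = tan1 c1 l" and "v = tan2 c1 l"
    have 1: "x * u = - (y * v)" using gr_tan[OF l c1(1)] by (simp add: x_def y_def u_def v_def add_eq_0_iff)
    have 2: "l$1 * u + l$2 * v = 0" using tan_relation[OF l, of c1] by (simp add: u_def v_def)
    have "(x * l$2 - y * l$1) * u = (x * u) * l$2 - y * (l$1 * u)" by (simp add: algebra_simps)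
    also have "\<dots> = - y * (l$1 * u + l$2 * v)" unfolding 1 by (simp add: algebra_simps)
    finally show "(gr1 (psi1 l) (psi2 l) * l$2 - gr2 (psi1 l) (psi2 l) * l$1) * tan1 c1 l = 0"
      unfolding 2 by (simp add: x_def y_def u_def)
  qed
  then show ?thesis using assms tan1_not_zero by auto
qed

lemma good_nonzero: "l \<in> good \<Longrightarrow> l$1 \<noteq> 0 \<or> l$2 \<noteq> 0"
  using goodD[of l undefined] by (auto simp: lf_def)

lemma gradient_parallel:
  assumes l: "l \<in> good"
  shows "\<exists>r. vec2 (gr1 (psi1 l) (psi2 l)) (gr2 (psi1 l) (psi2 l)) = r *s l"
proof (cases "l$1 = 0")
  case True
  then have l2: "l$2 \<noteq> 0" using good_nonzero[OF l] by simp
  show ?thesis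
    by (rule exI[of _ "gr2 (psi1 l) (psi2 l) / l$2"], rule vec2_eqI)
       (use gradient[OF l] True l2 in \<open>simp_all\<close>)
next
  case False
  show ?thesis
    by (rule exI[of _ "gr1 (psi1 l) (psi2 l) / l$1"], rule vec2_eqI)
       (use gradient[OF l] False in \<open>simp_all add: field_simps\<close>)
qed

definition Lp :: "'n \<Rightarrow> int poly poly" where
  "Lp i = smult [:b1 i:] (dlog1 P0) + smult [:b2 i:] (dlog2 P0)"

lemma eval2_Lp: "eval2 (Lp i) a b = lf i (vec2 (gr1 a b) (gr2 a b))"
  by (simp add: Lp_def gr1_def gr2_def)

text \<open>Along the curve the gradient is a multiple of a point of \<open>good\<close>. If form
  \<open>i\<close> vanished on it, the multiple would be 0 and \<open>P0\<close> would divide b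
  dP0/db; but \<open>psi2\<close> has no zeros, and dP0/db is nonzero of smaller degree.\<close>

lemma not_van_Lp: "\<not> van (Lp i)"
proof
  assume v: "van (Lp i)"
  have "van (dlog2 P0)"
    unfolding van_def
  proof
    fix l assume l: "l \<in> good"
    obtain r where r: "vec2 (gr1 (psi1 l) (psi2 l)) (gr2 (psi1 l) (psi2 l)) = r *s l"
      using gradient_parallel[OF l] by (rule exE)
    have "lf i (r *s l) = 0" using vanD[OF v l] unfolding eval2_Lp r .
    then have "r = 0" using goodD[OF l, of i] by (simp add: lf_smult)
    then have "gr2 (psi1 l) (psi2 l) = 0" using arg_cong[OF r, of "\<lambda>v. v$2"] by simp
    then show "eval2 (dlog2 P0) (psi1 l) (psi2 l) = 0" by (simp add: gr2_def)
  qed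
  then have "P0 dvd [:0, 1:] * pderiv P0" unfolding van_iff_dvd by (simp add: dlog2_def)
  then have "P0 dvd [:0, 1:] \<or> P0 dvd pderiv P0" by (rule prime_elem_dvd_multD[OF P0(1)])
  moreover have "\<not> P0 dvd [:0, 1:]"
  proof
    assume "P0 dvd [:0, 1:]"
    then have "van [:0, 1:]" unfolding van_iff_dvd .
    from vanD[OF this c1(1)] show False using psi_nz(2)[OF c1(1)] by simp
  qed
  moreover have "\<not> P0 dvd pderiv P0"
  proof
    assume d: "P0 dvd pderiv P0"
    have "pderiv P0 \<noteq> 0" using degree_P0 by (simp add: pderiv_eq_0_iff)
    from dvd_imp_degree_le[OF d this] show False using degree_P0 by (simp add: degree_pderiv)
  qed
  ultimately show False by simp
qed

lemma van_prod: "finite I \<Longrightarrow> van (\<Prod>i\<in>I. p i) \<Longrightarrow> \<exists>i\<in>I. van (p i)"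
proof (induction I rule: finite_induct)
  case empty
  then show ?case using not_van_1 by simp
next
  case (insert i I)
  then have "van (p i * (\<Prod>i\<in>I. p i))" by simp
  from van_mult[OF this] insert.IH show ?case by auto
qed

text \<open>The curve points whose logarithmic gradient lies outside \<open>good\<close>. Points
  with zero gradient are among them.\<close>

definition Bad :: "(complex \<times> complex) set" where
  "Bad = {y. eval2 P0 (fst y) (snd y) = 0 \<and> eval2 (\<Prod>i\<in>UNIV. Lp i) (fst y) (snd y) = 0}"

lemma finite_Bad: "finite Bad"
  unfolding Bad_def by (rule finite_P0_common) (use van_prod[of UNIV Lp] not_van_Lp in auto)

lemma not_Bad_good:
  "eval2 P0 a b = 0 \<Longrightarrow> (a, b) \<notin> Bad \<Longrightarrow> vec2 (gr1 a b) (gr2 a b) \<in> good"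
  by (simp add: Bad_def eval2_Lp good_def)

lemma sum_nat_eq: "(\<Sum>i\<in>I. b i) = (0::int) \<Longrightarrow> (\<Sum>i\<in>I. nat (b i)) = (\<Sum>i\<in>I. nat (- b i))"
proof -
  assume "(\<Sum>i\<in>I. b i) = 0"
  moreover have "int (\<Sum>i\<in>I. nat (b i)) - int (\<Sum>i\<in>I. nat (- b i)) = (\<Sum>i\<in>I. b i)"
    unfolding of_nat_sum sum_subtractf[symmetric] by (intro sum.cong refl) simp
  ultimately have "int (\<Sum>i\<in>I. nat (b i)) = int (\<Sum>i\<in>I. nat (- b i))"
    by (simp only: right_minus_eq)
  then show ?thesis by (simp only: of_nat_eq_iff)
qed

text \<open>Horn--Kapranov: the logarithmic Gauss map inverts the parametrization. The relation is a
  polynomial identity on the curve, hence holds modulo \<open>P0\<close>.\<close>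

lemma log_gauss_inverse:
  assumes P: "eval2 P0 a b = 0" and g: "vec2 (gr1 a b) (gr2 a b) \<in> good"
  shows "psi1 (vec2 (gr1 a b) (gr2 a b)) = a" "psi2 (vec2 (gr1 a b) (gr2 a b)) = b"
proof -
  have quot: "(\<Prod>i\<in>UNIV. lf i l powi e i) = (\<Prod>i\<in>UNIV. lf i l ^ nat (e i)) / (\<Prod>i\<in>UNIV. lf i l ^ nat (- e i))"
    if "l \<in> good" for l e
    using goodD[OF that] by (simp add: powi_as_quotient prod_dividef)
  have main: "(\<Prod>i\<in>UNIV. lf i (vec2 (gr1 a b) (gr2 a b)) powi e i) = eval2 Y a b"
    if e0: "(\<Sum>i\<in>UNIV. e i) = 0" and Y: "\<And>l. l \<in> good \<Longrightarrow> eval2 Y (psi1 l) (psi2 l) = (\<Prod>i\<in>UNIV. lf i l powi e i)" for e Y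
  proof -
    \<comment> \<open>The relation with denominators cleared. As \<open>e\<close> sums to zero, both
      products have the same degree in the gradient, so the scalar relating the gradient to
      \<open>l\<close> factors out.\<close>
    define G where "G = (\<Prod>i\<in>UNIV. Lp i ^ nat (e i)) - Y * (\<Prod>i\<in>UNIV. Lp i ^ nat (- e i))"
    have "van G"
      unfolding van_def
    proof
      fix l assume l: "l \<in> good"
      obtain r where r: "vec2 (gr1 (psi1 l) (psi2 l)) (gr2 (psi1 l) (psi2 l)) = r *s l"
        using gradient_parallel[OF l] by (rule exE)
      define N where "N = (\<Sum>i\<in>UNIV. nat (e i))"
      have N: "N = (\<Sum>i\<in>UNIV. nat (- e i))" unfolding N_def by (rule sum_nat_eq[OF e0])
      have pr: "(\<Prod>i\<in>UNIV. (r * lf i l) ^ k i) = r ^ (\<Sum>i\<in>UNIV. k i) * (\<Prod>i\<in>UNIV. lf i l ^ k i)" for k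
        by (simp add: power_mult_distrib prod.distrib power_sum)
      have nz: "(\<Prod>i\<in>UNIV. lf i l ^ nat (- e i)) \<noteq> 0" using goodD[OF l] by simp
      have "eval2 G (psi1 l) (psi2 l) = (\<Prod>i\<in>UNIV. (r * lf i l) ^ nat (e i)) -
          (\<Prod>i\<in>UNIV. lf i l powi e i) * (\<Prod>i\<in>UNIV. (r * lf i l) ^ nat (- e i))"
        by (simp add: G_def eval2_Lp r lf_smult Y[OF l] del: lf_vec2)
      also have "\<dots> = r ^ N * (\<Prod>i\<in>UNIV. lf i l ^ nat (e i)) -
          (\<Prod>i\<in>UNIV. lf i l powi e i) * (r ^ N * (\<Prod>i\<in>UNIV. lf i l ^ nat (- e i)))"
        unfolding pr N[symmetric] N_def[symmetric] ..
      also have "\<dots> = 0"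
      proof -
        have "r * x - x / z * (r * z) = 0" if "z \<noteq> 0" for r x z :: complex using that by simp
        from this[OF nz] show ?thesis unfolding quot[OF l] .
      qed
      finally show "eval2 G (psi1 l) (psi2 l) = 0" .
    qed
    then obtain H where "G = P0 * H" unfolding van_iff_dvd by (elim dvdE)
    then have "eval2 G a b = 0" using P by simp
    then have "(\<Prod>i\<in>UNIV. lf i (vec2 (gr1 a b) (gr2 a b)) ^ nat (e i)) =
        eval2 Y a b * (\<Prod>i\<in>UNIV. lf i (vec2 (gr1 a b) (gr2 a b)) ^ nat (- e i))"
      by (simp add: G_def eval2_Lp del: lf_vec2)
    moreover have "(\<Prod>i\<in>UNIV. lf i (vec2 (gr1 a b) (gr2 a b)) ^ nat (- e i)) \<noteq> 0"
      using goodD[OF g] by simp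
    ultimately show ?thesis unfolding quot[OF g] by simp
  qed
  have "eval2 [:[:0, 1:]:] x y = x" "eval2 [:0, 1:] x y = y" for x y by simp_all
  then show "psi1 (vec2 (gr1 a b) (gr2 a b)) = a" "psi2 (vec2 (gr1 a b) (gr2 a b)) = b"
    using main[OF sum1, of "[:[:0, 1:]:]"] main[OF sum2, of "[:0, 1:]"] unfolding psi1_def psi2_def by simp_all
qed

text \<open>Up to a scalar, a point of the projective line lies in the chart or is its point at
  infinity \<open>c1\<close>.\<close>

lemma chart:
  assumes "l \<in> good"
  shows "(\<exists>x s. x \<noteq> 0 \<and> l = x *s lam s) \<or> (\<exists>x. x \<noteq> 0 \<and> l = x *s c1)"
proof -
  define y where "y = l$1 / c1$1"
  define x where "x = l$2 - y * c1$2"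
  have l1: "l$1 = y * c1$1" using c1(2) by (simp add: y_def)
  have l2: "l$2 = x + y * c1$2" by (simp add: x_def)
  show ?thesis
  proof (cases "x = 0")
    case True
    have "l = y *s c1" by (rule vec2_eqI) (simp_all add: l1 l2 True)
    moreover have "y \<noteq> 0" using good_nonzero[OF assms] l1 l2 True by auto
    ultimately show ?thesis by blast
  next
    case False
    have "l = x *s lam (y / x)"
      by (rule vec2_eqI) (use False in \<open>simp_all add: l1 l2 lam_def c0 algebra_simps\<close>)
    then show ?thesis using False by blast
  qed
qed

lemma lam_parallel:
  assumes "lam s = x *s lam s'" shows "s = s'"
proof -
  have 1: "s * c1$1 = x * (s' * c1$1)" using arg_cong[OF assms, of "\<lambda>v. v$1"] by (simp add: lam_def c0)
  then have s: "s = x * s'" using c1(2) by simp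
  have "1 + s * c1$2 = x * (1 + s' * c1$2)" using arg_cong[OF assms, of "\<lambda>v. v$2"] by (simp add: lam_def c0 distrib_left)
  then have "x = 1" unfolding s by (simp add: algebra_simps)
  then show ?thesis using s by simp
qed

text \<open>Off \<open>Bad\<close> the gradient recovers the parameter up to a nonzero scalar, so
  the parametrization is injective there.\<close>

lemma not_Bad_unique:
  assumes l: "l \<in> good" and nb: "(psi1 l, psi2 l) \<notin> Bad"
  shows "\<exists>r. r \<noteq> 0 \<and> vec2 (gr1 (psi1 l) (psi2 l)) (gr2 (psi1 l) (psi2 l)) = r *s l"
proof -
  obtain r where r: "vec2 (gr1 (psi1 l) (psi2 l)) (gr2 (psi1 l) (psi2 l)) = r *s l"
    using gradient_parallel[OF l] by (rule exE)
  have "r *s l \<in> good" using not_Bad_good[OF vanD[OF P0(2) l] nb] unfolding r .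
  then have "r \<noteq> 0" using goodD[of "r *s l" undefined] by (auto simp: lf_smult)
  then show ?thesis using r by (intro exI[of _ r] conjI)
qed

end

section \<open>The width of the polygon of \<open>P0\<close>\<close>

lemma finite_powi_preimage:
  fixes K :: "complex set"
  assumes "finite K" "n > 0"
  shows "finite {z. z ^ n \<in> K}"
proof -
  have "finite {z. z ^ n = c}" for c :: complex
  proof -
    have cf: "coeff (monom 1 n - [:c:]) n = 1" using assms(2) by (simp add: coeff_eq_0)
    have "monom 1 n - [:c:] \<noteq> 0"
    proof
      assume e: "monom 1 n - [:c:] = 0"
      show False using cf unfolding e by simp
    qed
    from poly_roots_finite[OF this] show ?thesis by (simp add: poly_monom)
  qed
  then have "finite (\<Union>c\<in>K. {z. z ^ n = c})" using assms(1) by simp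
  moreover have "(\<Union>c\<in>K. {z. z ^ n = c}) = {z. z ^ n \<in> K}" by auto
  ultimately show ?thesis by simp
qed

text \<open>Bezout coefficients invert the map \<open>\<tau>\<close> to (\<open>\<tau>\<close>^w1,
  \<open>\<tau>\<close>^w2) on its image, the curve x^w2 = y^w1.\<close>

lemma powi_coprime_param:
  fixes x y :: complex
  assumes nz: "x \<noteq> 0" "y \<noteq> 0" and eq: "x powi w2 = y powi w1" and bez: "u * w1 + v * w2 = 1"
  shows "(x powi u * y powi v) powi w1 = x" "(x powi u * y powi v) powi w2 = y"
proof -
  have "(x powi u * y powi v) powi w1 = x powi (u * w1) * (y powi w1) powi v"
    by (simp add: power_int_mult_distrib power_int_mult[symmetric] mult.commute)
  also have "\<dots> = x powi (u * w1) * x powi (v * w2)"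
    unfolding eq[symmetric] by (simp add: power_int_mult[symmetric] mult.commute)
  also have "\<dots> = x powi 1" unfolding bez[symmetric] using nz by (simp add: power_int_add)
  finally show "(x powi u * y powi v) powi w1 = x" by simp
  have "(x powi u * y powi v) powi w2 = (x powi w2) powi u * y powi (v * w2)"
    by (simp add: power_int_mult_distrib power_int_mult[symmetric] mult.commute)
  also have "\<dots> = y powi (u * w1) * y powi (v * w2)"
    unfolding eq by (simp add: power_int_mult[symmetric] mult.commute)
  also have "\<dots> = y powi 1" unfolding bez[symmetric] using nz by (simp add: power_int_add)
  finally show "(x powi u * y powi v) powi w2 = y" by simp
qed

context horn_nd
begin

lemma chi_smult: "c \<noteq> 0 \<Longrightarrow> chi w1 w2 (c *s l) = chi w1 w2 l"
  by (simp add: chi_def psi_smult)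

lemma lam_in_good: "x \<noteq> 0 \<Longrightarrow> x *s l \<in> good \<Longrightarrow> l \<in> good"
  by (simp add: good_def lf_smult)

text \<open>The character labels the coset of \<open>\<zeta>\<close> by \<open>\<zeta>\<close> to
  the power |w|^2, so a generic \<open>\<zeta>\<close> gives a generic label.\<close>

lemma cu_chi:
  assumes "\<zeta> \<noteq> 0" "\<tau> \<noteq> 0"
  shows "cu1 w1 w2 \<zeta> \<tau> powi w2 * cu2 w1 w2 \<zeta> \<tau> powi (- w1) = \<zeta> ^ nat (w1 * w1 + w2 * w2)"
proof -
  have "cu1 w1 w2 \<zeta> \<tau> powi w2 * cu2 w1 w2 \<zeta> \<tau> powi (- w1) =
    (\<zeta> powi (w2 * w2) * \<zeta> powi (- w1 * - w1)) * (\<tau> powi (w1 * w2) * \<tau> powi (w2 * - w1))"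
    unfolding cu1_def cu2_def power_int_mult_distrib power_int_mult by (simp only: mult_ac)
  also have "\<zeta> powi (w2 * w2) * \<zeta> powi (- w1 * - w1) = \<zeta> powi (w1 * w1 + w2 * w2)"
    using assms by (simp add: power_int_add)
  also have "\<tau> powi (w1 * w2) * \<tau> powi (w2 * - w1) = \<tau> powi (w1 * w2 + w2 * - w1)"
    by (rule power_int_add[symmetric]) (use assms in simp)
  also have "\<tau> powi (w1 * w2 + w2 * - w1) = 1" by (simp add: mult.commute)
  finally show ?thesis by (simp add: power_int_def)
qed

text \<open>The number of torus points of the curve on the generic coset of the one-parameter subgroup
  \<open>w\<close> is counted twice: on the curve and on its parametrization.\<close>

lemma width_P0:
  assumes cop: "coprime w1 w2"
  shows "hmax w1 w2 P0 - hmin w1 w2 P0 = (\<Sum>L\<in>lines. max 0 (\<Sum>j\<in>L. ee w1 w2 j))"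
proof -
  have w: "w1 \<noteq> 0 \<or> w2 \<noteq> 0" using cop by auto
  obtain u v where bez: "u * w1 + v * w2 = 1"
    using bezout_int[of w1 w2] cop by (auto simp: coprime_iff_gcd_eq_1)
  define n where "n = nat (w1 * w1 + w2 * w2)"
  have npos: "w1 * w1 + w2 * w2 > 0" using w by (simp add: sum_squares_gt_zero_iff)
  then have n: "n > 0" by (simp add: n_def)
  from card_chi_fiber[OF w] obtain K where KK: "finite K \<and> chi w1 w2 c1 \<in> K \<and> (\<forall>\<kappa>. \<kappa> \<notin> K \<longrightarrow>
    int (card {s. lam s \<in> good \<and> chi w1 w2 (lam s) = \<kappa>}) = (\<Sum>L\<in>lines. max 0 (\<Sum>j\<in>L. ee w1 w2 j)))"
    by (rule exE)
  note K1 = conjunct1[OF KK] and K2 = conjunct1[OF conjunct2[OF KK]] and K3 = mp[OF spec[OF conjunct2[OF conjunct2[OF KK]]]]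
  \<comment> \<open>Besides the exceptional values of the fibre count, this excludes the values on
    \<open>Bad\<close> and at the parameter (w2, -w1), where the curve would be tangent to the
    coset.\<close>
  define K' where "K' = K \<union> insert (chi w1 w2 (vec2 (of_int w2) (- of_int w1))) ((\<lambda>y. fst y powi w2 * snd y powi (- w1)) ` Bad)"
  have fK': "finite K'" using K1 finite_Bad by (simp add: K'_def)
  have hh: "hmin w1 w2 P0 \<in> wt w1 w2 ` supp2 P0" "hmax w1 w2 P0 \<in> wt w1 w2 ` supp2 P0"
    using hmin_in[OF P0_nz, of w1 w2] hmax_in[OF P0_nz, of w1 w2] by force+
  have "finite ({\<zeta>. \<zeta> \<noteq> 0 \<and> face w1 w2 P0 (hmin w1 w2 P0) \<zeta> = 0} \<union> {\<zeta>. \<zeta> \<noteq> 0 \<and> face w1 w2 P0 (hmax w1 w2 P0) \<zeta> = 0}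
    \<union> {z. z ^ n \<in> K'})" (is "finite ?Z")
    by (intro finite_UnI finite_face_zeros w hh finite_powi_preimage fK' n)
  from ex_nonzero_avoiding[OF this] obtain \<zeta> where "\<zeta> \<noteq> 0 \<and> \<zeta> \<notin> ?Z" by (rule exE)
  note zz = this
  have z: "\<zeta> \<noteq> 0" using zz by simp
  have f1: "face w1 w2 P0 (hmin w1 w2 P0) \<zeta> \<noteq> 0" and f2: "face w1 w2 P0 (hmax w1 w2 P0) \<zeta> \<noteq> 0"
    and \<kappa>: "\<zeta> ^ n \<notin> K'" using zz z by simp_all
  define \<kappa> where "\<kappa> = \<zeta> ^ n"
  define F where "F = Fpoly w1 w2 P0 \<zeta>"
  define S where "S = {s. lam s \<in> good \<and> chi w1 w2 (lam s) = \<kappa>}"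
  define T where "T = {\<tau>. poly F \<tau> = 0}"
  have F0: "poly F 0 \<noteq> 0" using f1 by (simp add: F_def poly_0_coeff_0 coeff_Fpoly)
  then have Fnz: "F \<noteq> 0" by auto
  have degF: "degree F = nat (hmax w1 w2 P0 - hmin w1 w2 P0)" unfolding F_def by (rule degree_Fpoly[OF P0_nz f2])
  have Tnz: "\<tau> \<noteq> 0" if "\<tau> \<in> T" for \<tau> using that F0 by (cases "\<tau> = 0") (simp_all add: T_def)
  have cu: "cu1 w1 w2 \<zeta> \<tau> powi w2 * cu2 w1 w2 \<zeta> \<tau> powi (- w1) = \<kappa>" if "\<tau> \<in> T" for \<tau>
    using cu_chi[OF z Tnz[OF that]] by (simp add: \<kappa>_def n_def)
  have nBad: "(a, b) \<notin> Bad" if "a powi w2 * b powi (- w1) = \<kappa>" for a b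
  proof
    assume "(a, b) \<in> Bad"
    then have "\<kappa> \<in> (\<lambda>y. fst y powi w2 * snd y powi (- w1)) ` Bad" using that by (force simp: image_iff)
    then show False using \<kappa> by (simp add: K'_def \<kappa>_def)
  qed
  have Tcurve: "eval2 P0 (cu1 w1 w2 \<zeta> \<tau>) (cu2 w1 w2 \<zeta> \<tau>) = 0" if "\<tau> \<in> T" for \<tau>
    using eval2_curve[OF z Tnz[OF that], of P0 w1 w2] that by (simp add: T_def F_def)
  \<comment> \<open>Roots \<open>\<tau>\<close> on the coset and parameters \<open>s\<close> are
    matched when they give the same point; the next four facts make this a bijection.\<close>
  define rel where "rel \<tau> s \<longleftrightarrow> psi1 (lam s) = cu1 w1 w2 \<zeta> \<tau> \<and> psi2 (lam s) = cu2 w1 w2 \<zeta> \<tau>" for \<tau> s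
  have gv: "\<exists>v. v = vec2 (gr1 (cu1 w1 w2 \<zeta> \<tau>) (cu2 w1 w2 \<zeta> \<tau>)) (gr2 (cu1 w1 w2 \<zeta> \<tau>) (cu2 w1 w2 \<zeta> \<tau>)) \<and> v \<in> good \<and>
      psi1 v = cu1 w1 w2 \<zeta> \<tau> \<and> psi2 v = cu2 w1 w2 \<zeta> \<tau> \<and> chi w1 w2 v = \<kappa>" if "\<tau> \<in> T" for \<tau>
  proof -
    note g = not_Bad_good[OF Tcurve[OF that] nBad[OF cu[OF that]]]
    note p = log_gauss_inverse[OF Tcurve[OF that] g]
    show ?thesis using g p cu[OF that] by (simp add: chi_def)
  qed
  have ex_s: "\<exists>s. s \<in> S \<and> rel \<tau> s" if t: "\<tau> \<in> T" for \<tau>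
  proof -
    obtain v where v: "v \<in> good" "psi1 v = cu1 w1 w2 \<zeta> \<tau>" "psi2 v = cu2 w1 w2 \<zeta> \<tau>" "chi w1 w2 v = \<kappa>"
      using gv[OF t] by (elim exE conjE) (rule that)
    from chart[OF v(1)] show ?thesis
    proof (elim disjE exE conjE)
      fix x s assume xs: "x \<noteq> 0" "v = x *s lam s"
      have g: "lam s \<in> good" using lam_in_good[OF xs(1)] v(1) unfolding xs(2) .
      have "chi w1 w2 (lam s) = \<kappa>" using v(4) unfolding xs(2) chi_smult[OF xs(1)] .
      moreover have "rel \<tau> s" using v(2,3) unfolding rel_def xs(2) psi_smult[OF xs(1)] by simp
      ultimately show ?thesis using g by (intro exI[of _ s]) (simp add: S_def)
    next
      fix x assume x: "x \<noteq> 0" "v = x *s c1"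
      have "chi w1 w2 c1 = \<kappa>" using v(4) unfolding x(2) chi_smult[OF x(1)] .
      then have "\<kappa> \<in> K" using K2 by simp
      then show ?thesis using \<kappa> by (simp add: K'_def \<kappa>_def)
    qed
  qed
  have ex_t: "\<exists>\<tau>. \<tau> \<in> T \<and> rel \<tau> s" if s: "s \<in> S" for s
  proof -
    \<comment> \<open>Dividing by the base point (\<open>\<zeta>\<close>^w2,
      \<open>\<zeta>\<close>^(-w1)) moves the point into the subgroup itself, where coprimality
      yields \<open>\<tau>\<close>.\<close>
    define a b where "a = psi1 (lam s)" and "b = psi2 (lam s)"
    have g: "lam s \<in> good" and ch: "a powi w2 * b powi (- w1) = \<zeta> powi (w1 * w1 + w2 * w2)"
      using s npos by (auto simp: S_def chi_def a_def b_def \<kappa>_def n_def power_int_def)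
    have nz: "a \<noteq> 0" "b \<noteq> 0" using psi_nz[OF g] by (simp_all add: a_def b_def)
    define x y where "x = a / \<zeta> powi w2" and "y = b / \<zeta> powi (- w1)"
    have xy: "x \<noteq> 0" "y \<noteq> 0" using nz z by (simp_all add: x_def y_def)
    have "a powi w2 = (\<zeta> powi (w1 * w1) * \<zeta> powi (w2 * w2)) * b powi w1"
    proof -
      have "a powi w2 = (a powi w2 * b powi (- w1)) * b powi w1" using nz by (simp add: power_int_minus)
      then show ?thesis unfolding ch using z by (simp add: power_int_add)
    qed
    moreover have "x powi w2 = a powi w2 / \<zeta> powi (w2 * w2)"
      by (simp add: x_def power_int_divide_distrib power_int_mult)
    moreover have "y powi w1 = b powi w1 * \<zeta> powi (w1 * w1)"
      by (simp add: y_def power_int_mult_distrib power_int_mult power_int_minus power_int_inverse divide_inverse)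
    ultimately have "x powi w2 = y powi w1" using z by simp
    note par = powi_coprime_param[OF xy this bez]
    define \<tau> where "\<tau> = x powi u * y powi v"
    have t0: "\<tau> \<noteq> 0" using xy by (simp add: \<tau>_def)
    note t1 = par[folded \<tau>_def]
    have "\<zeta> powi w2 * x = a" "\<zeta> powi (- w1) * y = b" using z by (simp_all add: x_def y_def)
    then have r: "rel \<tau> s"
      unfolding rel_def cu1_def cu2_def t1 a_def[symmetric] b_def[symmetric] by simp
    have "eval2 P0 (cu1 w1 w2 \<zeta> \<tau>) (cu2 w1 w2 \<zeta> \<tau>) = 0"
      using vanD[OF P0(2) g] r by (simp add: rel_def)
    then have "\<tau> \<in> T" using eval2_curve[OF z t0, of P0 w1 w2] t0 by (simp add: T_def F_def)
    then show ?thesis using r by blast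
  qed
  have uniq_s: "s = s'" if ss: "\<tau> \<in> T" "s \<in> S" "s' \<in> S" "rel \<tau> s" "rel \<tau> s'" for \<tau> s s'
  proof -
    have nb: "(psi1 (lam s), psi2 (lam s)) \<notin> Bad" "(psi1 (lam s'), psi2 (lam s')) \<notin> Bad"
      using nBad[OF cu[OF ss(1)]] ss(4,5) by (simp_all add: rel_def)
    have g: "lam s \<in> good" "lam s' \<in> good" using ss by (simp_all add: S_def)
    obtain r where r: "r \<noteq> 0 \<and> vec2 (gr1 (psi1 (lam s)) (psi2 (lam s))) (gr2 (psi1 (lam s)) (psi2 (lam s))) = r *s lam s"
      using not_Bad_unique[OF g(1) nb(1)] by (rule exE)
    obtain r' where r': "r' \<noteq> 0 \<and> vec2 (gr1 (psi1 (lam s')) (psi2 (lam s'))) (gr2 (psi1 (lam s')) (psi2 (lam s'))) = r' *s lam s'"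
      using not_Bad_unique[OF g(2) nb(2)] by (rule exE)
    have "psi1 (lam s) = psi1 (lam s')" "psi2 (lam s) = psi2 (lam s')" using ss(4,5) by (simp_all add: rel_def)
    then have eq: "r *s lam s = r' *s lam s'" using conjunct2[OF r] conjunct2[OF r'] by simp
    have "lam s = (1 / r) *s (r *s lam s)" using r by (simp add: vector_smult_assoc)
    also have "\<dots> = (r' / r) *s lam s'" unfolding eq by (simp add: vector_smult_assoc)
    finally show ?thesis by (rule lam_parallel)
  qed
  have uniq_t: "\<tau> = \<tau>'" if tt: "\<tau> \<in> T" "\<tau>' \<in> T" "rel \<tau> s" "rel \<tau>' s" for \<tau> \<tau>' s
  proof -
    have e: "\<tau> powi w1 = \<tau>' powi w1" "\<tau> powi w2 = \<tau>' powi w2"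
      using tt(3,4) z by (auto simp: rel_def cu1_def cu2_def)
    have "t powi 1 = (t powi w1) powi u * (t powi w2) powi v" if "t \<noteq> 0" for t :: complex
      unfolding bez[symmetric] using that by (simp add: power_int_add power_int_mult[symmetric] mult.commute)
    from this[OF Tnz[OF tt(1)]] this[OF Tnz[OF tt(2)]] show ?thesis unfolding e by simp
  qed
  have finT: "finite T" unfolding T_def by (rule poly_roots_finite[OF Fnz])
  obtain f where f: "\<And>\<tau>. \<tau> \<in> T \<Longrightarrow> f \<tau> \<in> S \<and> rel \<tau> (f \<tau>)" using ex_s by metis
  obtain h where h: "\<And>s. s \<in> S \<Longrightarrow> h s \<in> T \<and> rel (h s) s" using ex_t by metis
  have injh: "inj_on h S"
  proof (rule inj_onI)
    fix s s' assume s: "s \<in> S" "s' \<in> S" "h s = h s'"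
    show "s = s'" by (rule uniq_s[of "h s"]) (use h[OF s(1)] h[OF s(2)] s in simp_all)
  qed
  have injf: "inj_on f T"
  proof (rule inj_onI)
    fix t t' assume s: "t \<in> T" "t' \<in> T" "f t = f t'"
    show "t = t'" by (rule uniq_t[of _ _ "f t"]) (use f[OF s(1)] f[OF s(2)] s in simp_all)
  qed
  have hT: "h ` S \<subseteq> T" and fS: "f ` T \<subseteq> S" using h f by blast+
  have finS: "finite S" using injh hT finT by (metis finite_imageD finite_subset)
  have "card S \<le> card T" by (rule card_inj_on_le[OF injh hT finT])
  moreover have "card T \<le> card S" by (rule card_inj_on_le[OF injf fS finS])
  ultimately have card_eq: "card S = card T" by simp
  have "card T = degree F"
  proof -
    \<comment> \<open>A double root makes the gradient orthogonal to w, hence proportional to (w2,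
      -w1), whose character value was excluded. So roots are counted without multiplicity.\<close>
    have "rsquarefree F"
      unfolding rsquarefree_roots
    proof (intro allI notI)
      fix \<tau> assume t: "poly F \<tau> = 0 \<and> poly (pderiv F) \<tau> = 0"
      then have tT: "\<tau> \<in> T" by (simp add: T_def)
      define a b where "a = gr1 (cu1 w1 w2 \<zeta> \<tau>) (cu2 w1 w2 \<zeta> \<tau>)" and "b = gr2 (cu1 w1 w2 \<zeta> \<tau>) (cu2 w1 w2 \<zeta> \<tau>)"
      have rel0: "of_int w1 * a + of_int w2 * b = 0"
        unfolding a_def b_def gr1_def gr2_def
        by (rule Fpoly_double_root[OF z Tnz[OF tT]]) (use t in \<open>simp_all add: F_def\<close>)
      have v: "vec2 a b \<in> good" "chi w1 w2 (vec2 a b) = \<kappa>"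
        using gv[OF tT] by (auto simp: a_def b_def)
      have "\<exists>r. vec2 a b = r *s vec2 (of_int w2) (- of_int w1)"
      proof (cases "w1 = 0")
        case True
        then have w2: "of_int w2 \<noteq> (0::complex)" using w by simp
        then have b0: "b = 0" using rel0 True by simp
        show ?thesis
          by (rule exI[of _ "a / of_int w2"], rule vec2_eqI) (use w2 b0 True in simp_all)
      next
        case False
        then have w1: "of_int w1 \<noteq> (0::complex)" by simp
        have a: "a = - (of_int w2 * b) / of_int w1" using rel0 w1 by (simp add: field_simps add_eq_0_iff)
        show ?thesis
          by (rule exI[of _ "- b / of_int w1"], rule vec2_eqI) (use w1 a in simp_all)
      qed
      then obtain r where r: "vec2 a b = r *s vec2 (of_int w2) (- of_int w1)" by (rule exE)
      have "r \<noteq> 0" using good_nonzero[OF v(1)] unfolding r by auto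
      then have "chi w1 w2 (vec2 (of_int w2) (- of_int w1)) = \<kappa>" using v(2) chi_smult[of r w1 w2] unfolding r by simp
      then show False using \<kappa> by (simp add: K'_def \<kappa>_def)
    qed
    from complex_poly_decompose_rsquarefree[OF this]
    have "degree F = degree (smult (lead_coeff F) (\<Prod>z | poly F z = 0. [:- z, 1:]))" by simp
    also have "\<dots> = card {z. poly F z = 0}"
      using Fnz by (simp add: degree_prod_eq_sum_degree)
    finally show ?thesis by (simp add: T_def)
  qed
  moreover have "int (card S) = (\<Sum>L\<in>lines. max 0 (\<Sum>j\<in>L. ee w1 w2 j))"
    unfolding S_def by (rule K3) (use \<kappa> in \<open>simp add: K'_def \<kappa>_def\<close>)
  moreover have "hmin w1 w2 P0 \<le> hmax w1 w2 P0"
  proof -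
    obtain k where "k \<in> supp2 P0" "wt w1 w2 k = hmin w1 w2 P0" using hmin_in[OF P0_nz] by blast
    then show ?thesis using hmax_ge[of k P0 w1 w2] by simp
  qed
  ultimately show ?thesis using card_eq degF by simp
qed

end

section \<open>Edge directions from points escaping to infinity\<close>

lemma ln_power_int: "x > 0 \<Longrightarrow> ln (x powi n) = of_int n * ln (x :: real)"
  by (cases "n \<ge> 0") (auto simp: power_int_def ln_realpow ln_inverse power_inverse)

text \<open>Eliminating \<open>Y\<close> leaves a bounded multiple of the divergent
  \<open>X\<close>, so the determinant of w and c is 0. If their inner product were not positive,
  then since \<open>Y\<close> is eventually nonpositive, pairing with w would bound |w|^2
  \<open>X\<close> from below.\<close>

lemma parallel_of_divergence:
  fixes X Y :: "nat \<Rightarrow> real" and w1 w2 c1 c2 :: real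
  assumes X: "filterlim X at_bot sequentially" and Y: "\<forall>\<^sub>F n in sequentially. Y n \<le> 0"
    and conv: "convergent (\<lambda>n. w1 * X n - c1 * Y n)" "convergent (\<lambda>n. w2 * X n - c2 * Y n)"
    and w: "w1 \<noteq> 0 \<or> w2 \<noteq> 0"
  shows "w1 * c2 = w2 * c1 \<and> w1 * c1 + w2 * c2 > 0"
proof -
  have unb: False if cf: "convergent f" and le: "\<forall>\<^sub>F n in sequentially. f n \<le> a * X n" and a: "a > 0" for f :: "nat \<Rightarrow> real" and a
  proof -
    obtain K where K: "\<And>n. \<bar>f n\<bar> \<le> K" using convergent_imp_Bseq[OF cf] unfolding Bseq_def by auto
    have "\<forall>\<^sub>F n in sequentially. X n \<le> (- K - 1) / a" using X unfolding filterlim_at_bot by blast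
    with le have "\<forall>\<^sub>F n in sequentially. False"
    proof eventually_elim
      case (elim n)
      have "a * X n \<le> - K - 1" using elim(2) a by (simp add: field_simps)
      then show ?case using elim(1) K[of n] by simp
    qed
    then show False by simp
  qed
  define d where "d = w1 * c2 - w2 * c1"
  have c: "convergent (\<lambda>n. s * (w1 * X n - c1 * Y n) + t * (w2 * X n - c2 * Y n))" for s t
    by (intro convergent_add convergent_mult conv convergent_const)
  have "d = 0"
  proof (rule ccontr)
    assume "d \<noteq> 0"
    have e: "sgn d * c2 * (w1 * X n - c1 * Y n) + (- sgn d * c1) * (w2 * X n - c2 * Y n) = \<bar>d\<bar> * X n" for n
    proof -
      have "sgn d * c2 * (w1 * X n - c1 * Y n) + (- sgn d * c1) * (w2 * X n - c2 * Y n) = (sgn d * d) * X n"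
        by (simp add: d_def algebra_simps)
      then show ?thesis by (simp add: abs_sgn mult.commute)
    qed
    have "convergent (\<lambda>n. \<bar>d\<bar> * X n)" using c[of "sgn d * c2" "- sgn d * c1"] unfolding e .
    from unb[OF this _, of "\<bar>d\<bar>"] show False using \<open>d \<noteq> 0\<close> by simp
  qed
  moreover have "w1 * c1 + w2 * c2 > 0"
  proof (rule ccontr)
    assume neg: "\<not> ?thesis"
    have ww: "w1 * w1 + w2 * w2 > 0" using w by (simp add: sum_squares_gt_zero_iff)
    have "\<forall>\<^sub>F n in sequentially. w1 * (w1 * X n - c1 * Y n) + w2 * (w2 * X n - c2 * Y n) \<le> (w1 * w1 + w2 * w2) * X n"
      using Y
    proof eventually_elim
      case (elim n)
      have "0 \<le> (w1 * c1 + w2 * c2) * Y n" using neg elim by (intro mult_nonpos_nonpos) auto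
      then show ?case by (simp add: algebra_simps)
    qed
    from unb[OF c this ww] show False .
  qed
  ultimately show ?thesis by (simp add: d_def)
qed

context horn_nd
begin

lemma tendsto_lf:
  assumes "(f \<longlongrightarrow> l) F" shows "((\<lambda>n. lf i (f n)) \<longlongrightarrow> lf i l) F"
  unfolding lf_def by (intro tendsto_intros tendsto_vec_nth assms)

lemma lf_parallel:
  assumes "j \<in> lin i"
  shows "of_int (b1 i) * lf j x = of_int (b1 j) * lf i x" "of_int (b2 i) * lf j x = of_int (b2 j) * lf i x"
proof -
  have e: "of_int (b1 i) * of_int (b2 j) = (of_int (b2 i) * of_int (b1 j) :: complex)"
    using line_parallel[OF assms] by (metis of_int_mult)
  have "of_int (b1 i) * lf j x = of_int (b1 j) * (of_int (b1 i) * x$1) + (of_int (b1 i) * of_int (b2 j)) * x$2"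
    by (simp add: lf_def algebra_simps)
  then show "of_int (b1 i) * lf j x = of_int (b1 j) * lf i x" unfolding e by (simp add: lf_def algebra_simps)
  have "of_int (b2 i) * lf j x = (of_int (b2 i) * of_int (b1 j)) * x$1 + of_int (b2 j) * (of_int (b2 i) * x$2)"
    by (simp add: lf_def algebra_simps)
  then show "of_int (b2 i) * lf j x = of_int (b2 j) * lf i x" unfolding e[symmetric] by (simp add: lf_def algebra_simps)
qed

lemma ln_lf_parallel:
  assumes "j \<in> lin i"
  shows "\<exists>c. \<forall>x\<in>good. ln (cmod (lf j x)) - ln (cmod (lf i x)) = c"
proof -
  have "\<exists>q. \<forall>x. lf j x = q * lf i x"
  proof (cases "b1 i = 0")
    case True
    then have nz: "of_int (b2 i) \<noteq> (0::complex)" using row_nz[of i] by simp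
    have "lf j x = of_int (b2 j) / of_int (b2 i) * lf i x" for x
      using lf_parallel(2)[OF assms, of x] nz by (simp add: field_simps)
    then show ?thesis by blast
  next
    case False
    then have nz: "of_int (b1 i) \<noteq> (0::complex)" by simp
    have "lf j x = of_int (b1 j) / of_int (b1 i) * lf i x" for x
      using lf_parallel(1)[OF assms, of x] nz by (simp add: field_simps)
    then show ?thesis by blast
  qed
  then obtain q where q: "\<forall>x. lf j x = q * lf i x" by (rule exE)
  have "ln (cmod (lf j x)) - ln (cmod (lf i x)) = ln (cmod q)" if "x \<in> good" for x
  proof -
    have "lf i x \<noteq> 0" "q * lf i x \<noteq> 0" using goodD[OF that, of i] goodD[OF that, of j] q by auto
    then have "ln (cmod (q * lf i x)) = ln (cmod q) + ln (cmod (lf i x))"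
      by (simp add: norm_mult ln_mult)
    then show ?thesis using spec[OF q, of x] by simp
  qed
  then show ?thesis by blast
qed

lemma common_zero_line:
  assumes l: "l$1 \<noteq> 0 \<or> l$2 \<noteq> 0" and i: "lf i l = 0"
  shows "{j. lf j l = 0} = lin i"
proof (intro set_eqI iffI)
  fix j assume "j \<in> {j. lf j l = 0}"
  then have j: "lf j l = 0" by simp
  have "of_int (b1 i * b2 j - b2 i * b1 j) * l$1 = of_int (b2 j) * lf i l - of_int (b2 i) * lf j l"
    "of_int (b1 i * b2 j - b2 i * b1 j) * l$2 = of_int (b1 i) * lf j l - of_int (b1 j) * lf i l"
    by (simp_all add: lf_def algebra_simps)
  then have "of_int (b1 i * b2 j - b2 i * b1 j) * l$1 = 0" "of_int (b1 i * b2 j - b2 i * b1 j) * l$2 = 0"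
    unfolding i j by simp_all
  then have "of_int (b1 i * b2 j - b2 i * b1 j) = (0::complex)" using l by (metis mult_eq_0_iff)
  then show "j \<in> lin i" unfolding of_int_eq_0_iff by (simp add: lin_def)
next
  fix j assume j: "j \<in> lin i"
  have "of_int (b1 i) * lf j l = 0" "of_int (b2 i) * lf j l = 0" using lf_parallel[OF j, of l] i by simp_all
  then show "j \<in> {j. lf j l = 0}" using row_nz[of i] by auto
qed

lemma ln_psi:
  assumes "l \<in> good"
  shows "ln (cmod (psi1 l)) = (\<Sum>i\<in>UNIV. of_int (b1 i) * ln (cmod (lf i l)))"
    and "ln (cmod (psi2 l)) = (\<Sum>i\<in>UNIV. of_int (b2 i) * ln (cmod (lf i l)))"
proof -
  have "ln (cmod (\<Prod>i\<in>UNIV. lf i l powi e i)) = (\<Sum>i\<in>UNIV. of_int (e i) * ln (cmod (lf i l)))" for e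
    unfolding prod_norm[symmetric] using goodD[OF assms]
    by (subst ln_prod) (simp_all add: norm_power_int ln_power_int)
  then show "ln (cmod (psi1 l)) = (\<Sum>i\<in>UNIV. of_int (b1 i) * ln (cmod (lf i l)))"
    "ln (cmod (psi2 l)) = (\<Sum>i\<in>UNIV. of_int (b2 i) * ln (cmod (lf i l)))"
    by (simp_all add: psi1_def psi2_def)
qed

text \<open>A nonzero root of an edge polynomial yields points of the curve escaping to infinity in the
  direction \<open>w\<close>; by compactness their parameters accumulate at a zero of the linear forms of one
  line, whose row sum has to point in the same direction.\<close>

lemma edge_direction:
  assumes w: "w1 \<noteq> 0 \<or> w2 \<noteq> 0" and k: "k \<in> supp2 P0" "k' \<in> supp2 P0" "k \<noteq> k'"
    "wt w1 w2 k = hmin w1 w2 P0" "wt w1 w2 k' = hmin w1 w2 P0"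
  shows "\<exists>L\<in>lines. w1 * (\<Sum>j\<in>L. b2 j) = w2 * (\<Sum>j\<in>L. b1 j) \<and> w1 * (\<Sum>j\<in>L. b1 j) + w2 * (\<Sum>j\<in>L. b2 j) > 0"
proof -
  define F where "F \<tau> z = poly (Fpoly w1 w2 P0 z) \<tau>" for \<tau> z
  obtain z0 where z0: "z0 \<noteq> 0 \<and> face w1 w2 P0 (hmin w1 w2 P0) z0 = 0"
    using face_zero_exists[OF w k] by (rule exE)
  have "hmin w1 w2 P0 \<in> wt w1 w2 ` supp2 P0" using hmin_in[OF P0_nz, of w1 w2] by force
  from finite_face_zeros[OF w this] have "finite {z. z \<noteq> 0 \<and> face w1 w2 P0 (hmin w1 w2 P0) z = 0}" .
  from ex_nonzero_avoiding[OF this] obtain z1 where z1: "z1 \<noteq> 0 \<and> z1 \<notin> {z. z \<noteq> 0 \<and> face w1 w2 P0 (hmin w1 w2 P0) z = 0}"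
    by (rule exE)
  have z1': "z1 \<noteq> 0" "face w1 w2 P0 (hmin w1 w2 P0) z1 \<noteq> 0" using z1 conjunct1[OF z1] by simp_all
  have Fz: "F 0 z = face w1 w2 P0 (hmin w1 w2 P0) z" for z
    by (simp add: F_def poly_0_coeff_0 coeff_Fpoly)
  \<comment> \<open>At \<open>\<tau>\<close> = 0 the restricted polynomial is the edge polynomial;
    its root \<open>z0\<close> persists for small \<open>\<tau>\<close>.\<close>
  have near: "\<exists>d>0. \<forall>\<tau>\<in>UNIV. dist \<tau> 0 < d \<longrightarrow> (\<exists>z\<in>- {0}. dist z z0 < e \<and> F \<tau> z = 0)" if "e > 0" for e
  proof (rule root_near)
    show "continuous_on (UNIV \<times> - {0}) (\<lambda>p. F (fst p) (snd p))"
      unfolding F_def poly_Fpoly by (intro continuous_intros) auto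
    show "F x holomorphic_on - {0}" for x
      unfolding F_def[abs_def] poly_Fpoly by (intro holomorphic_intros) auto
    show "connected (- {0::complex})" by (rule connected_punctured_universe) simp
    show "F 0 z0 = 0" "F 0 z1 \<noteq> 0" using z0 z1' by (simp_all add: Fz)
  qed (use z0 z1' that in auto)
  have ww: "w1 * w1 + w2 * w2 > 0" using w by (simp add: sum_squares_gt_zero_iff)
  \<comment> \<open>This functional is bounded below on the finite set \<open>Bad\<close>. On the
    constructed points the share of z cancels and it equals \<open>W\<close> ln
    |\<open>\<tau>\<close>|, so a small \<open>\<tau>\<close> avoids \<open>Bad\<close>.\<close>
  define ff where "ff y = of_int w1 * ln (cmod (fst y)) + of_int w2 * ln (cmod (snd y))" for y :: "complex \<times> complex"
  define M where "M = Min (insert 0 (ff ` Bad))"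
  have M: "M \<le> ff y" if "y \<in> Bad" for y unfolding M_def using that finite_Bad by (intro Min_le) auto
  define W where "W = real_of_int (w1 * w1 + w2 * w2)"
  have W: "W > 0" using ww by (simp only: W_def of_int_0_less_iff)
  have "\<exists>\<tau> z. \<tau> \<noteq> 0 \<and> z \<noteq> 0 \<and> cmod \<tau> < 1 / real (Suc n) \<and> dist z z0 < 1 / real (Suc n) \<and> F \<tau> z = 0 \<and> W * ln (cmod \<tau>) < M" for n
  proof -
    obtain d where d: "d > 0 \<and> (\<forall>\<tau>\<in>UNIV. dist \<tau> 0 < d \<longrightarrow> (\<exists>z\<in>- {0}. dist z z0 < 1 / real (Suc n) \<and> F \<tau> z = 0))"
      using near[of "1 / real (Suc n)"] by auto
    define m where "m = min (min d (1 / real (Suc n))) (exp (M / W))"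
    have m: "m > 0" "m \<le> d" "m \<le> 1 / real (Suc n)" "m \<le> exp (M / W)"
      using d by (simp_all add: m_def min_le_iff_disj)
    define t where "t = m / 2"
    have t: "t > 0" "t < d" "t < 1 / real (Suc n)" "t < exp (M / W)" using m by (simp_all only: t_def)
    define \<tau> where "\<tau> = complex_of_real t"
    have n\<tau>: "cmod \<tau> = t" using t by (simp add: \<tau>_def)
    then have "\<exists>z\<in>- {0}. dist z z0 < 1 / real (Suc n) \<and> F \<tau> z = 0" using d t by simp
    then obtain z where z: "z \<noteq> 0" "dist z z0 < 1 / real (Suc n)" "F \<tau> z = 0" by auto
    have "ln t < M / W" using t by (metis exp_gt_zero ln_exp ln_less_cancel_iff)
    then have "W * ln t < M" using W by (simp add: field_simps)
    then show ?thesis using t z n\<tau> by (intro exI[of _ \<tau>] exI[of _ z]) auto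
  qed
  then obtain \<tau> z where tz: "\<And>n. \<tau> n \<noteq> 0 \<and> z n \<noteq> 0 \<and> cmod (\<tau> n) < 1 / real (Suc n) \<and> dist (z n) z0 < 1 / real (Suc n) \<and>
      F (\<tau> n) (z n) = 0 \<and> W * ln (cmod (\<tau> n)) < M"
    by metis
  define X Z where "X n = ln (cmod (\<tau> n))" and "Z n = ln (cmod (z n))" for n
  have inv0: "(\<lambda>n. 1 / real (Suc n)) \<longlonglongrightarrow> 0" using LIMSEQ_inverse_real_of_nat by (simp add: inverse_eq_divide)
  have "(\<lambda>n. cmod (\<tau> n)) \<longlonglongrightarrow> 0"
    by (rule tendsto_sandwich[OF _ _ tendsto_const inv0]) (use tz in \<open>auto intro!: always_eventually less_imp_le\<close>)
  then have "filterlim (\<lambda>n. cmod (\<tau> n)) (at_right 0) sequentially"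
    by (rule tendsto_imp_filterlim_at_right) (use tz in auto)
  then have X: "filterlim X at_bot sequentially"
    unfolding X_def[abs_def] by (rule filterlim_compose[OF ln_at_0])
  have "(\<lambda>n. dist (z n) z0) \<longlonglongrightarrow> 0"
    by (rule tendsto_sandwich[OF _ _ tendsto_const inv0]) (use tz in \<open>auto intro!: always_eventually less_imp_le\<close>)
  then have "z \<longlonglongrightarrow> z0" by (simp only: tendsto_dist_iff[symmetric])
  then have Zlim: "Z \<longlonglongrightarrow> ln (cmod z0)"
    unfolding Z_def[abs_def] using z0 by (intro tendsto_ln tendsto_norm) auto
  define y1 y2 where "y1 n = cu1 w1 w2 (z n) (\<tau> n)" and "y2 n = cu2 w1 w2 (z n) (\<tau> n)" for n
  have lny: "ln (cmod (y1 n)) = of_int w2 * Z n + of_int w1 * X n" "ln (cmod (y2 n)) = - of_int w1 * Z n + of_int w2 * X n" for n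
    using tz[of n] unfolding y1_def y2_def cu1_def cu2_def X_def Z_def
    by (simp_all add: norm_mult norm_power_int ln_mult ln_power_int del: power_int_minus)
  have curve: "eval2 P0 (y1 n) (y2 n) = 0" for n
    using eval2_curve[of "z n" "\<tau> n" P0 w1 w2] tz[of n] by (simp add: y1_def y2_def F_def)
  have "ff (y1 n, y2 n) = W * X n" for n
    by (simp add: ff_def lny W_def algebra_simps)
  then have nB: "(y1 n, y2 n) \<notin> Bad" for n
    using M[of "(y1 n, y2 n)"] tz[of n] by (auto simp: X_def)
  define v where "v n = vec2 (gr1 (y1 n) (y2 n)) (gr2 (y1 n) (y2 n))" for n
  have vg: "v n \<in> good" for n unfolding v_def by (rule not_Bad_good[OF curve nB])
  have vp: "psi1 (v n) = y1 n" "psi2 (v n) = y2 n" for n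
    unfolding v_def using log_gauss_inverse[OF curve vg[unfolded v_def]] by blast+
  \<comment> \<open>By homogeneity the parameters can be taken on the compact unit sphere.\<close>
  define u where "u n = (1 / norm (v n)) *\<^sub>R v n" for n
  have vnz: "norm (v n) \<noteq> 0" for n using good_nonzero[OF vg, of n] by auto
  have us: "u n = complex_of_real (1 / norm (v n)) *s v n" for n
    unfolding u_def vec_eq_iff by (simp add: scaleR_conv_of_real[where 'a = complex])
  have ug: "u n \<in> good" for n using goodD[OF vg, of _ n] vnz[of n] unfolding us good_def by (simp add: lf_smult)
  have up: "psi1 (u n) = y1 n" "psi2 (u n) = y2 n" for n
    unfolding us using vnz[of n] by (simp_all add: psi_smult vp)
  have "\<forall>n. u n \<in> sphere 0 1" using vnz by (simp add: u_def)
  then obtain l r where l: "l \<in> sphere 0 1" and r: "strict_mono r" "(u \<circ> r) \<longlonglongrightarrow> l"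
    using compact_sphere[of "0 :: complex^2" 1] unfolding compact_def by metis
  have lnz: "l$1 \<noteq> 0 \<or> l$2 \<noteq> 0"
  proof (rule ccontr)
    assume "\<not> ?thesis"
    then have "l = 0" by (intro vec2_eqI) simp_all
    then show False using l by simp
  qed
  define Ls where "Ls = {i. lf i l = 0}"
  define i0 where "i0 = (SOME i. i \<in> Ls)"
  \<comment> \<open>The common logarithmic rate at which the forms vanishing at the limit tend to 0.
    The value 0 when there are none lets both cases run together.\<close>
  define Y where "Y n = (if Ls = {} then 0 else ln (cmod (lf i0 (u (r n)))))" for n
  have i0: "i0 \<in> Ls" if "Ls \<noteq> {}" using that unfolding i0_def by (metis some_in_eq)
  have Lline: "Ls = lin i0" if "Ls \<noteq> {}"
    using common_zero_line[OF lnz, of i0] i0[OF that] by (simp add: Ls_def)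
  have lim: "(\<lambda>n. lf i (u (r n))) \<longlonglongrightarrow> lf i l" for i using tendsto_lf[OF r(2)] by (simp add: o_def)
  have Yneg: "\<forall>\<^sub>F n in sequentially. Y n \<le> 0"
  proof (cases "Ls = {}")
    case False
    have "lf i0 l = 0" using i0[OF False] by (simp add: Ls_def)
    then have "(\<lambda>n. cmod (lf i0 (u (r n)))) \<longlonglongrightarrow> 0" using tendsto_norm[OF lim[of i0]] by simp
    then have "\<forall>\<^sub>F n in sequentially. cmod (lf i0 (u (r n))) < 1" by (rule order_tendstoD) simp
    then show ?thesis
    proof eventually_elim
      case (elim n)
      have "cmod (lf i0 (u (r n))) > 0" using goodD[OF ug] by simp
      then show ?case using elim by (simp add: Y_def)
    qed
  qed (simp add: Y_def)
  have trm: "convergent (\<lambda>n. ln (cmod (lf i (u (r n)))) - (if i \<in> Ls then Y n else 0))" for i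
  proof (cases "i \<in> Ls")
    case True
    then have ne: "Ls \<noteq> {}" by auto
    have "i \<in> lin i0" using True Lline[OF ne] by simp
    from ln_lf_parallel[OF this] obtain c where "\<forall>x\<in>good. ln (cmod (lf i x)) - ln (cmod (lf i0 x)) = c" by (rule exE)
    then have "ln (cmod (lf i (u (r n)))) - (if i \<in> Ls then Y n else 0) = c" for n
      using ug[of "r n"] True ne by (simp add: Y_def)
    then show ?thesis by (simp add: convergent_const)
  next
    case False
    then have "(\<lambda>n. ln (cmod (lf i (u (r n))))) \<longlonglongrightarrow> ln (cmod (lf i l))"
      by (intro tendsto_ln tendsto_norm lim) (simp add: Ls_def)
    then show ?thesis using False by (auto simp: convergent_def)
  qed
  \<comment> \<open>Forms that do not vanish at \<open>l\<close> have convergent logarithms; the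
    others differ from \<open>Y\<close> by constants, since they belong to one line.\<close>
  have conv: "convergent (\<lambda>n. (\<Sum>i\<in>UNIV. of_int (e i) * ln (cmod (lf i (u (r n))))) - of_int (\<Sum>i\<in>Ls. e i) * Y n)" for e :: "'n \<Rightarrow> int"
  proof -
    have "(\<Sum>i\<in>UNIV. of_int (e i) * ln (cmod (lf i (u (r n))))) - of_int (\<Sum>i\<in>Ls. e i) * Y n =
        (\<Sum>i\<in>UNIV. of_int (e i) * (ln (cmod (lf i (u (r n)))) - (if i \<in> Ls then Y n else 0)))" for n
    proof -
      have "of_int (\<Sum>i\<in>Ls. e i) * Y n = (\<Sum>i\<in>UNIV. of_int (e i) * (if i \<in> Ls then Y n else 0))"
        by (simp add: sum_distrib_right sum.If_cases if_distrib[of "(*) _"] cong: if_cong)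
      then show ?thesis by (simp add: right_diff_distrib sum_subtractf)
    qed
    moreover have "convergent (\<lambda>n. \<Sum>i\<in>UNIV. of_int (e i) * (ln (cmod (lf i (u (r n)))) - (if i \<in> Ls then Y n else 0)))"
      by (intro convergent_sum convergent_mult convergent_const trm)
    ultimately show ?thesis by simp
  qed
  have Zc: "convergent (\<lambda>n. Z (r n))" using LIMSEQ_subseq_LIMSEQ[OF Zlim r(1)] by (auto simp: convergent_def o_def)
  have Xr: "filterlim (\<lambda>n. X (r n)) at_bot sequentially"
    using filterlim_compose[OF X filterlim_subseq[OF r(1)]] .
  define c1 c2 where "c1 = (\<Sum>i\<in>Ls. b1 i)" and "c2 = (\<Sum>i\<in>Ls. b2 i)"
  \<comment> \<open>The logarithms of z converge to that of \<open>z0\<close> and can be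
    subtracted.\<close>
  have "convergent (\<lambda>n. (of_int w2 * Z (r n) + of_int w1 * X (r n) - of_int c1 * Y n) - of_int w2 * Z (r n))"
    using conv[of b1] unfolding ln_psi(1)[OF ug, symmetric] up lny c1_def[symmetric]
    by (rule convergent_diff[OF _ convergent_mult[OF convergent_const Zc]])
  then have C1: "convergent (\<lambda>n. of_int w1 * X (r n) - of_int c1 * Y n)" by (simp add: algebra_simps)
  have "convergent (\<lambda>n. (- of_int w1 * Z (r n) + of_int w2 * X (r n) - of_int c2 * Y n) - (- of_int w1) * Z (r n))"
    using conv[of b2] unfolding ln_psi(2)[OF ug, symmetric] up lny c2_def[symmetric]
    by (rule convergent_diff[OF _ convergent_mult[OF convergent_const Zc]])
  then have C2: "convergent (\<lambda>n. of_int w2 * X (r n) - of_int c2 * Y n)" by (simp add: algebra_simps)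
  have wr: "real_of_int w1 \<noteq> 0 \<or> real_of_int w2 \<noteq> 0" using w by simp
  from parallel_of_divergence[OF Xr Yneg C1 C2 wr]
  have "of_int (w1 * c2) = (of_int (w2 * c1) :: real) \<and> (of_int (w1 * c1 + w2 * c2) :: real) > 0" by simp
  then have res: "w1 * c2 = w2 * c1 \<and> w1 * c1 + w2 * c2 > 0" by (simp only: of_int_eq_iff of_int_0_less_iff)
  have "Ls \<noteq> {}"
  proof
    assume "Ls = {}"
    then have "c1 = 0" "c2 = 0" by (simp_all add: c1_def c2_def)
    then show False using res by simp
  qed
  then have "Ls \<in> lines" using Lline by (simp add: lines_def)
  then show ?thesis using res by (intro bexI[of _ Ls]) (simp_all add: c1_def c2_def)
qed

end

section \<open>The Newton polygon of the implicit equation\<close>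

definition edge_list :: "int^2^'n::finite \<Rightarrow> complex list" where
  "edge_list B = (SOME es. mset es = QB_edges B \<and> sorted (map Arg es))"

lemma edge_list: "mset (edge_list B) = QB_edges B" "sorted (map Arg (edge_list B))"
proof -
  obtain xs where "mset xs = QB_edges B" using ex_mset by blast
  then have "mset (sort_key Arg xs) = QB_edges B \<and> sorted (map Arg (sort_key Arg xs))" by simp
  then have "\<exists>es. mset es = QB_edges B \<and> sorted (map Arg es)" by blast
  from someI_ex[OF this] show "mset (edge_list B) = QB_edges B" "sorted (map Arg (edge_list B))"
    unfolding edge_list_def by blast+
qed

locale horn_matrix = horn b1 b2 for b1 b2 :: "'n::finite \<Rightarrow> int" +
  fixes B :: "int^2^'n"
  assumes B1: "b1 = (\<lambda>i. B$i$1)" and B2: "b2 = (\<lambda>i. B$i$2)"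
begin

lemma row_c: "row_c B i = Complex (of_int (b1 i)) (of_int (b2 i))"
  by (simp add: row_c_def B1 B2)

lemma row_c_nz: "row_c B i \<noteq> 0"
  using row_nz[of i] by (simp add: row_c complex_eq_iff)

lemma det2_row: "det2 (row_c B i) (row_c B j) = 0 \<longleftrightarrow> j \<in> lin i"
proof -
  have "det2 (row_c B i) (row_c B j) = of_int (b1 i * b2 j - b2 i * b1 j)"
    by (simp add: det2_def row_c)
  then show ?thesis unfolding lin_def by (simp only: of_int_eq_0_iff) simp
qed

lemma lin_set: "{j. det2 (row_c B i) (row_c B j) = 0} = lin i"
  unfolding det2_row by simp

definition opp :: "'n set \<Rightarrow> bool" where
  "opp L \<longleftrightarrow> (\<exists>r\<in>L. \<exists>s\<in>L. \<exists>c::real. c > 0 \<and> row_c B s = - (of_real c * row_c B r))"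

lemma on_rel: "on_relevant_line B i \<longleftrightarrow> opp (lin i)"
  unfolding on_relevant_line_def opp_def det2_row using row_c_nz by blast

lemma relevant_lines: "relevant_lines B = {L\<in>lines. opp L}"
  unfolding relevant_lines_def lin_set on_rel lines_def by blast

definition rsum :: "'n set \<Rightarrow> complex" where "rsum L = (\<Sum>j\<in>L. row_c B j)"

lemma rsum: "rsum L = Complex (of_int (\<Sum>j\<in>L. b1 j)) (of_int (\<Sum>j\<in>L. b2 j))"
  by (simp add: rsum_def row_c complex_eq_iff)

lemma sum_rsum: "(\<Sum>L\<in>lines. rsum L) = 0"
  unfolding rsum_def sum_lines by (simp add: row_c complex_eq_iff of_int_sum[symmetric] sum1 sum2 del: of_int_sum)

lemma pos_multiple:
  assumes "\<not> opp (lin i)" "j \<in> lin i"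
  shows "\<exists>t::real. t > 0 \<and> row_c B j = of_real t * row_c B i"
proof -
  have par: "real_of_int (b1 i) * of_int (b2 j) = of_int (b2 i) * of_int (b1 j)"
    using assms(2) unfolding lin_def mem_Collect_eq by (metis of_int_mult)
  have "\<exists>t::real. row_c B j = of_real t * row_c B i"
  proof (cases "b1 i = 0")
    case True
    then have "b2 i \<noteq> 0" using row_nz[of i] by simp
    then show ?thesis using par True
      by (intro exI[of _ "of_int (b2 j) / of_int (b2 i)"]) (simp add: row_c complex_eq_iff)
  next
    case False
    then show ?thesis using par
      by (intro exI[of _ "of_int (b1 j) / of_int (b1 i)"]) (simp add: row_c complex_eq_iff field_simps)
  qed
  then obtain t :: real where t: "row_c B j = of_real t * row_c B i" by (rule exE)
  have "t \<noteq> 0" using t row_c_nz[of j] by auto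
  moreover have "\<not> t < 0"
  proof
    assume "t < 0"
    then have "- t > 0 \<and> row_c B j = - (of_real (- t) * row_c B i)" using t by simp
    then have "opp (lin i)" unfolding opp_def using assms(2) self_in_lin[of i] by blast
    then show False using assms(1) by simp
  qed
  ultimately show ?thesis using t by (intro exI[of _ t]) simp
qed

text \<open>On a line without opposite rows all rows are positive multiples of one of them, and a
  positively homogeneous function is additive on a ray.\<close>

lemma sum_non_opp:
  fixes g :: "complex \<Rightarrow> 'b::real_vector"
  assumes g: "\<And>t v. t \<ge> 0 \<Longrightarrow> g (of_real t * v) = t *\<^sub>R g v" and i: "\<not> opp (lin i)"
  shows "(\<Sum>j\<in>lin i. g (row_c B j)) = g (rsum (lin i))"
    and "\<exists>t>0. rsum (lin i) = of_real t * row_c B i"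
proof -
  obtain t :: "'n \<Rightarrow> real" where t: "\<And>j. j \<in> lin i \<Longrightarrow> t j > 0 \<and> row_c B j = of_real (t j) * row_c B i"
    using pos_multiple[OF i] by metis
  have pos: "(\<Sum>j\<in>lin i. t j) > 0" using t self_in_lin[of i] by (intro sum_pos) auto
  have "rsum (lin i) = (\<Sum>j\<in>lin i. of_real (t j) * row_c B i)"
    unfolding rsum_def using t by (intro sum.cong refl) blast
  also have "\<dots> = of_real (\<Sum>j\<in>lin i. t j) * row_c B i" by (simp add: sum_distrib_right)
  finally have r: "rsum (lin i) = of_real (\<Sum>j\<in>lin i. t j) * row_c B i" .
  then show "\<exists>t>0. rsum (lin i) = of_real t * row_c B i" using pos by blast
  have "(\<Sum>j\<in>lin i. g (row_c B j)) = (\<Sum>j\<in>lin i. t j *\<^sub>R g (row_c B i))"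
  proof (intro sum.cong refl)
    fix j assume j: "j \<in> lin i"
    have "g (row_c B j) = g (of_real (t j) * row_c B i)" using t[OF j] by simp
    also have "\<dots> = t j *\<^sub>R g (row_c B i)" using t[OF j] by (intro g) simp
    finally show "g (row_c B j) = t j *\<^sub>R g (row_c B i)" .
  qed
  also have "\<dots> = (\<Sum>j\<in>lin i. t j) *\<^sub>R g (row_c B i)" by (simp add: scaleR_left.sum)
  also have "\<dots> = g (rsum (lin i))" unfolding r using pos by (intro g[symmetric]) simp
  finally show "(\<Sum>j\<in>lin i. g (row_c B j)) = g (rsum (lin i))" .
qed

text \<open>The rows of a line that is not relevant stay separate edges of \<open>Q_B\<close>. For
  positively homogeneous functions this is the same as the single edge given by their sum, so all
  lines can be treated alike.\<close>

lemma sum_edges: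
  fixes g :: "complex \<Rightarrow> 'b::real_vector"
  assumes g: "\<And>t v. t \<ge> 0 \<Longrightarrow> g (of_real t * v) = t *\<^sub>R g v"
  shows "(\<Sum>e\<leftarrow>edge_list B. g e) = (\<Sum>L\<in>lines. g (rsum L))"
proof -
  have g0: "g 0 = 0" using g[of 0 0] by simp
  have filt: "sum_mset (image_mset g (filter_mset (\<lambda>v. v \<noteq> 0) M)) = sum_mset (image_mset g M)" for M
    by (induction M) (auto simp: g0)
  have "(\<Sum>e\<leftarrow>edge_list B. g e) = sum_mset (image_mset g (QB_edges B))"
    by (simp add: edge_list(1)[symmetric] sum_mset_sum_list[symmetric])
  also have "\<dots> = (\<Sum>L\<in>relevant_lines B. g (rsum L)) + (\<Sum>i\<in>{i. \<not> on_relevant_line B i}. g (row_c B i))"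
    unfolding QB_edges_def image_mset_union sum_mset.union filt
    by (simp add: sum_unfold_sum_mset image_mset.compositionality o_def rsum_def)
  also have "(\<Sum>L\<in>relevant_lines B. g (rsum L)) = (\<Sum>L\<in>lines. if opp L then g (rsum L) else 0)"
    unfolding relevant_lines by (rule sum.inter_filter) simp
  also have "(\<Sum>i\<in>{i. \<not> on_relevant_line B i}. g (row_c B i)) = (\<Sum>i\<in>UNIV. if \<not> opp (lin i) then g (row_c B i) else 0)"
    using sum.inter_filter[of UNIV "\<lambda>i. g (row_c B i)" "\<lambda>i. \<not> opp (lin i)"] by (simp add: on_rel)
  also have "\<dots> = (\<Sum>L\<in>lines. \<Sum>i\<in>L. if \<not> opp (lin i) then g (row_c B i) else 0)" by (rule sum_lines[symmetric])
  also have "\<dots> = (\<Sum>L\<in>lines. if opp L then 0 else g (rsum L))"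
  proof (rule sum.cong[OF refl])
    fix L assume "L \<in> lines"
    then obtain i where L: "L = lin i" unfolding lines_def by blast
    have "(\<Sum>j\<in>L. if \<not> opp (lin j) then g (row_c B j) else 0) = (\<Sum>j\<in>L. if \<not> opp L then g (row_c B j) else 0)"
      unfolding L by (rule sum.cong[OF refl]) (simp add: lin_eq)
    then show "(\<Sum>j\<in>L. if \<not> opp (lin j) then g (row_c B j) else 0) = (if opp L then 0 else g (rsum L))"
      using sum_non_opp(1)[of g i, OF g] by (cases "opp L") (simp_all add: L)
  qed
  also have "(\<Sum>L\<in>lines. if opp L then g (rsum L) else 0) + (\<Sum>L\<in>lines. if opp L then 0 else g (rsum L)) = (\<Sum>L\<in>lines. g (rsum L))"
    unfolding sum.distrib[symmetric] by (intro sum.cong refl) simp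
  finally show ?thesis .
qed

lemma set_edge_list:
  "set (edge_list B) = {rsum L | L. L \<in> lines \<and> opp L \<and> rsum L \<noteq> 0} \<union> {row_c B i | i. \<not> opp (lin i)}"
proof -
  have fin: "finite {L \<in> lines. opp L}" by simp
  have "set (edge_list B) = set_mset (QB_edges B)" by (simp add: edge_list(1)[symmetric])
  also have "\<dots> = {rsum L | L. L \<in> lines \<and> opp L \<and> rsum L \<noteq> 0} \<union> {row_c B i | i. \<not> opp (lin i)}"
    unfolding QB_edges_def relevant_lines on_rel rsum_def[symmetric]
    using fin by auto
  finally show ?thesis .
qed

sublocale polygon "edge_list B"
proof
  show "sorted (map Arg (edge_list B))" by (rule edge_list(2))
  show "0 \<notin> set (edge_list B)" unfolding set_edge_list using row_c_nz by force
  show "sum_list (edge_list B) = 0"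
    using sum_edges[of "\<lambda>v. v"] sum_rsum by (simp add: scaleR_conv_of_real)
qed

lemma Q_B_eq: "Q_B B = Q"
  unfolding Q_def verts_def unfolding Q_B_def Let_def edge_list_def ..

lemma edge_line:
  assumes "e \<in> set (edge_list B)"
  shows "\<exists>i. det2 (row_c B i) e = 0 \<and> (if opp (lin i) then e = rsum (lin i) else e = row_c B i)"
proof -
  have d: "det2 (row_c B i) (rsum (lin i)) = 0" for i
    unfolding rsum_def det2_sum by (rule sum.neutral) (simp add: det2_row)
  consider L where "L \<in> lines" "opp L" "e = rsum L" | i where "\<not> opp (lin i)" "e = row_c B i"
    using assms unfolding set_edge_list by blast
  then show ?thesis
  proof cases
    case 1
    then obtain i where "L = lin i" unfolding lines_def by blast
    then show ?thesis using 1 d by (intro exI[of _ i]) simp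
  next
    case 2
    then show ?thesis using self_in_lin[of i] by (intro exI[of _ i]) (simp add: det2_row)
  qed
qed

text \<open>Opposite edges would come from one line. A relevant line contributes at most one edge,
  and any other line only rows pointing the same way.\<close>

lemma not_opposite_edges:
  assumes e: "e \<in> set (edge_list B)" "e' \<in> set (edge_list B)"
  shows "Arg e' \<noteq> Arg (- e)"
proof
  assume A: "Arg e' = Arg (- e)"
  have nz: "e \<noteq> 0" "e' \<noteq> 0" using e nz_es by auto
  define t where "t = cmod e' / cmod e"
  have t: "t > 0" using nz by (simp add: t_def)
  have "e' = of_real (cmod e') * cis (Arg e')" using nz by (metis rcis_cmod_Arg rcis_def)
  moreover have "- e = of_real (cmod e) * cis (Arg (- e))" using rcis_cmod_Arg[of "- e"] unfolding rcis_def by simp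
  ultimately have et: "e' = - (of_real t * e)"
  proof -
    assume 1: "e' = of_real (cmod e') * cis (Arg e')" and 2: "- e = of_real (cmod e) * cis (Arg (- e))"
    have "of_real t * (- e) = of_real t * (of_real (cmod e) * cis (Arg e'))" using 2 A by simp
    also have "\<dots> = of_real (cmod e') * cis (Arg e')" using nz by (simp add: t_def)
    finally show ?thesis using 1 by simp
  qed
  obtain i where i: "det2 (row_c B i) e = 0 \<and> (if opp (lin i) then e = rsum (lin i) else e = row_c B i)"
    using edge_line[OF e(1)] by (rule exE)
  obtain j where j: "det2 (row_c B j) e' = 0 \<and> (if opp (lin j) then e' = rsum (lin j) else e' = row_c B j)"
    using edge_line[OF e(2)] by (rule exE)
  have "det2 (row_c B j) e' = - t * det2 (row_c B j) e" unfolding et by (simp add: det2_def algebra_simps)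
  then have je: "det2 (row_c B j) e = 0" using j t by simp
  have "det2 (row_c B i) (row_c B j) = 0"
  proof -
    define a b c d x y where "a = Re (row_c B i)" and "b = Im (row_c B i)" and "c = Re (row_c B j)" and "d = Im (row_c B j)"
      and "x = Re e" and "y = Im e"
    have 1: "a * y = b * x" "c * y = d * x" using i je by (simp_all add: det2_def a_def b_def c_def d_def x_def y_def)
    have "(a * d - b * c) * x = a * (d * x) - (b * x) * c" by (simp add: algebra_simps)
    also have "\<dots> = 0" unfolding 1[symmetric] by simp
    finally have x: "(a * d - b * c) * x = 0" .
    have "(a * d - b * c) * y = (a * y) * d - b * (c * y)" by (simp add: algebra_simps)
    also have "\<dots> = 0" unfolding 1 by simp
    finally have y: "(a * d - b * c) * y = 0" .
    have "x \<noteq> 0 \<or> y \<noteq> 0" using nz by (simp add: x_def y_def complex_eq_iff)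
    then have "a * d - b * c = 0" using x y by (metis mult_eq_0_iff)
    then show ?thesis by (simp add: det2_def a_def b_def c_def d_def)
  qed
  then have "j \<in> lin i" by (simp add: det2_row)
  then have ji: "lin j = lin i" by (rule lin_eq)
  show False
  proof (cases "opp (lin i)")
    case True
    then have "e' = e" using i j ji by simp
    have "e = - (of_real t * e)" using et unfolding \<open>e' = e\<close> .
    then have "e - - (of_real t * e) = 0" by (simp only: right_minus_eq)
    then have "of_real (1 + t) * e = 0" by (simp add: algebra_simps)
    then have "complex_of_real (1 + t) = 0" using nz by (metis mult_eq_0_iff)
    then show False using t by (metis add_pos_pos less_irrefl of_real_eq_0_iff zero_less_one)
  next
    case False
    then have "row_c B j = - (of_real t * row_c B i)" using i j ji et by simp
    then have "opp (lin i)" unfolding opp_def using t \<open>j \<in> lin i\<close> self_in_lin[of i] by blast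
    then show False using False by simp
  qed
qed

lemma ex_edge_Arg:
  assumes "L \<in> lines" "rsum L \<noteq> 0" shows "\<exists>e\<in>set (edge_list B). Arg e = Arg (rsum L)"
proof (cases "opp L")
  case True
  then show ?thesis using assms unfolding set_edge_list by blast
next
  case False
  obtain i where i: "L = lin i" using assms(1) unfolding lines_def by blast
  obtain t where t: "t > 0 \<and> rsum (lin i) = of_real t * row_c B i"
    using sum_non_opp(2)[of "\<lambda>v. v" i] False i by (auto simp: scaleR_conv_of_real)
  then have "Arg (row_c B i) = Arg (rsum L)" unfolding i by simp
  moreover have "row_c B i \<in> set (edge_list B)" using False unfolding i set_edge_list by blast
  ultimately show ?thesis by blast
qed

end

lemma continuous_on_Max_inner:
  fixes K :: "complex set"
  assumes "finite K" "K \<noteq> {}"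
  shows "continuous_on UNIV (\<lambda>c. Max (inner c ` K))"
  using assms
proof (induction K rule: finite_ne_induct)
  case (singleton x)
  then show ?case by (simp add: continuous_intros)
next
  case (insert x K)
  have eq: "(\<lambda>c. Max (inner c ` insert x K)) = (\<lambda>c. max (inner c x) (Max (inner c ` K)))"
    using insert by (simp add: Max_insert)
  show ?case unfolding eq by (intro continuous_intros insert.IH)
qed

text \<open>Every integer vector is a nonnegative multiple of a primitive one, and multiples of
  integer vectors are dense. This passes from the directions of one-parameter subgroups to all
  directions.\<close>

lemma homogeneous_eq_if_eq_on_coprime:
  fixes f g :: "complex \<Rightarrow> real"
  assumes cont: "continuous_on UNIV f" "continuous_on UNIV g"
    and hom: "\<And>t c. t \<ge> 0 \<Longrightarrow> f (of_real t * c) = t * f c" "\<And>t c. t \<ge> 0 \<Longrightarrow> g (of_real t * c) = t * g c"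
    and eq: "\<And>a b. coprime a b \<Longrightarrow> f (Complex (of_int a) (of_int b)) = g (Complex (of_int a) (of_int b))"
  shows "f c = g c"
proof -
  have int: "f (Complex (of_int a) (of_int b)) = g (Complex (of_int a) (of_int b))" for a b :: int
  proof (cases "a = 0 \<and> b = 0")
    case True
    have z: "Complex 0 0 = 0" by (simp add: complex_eq_iff)
    have "f 0 = 0" "g 0 = 0" using hom(1)[of 0 0] hom(2)[of 0 0] by simp_all
    then show ?thesis using True by (simp add: z)
  next
    case False
    define d where "d = gcd a b"
    obtain a' b' where ab: "a = a' * d" "b = b' * d" "coprime a' b'"
      using gcd_coprime_exists[of a b] False unfolding d_def by auto
    have c: "Complex (of_int a) (of_int b) = of_real (of_int d) * Complex (of_int a') (of_int b')"
      by (simp add: complex_eq_iff ab(1,2) mult.commute)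
    have d0: "real_of_int d \<ge> 0" by (simp add: d_def)
    show ?thesis unfolding c hom(1)[OF d0] hom(2)[OF d0] eq[OF ab(3)] ..
  qed
  define q where "q n = Complex (of_int \<lfloor>real n * Re c\<rfloor>) (of_int \<lfloor>real n * Im c\<rfloor>)" for n
  define p where "p n = of_real (1 / real n) * q n" for n
  have fp: "f (p n) = g (p n)" for n
    unfolding p_def using hom(1)[of "1 / real n" "q n"] hom(2)[of "1 / real n" "q n"] int by (simp add: q_def)
  have fl: "(\<lambda>n. real_of_int \<lfloor>real n * x\<rfloor> / real n) \<longlonglongrightarrow> x" for x :: real
  proof (rule LIMSEQ_I)
    fix r :: real assume r: "r > 0"
    obtain N :: nat where N: "1 / r < real N" using reals_Archimedean2 by blast
    have "norm (real_of_int \<lfloor>real n * x\<rfloor> / real n - x) < r" if "n \<ge> N" for n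
    proof -
      have n: "real n > 1 / r" using N that by (meson less_le_trans of_nat_le_iff)
      then have n0: "real n > 0" using r by (meson less_trans zero_less_divide_1_iff)
      have "\<bar>real_of_int \<lfloor>real n * x\<rfloor> - real n * x\<bar> < 1" by linarith
      then have "\<bar>real_of_int \<lfloor>real n * x\<rfloor> - real n * x\<bar> / real n < 1 / real n" using n0 by (simp add: divide_strict_right_mono)
      moreover have "real_of_int \<lfloor>real n * x\<rfloor> / real n - x = (real_of_int \<lfloor>real n * x\<rfloor> - real n * x) / real n"
        using n0 by (simp add: field_simps)
      moreover have "1 / real n < r" using n n0 r by (simp add: field_simps)
      ultimately show ?thesis using n0 by (simp add: abs_divide)
    qed
    then show "\<exists>no. \<forall>n\<ge>no. norm (real_of_int \<lfloor>real n * x\<rfloor> / real n - x) < r" by blast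
  qed
  have "p \<longlonglongrightarrow> c"
    unfolding tendsto_complex_iff using fl[of "Re c"] fl[of "Im c"] by (simp add: p_def q_def)
  then have "(\<lambda>n. f (p n)) \<longlonglongrightarrow> f c" "(\<lambda>n. g (p n)) \<longlonglongrightarrow> g c"
    using cont by (auto intro: isCont_tendsto_compose simp: continuous_on_eq_continuous_at)
  then show ?thesis unfolding fp using LIMSEQ_unique by blast
qed

locale horn_nd_matrix = horn_nd b1 b2 + horn_matrix b1 b2 B
  for b1 b2 :: "'n::finite \<Rightarrow> int" and B :: "int^2^'n"
begin

definition pt :: "nat \<times> nat \<Rightarrow> complex" where "pt k = Complex (real (fst k)) (real (snd k))"
definition K0 :: "complex set" where "K0 = pt ` supp2 P0"

lemma K0: "finite K0" "K0 \<noteq> {}" using P0_nz by (simp_all add: K0_def)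

lemma inner_pt: "inner (Complex (of_int a) (of_int b)) (pt k) = of_int (wt a b k)"
  by (simp add: inner_complex_def pt_def wt_def)

lemma Min_K0: "Min (inner (Complex (of_int a) (of_int b)) ` K0) = of_int (hmin a b P0)"
proof (rule Min_eqI)
  show "finite (inner (Complex (of_int a) (of_int b)) ` K0)" using K0 by simp
  show "of_int (hmin a b P0) \<le> y" if "y \<in> inner (Complex (of_int a) (of_int b)) ` K0" for y
    using that hmin_le[of _ P0 a b] by (auto simp: K0_def inner_pt)
  obtain k where "k \<in> supp2 P0" "wt a b k = hmin a b P0" using hmin_in[OF P0_nz] by blast
  then show "of_int (hmin a b P0) \<in> inner (Complex (of_int a) (of_int b)) ` K0"
    unfolding K0_def image_image inner_pt by (intro image_eqI[of _ _ k]) simp_all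
qed

lemma Max_K0: "Max (inner (Complex (of_int a) (of_int b)) ` K0) = of_int (hmax a b P0)"
proof (rule Max_eqI)
  show "finite (inner (Complex (of_int a) (of_int b)) ` K0)" using K0 by simp
  show "y \<le> of_int (hmax a b P0)" if "y \<in> inner (Complex (of_int a) (of_int b)) ` K0" for y
    using that hmax_ge[of _ P0 a b] by (auto simp: K0_def inner_pt)
  obtain k where "k \<in> supp2 P0" "wt a b k = hmax a b P0" using hmax_in[OF P0_nz] by blast
  then show "of_int (hmax a b P0) \<in> inner (Complex (of_int a) (of_int b)) ` K0"
    unfolding K0_def image_image inner_pt by (intro image_eqI[of _ _ k]) simp_all
qed

lemma max0_hom: "t \<ge> 0 \<Longrightarrow> max 0 (t * x) = t * max 0 (x :: real)"
  by (simp add: max_def mult_le_0_iff zero_le_mult_iff)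

lemma width_K0: "Max (inner c ` K0) - Min (inner c ` K0) = (\<Sum>e\<leftarrow>edge_list B. max 0 (det2 c e))"
proof -
  have "(\<Sum>e\<leftarrow>edge_list B. max 0 (det2 c e)) = (\<Sum>L\<in>lines. max 0 (det2 c (rsum L)))"
    by (rule sum_edges) (simp add: det2_def max0_hom[symmetric] algebra_simps)
  moreover have "Max (inner c ` K0) - Min (inner c ` K0) = (\<Sum>L\<in>lines. max 0 (det2 c (rsum L)))"
  proof (rule homogeneous_eq_if_eq_on_coprime[where f = "\<lambda>c. Max (inner c ` K0) - Min (inner c ` K0)"])
    have mm: "Min (inner c ` K0) = - Max (inner (- c) ` K0)" for c
    proof -
      have im: "inner (- c) ` K0 = uminus ` (inner c ` K0)" by (simp add: image_image)
      have "- Min (inner c ` K0) = Max (uminus ` (inner c ` K0))"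
        by (rule minus_Min_eq_Max) (use K0 in auto)
      then show ?thesis unfolding im by linarith
    qed
    have "continuous_on UNIV (\<lambda>c. Max (inner (- c) ` K0))"
      using continuous_on_compose2[OF continuous_on_Max_inner[OF K0], of UNIV uminus] by (simp add: continuous_intros)
    then show "continuous_on UNIV (\<lambda>c. Max (inner c ` K0) - Min (inner c ` K0))"
      unfolding mm by (intro continuous_intros continuous_on_Max_inner K0)
    show "continuous_on UNIV (\<lambda>c. \<Sum>L\<in>lines. max 0 (det2 c (rsum L)))"
      unfolding det2_def by (intro continuous_intros)
    have mh: "Max (inner (of_real t * c) ` K0) = t * Max (inner c ` K0)" if "t \<ge> 0" for t c
    proof -
      have "inner (of_real t * c) ` K0 = (\<lambda>x. t * x) ` inner c ` K0"
        unfolding image_image by (intro image_cong refl) (simp add: inner_complex_def algebra_simps)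
      moreover have "mono ((*) t)" using that by (intro monoI mult_left_mono)
      ultimately show ?thesis using mono_Max_commute[of "(*) t" "inner c ` K0"] K0 by simp
    qed
    show "Max (inner (of_real t * c) ` K0) - Min (inner (of_real t * c) ` K0) = t * (Max (inner c ` K0) - Min (inner c ` K0))"
      if "t \<ge> 0" for t c
      unfolding mm using mh[OF that, of c] mh[OF that, of "- c"] by (simp add: algebra_simps)
    show "(\<Sum>L\<in>lines. max 0 (det2 (of_real t * c) (rsum L))) = t * (\<Sum>L\<in>lines. max 0 (det2 c (rsum L)))" if "t \<ge> 0" for t c
      unfolding sum_distrib_left max0_hom[OF that, symmetric]
      by (intro sum.cong refl) (simp add: det2_def algebra_simps)
    fix a b :: int assume ab: "coprime a b"
    have d: "det2 (Complex (of_int a) (of_int b)) (rsum L) = - of_int (\<Sum>j\<in>L. ee a b j)" for L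
      unfolding sum_ee_line by (simp add: det2_def rsum algebra_simps)
    have "(\<Sum>L\<in>lines. max 0 (det2 (Complex (of_int a) (of_int b)) (rsum L))) =
        (\<Sum>L\<in>lines. max 0 (of_int (\<Sum>j\<in>L. ee a b j)) - of_int (\<Sum>j\<in>L. ee a b j))"
      unfolding d by (intro sum.cong refl) (simp add: max_def)
    also have "\<dots> = of_int (\<Sum>L\<in>lines. max 0 (\<Sum>j\<in>L. ee a b j)) - of_int (\<Sum>L\<in>lines. \<Sum>j\<in>L. ee a b j)"
      unfolding sum_subtractf of_int_sum[of _ lines] by (simp add: of_int_max)
    also have "\<dots> = of_int (hmax a b P0 - hmin a b P0)" unfolding sum_lines sum_ee width_P0[OF ab] by simp
    finally show "Max (inner (Complex (of_int a) (of_int b)) ` K0) - Min (inner (Complex (of_int a) (of_int b)) ` K0) =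
        (\<Sum>L\<in>lines. max 0 (det2 (Complex (of_int a) (of_int b)) (rsum L)))"
      unfolding Min_K0 Max_K0 by simp
  qed
  ultimately show ?thesis by simp
qed

text \<open>An edge between lattice points has a rational normal, so \<open>c\<close> is a positive
  multiple of an integer vector (a, b), to which \<open>edge_direction\<close> applies.\<close>

lemma edge_K0:
  assumes c: "c \<noteq> 0" and x: "x \<in> K0" "y \<in> K0" "x \<noteq> y" "inner c x = Min (inner c ` K0)" "inner c y = Min (inner c ` K0)"
  shows "\<exists>e\<in>set (edge_list B). Arg e = Arg c"
proof -
  obtain k k' where k: "k \<in> supp2 P0" "x = pt k" and k': "k' \<in> supp2 P0" "y = pt k'"
    using x(1,2) unfolding K0_def by blast
  define m n where "m = int (fst k) - int (fst k')" and "n = int (snd k) - int (snd k')"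
  have mn: "m \<noteq> 0 \<or> n \<noteq> 0" using x(3) unfolding k k' by (auto simp: m_def n_def pt_def)
  have perp: "Re c * of_int m + Im c * of_int n = 0"
    using x(4,5) unfolding k k' by (simp add: inner_complex_def pt_def m_def n_def algebra_simps)
  define q where "q = real_of_int (m * m + n * n)"
  have q: "q > 0" using mn by (simp only: q_def of_int_0_less_iff sum_squares_gt_zero_iff)
  define t where "t = (Im c * of_int m - Re c * of_int n) / q"
  have tm: "t * of_int m = Im c" "- t * of_int n = Re c"
  proof -
    have "(Im c * of_int m - Re c * of_int n) * of_int m = Im c * q - of_int n * (Re c * of_int m + Im c * of_int n)"
      by (simp add: q_def algebra_simps)
    then show "t * of_int m = Im c" using perp q by (simp add: t_def)
    have e2: "- (Im c * of_int m - Re c * of_int n) * of_int n = Re c * q - of_int m * (Re c * of_int m + Im c * of_int n)"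
      by (simp add: q_def algebra_simps)
    have "- t * of_int n = (- (Im c * of_int m - Re c * of_int n) * of_int n) / q"
    proof -
      have "- (x / q) * y = (- x * y) / q" for x y by simp
      then show ?thesis unfolding t_def .
    qed
    also have "\<dots> = Re c" unfolding e2 perp using q by simp
    finally show "- t * of_int n = Re c" .
  qed
  have t0: "t \<noteq> 0" using c tm by (auto simp: complex_eq_iff)
  \<comment> \<open>The sign orients the integer normal (-n, m) along \<open>c\<close>.\<close>
  define s where "s = (if t > 0 then 1 else - 1 :: int)"
  define a b where "a = - s * n" and "b = s * m"
  have ab: "a \<noteq> 0 \<or> b \<noteq> 0" using mn by (auto simp: a_def b_def s_def)
  have st: "\<bar>t\<bar> * of_int s = t" by (simp add: s_def abs_if)
  have cw: "c = of_real \<bar>t\<bar> * Complex (of_int a) (of_int b)"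
    using tm st by (simp add: complex_eq_iff a_def b_def mult.assoc[symmetric])
  have scal: "inner c z = \<bar>t\<bar> * inner (Complex (of_int a) (of_int b)) z" for z
    unfolding cw by (simp add: inner_complex_def algebra_simps)
  have low: "wt a b j = hmin a b P0" if j: "j \<in> supp2 P0" "inner c (pt j) = Min (inner c ` K0)" for j
  proof -
    obtain i where i: "i \<in> supp2 P0" "wt a b i = hmin a b P0" using hmin_in[OF P0_nz] by blast
    have "inner c (pt j) \<le> inner c (pt i)" unfolding j(2) using i(1) K0 by (simp add: K0_def)
    then have "of_int (wt a b j) \<le> (of_int (wt a b i) :: real)" unfolding scal inner_pt using t0 by simp
    then show ?thesis using i(2) hmin_le[OF j(1), of a b] by simp
  qed
  have "k \<noteq> k'" using x(3) k k' by blast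
  from edge_direction[OF ab k(1) k'(1) this low low]
  obtain L where L: "L \<in> lines" "a * (\<Sum>j\<in>L. b2 j) = b * (\<Sum>j\<in>L. b1 j)" "a * (\<Sum>j\<in>L. b1 j) + b * (\<Sum>j\<in>L. b2 j) > 0"
    using x(4,5) k k' by blast
  define u v where "u = (\<Sum>j\<in>L. b1 j)" and "v = (\<Sum>j\<in>L. b2 j)"
  have uv: "a * v = b * u" "a * u + b * v > 0" using L by (simp_all add: u_def v_def)
  have ww: "a * a + b * b > 0" using ab by (simp add: sum_squares_gt_zero_iff)
  have "(a * a + b * b) * u = a * (a * u + b * v)" "(a * a + b * b) * v = b * (a * u + b * v)"
  proof -
    have "(a * a + b * b) * u = a * (a * u) + b * (b * u)" by (simp add: algebra_simps)
    then show "(a * a + b * b) * u = a * (a * u + b * v)" unfolding uv(1)[symmetric] by (simp add: algebra_simps)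
    have "(a * a + b * b) * v = a * (a * v) + b * (b * v)" by (simp add: algebra_simps)
    then show "(a * a + b * b) * v = b * (a * u + b * v)" unfolding uv(1) by (simp add: algebra_simps)
  qed
  then have "real_of_int (a * a + b * b) * of_int u = of_int a * of_int (a * u + b * v)"
    "real_of_int (a * a + b * b) * of_int v = of_int b * of_int (a * u + b * v)"
    by (metis of_int_mult)+
  moreover define w where "w = real_of_int (a * a + b * b)"
  moreover define z where "z = real_of_int (a * u + b * v)"
  ultimately have wz: "w * of_int u = of_int a * z" "w * of_int v = of_int b * z" by simp_all
  have w0: "w > 0" and z0: "z > 0" using ww uv(2) by (simp_all only: w_def z_def of_int_0_less_iff)
  have r: "rsum L = of_real (z / w) * Complex (of_int a) (of_int b)"
    using wz w0 unfolding rsum u_def[symmetric] v_def[symmetric] by (simp add: complex_eq_iff field_simps)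
  have "Arg (rsum L) = Arg c" unfolding r cw using w0 z0 t0 by simp
  moreover have "rsum L \<noteq> 0" unfolding r using w0 z0 ab by (simp add: complex_eq_iff)
  ultimately show ?thesis using ex_edge_Arg[OF L(1)] by simp
qed

lemma nu_eq: "nu B i = det2 (row_c B i) (T (row_c B i))"
  unfolding nu_def Q_B_eq
  by (rule cInf_eq_minimum) (use T_in_Q T_minimal in auto)

text \<open>Both sides are normalized to have minimum 0 in every coordinate, so the unknown
  translation \<open>d\<close> cancels.\<close>

theorem hull_supp_P0:
  "convex hull ((\<lambda>k. \<chi> i. of_int (wt (b1 i) (b2 i) k - hmin (b1 i) (b2 i) P0)) ` supp2 P0) = bar_map B ` Q_B B"
proof -
  have "\<exists>d. convex hull K0 = (\<lambda>v. - \<i> * v + d) ` Q \<and> (\<forall>c. Min (inner c ` K0) = det2 c (T c) + inner c d)"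
    by (rule hull_eq_translate[OF K0 edge_K0 width_K0 not_opposite_edges])
  then obtain d where d: "convex hull K0 = (\<lambda>v. - \<i> * v + d) ` Q \<and> (\<forall>c. Min (inner c ` K0) = det2 c (T c) + inner c d)"
    by (rule exE)
  have hm: "of_int (hmin (b1 i) (b2 i) P0) = nu B i + inner (row_c B i) d" for i
    using spec[OF conjunct2[OF d], of "row_c B i"] unfolding nu_eq row_c Min_K0 .
  define A :: "complex \<Rightarrow> real^'n" where "A x = (\<chi> i. inner (row_c B i) x)" for x
  define h :: "real^'n" where "h = (\<chi> i. - nu B i - inner (row_c B i) d)"
  have linA: "linear A" by (rule linearI) (simp_all add: A_def vec_eq_iff inner_add_right)
  have "(\<lambda>k. \<chi> i. of_int (wt (b1 i) (b2 i) k - hmin (b1 i) (b2 i) P0)) ` supp2 P0 = (\<lambda>x. h + x) ` A ` K0"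
    unfolding K0_def image_image
    by (intro image_cong refl) (simp add: vec_eq_iff A_def h_def row_c inner_pt hm)
  then have "convex hull ((\<lambda>k. \<chi> i. of_int (wt (b1 i) (b2 i) k - hmin (b1 i) (b2 i) P0)) ` supp2 P0)
      = (\<lambda>x. h + x) ` A ` (convex hull K0)"
    by (simp only: convex_hull_translation convex_hull_linear_image[OF linA])
  also have "\<dots> = (\<lambda>v. h + A (- \<i> * v + d)) ` Q" unfolding conjunct1[OF d] image_image ..
  also have "\<dots> = bar_map B ` Q"
    by (intro image_cong refl) (simp add: vec_eq_iff A_def h_def bar_map_def det2_inner inner_add_right inner_diff_right)
  finally show ?thesis unfolding Q_B_eq .
qed

end

section \<open>Gale duality and the discriminant locus\<close>

lemma finite_bezout:
  fixes a :: "'i \<Rightarrow> int"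
  assumes "finite I"
  shows "\<exists>s g. (\<forall>i\<in>I. g dvd a i) \<and> (\<Sum>i\<in>I. s i * a i) = g"
  using assms
proof (induction I rule: finite_induct)
  case empty
  then show ?case by (intro exI[of _ "\<lambda>_. 0"]) simp
next
  case (insert i I)
  from insert.IH obtain s g where sg: "(\<forall>i\<in>I. g dvd a i) \<and> (\<Sum>i\<in>I. s i * a i) = g" by (elim exE)
  obtain u v where uv: "u * g + v * a i = gcd g (a i)" using bezout_int by blast
  define s' where "s' k = (if k = i then v else u * s k)" for k
  have "(\<Sum>k\<in>I. s' k * a k) = u * (\<Sum>k\<in>I. s k * a k)"
    unfolding sum_distrib_left using insert.hyps by (intro sum.cong refl) (auto simp: s'_def)
  then have "(\<Sum>k\<in>insert i I. s' k * a k) = gcd g (a i)"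
    using insert.hyps sg uv by (simp add: s'_def)
  moreover have "\<forall>k\<in>insert i I. gcd g (a i) dvd a k"
    using sg by (auto intro: dvd_trans[OF gcd_dvd1])
  ultimately show ?case by blast
qed

lemma sum_mult_delta:
  fixes f :: "'i::finite \<Rightarrow> 'b::comm_semiring_1"
  shows "(\<Sum>i\<in>UNIV. f i * (if i = k then 1 else 0)) = f k" "(\<Sum>i\<in>UNIV. (if i = k then 1 else 0) * f i) = f k"
    "(\<Sum>i\<in>UNIV. (if k = i then 1 else 0) * f i) = f k"
proof -
  have "(\<Sum>i\<in>UNIV. if i = k then f i else 0) = f k" by simp
  moreover have "f i * (if i = k then 1 else 0) = (if i = k then f i else 0)"
    "(if i = k then 1 else 0) * f i = (if i = k then f i else 0)"
    "(if k = i then 1 else 0) * f i = (if i = k then f i else 0)" for i by auto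
  ultimately show "(\<Sum>i\<in>UNIV. f i * (if i = k then 1 else 0)) = f k" "(\<Sum>i\<in>UNIV. (if i = k then 1 else 0) * f i) = f k"
    "(\<Sum>i\<in>UNIV. (if k = i then 1 else 0) * f i) = f k" by presburger+
qed

lemma exp_eq_1_imp:
  fixes z :: complex
  assumes "exp z = 1" shows "\<exists>n::int. z = 2 * of_int n * of_real pi * \<i>"
proof -
  from assms[unfolded exp_eq_1] obtain n :: int where n: "Re z = 0" "Im z = of_int (2 * n) * pi"
    by (elim conjE exE) (rule that)
  have "z = 2 * of_int n * of_real pi * \<i>"
    by (rule complex_eqI) (simp_all add: n)
  then show ?thesis by (rule exI)
qed

lemma exp_of_int_2pi: "exp (2 * of_real pi * \<i> * of_int k) = (1 :: complex)"
proof -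
  have "2 * of_real pi * \<i> * of_int k = (2 * of_int k * of_real pi) * (\<i> :: complex)" by simp
  moreover have "exp ((2 * of_int k * of_real pi) * \<i>) = (1 :: complex)"
    using exp_integer_2pi[of "of_int k"] by simp
  ultimately show ?thesis by (simp only:)
qed

lemma right_inverse_of_full_row_rank:
  fixes M :: "'a::field^'n^'m"
  assumes "rank M = CARD('m)"
  shows "\<exists>Y. M ** Y = mat 1"
  unfolding matrix_right_invertible_independent_rows
proof (rule allI, rule impI, rule allI, rule ccontr)
  fix c i0 assume c: "(\<Sum>i\<in>UNIV. c i *s row i M) = 0" "c i0 \<noteq> 0"
  let ?W = "(\<lambda>i. row i M) ` (UNIV - {i0})"
  have "c i0 *s row i0 M + (\<Sum>i\<in>UNIV - {i0}. c i *s row i M) = 0"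
    using c(1) sum.remove[of UNIV i0 "\<lambda>i. c i *s row i M"] by simp
  then have "c i0 *s row i0 M = - (\<Sum>i\<in>UNIV - {i0}. c i *s row i M)" by (simp add: add_eq_0_iff2)
  moreover have "- (\<Sum>i\<in>UNIV - {i0}. c i *s row i M) \<in> vec.span ?W"
    by (intro vec.span_neg vec.span_sum vec.span_scale vec.span_base) auto
  ultimately have "(1 / c i0) *s (c i0 *s row i0 M) \<in> vec.span ?W" by (simp only: vec.span_scale)
  then have r: "row i0 M \<in> vec.span ?W" using c(2) by (simp add: vector_smult_assoc)
  have "rows M \<subseteq> vec.span ?W"
  proof
    fix v assume "v \<in> rows M"
    then obtain i where v: "v = row i M" by (auto simp: rows_def)
    show "v \<in> vec.span ?W"
    proof (cases "i = i0")
      case False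
      then show ?thesis unfolding v by (intro vec.span_base) auto
    qed (use r v in simp)
  qed
  then have "vec.dim (rows M) \<le> card ?W" by (intro vec.dim_le_card) simp_all
  also have "\<dots> \<le> card (UNIV - {i0})" by (rule card_image_le) simp
  also have "\<dots> < CARD('m)" by (rule psubset_card_mono) auto
  finally show False using assms by (simp add: row_rank_def_gen)
qed

locale gale =
  fixes A :: "int^'n::finite^'m::finite" and B :: "int^2^'n"
  assumes dims: "CARD('m) + 2 = CARD('n)"
    and rank_A: "rank (\<chi> j k. (of_int (A$j$k) :: rat)) = CARD('m)"
    and homog: "\<exists>w::rat^'m. \<forall>i. (\<Sum>j\<in>UNIV. w$j * of_int (A$j$i)) = 1"
    and B_ker: "\<forall>c::2. A *v column c B = 0"
    and B_span: "\<forall>z::int^'n. A *v z = 0 \<longrightarrow> (\<exists>c1 c2::int. z = c1 *s column 1 B + c2 *s column 2 B)"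
    and B_indep: "\<forall>c1 c2::int. c1 *s column 1 B + c2 *s column 2 B = 0 \<longrightarrow> c1 = 0 \<and> c2 = 0"
    and rows_nz: "\<forall>i. row i B \<noteq> 0"
begin

definition r1 :: "'n \<Rightarrow> int" where "r1 i = B$i$1"
definition r2 :: "'n \<Rightarrow> int" where "r2 i = B$i$2"

lemma AB: "(\<Sum>i\<in>UNIV. A$j$i * r1 i) = 0" "(\<Sum>i\<in>UNIV. A$j$i * r2 i) = 0"
  using B_ker[rule_format, of 1] B_ker[rule_format, of 2]
  by (simp_all add: vec_eq_iff matrix_vector_mult_def column_def r1_def r2_def)

lemma kernel:
  assumes "\<And>j. (\<Sum>i\<in>UNIV. A$j$i * z i) = 0"
  shows "\<exists>c1 c2. \<forall>i. z i = c1 * r1 i + c2 * r2 i"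
proof -
  have "A *v (\<chi> i. z i) = 0" by (simp add: vec_eq_iff matrix_vector_mult_def assms)
  from B_span[rule_format, OF this] obtain c1 c2 where e: "(\<chi> i. z i) = c1 *s column 1 B + c2 *s column 2 B"
    by (elim exE) (rule that)
  have "z i = c1 * r1 i + c2 * r2 i" for i
    using arg_cong[OF e, of "\<lambda>v. v$i"] by (simp add: column_def r1_def r2_def)
  then show ?thesis by (intro exI allI)
qed

lemma indep:
  assumes "\<And>i. c1 * r1 i + c2 * r2 i = 0" shows "c1 = 0 \<and> c2 = 0"
proof -
  have "c1 *s column 1 B + c2 *s column 2 B = 0"
    using assms by (simp add: vec_eq_iff column_def r1_def r2_def)
  from B_indep[rule_format, OF this] show ?thesis .
qed

lemma weights: "\<exists>w. \<forall>i. (\<Sum>j\<in>UNIV. w j * rat_of_int (A$j$i)) = 1"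
proof -
  obtain w :: "rat^'m" where "\<forall>i. (\<Sum>j\<in>UNIV. w$j * of_int (A$j$i)) = 1" using homog by (rule exE)
  then show ?thesis by (intro exI[of _ "\<lambda>j. w$j"])
qed

text \<open>The all-ones vector lies in the rational row space of \<open>A\<close>.\<close>

lemma row_sum:
  assumes "\<And>j. (\<Sum>i\<in>UNIV. A$j$i * r i) = 0" shows "(\<Sum>i\<in>UNIV. r i) = 0"
proof -
  obtain w where w: "\<forall>i. (\<Sum>j\<in>UNIV. w j * rat_of_int (A$j$i)) = 1" using weights by (rule exE)
  have "rat_of_int (\<Sum>i\<in>UNIV. r i) = (\<Sum>i\<in>UNIV. (\<Sum>j\<in>UNIV. w j * rat_of_int (A$j$i)) * of_int (r i))"
    using w by simp
  also have "\<dots> = (\<Sum>j\<in>UNIV. w j * of_int (\<Sum>i\<in>UNIV. A$j$i * r i))"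
    by (simp add: sum_distrib_left sum_distrib_right mult.assoc) (rule sum.swap)
  also have "\<dots> = 0" unfolding assms by simp
  finally show ?thesis by (simp only: of_int_eq_0_iff)
qed

sublocale horn r1 r2
proof
  show "r1 i \<noteq> 0 \<or> r2 i \<noteq> 0" for i
  proof (rule ccontr)
    assume "\<not> ?thesis"
    then have "row i B = 0" by (simp add: vec_eq_iff row_def forall_2 r1_def r2_def)
    then show False using rows_nz by blast
  qed
  show "(\<Sum>i\<in>UNIV. r1 i) = 0" "(\<Sum>i\<in>UNIV. r2 i) = 0" by (rule row_sum, rule AB)+
qed

text \<open>The columns of \<open>B\<close> span all integer solutions of A z = 0, and this lattice
  contains the quotient by \<open>q\<close> of any of its vectors divisible by
  \<open>q\<close>.\<close>

lemma saturated:
  assumes q: "\<And>i. q dvd c1 * r1 i + c2 * r2 i" shows "q dvd c1 \<and> q dvd c2"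
proof (cases "q = 0")
  case True
  then have "c1 * r1 i + c2 * r2 i = 0" for i using q[of i] by simp
  then show ?thesis using indep[of c1 c2] True by simp
next
  case False
  have "\<forall>i. \<exists>z. c1 * r1 i + c2 * r2 i = q * z" using q unfolding dvd_def by (rule allI)
  from choice[OF this] obtain z where zz: "\<forall>i. c1 * r1 i + c2 * r2 i = q * z i" by (rule exE)
  have z: "c1 * r1 i + c2 * r2 i = q * z i" for i using spec[OF zz] .
  have "(\<Sum>i\<in>UNIV. A$j$i * z i) = 0" for j
  proof -
    have "q * (\<Sum>i\<in>UNIV. A$j$i * z i) = (\<Sum>i\<in>UNIV. A$j$i * (c1 * r1 i + c2 * r2 i))"
      unfolding z sum_distrib_left by (intro sum.cong refl) (simp only: mult_ac)
    also have "\<dots> = c1 * (\<Sum>i\<in>UNIV. A$j$i * r1 i) + c2 * (\<Sum>i\<in>UNIV. A$j$i * r2 i)"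
      unfolding sum_distrib_left sum.distrib[symmetric] by (intro sum.cong refl) (simp add: algebra_simps)
    finally show ?thesis using False by (simp add: AB)
  qed
  from kernel[OF this] obtain d1 d2 where d: "\<forall>i. z i = d1 * r1 i + d2 * r2 i" by (elim exE)
  have "(c1 - q * d1) * r1 i + (c2 - q * d2) * r2 i = 0" for i
    using z[of i] unfolding spec[OF d, of i] by (simp add: algebra_simps)
  from indep[OF this] show ?thesis by simp
qed

text \<open>Saturation makes the entries of \<open>r1\<close> jointly coprime, and then also those
  of \<open>r2 - e * r1\<close>. Two Bezout relations give a triangular system, which is then
  diagonalized.\<close>

lemma ex_dual_basis:
  "\<exists>S1 S2. (\<Sum>i\<in>UNIV. S1 i * r1 i) = 1 \<and> (\<Sum>i\<in>UNIV. S1 i * r2 i) = 0 \<and>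
    (\<Sum>i\<in>UNIV. S2 i * r1 i) = 0 \<and> (\<Sum>i\<in>UNIV. S2 i * r2 i) = (1::int)"
proof -
  obtain s g where s: "(\<forall>i\<in>UNIV. g dvd r1 i) \<and> (\<Sum>i\<in>UNIV. s i * r1 i) = g"
    using finite_bezout[OF finite[of UNIV], of r1] by (elim exE) (rule that)
  have "g dvd 1" using saturated[of g 1 0] s by simp
  then obtain g' where g': "1 = g * g'" by (elim dvdE)
  define s1 where "s1 i = g' * s i" for i
  have s1: "(\<Sum>i\<in>UNIV. s1 i * r1 i) = 1"
    unfolding s1_def mult.assoc sum_distrib_left[symmetric] conjunct2[OF s] using g' by (simp add: mult.commute)
  define e where "e = (\<Sum>i\<in>UNIV. s1 i * r2 i)"
  obtain t h where t: "(\<forall>i\<in>UNIV. h dvd r2 i - e * r1 i) \<and> (\<Sum>i\<in>UNIV. t i * (r2 i - e * r1 i)) = h"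
    using finite_bezout[OF finite[of UNIV], of "\<lambda>i. r2 i - e * r1 i"] by (elim exE) (rule that)
  have "h dvd 1" using saturated[of h "- e" 1] t by simp
  then obtain h' where h': "1 = h * h'" by (elim dvdE)
  define t1 where "t1 i = h' * t i" for i
  define f where "f = (\<Sum>i\<in>UNIV. t1 i * r1 i)"
  have "(\<Sum>i\<in>UNIV. t1 i * (r2 i - e * r1 i)) = h' * h"
    unfolding t1_def mult.assoc sum_distrib_left[symmetric] conjunct2[OF t] ..
  then have t2: "(\<Sum>i\<in>UNIV. t1 i * r2 i) = 1 + e * f"
    using h' by (simp add: f_def right_diff_distrib sum_subtractf sum_distrib_left algebra_simps)
  define S2 where "S2 i = t1 i - f * s1 i" for i
  define S1 where "S1 i = s1 i - e * S2 i" for i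
  have lin: "(\<Sum>i\<in>UNIV. (a i - c * b i) * r i) = (\<Sum>i\<in>UNIV. a i * r i) - c * (\<Sum>i\<in>UNIV. b i * r i)"
    for a b r :: "'n \<Rightarrow> int" and c
    by (simp add: left_diff_distrib sum_subtractf sum_distrib_left mult.assoc)
  have S2: "(\<Sum>i\<in>UNIV. S2 i * r1 i) = 0" "(\<Sum>i\<in>UNIV. S2 i * r2 i) = 1"
    unfolding S2_def lin s1 t2 e_def[symmetric] f_def[symmetric] by (simp_all add: mult.commute)
  have S1: "(\<Sum>i\<in>UNIV. S1 i * r1 i) = 1" "(\<Sum>i\<in>UNIV. S1 i * r2 i) = 0"
    unfolding S1_def lin S2 s1 e_def[symmetric] by simp_all
  show ?thesis by (intro exI[of _ S1] exI[of _ S2] conjI S1 S2)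
qed

lemma clear_denominators:
  fixes q :: "'n \<Rightarrow> rat"
  shows "\<exists>d z. d \<noteq> 0 \<and> (\<forall>i. of_int d * q i = of_int (z i))"
proof -
  define den num where "den i = snd (quotient_of (q i))" and "num i = fst (quotient_of (q i))" for i
  have den: "den i > 0" for i unfolding den_def by (rule quotient_of_denom_pos')
  have qi: "q i = of_int (num i) / of_int (den i)" for i
    unfolding num_def den_def by (rule quotient_of_div) simp
  define d where "d = (\<Prod>i\<in>UNIV. den i)"
  have "den i dvd d" for i unfolding d_def by (rule dvd_prodI) simp_all
  then have "\<forall>i. \<exists>e. d = den i * e" unfolding dvd_def by (rule allI)
  from choice[OF this] obtain e where e: "\<forall>i. d = den i * e i" by (rule exE)
  have "of_int d * q i = of_int (e i * num i)" for i
  proof -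
    have "rat_of_int d = of_int (den i) * of_int (e i)" unfolding spec[OF e, of i, THEN arg_cong[where f = rat_of_int]] by simp
    then have "of_int d * q i = of_int (den i) * of_int (e i) * (of_int (num i) / of_int (den i))"
      by (simp only: qi[symmetric])
    then show ?thesis using den[of i] by simp
  qed
  moreover have "d \<noteq> 0" using den by (simp add: d_def less_imp_neq[symmetric])
  ultimately show ?thesis by (intro exI[of _ d] exI[of _ "\<lambda>i. e i * num i"] conjI allI)
qed

text \<open>Over the rationals \<open>A\<close> has a right inverse \<open>X\<close>, and \<open>1 - X A\<close> projects onto the column span of \<open>B\<close>.\<close>

lemma ex_splitting:
  "\<exists>(X :: 'n \<Rightarrow> 'm \<Rightarrow> complex) (C1 :: 'n \<Rightarrow> complex) C2. \<forall>i k. (if i = k then 1 else 0) =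
    (\<Sum>j\<in>UNIV. X i j * of_int (A$j$k)) + of_int (r1 i) * C1 k + of_int (r2 i) * C2 k"
proof -
  define AQ :: "rat^'n^'m" where "AQ = (\<chi> j k. of_int (A$j$k))"
  obtain Y where Y: "AQ ** Y = mat 1"
    using right_inverse_of_full_row_rank[OF rank_A] unfolding AQ_def by (rule exE)
  have YA: "(\<Sum>i\<in>UNIV. of_int (A$j$i) * Y$i$l) = (if j = l then 1 else 0)" for j l
    using arg_cong[OF Y, of "\<lambda>M. M$j$l"] by (simp add: matrix_matrix_mult_def AQ_def mat_def)
  have "\<exists>c :: rat \<times> rat. \<forall>i. (if i = k then 1 else 0) - (\<Sum>j\<in>UNIV. Y$i$j * of_int (A$j$k)) =
      of_int (r1 i) * fst c + of_int (r2 i) * snd c" for k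
  proof -
    define q where "q i = (if i = k then 1 else 0) - (\<Sum>j\<in>UNIV. Y$i$j * of_int (A$j$k))" for i
    have q0: "(\<Sum>i\<in>UNIV. of_int (A$j$i) * q i) = 0" for j
    proof -
      have "(\<Sum>i\<in>UNIV. of_int (A$j$i) * q i) = of_int (A$j$k) - (\<Sum>i\<in>UNIV. \<Sum>l\<in>UNIV. of_int (A$j$i) * (Y$i$l * of_int (A$l$k)))"
        unfolding q_def right_diff_distrib sum_subtractf sum_mult_delta sum_distrib_left ..
      also have "(\<Sum>i\<in>UNIV. \<Sum>l\<in>UNIV. of_int (A$j$i) * (Y$i$l * of_int (A$l$k))) =
          (\<Sum>l\<in>UNIV. (\<Sum>i\<in>UNIV. of_int (A$j$i) * Y$i$l) * of_int (A$l$k))"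
        by (subst sum.swap) (simp add: sum_distrib_right mult.assoc)
      also have "\<dots> = of_int (A$j$k)" unfolding YA by (rule sum_mult_delta)
      finally show ?thesis by simp
    qed
    obtain d z where dz: "d \<noteq> 0 \<and> (\<forall>i. of_int d * q i = of_int (z i))" using clear_denominators[of q] by (elim exE)
    have "(\<Sum>i\<in>UNIV. A$j$i * z i) = 0" for j
    proof -
      have "rat_of_int (\<Sum>i\<in>UNIV. A$j$i * z i) = (\<Sum>i\<in>UNIV. of_int (A$j$i) * (of_int d * q i))" using dz by simp
      also have "\<dots> = of_int d * (\<Sum>i\<in>UNIV. of_int (A$j$i) * q i)"
        unfolding sum_distrib_left by (intro sum.cong refl) (simp add: mult_ac)
      also have "\<dots> = 0" unfolding q0 by simp
      finally show ?thesis by (simp only: of_int_eq_0_iff)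
    qed
    from kernel[OF this] obtain c1 c2 where c: "\<forall>i. z i = c1 * r1 i + c2 * r2 i" by (elim exE)
    have "q i = of_int (r1 i) * (of_int c1 / of_int d) + of_int (r2 i) * (of_int c2 / of_int d)" for i
    proof -
      have d0: "rat_of_int d \<noteq> 0" using dz by simp
      have "q i = of_int (z i) / of_int d"
        using spec[OF conjunct2[OF dz], of i] d0 by (simp add: eq_divide_eq mult.commute)
      also have "\<dots> = of_int (r1 i) * (of_int c1 / of_int d) + of_int (r2 i) * (of_int c2 / of_int d)"
        unfolding spec[OF c, of i] by (simp add: add_divide_distrib mult.commute)
      finally show ?thesis .
    qed
    note qq = this
    define cc where "cc = (rat_of_int c1 / of_int d, rat_of_int c2 / of_int d)"
    have "\<forall>i. q i = of_int (r1 i) * fst cc + of_int (r2 i) * snd cc"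
      unfolding cc_def fst_conv snd_conv using qq by (rule allI)
    then show ?thesis unfolding q_def by (rule exI)
  qed
  then have "\<forall>k. \<exists>c :: rat \<times> rat. \<forall>i. (if i = k then 1 else 0) - (\<Sum>j\<in>UNIV. Y$i$j * of_int (A$j$k)) =
      of_int (r1 i) * fst c + of_int (r2 i) * snd c" by (rule allI)
  from choice[OF this] obtain cc :: "'n \<Rightarrow> rat \<times> rat" where cc: "\<forall>k i. (if i = k then 1 else 0) - (\<Sum>j\<in>UNIV. Y$i$j * of_int (A$j$k)) =
      of_int (r1 i) * fst (cc k) + of_int (r2 i) * snd (cc k)" by (rule exE)
  define c1 c2 where "c1 k = fst (cc k)" and "c2 k = snd (cc k)" for k
  have c: "(if i = k then 1 else 0) - (\<Sum>j\<in>UNIV. Y$i$j * of_int (A$j$k)) = of_int (r1 i) * c1 k + of_int (r2 i) * c2 k" for i k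
    using spec[OF spec[OF cc, of k], of i] by (simp only: c1_def c2_def)
  have "(if i = k then 1 else 0) = (\<Sum>j\<in>UNIV. of_rat (Y$i$j) * of_int (A$j$k)) + of_int (r1 i) * complex_of_rat (c1 k) + of_int (r2 i) * of_rat (c2 k)" for i k
  proof -
    have "(if i = k then 1 else 0) = (\<Sum>j\<in>UNIV. Y$i$j * of_int (A$j$k)) + of_int (r1 i) * c1 k + of_int (r2 i) * c2 k"
      using c[of i k] by (simp only: diff_eq_eq add_ac)
    then have "complex_of_rat (if i = k then 1 else 0) = of_rat ((\<Sum>j\<in>UNIV. Y$i$j * of_int (A$j$k)) + of_int (r1 i) * c1 k + of_int (r2 i) * c2 k)"
      by (rule arg_cong)
    moreover have "complex_of_rat (if i = k then 1 else 0) = (if i = k then 1 else 0)" by simp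
    ultimately show ?thesis by (simp only: of_rat_add of_rat_mult of_rat_sum of_rat_of_int_eq)
  qed
  then show ?thesis
    by (intro exI[of _ "\<lambda>i j. of_rat (Y$i$j)"] exI[of _ "\<lambda>k. of_rat (c1 k)"] exI[of _ "\<lambda>k. of_rat (c2 k)"] allI)
qed

lemma kernel_complex:
  fixes u :: "'n \<Rightarrow> complex"
  assumes "\<And>j. (\<Sum>i\<in>UNIV. of_int (A$j$i) * u i) = 0"
  shows "\<exists>l. \<forall>i. u i = lf i l"
proof -
  obtain X :: "'n \<Rightarrow> 'm \<Rightarrow> complex" and C1 C2 where S: "\<forall>i k. (if i = k then 1 else 0) =
    (\<Sum>j\<in>UNIV. X i j * of_int (A$j$k)) + of_int (r1 i) * C1 k + of_int (r2 i) * C2 k"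
    using ex_splitting by (elim exE)
  have "u i = of_int (r1 i) * (\<Sum>k\<in>UNIV. C1 k * u k) + of_int (r2 i) * (\<Sum>k\<in>UNIV. C2 k * u k)" for i
  proof -
    have "u i = (\<Sum>k\<in>UNIV. (if i = k then 1 else 0) * u k)" by (rule sum_mult_delta[symmetric])
    also have "\<dots> = (\<Sum>k\<in>UNIV. (\<Sum>j\<in>UNIV. X i j * of_int (A$j$k)) * u k) +
        (\<Sum>k\<in>UNIV. of_int (r1 i) * C1 k * u k) + (\<Sum>k\<in>UNIV. of_int (r2 i) * C2 k * u k)"
      by (simp only: S[rule_format, of i] distrib_right sum.distrib)
    also have "(\<Sum>k\<in>UNIV. (\<Sum>j\<in>UNIV. X i j * of_int (A$j$k)) * u k) = (\<Sum>j\<in>UNIV. X i j * (\<Sum>k\<in>UNIV. of_int (A$j$k) * u k))"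
      by (simp add: sum_distrib_left sum_distrib_right mult.assoc) (rule sum.swap)
    also have "\<dots> = 0" unfolding assms by simp
    finally show ?thesis by (simp add: sum_distrib_left mult.assoc)
  qed
  note u = this
  have "lf i (vec2 a b) = of_int (r1 i) * a + of_int (r2 i) * b" for i a b by (simp add: lf_def)
  then have "\<forall>i. u i = lf i (vec2 (\<Sum>k\<in>UNIV. C1 k * u k) (\<Sum>k\<in>UNIV. C2 k * u k))"
    by (intro allI) (rule trans[OF u], rule sym)
  then show ?thesis by (rule exI)
qed

lemma row_space_complex:
  fixes \<zeta> :: "'n \<Rightarrow> complex"
  assumes "(\<Sum>i\<in>UNIV. of_int (r1 i) * \<zeta> i) = 0" "(\<Sum>i\<in>UNIV. of_int (r2 i) * \<zeta> i) = 0"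
  shows "\<exists>\<theta>. \<forall>k. \<zeta> k = (\<Sum>j\<in>UNIV. of_int (A$j$k) * \<theta> j)"
proof -
  obtain X :: "'n \<Rightarrow> 'm \<Rightarrow> complex" and C1 C2 where S: "\<forall>i k. (if i = k then 1 else 0) =
    (\<Sum>j\<in>UNIV. X i j * of_int (A$j$k)) + of_int (r1 i) * C1 k + of_int (r2 i) * C2 k"
    using ex_splitting by (elim exE)
  have "\<zeta> k = (\<Sum>j\<in>UNIV. of_int (A$j$k) * (\<Sum>i\<in>UNIV. X i j * \<zeta> i))" for k
  proof -
    have "\<zeta> k = (\<Sum>i\<in>UNIV. (if i = k then 1 else 0) * \<zeta> i)" by (rule sum_mult_delta[symmetric])
    also have "\<dots> = (\<Sum>i\<in>UNIV. (\<Sum>j\<in>UNIV. X i j * of_int (A$j$k)) * \<zeta> i) +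
        (\<Sum>i\<in>UNIV. of_int (r1 i) * C1 k * \<zeta> i) + (\<Sum>i\<in>UNIV. of_int (r2 i) * C2 k * \<zeta> i)"
      by (simp only: S[rule_format, of _ k] distrib_right sum.distrib)
    also have "(\<Sum>i\<in>UNIV. of_int (r1 i) * C1 k * \<zeta> i) = C1 k * (\<Sum>i\<in>UNIV. of_int (r1 i) * \<zeta> i)"
      unfolding sum_distrib_left by (intro sum.cong refl) (simp add: mult_ac)
    also have "(\<Sum>i\<in>UNIV. of_int (r2 i) * C2 k * \<zeta> i) = C2 k * (\<Sum>i\<in>UNIV. of_int (r2 i) * \<zeta> i)"
      unfolding sum_distrib_left by (intro sum.cong refl) (simp add: mult_ac)
    also have "(\<Sum>i\<in>UNIV. (\<Sum>j\<in>UNIV. X i j * of_int (A$j$k)) * \<zeta> i) = (\<Sum>i\<in>UNIV. \<Sum>j\<in>UNIV. of_int (A$j$k) * (X i j * \<zeta> i))"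
      unfolding sum_distrib_right by (intro sum.cong refl) (simp only: mult_ac)
    also have "\<dots> = (\<Sum>j\<in>UNIV. \<Sum>i\<in>UNIV. of_int (A$j$k) * (X i j * \<zeta> i))" by (rule sum.swap)
    finally show ?thesis unfolding assms by (simp add: sum_distrib_left)
  qed
  then show ?thesis by (intro exI[of _ "\<lambda>j. \<Sum>i\<in>UNIV. X i j * \<zeta> i"] allI)
qed

definition tmon :: "complex^'m \<Rightarrow> 'n \<Rightarrow> complex" where
  "tmon t i = (\<Prod>j\<in>UNIV. (t$j) powi (A$j$i))"

lemma exp_powi_prod: "(\<Prod>i\<in>I. exp (f i) powi e i) = exp (\<Sum>i\<in>I. of_int (e i) * (f i :: complex))"
proof (induction I rule: infinite_finite_induct)
  case (insert i I)
  have "(\<Prod>i\<in>insert i I. exp (f i) powi e i) = exp (f i) powi e i * (\<Prod>i\<in>I. exp (f i) powi e i)"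
    using insert.hyps by (simp del: exp_power_int)
  also have "\<dots> = exp (of_int (e i) * f i) * exp (\<Sum>i\<in>I. of_int (e i) * f i)"
    by (rule arg_cong2[where f = "(*)", OF exp_power_int insert.IH])
  also have "\<dots> = exp (of_int (e i) * f i + (\<Sum>i\<in>I. of_int (e i) * f i))" by (rule exp_add[symmetric])
  finally show ?case using insert.hyps by simp
qed simp_all

text \<open>Logarithms satisfy the two relations only up to integer multiples of 2 pi i. The
  integral dual basis absorbs these by changing branches, after which the logarithms lie in the
  complex row space of \<open>A\<close>.\<close>

lemma torus_param:
  assumes nz: "\<And>i. z i \<noteq> 0" and r: "(\<Prod>i\<in>UNIV. z i powi r1 i) = 1" "(\<Prod>i\<in>UNIV. z i powi r2 i) = 1"
  shows "\<exists>t. (\<forall>j. t$j \<noteq> 0) \<and> (\<forall>i. z i = tmon t i)"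
proof -
  obtain S1 S2 :: "'n \<Rightarrow> int" where S: "(\<Sum>i\<in>UNIV. S1 i * r1 i) = 1 \<and> (\<Sum>i\<in>UNIV. S1 i * r2 i) = 0 \<and>
    (\<Sum>i\<in>UNIV. S2 i * r1 i) = 0 \<and> (\<Sum>i\<in>UNIV. S2 i * r2 i) = 1" using ex_dual_basis by (elim exE)
  define \<zeta> where "\<zeta> i = Ln (z i)" for i
  have e\<zeta>: "exp (\<zeta> i) = z i" for i using nz[of i] by (simp add: \<zeta>_def)
  have "exp (\<Sum>i\<in>UNIV. of_int (r1 i) * \<zeta> i) = 1" "exp (\<Sum>i\<in>UNIV. of_int (r2 i) * \<zeta> i) = 1"
    unfolding exp_powi_prod[symmetric] e\<zeta> by (fact r)+
  note e1 = this
  obtain N1 :: int where N1: "(\<Sum>i\<in>UNIV. of_int (r1 i) * \<zeta> i) = 2 * of_int N1 * of_real pi * \<i>"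
    using exp_eq_1_imp[OF e1(1)] by (rule exE)
  obtain N2 :: int where N2: "(\<Sum>i\<in>UNIV. of_int (r2 i) * \<zeta> i) = 2 * of_int N2 * of_real pi * \<i>"
    using exp_eq_1_imp[OF e1(2)] by (rule exE)
  define \<xi> where "\<xi> i = \<zeta> i - 2 * of_real pi * \<i> * of_int (N1 * S1 i + N2 * S2 i)" for i
  have e\<xi>: "exp (\<xi> i) = z i" for i
    unfolding \<xi>_def exp_diff exp_of_int_2pi e\<zeta> by simp
  have lin: "(\<Sum>i\<in>UNIV. of_int (r i) * \<xi> i) = (\<Sum>i\<in>UNIV. of_int (r i) * \<zeta> i) -
      2 * of_real pi * \<i> * (of_int N1 * of_int (\<Sum>i\<in>UNIV. S1 i * r i) + of_int N2 * of_int (\<Sum>i\<in>UNIV. S2 i * r i))" for r :: "'n \<Rightarrow> int"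
  proof -
    have "(\<Sum>i\<in>UNIV. of_int (r i) * \<xi> i) = (\<Sum>i\<in>UNIV. of_int (r i) * \<zeta> i -
        2 * of_real pi * \<i> * (of_int N1 * of_int (S1 i * r i) + of_int N2 * of_int (S2 i * r i)))"
      by (intro sum.cong refl) (simp add: \<xi>_def algebra_simps)
    then show ?thesis by (simp only: sum_subtractf sum_distrib_left[symmetric] sum.distrib of_int_sum)
  qed
  have "(\<Sum>i\<in>UNIV. of_int (r1 i) * \<xi> i) = 0" "(\<Sum>i\<in>UNIV. of_int (r2 i) * \<xi> i) = 0"
    unfolding lin N1 N2 using S by simp_all
  from row_space_complex[OF this] obtain \<theta> where \<theta>: "\<forall>k. \<xi> k = (\<Sum>j\<in>UNIV. of_int (A$j$k) * \<theta> j)" by (rule exE)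
  have "z i = tmon (\<chi> j. exp (\<theta> j)) i" for i
    unfolding tmon_def by (simp add: exp_powi_prod spec[OF \<theta>, of i, symmetric] e\<xi>)
  then show ?thesis by (intro exI[of _ "\<chi> j. exp (\<theta> j)"]) simp
qed

lemma tmon_nz: "(\<And>j. t$j \<noteq> 0) \<Longrightarrow> tmon t i \<noteq> 0"
  by (simp add: tmon_def)

lemma tmon_rows:
  assumes t: "\<And>j. t$j \<noteq> 0" and r: "\<And>j. (\<Sum>i\<in>UNIV. A$j$i * r i) = 0"
  shows "(\<Prod>i\<in>UNIV. tmon t i powi r i) = 1"
proof -
  have "(\<Prod>i\<in>UNIV. tmon t i powi r i) = (\<Prod>i\<in>UNIV. \<Prod>j\<in>UNIV. t$j powi (A$j$i * r i))"
    unfolding tmon_def prod_power_int by (simp add: power_int_mult)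
  also have "\<dots> = (\<Prod>j\<in>UNIV. \<Prod>i\<in>UNIV. t$j powi (A$j$i * r i))" by (rule prod.swap)
  also have "\<dots> = 1" using t by (simp add: prod_powi_sum r)
  finally show ?thesis .
qed

text \<open>With \<open>phi2\<close>, coordinates on the quotient of the torus by the action of
  \<open>tmon\<close>.\<close>

definition phi1 :: "complex^'n \<Rightarrow> complex" where "phi1 x = (\<Prod>i\<in>UNIV. x$i powi r1 i)"
definition phi2 :: "complex^'n \<Rightarrow> complex" where "phi2 x = (\<Prod>i\<in>UNIV. x$i powi r2 i)"

text \<open>The j-th partial derivative multiplied by t_j is row j of \<open>A\<close> applied to
  the vector of terms of f.\<close>

lemma multiple_root_iff:
  "has_multiple_root A x \<longleftrightarrow> (\<exists>t. (\<forall>j. t$j \<noteq> 0) \<and> (\<forall>j. (\<Sum>i\<in>UNIV. of_int (A$j$i) * (x$i * tmon t i)) = 0))"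
proof -
  have f: "laurent_f A x t = (\<Sum>i\<in>UNIV. x$i * tmon t i)" for t
    by (simp add: laurent_f_def tmon_def)
  have d: "deriv (\<lambda>s. laurent_f A x (\<chi> k. if k = j then s else t$k)) (t$j) =
      (\<Sum>i\<in>UNIV. of_int (A$j$i) * (x$i * tmon t i)) / t$j" if t: "\<And>j. t$j \<noteq> 0" for t :: "complex^'m" and j
  proof -
    define g where "g i k s = (if k = j then s else t$k) powi (A$k$i)" for i k s
    have gt: "(\<Prod>k\<in>UNIV. g i k (t$j)) = tmon t i" for i
      unfolding tmon_def g_def by (intro prod.cong refl) simp
    have dg: "(g i k has_field_derivative g i k (t$j) * (if k = j then of_int (A$j$i) / t$j else 0)) (at (t$j))" for i k
    proof (cases "k = j")
      case True
      have "((\<lambda>s. s powi (A$j$i)) has_field_derivative t$j powi (A$j$i) * (of_int (A$j$i) * (1 / t$j))) (at (t$j))"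
        by (rule powi_log_derivative) (use t[of j] in simp_all)
      then show ?thesis using True by (simp add: g_def[abs_def])
    next
      case False
      then show ?thesis by (simp add: g_def[abs_def])
    qed
    have "((\<lambda>s. \<Prod>k\<in>UNIV. g i k s) has_field_derivative
        (\<Prod>k\<in>UNIV. g i k (t$j)) * (\<Sum>k\<in>UNIV. if k = j then of_int (A$j$i) / t$j else 0)) (at (t$j))" for i
      by (rule prod_log_derivative) (use dg in simp_all)
    then have "((\<lambda>s. \<Prod>k\<in>UNIV. g i k s) has_field_derivative tmon t i * (of_int (A$j$i) / t$j)) (at (t$j))" for i
      by (simp add: gt)
    then have "((\<lambda>s. \<Sum>i\<in>UNIV. x$i * (\<Prod>k\<in>UNIV. g i k s)) has_field_derivative
        (\<Sum>i\<in>UNIV. x$i * (tmon t i * (of_int (A$j$i) / t$j)))) (at (t$j))"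
      by (intro DERIV_sum DERIV_cmult)
    note D = this
    have e1: "(\<lambda>s. \<Sum>i\<in>UNIV. x$i * (\<Prod>k\<in>UNIV. g i k s)) = (\<lambda>s. laurent_f A x (\<chi> k. if k = j then s else t$k))"
      by (simp add: laurent_f_def g_def)
    have e2: "(\<Sum>i\<in>UNIV. x$i * (tmon t i * (of_int (A$j$i) / t$j))) = (\<Sum>i\<in>UNIV. of_int (A$j$i) * (x$i * tmon t i)) / t$j"
      unfolding sum_divide_distrib by (intro sum.cong refl) simp
    show ?thesis by (rule DERIV_imp_deriv[OF D[unfolded e1 e2]])
  qed
  \<comment> \<open>The equation f = 0 is implied by the others: a kernel vector of \<open>A\<close>
    is a combination of the columns of \<open>B\<close>, whose entries sum to 0.\<close>
  have hom: "(\<Sum>i\<in>UNIV. u i) = 0" if u: "\<And>j. (\<Sum>i\<in>UNIV. of_int (A$j$i) * u i) = 0" for u :: "'n \<Rightarrow> complex"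
  proof -
    from kernel_complex[OF u] obtain l where "\<forall>i. u i = lf i l" by (rule exE)
    then have "(\<Sum>i\<in>UNIV. u i) = of_int (\<Sum>i\<in>UNIV. r1 i) * l$1 + of_int (\<Sum>i\<in>UNIV. r2 i) * l$2"
      by (simp add: lf_def sum.distrib sum_distrib_right)
    then show ?thesis by (simp add: sum1 sum2)
  qed
  show ?thesis
  proof
    assume "has_multiple_root A x"
    then obtain t :: "complex^'m" where t: "\<forall>j. t$j \<noteq> 0"
      "\<forall>j. deriv (\<lambda>s. laurent_f A x (\<chi> k. if k = j then s else t$k)) (t$j) = 0"
      unfolding has_multiple_root_def by (elim exE conjE) (rule that)
    have "(\<Sum>i\<in>UNIV. of_int (A$j$i) * (x$i * tmon t i)) = 0" for j
      using spec[OF t(2), of j] unfolding d[OF spec[OF t(1)]] using spec[OF t(1), of j] by simp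
    then show "\<exists>t. (\<forall>j. t$j \<noteq> 0) \<and> (\<forall>j. (\<Sum>i\<in>UNIV. of_int (A$j$i) * (x$i * tmon t i)) = 0)"
      by (intro exI[of _ t] conjI t(1) allI)
  next
    assume "\<exists>t. (\<forall>j. t$j \<noteq> 0) \<and> (\<forall>j. (\<Sum>i\<in>UNIV. of_int (A$j$i) * (x$i * tmon t i)) = 0)"
    then obtain t where t: "\<forall>j. t$j \<noteq> 0" "\<forall>j. (\<Sum>i\<in>UNIV. of_int (A$j$i) * (x$i * tmon t i)) = 0"
      by (elim exE conjE) (rule that)
    have "laurent_f A x t = 0" unfolding f by (rule hom, rule spec[OF t(2)])
    moreover have "deriv (\<lambda>s. laurent_f A x (\<chi> k. if k = j then s else t$k)) (t$j) = 0" for j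
      unfolding d[OF spec[OF t(1)]] using t(2) by simp
    ultimately show "has_multiple_root A x" unfolding has_multiple_root_def by (intro exI[of _ t] conjI t(1) allI)
  qed
qed

text \<open>At a multiple root the terms of f form a kernel vector (\<open>lf i l\<close>), and
  \<open>phi1\<close>, \<open>phi2\<close> do not see t. Conversely, \<open>torus_param\<close>
  recovers t from the quotients \<open>lf i l\<close> / x_i.\<close>

lemma disc_locus_iff:
  "x \<in> disc_locus A \<longleftrightarrow> (\<forall>i. x$i \<noteq> 0) \<and> (\<exists>l\<in>good. phi1 x = psi1 l \<and> phi2 x = psi2 l)"
proof (cases "\<forall>i. x$i \<noteq> 0")
  case False
  then show ?thesis unfolding disc_locus_def mem_Collect_eq by (simp only: simp_thms)
next
  case True
  then have nz: "x$i \<noteq> 0" for i by simp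
  have "has_multiple_root A x \<longleftrightarrow> (\<exists>l\<in>good. phi1 x = psi1 l \<and> phi2 x = psi2 l)"
    unfolding multiple_root_iff
  proof
    assume "\<exists>t. (\<forall>j. t$j \<noteq> 0) \<and> (\<forall>j. (\<Sum>i\<in>UNIV. of_int (A$j$i) * (x$i * tmon t i)) = 0)"
    then obtain t where t: "\<forall>j. t$j \<noteq> 0" "\<forall>j. (\<Sum>i\<in>UNIV. of_int (A$j$i) * (x$i * tmon t i)) = 0"
      by (elim exE conjE) (rule that)
    from kernel_complex[OF spec[OF t(2)]] obtain l where l: "\<forall>i. x$i * tmon t i = lf i l" by (rule exE)
    have tn: "tmon t i \<noteq> 0" for i by (rule tmon_nz, rule spec[OF t(1)])
    have "lf i l \<noteq> 0" for i unfolding spec[OF l, of i, symmetric] using nz[of i] tn[of i] by simp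
    then have "l \<in> good" by (simp add: good_def)
    moreover have "psi1 l = phi1 x" "psi2 l = phi2 x"
      unfolding psi1_def psi2_def phi1_def phi2_def l[rule_format, symmetric] power_int_mult_distrib prod.distrib
      using tmon_rows[OF spec[OF t(1)] AB(1)] tmon_rows[OF spec[OF t(1)] AB(2)] by simp_all
    ultimately show "\<exists>l\<in>good. phi1 x = psi1 l \<and> phi2 x = psi2 l"
      by (intro bexI[of _ l]) simp_all
  next
    assume "\<exists>l\<in>good. phi1 x = psi1 l \<and> phi2 x = psi2 l"
    then obtain l where l: "l \<in> good" "phi1 x = psi1 l" "phi2 x = psi2 l" by (elim bexE conjE) (rule that)
    define z where "z i = lf i l / x$i" for i
    have z: "z i \<noteq> 0" for i using goodD[OF l(1)] nz by (simp add: z_def)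
    have "(\<Prod>i\<in>UNIV. z i powi r1 i) = 1" "(\<Prod>i\<in>UNIV. z i powi r2 i) = 1"
      unfolding z_def power_int_divide_distrib prod_dividef psi1_def[symmetric] psi2_def[symmetric] phi1_def[symmetric] phi2_def[symmetric] l(2,3)
      using psi_nz[OF l(1)] by simp_all
    from torus_param[OF z this] obtain t where t: "\<forall>j. t$j \<noteq> 0" "\<forall>i. z i = tmon t i" by (elim exE conjE) (rule that)
    have xt: "x$i * tmon t i = lf i l" for i using spec[OF t(2), of i] nz[of i] by (simp add: z_def field_simps)
    have "(\<Sum>i\<in>UNIV. of_int (A$j$i) * (x$i * tmon t i)) = 0" for j
    proof -
      have "(\<Sum>i\<in>UNIV. of_int (A$j$i) * (x$i * tmon t i)) = of_int (\<Sum>i\<in>UNIV. A$j$i * r1 i) * l$1 + of_int (\<Sum>i\<in>UNIV. A$j$i * r2 i) * l$2"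
        unfolding xt by (simp add: lf_def distrib_left sum.distrib sum_distrib_right mult.assoc)
      then show ?thesis unfolding AB by simp
    qed
    then show "\<exists>t. (\<forall>j. t$j \<noteq> 0) \<and> (\<forall>j. (\<Sum>i\<in>UNIV. of_int (A$j$i) * (x$i * tmon t i)) = 0)" by (intro exI[of _ t] conjI t(1) allI)
  qed
  then show ?thesis unfolding disc_locus_def mem_Collect_eq using True by (simp only: simp_thms)
qed

end

section \<open>The defining polynomial of the discriminant locus\<close>

text \<open>Faithful only for nonnegative \<open>f\<close>, since \<open>nat\<close> sends negative
  values to 0.\<close>

definition expo :: "('n::finite \<Rightarrow> int) \<Rightarrow> 'n \<Rightarrow>\<^sub>0 nat" where
  "expo f = Abs_poly_mapping (\<lambda>i. nat (f i))"

lemma lookup_expo [simp]: "Poly_Mapping.lookup (expo f) i = nat (f i)"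
  unfolding expo_def by (subst Abs_poly_mapping_inverse) simp_all

lemma mon_expo:
  assumes "\<And>i. f i \<ge> 0" shows "mon (expo f) x = (\<Prod>i\<in>UNIV. x$i powi f i)"
  using assms by (simp add: mon_def power_int_def)

lemma mon_mult_coords: "mon m (\<chi> i. x$i * y i) = mon m x * (\<Prod>i\<in>UNIV. y i ^ Poly_Mapping.lookup m i)"
  by (simp add: mon_def power_mult_distrib prod.distrib)

text \<open>Along a ray s x both factors become polynomials in s with product 1, hence constants.
  Each equals its value at s = 0, the constant coefficient, which is then a unit of the
  integers.\<close>

lemma mpoly_int_unit_cases:
  fixes H H' :: "('n::finite \<Rightarrow>\<^sub>0 nat) \<Rightarrow>\<^sub>0 int"
  assumes "H * H' = 1" shows "H = 1 \<or> H = - 1"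
proof -
  define dg where "dg m = (\<Sum>i\<in>UNIV. Poly_Mapping.lookup m i)" for m :: "'n \<Rightarrow>\<^sub>0 nat"
  define q where "q p x = (\<Sum>m\<in>Poly_Mapping.keys p. monom (of_int (Poly_Mapping.lookup p m) * mon m x) (dg m))"
    for p :: "('n \<Rightarrow>\<^sub>0 nat) \<Rightarrow>\<^sub>0 int" and x :: "complex^'n"
  have q: "poly (q p x) s = ieval p (\<chi> i. x$i * s)" for p s x
    unfolding q_def ieval_def mon_mult_coords poly_sum poly_monom dg_def power_sum by (simp only: mult.assoc)
  have dg0: "dg m = 0 \<longleftrightarrow> m = 0" for m
    by (auto simp: dg_def intro: poly_mapping_eqI)
  have const: "\<exists>c::int. p = Poly_Mapping.single 0 c" if pp: "p * p' = 1" for p p' :: "('n \<Rightarrow>\<^sub>0 nat) \<Rightarrow>\<^sub>0 int"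
  proof -
    have "ieval p x = ieval (Poly_Mapping.single 0 (Poly_Mapping.lookup p 0)) x" for x
    proof -
      have "poly (q p x * q p' x) s = poly 1 s" for s
        unfolding poly_mult q ieval_mult[symmetric] pp by simp
      then have "q p x * q p' x = 1" by (intro poly_eq_poly_eq_iff[THEN iffD1] ext)
      then have "degree (q p x) = 0"
        by (metis add_is_0 degree_1 degree_mult_eq mult_zero_left mult_zero_right zero_neq_one)
      then have "poly (q p x) 1 = poly (q p x) 0" by (elim degree_eq_zeroE) simp
      also have "poly (q p x) 0 = coeff (q p x) 0" by (rule poly_0_coeff_0)
      also have "\<dots> = (\<Sum>m\<in>Poly_Mapping.keys p. if m = 0 then of_int (Poly_Mapping.lookup p m) * mon m x else 0)"
        unfolding q_def coeff_sum coeff_monom dg0 ..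
      also have "\<dots> = of_int (Poly_Mapping.lookup p 0)"
        by (simp add: sum.delta in_keys_iff)
      finally show ?thesis unfolding q by (simp add: vec_eq_iff)
    qed
    then have "p = Poly_Mapping.single 0 (Poly_Mapping.lookup p 0)" by (intro ieval_inject)
    then show ?thesis by (rule exI)
  qed
  obtain c where c: "H = Poly_Mapping.single 0 c" using const[OF assms] by (rule exE)
  obtain c' where c': "H' = Poly_Mapping.single 0 c'"
    using const[OF assms[unfolded mult.commute[of H]]] by (rule exE)
  have "Poly_Mapping.single (0 :: 'n \<Rightarrow>\<^sub>0 nat) (c * c') = 1"
    using assms unfolding c c' mult_single by simp
  from arg_cong[where f = "\<lambda>p. Poly_Mapping.lookup p 0", OF this] have "c * c' = 1" by simp
  then have "c = 1 \<or> c = - 1" by (rule zmult_eq_1_iff[THEN iffD1, THEN disj_forward]) simp_all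
  then show ?thesis unfolding c by (auto simp: single_uminus)
qed

lemma newton_polygon_uminus: "newton_polygon (- p) = newton_polygon p"
proof -
  have "Poly_Mapping.keys (- p) = Poly_Mapping.keys p" by (auto simp: in_keys_iff)
  then show ?thesis unfolding newton_polygon_def by simp
qed

lemma newton_polygon_1: "newton_polygon (1 :: ('n::finite \<Rightarrow>\<^sub>0 nat) \<Rightarrow>\<^sub>0 int) = {0}"
proof -
  have "(\<chi> i. real (Poly_Mapping.lookup (0 :: 'n \<Rightarrow>\<^sub>0 nat) i)) = 0" by (simp add: vec_eq_iff)
  then show ?thesis by (simp add: newton_polygon_def)
qed

context gale
begin

lemma phi_mult:
  "phi1 (\<chi> i. x$i * z i) = phi1 x * (\<Prod>i\<in>UNIV. z i powi r1 i)"
  "phi2 (\<chi> i. x$i * z i) = phi2 x * (\<Prod>i\<in>UNIV. z i powi r2 i)"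
  by (simp_all add: phi1_def phi2_def power_int_mult_distrib prod.distrib)

lemma phi_nz: "(\<And>i. x$i \<noteq> 0) \<Longrightarrow> phi1 x \<noteq> 0" "(\<And>i. x$i \<noteq> 0) \<Longrightarrow> phi2 x \<noteq> 0"
  by (simp_all add: phi1_def phi2_def)

lemma prod_powi_wt:
  assumes "\<And>i. x$i \<noteq> 0"
  shows "(\<Prod>i\<in>UNIV. x$i powi wt (r1 i) (r2 i) k) = phi1 x ^ fst k * phi2 x ^ snd k"
proof -
  have "x$i powi wt (r1 i) (r2 i) k = (x$i powi r1 i) ^ fst k * (x$i powi r2 i) ^ snd k" for i
    using assms[of i] unfolding wt_def by (simp add: power_int_add power_int_mult)
  then show ?thesis by (simp add: phi1_def phi2_def prod.distrib prod_power_distrib)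
qed

text \<open>The Laurent polynomial P(\<open>phi1\<close>, \<open>phi2\<close>) divided by the
  monomial with exponent \<open>\<mu>\<close>.\<close>

definition hom :: "('n \<Rightarrow> int) \<Rightarrow> int poly poly \<Rightarrow> ('n \<Rightarrow>\<^sub>0 nat) \<Rightarrow>\<^sub>0 int" where
  "hom \<mu> P = (\<Sum>k\<in>supp2 P. Poly_Mapping.single (expo (\<lambda>i. wt (r1 i) (r2 i) k - \<mu> i)) (cf P k))"

lemma ieval_hom:
  assumes x: "\<And>i. x$i \<noteq> 0" and \<mu>: "\<And>k i. k \<in> supp2 P \<Longrightarrow> \<mu> i \<le> wt (r1 i) (r2 i) k"
  shows "ieval (hom \<mu> P) x = (\<Prod>i\<in>UNIV. x$i powi (- \<mu> i)) * eval2 P (phi1 x) (phi2 x)"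
proof -
  have "mon (expo (\<lambda>i. wt (r1 i) (r2 i) k - \<mu> i)) x = (\<Prod>i\<in>UNIV. x$i powi (- \<mu> i)) * (phi1 x ^ fst k * phi2 x ^ snd k)"
    if "k \<in> supp2 P" for k
  proof -
    have "mon (expo (\<lambda>i. wt (r1 i) (r2 i) k - \<mu> i)) x = (\<Prod>i\<in>UNIV. x$i powi (- \<mu> i + wt (r1 i) (r2 i) k))"
      using \<mu>[OF that] by (subst mon_expo) simp_all
    also have "\<dots> = (\<Prod>i\<in>UNIV. x$i powi (- \<mu> i)) * (\<Prod>i\<in>UNIV. x$i powi wt (r1 i) (r2 i) k)"
      unfolding prod.distrib[symmetric] using x by (intro prod.cong refl power_int_add) simp
    finally show ?thesis unfolding prod_powi_wt[OF x] .
  qed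
  then have "ieval (hom \<mu> P) x = (\<Sum>k\<in>supp2 P. (\<Prod>i\<in>UNIV. x$i powi (- \<mu> i)) * (of_int (cf P k) * phi1 x ^ fst k * phi2 x ^ snd k))"
    unfolding hom_def ieval_sum by (intro sum.cong refl) (simp add: mult_ac)
  then show ?thesis
    unfolding sum_distrib_left[symmetric] by (simp add: eval2_sum_superset[OF finite_supp2 order.refl])
qed

lemma locus_torus: "x \<in> disc_locus A \<Longrightarrow> x$i \<noteq> 0"
  by (simp add: disc_locus_def)

lemma locus_translate:
  assumes x: "x \<in> disc_locus A" and t: "\<And>j. t$j \<noteq> 0"
  shows "(\<chi> i. x$i * tmon t i) \<in> disc_locus A"
proof -
  have "phi1 (\<chi> i. x$i * tmon t i) = phi1 x" "phi2 (\<chi> i. x$i * tmon t i) = phi2 x"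
    unfolding phi_mult tmon_rows[OF t AB(1)] tmon_rows[OF t AB(2)] by simp_all
  moreover have "\<forall>i. (\<chi> i. x$i * tmon t i)$i \<noteq> 0" using locus_torus[OF x] tmon_nz[OF t] by simp
  ultimately show ?thesis
    using conjunct2[OF x[unfolded disc_locus_iff]] unfolding disc_locus_iff by (intro conjI) simp_all
qed

definition lpt :: "complex^2 \<Rightarrow> complex^'n" where "lpt l = (\<chi> i. lf i l)"

lemma phi_lpt: "phi1 (lpt l) = psi1 l" "phi2 (lpt l) = psi2 l"
  by (simp_all add: phi1_def phi2_def psi1_def psi2_def lpt_def)

lemma lpt_locus: "l \<in> good \<Longrightarrow> lpt l \<in> disc_locus A"
  unfolding disc_locus_iff by (intro conjI bexI[of _ l] phi_lpt) (simp add: lpt_def good_def)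

lemma locus_param:
  assumes x: "x \<in> disc_locus A"
  shows "\<exists>l t. l \<in> good \<and> (\<forall>j. t$j \<noteq> 0) \<and> x = (\<chi> i. lpt l $ i * tmon t i)"
proof -
  obtain l where l: "l \<in> good" "phi1 x = psi1 l" "phi2 x = psi2 l"
    using conjunct2[OF x[unfolded disc_locus_iff]] by (elim bexE conjE) (rule that)
  define z where "z i = x$i / lf i l" for i
  have "(\<Prod>i\<in>UNIV. z i powi r1 i) = 1" "(\<Prod>i\<in>UNIV. z i powi r2 i) = 1"
    unfolding z_def power_int_divide_distrib prod_dividef psi1_def[symmetric] psi2_def[symmetric] phi1_def[symmetric] phi2_def[symmetric] l(2,3)
    using psi_nz[OF l(1)] by simp_all
  note pz = this
  have "z i \<noteq> 0" for i using goodD[OF l(1)] locus_torus[OF x] by (simp add: z_def)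
  from torus_param[OF this pz] obtain t where t: "\<forall>j. t$j \<noteq> 0" "\<forall>i. z i = tmon t i"
    by (elim exE conjE) (rule that)
  have "x = (\<chi> i. lpt l $ i * tmon t i)"
    unfolding vec_eq_iff vec_lambda_beta spec[OF t(2), symmetric] using goodD[OF l(1)] by (simp add: z_def lpt_def)
  then show ?thesis using l(1) t(1) by (intro exI[of _ l] exI[of _ t] conjI)
qed

definition vanishes :: "(('n \<Rightarrow>\<^sub>0 nat) \<Rightarrow>\<^sub>0 int) \<Rightarrow> bool" where
  "vanishes G \<longleftrightarrow> (\<forall>x\<in>disc_locus A. ieval G x = 0)"

text \<open>Every point of the locus is \<open>tmon t\<close> times a point \<open>lpt l\<close>; writing \<open>t\<close> as an exponential makes
  both parameter domains connected along complex lines.\<close>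

lemma vanishes_mult:
  assumes FG: "vanishes (F * G)" shows "vanishes F \<or> vanishes G"
proof (rule ccontr)
  assume "\<not> ?thesis"
  then have nv: "\<not> vanishes F" "\<not> vanishes G" by simp_all
  define pt where "pt \<theta> l = (\<chi> i. lpt l $ i * tmon (\<chi> j. exp (\<theta> $ j)) i)" for \<theta> :: "complex^'m" and l
  have ex: "\<exists>\<theta> l. l \<in> good \<and> ieval H (pt \<theta> l) \<noteq> 0" if nH: "\<not> vanishes H" for H
  proof -
    obtain x where x: "x \<in> disc_locus A" "ieval H x \<noteq> 0" using nH unfolding vanishes_def ball_simps by (elim bexE) (rule that)
    obtain l t where lt: "l \<in> good" "\<forall>j. t$j \<noteq> 0" "x = (\<chi> i. lpt l $ i * tmon t i)"
      using locus_param[OF x(1)] by (elim exE conjE) (rule that)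
    have t: "(\<chi> j. exp ((\<chi> j. Ln (t$j)) $ j)) = t" using lt(2) by (simp add: vec_eq_iff)
    have "pt (\<chi> j. Ln (t$j)) l = x" unfolding pt_def t lt(3) ..
    then show ?thesis using lt(1) x(2) by (intro exI[of _ "\<chi> j. Ln (t$j)"] exI[of _ l]) simp
  qed
  have loc: "pt \<theta> l \<in> disc_locus A" if "l \<in> good" for \<theta> l
    unfolding pt_def by (rule locus_translate[OF lpt_locus[OF that]]) simp
  have hl: "line_hol good (\<lambda>l. ieval H (pt \<theta> l))" for H \<theta>
    unfolding ieval_def mon_def pt_def lpt_def lf_def vec_lambda_beta
    by (intro line_hol_sum line_hol_mult line_hol_prod line_hol_power line_hol_add line_hol_const line_hol_coord)
  have he: "line_hol UNIV (\<lambda>\<theta>::complex^'m. exp (\<theta>$j) powi k)" for j k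
    unfolding line_hol_def by (auto intro!: holomorphic_intros)
  have ht: "line_hol UNIV (\<lambda>\<theta>. ieval H (pt \<theta> l))" for H l
    unfolding ieval_def mon_def pt_def tmon_def vec_lambda_beta
    by (intro line_hol_sum line_hol_mult line_hol_prod line_hol_power line_hol_const he)
  obtain \<theta>1 l1 where 1: "l1 \<in> good" "ieval F (pt \<theta>1 l1) \<noteq> 0" using ex[OF nv(1)] by (elim exE conjE) (rule that)
  obtain \<theta>2 l2 where 2: "l2 \<in> good" "ieval G (pt \<theta>2 l2) \<noteq> 0" using ex[OF nv(2)] by (elim exE conjE) (rule that)
  \<comment> \<open>A common \<open>\<theta>\<close> is found first, with \<open>l1\<close> and
    \<open>l2\<close> held fixed; then \<open>l\<close> varies with this \<open>\<theta>\<close>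
    fixed.\<close>
  have "\<exists>\<theta>. ieval F (pt \<theta> l1) * ieval G (pt \<theta> l2) \<noteq> 0"
  proof (rule ccontr)
    assume "\<not> ?thesis"
    then have "ieval F (pt \<theta> l1) * ieval G (pt \<theta> l2) = 0" for \<theta> by blast
    from line_hol_mult_eq_0[OF line_dom_UNIV ht ht this UNIV_I 1(2) UNIV_I] 2(2) show False by simp
  qed
  then obtain \<theta> where \<theta>: "ieval F (pt \<theta> l1) \<noteq> 0" "ieval G (pt \<theta> l2) \<noteq> 0" by auto
  have "ieval F (pt \<theta> l) * ieval G (pt \<theta> l) = 0" if "l \<in> good" for l
    using FG loc[OF that, of \<theta>] unfolding vanishes_def by (simp add: ieval_mult)
  from line_hol_mult_eq_0[OF line_dom_good hl hl this 1(1) \<theta>(1) 2(1)] \<theta>(2) show False by simp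
qed

end

section \<open>The grading by \<open>A\<close>, and homogeneous polynomials on the locus\<close>

context gale
begin

sublocale horn_matrix r1 r2 B
proof
  show "r1 = (\<lambda>i. B$i$1)" "r2 = (\<lambda>i. B$i$2)" by (simp_all add: r1_def[abs_def] r2_def[abs_def])
qed

text \<open>The degree for which the torus action multiplies a monomial by the character
  \<open>tch (deg m)\<close>.\<close>

definition deg :: "('n \<Rightarrow>\<^sub>0 nat) \<Rightarrow> int^'m" where
  "deg m = (\<chi> j. \<Sum>i\<in>UNIV. A$j$i * int (Poly_Mapping.lookup m i))"

definition tch :: "int^'m \<Rightarrow> complex^'m \<Rightarrow> complex" where
  "tch d t = (\<Prod>j\<in>UNIV. t$j powi d$j)"

lemma mon_translate:
  assumes "\<And>j. t$j \<noteq> 0" shows "mon m (\<chi> i. x$i * tmon t i) = mon m x * tch (deg m) t"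
proof -
  have "(\<Prod>i\<in>UNIV. tmon t i ^ Poly_Mapping.lookup m i) = (\<Prod>i\<in>UNIV. \<Prod>j\<in>UNIV. t$j powi (A$j$i * int (Poly_Mapping.lookup m i)))"
    unfolding tmon_def prod_power_distrib by (simp add: power_int_mult)
  also have "\<dots> = (\<Prod>j\<in>UNIV. \<Prod>i\<in>UNIV. t$j powi (A$j$i * int (Poly_Mapping.lookup m i)))" by (rule prod.swap)
  also have "\<dots> = tch (deg m) t" unfolding tch_def deg_def by (simp add: prod_powi_sum assms)
  finally show ?thesis unfolding mon_mult_coords by simp
qed

lemma powi_two_inj: "(2::complex) powi a = 2 powi b \<Longrightarrow> a = b"
proof -
  assume "(2::complex) powi a = 2 powi b"
  then have "norm ((2::complex) powi a) = norm ((2::complex) powi b)" by (rule arg_cong)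
  then have "(2::real) powi a = 2 powi b" unfolding norm_power_int by simp
  then show "a = b"
    using power_int_strict_increasing[of a b "2::real"] power_int_strict_increasing[of b a "2::real"]
    by (cases a b rule: linorder_cases) simp_all
qed

lemma tch_distinct:
  assumes "d \<noteq> d'" shows "\<exists>t\<in>{t. \<forall>j. t$j \<noteq> 0}. tch d t \<noteq> tch d' t"
proof -
  obtain k where k: "d$k \<noteq> d'$k" using assms by (auto simp: vec_eq_iff)
  define t :: "complex^'m" where "t = (\<chi> j. if j = k then 2 else 1)"
  have "tch e t = 2 powi (e$k)" for e
  proof -
    have "tch e t = (\<Prod>j\<in>UNIV. if j = k then 2 powi (e$k) else 1)"
      unfolding tch_def t_def by (intro prod.cong refl) simp
    then show ?thesis by simp
  qed
  then have "tch d t \<noteq> tch d' t" using powi_two_inj[of "d$k" "d'$k"] k by (simp only:) blast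
  then show ?thesis by (intro bexI[of _ t]) (simp_all add: t_def)
qed

definition part :: "(('n \<Rightarrow>\<^sub>0 nat) \<Rightarrow>\<^sub>0 int) \<Rightarrow> int^'m \<Rightarrow> ('n \<Rightarrow>\<^sub>0 nat) \<Rightarrow>\<^sub>0 int" where
  "part G d = (\<Sum>m\<in>{m\<in>Poly_Mapping.keys G. deg m = d}. Poly_Mapping.single m (Poly_Mapping.lookup G m))"

lemma sum_part: "G = (\<Sum>d\<in>deg ` Poly_Mapping.keys G. part G d)"
proof -
  have "(\<Sum>d\<in>deg ` Poly_Mapping.keys G. part G d) = (\<Sum>m\<in>Poly_Mapping.keys G. Poly_Mapping.single m (Poly_Mapping.lookup G m))"
    unfolding part_def by (rule sum.image_gen[symmetric]) simp
  then show ?thesis using poly_mapping_sum_single[of G] by simp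
qed

lemma ieval_part:
  "ieval (part G d) x = (\<Sum>m\<in>{m\<in>Poly_Mapping.keys G. deg m = d}. of_int (Poly_Mapping.lookup G m) * mon m x)"
  by (simp add: part_def ieval_sum)

text \<open>The locus is stable under the torus. Along an orbit, vanishing of \<open>G\<close> is a
  linear relation between distinct characters, whose coefficients are the values of the
  parts.\<close>

lemma vanishes_part:
  assumes G: "vanishes G" shows "vanishes (part G d)"
proof (cases "d \<in> deg ` Poly_Mapping.keys G")
  case False
  then have e: "{m\<in>Poly_Mapping.keys G. deg m = d} = {}" by auto
  show ?thesis unfolding vanishes_def ieval_part e by simp
next
  case True
  show ?thesis unfolding vanishes_def
  proof
    fix x assume x: "x \<in> disc_locus A"
    let ?T = "{t :: complex^'m. \<forall>j. t$j \<noteq> 0}"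
    have "\<forall>e\<in>deg ` Poly_Mapping.keys G. ieval (part G e) x = 0"
    proof (rule characters_independent[where T = ?T and ch = tch and m = "\<lambda>s t. \<chi> j. s$j * t$j"])
      show "?T \<noteq> {}" by (auto intro!: exI[of _ "\<chi> j. 1"])
      show "\<exists>t\<in>?T. tch i t \<noteq> tch j t" if "i \<noteq> j" for i j using tch_distinct[OF that] .
      fix t assume "t \<in> ?T"
      then have t: "t$j \<noteq> 0" for j by simp
      have "(\<Sum>e\<in>deg ` Poly_Mapping.keys G. ieval (part G e) x * tch e t) =
          (\<Sum>e\<in>deg ` Poly_Mapping.keys G. ieval (part G e) (\<chi> i. x$i * tmon t i))"
        unfolding ieval_part sum_distrib_right mon_translate[OF t] by (intro sum.cong refl) simp
      also have "\<dots> = ieval G (\<chi> i. x$i * tmon t i)"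
        unfolding ieval_sum[symmetric] sum_part[symmetric] ..
      also have "\<dots> = 0" using G locus_translate[OF x t] unfolding vanishes_def by (rule bspec)
      finally show "(\<Sum>e\<in>deg ` Poly_Mapping.keys G. ieval (part G e) x * tch e t) = 0" .
    qed (simp_all add: tch_def power_int_mult_distrib prod.distrib)
    then show "ieval (part G d) x = 0" using True by (rule bspec)
  qed
qed

lemma keys_part: "m \<in> Poly_Mapping.keys (part G d) \<Longrightarrow> deg m = d"
proof -
  assume "m \<in> Poly_Mapping.keys (part G d)"
  then have "m \<in> (\<Union>m\<in>{m\<in>Poly_Mapping.keys G. deg m = d}. Poly_Mapping.keys (Poly_Mapping.single m (Poly_Mapping.lookup G m)))"
    unfolding part_def using keys_sum[of _ "{m\<in>Poly_Mapping.keys G. deg m = d}"] by (rule rev_subsetD)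
  then show "deg m = d" by (auto split: if_splits)
qed

definition dual :: "('n \<Rightarrow> int) \<times> ('n \<Rightarrow> int)" where
  "dual = (SOME S. (\<Sum>i\<in>UNIV. fst S i * r1 i) = 1 \<and> (\<Sum>i\<in>UNIV. fst S i * r2 i) = 0 \<and>
    (\<Sum>i\<in>UNIV. snd S i * r1 i) = 0 \<and> (\<Sum>i\<in>UNIV. snd S i * r2 i) = 1)"
definition S1 where "S1 = fst dual"
definition S2 where "S2 = snd dual"

lemma dual_basis:
  "(\<Sum>i\<in>UNIV. S1 i * r1 i) = 1" "(\<Sum>i\<in>UNIV. S1 i * r2 i) = 0"
  "(\<Sum>i\<in>UNIV. S2 i * r1 i) = 0" "(\<Sum>i\<in>UNIV. S2 i * r2 i) = 1"
proof -
  obtain S1' S2' where S: "(\<Sum>i\<in>UNIV. S1' i * r1 i) = 1 \<and> (\<Sum>i\<in>UNIV. S1' i * r2 i) = 0 \<and>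
    (\<Sum>i\<in>UNIV. S2' i * r1 i) = 0 \<and> (\<Sum>i\<in>UNIV. S2' i * r2 i) = 1" using ex_dual_basis by (elim exE)
  have "\<exists>S. (\<Sum>i\<in>UNIV. fst S i * r1 i) = 1 \<and> (\<Sum>i\<in>UNIV. fst S i * r2 i) = 0 \<and>
    (\<Sum>i\<in>UNIV. snd S i * r1 i) = 0 \<and> (\<Sum>i\<in>UNIV. snd S i * r2 i) = 1"
    by (rule exI[of _ "(S1', S2')"]) (simp only: fst_conv snd_conv S)
  from someI_ex[OF this] show "(\<Sum>i\<in>UNIV. S1 i * r1 i) = 1" "(\<Sum>i\<in>UNIV. S1 i * r2 i) = 0"
    "(\<Sum>i\<in>UNIV. S2 i * r1 i) = 0" "(\<Sum>i\<in>UNIV. S2 i * r2 i) = 1"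
    unfolding S1_def S2_def dual_def by blast+
qed

lemma kernel_dual:
  assumes "\<And>j. (\<Sum>i\<in>UNIV. A$j$i * z i) = 0"
  shows "z i = (\<Sum>i\<in>UNIV. S1 i * z i) * r1 i + (\<Sum>i\<in>UNIV. S2 i * z i) * r2 i"
proof -
  from kernel[OF assms] obtain c1 c2 where z: "\<forall>i. z i = c1 * r1 i + c2 * r2 i" by (elim exE)
  have "(\<Sum>i\<in>UNIV. S i * z i) = c1 * (\<Sum>i\<in>UNIV. S i * r1 i) + c2 * (\<Sum>i\<in>UNIV. S i * r2 i)" for S
    unfolding z[rule_format] sum_distrib_left sum.distrib[symmetric] by (intro sum.cong refl) (simp add: algebra_simps)
  then have "(\<Sum>i\<in>UNIV. S1 i * z i) = c1" "(\<Sum>i\<in>UNIV. S2 i * z i) = c2" by (simp_all add: dual_basis)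
  then show ?thesis using spec[OF z, of i] by simp
qed

text \<open>A section of the quotient map: the dual basis turns (a, b) into a torus element on which
  \<open>phi1\<close> is a and \<open>phi2\<close> is b.\<close>

definition sig :: "complex \<Rightarrow> complex \<Rightarrow> 'n \<Rightarrow> complex" where
  "sig a b i = a powi S1 i * b powi S2 i"

lemma sig_nz: "a \<noteq> 0 \<Longrightarrow> b \<noteq> 0 \<Longrightarrow> sig a b i \<noteq> 0" by (simp add: sig_def)

lemma phi_sig:
  assumes "a \<noteq> 0" "b \<noteq> 0"
  shows "phi1 (\<chi> i. x$i * sig a b i) = phi1 x * a" "phi2 (\<chi> i. x$i * sig a b i) = phi2 x * b"
proof -
  have "(\<Prod>i\<in>UNIV. sig a b i powi r i) = a powi (\<Sum>i\<in>UNIV. S1 i * r i) * b powi (\<Sum>i\<in>UNIV. S2 i * r i)" for r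
    unfolding prod_powi_sum[OF assms(1), symmetric] prod_powi_sum[OF assms(2), symmetric] sig_def
    by (simp add: power_int_mult_distrib prod.distrib power_int_mult)
  then show "phi1 (\<chi> i. x$i * sig a b i) = phi1 x * a" "phi2 (\<chi> i. x$i * sig a b i) = phi2 x * b"
    unfolding phi_mult by (simp_all add: dual_basis)
qed

text \<open>The exponents of a homogeneous polynomial differ by lattice points of the kernel of \<open>A\<close>, so on
  the torus it is a monomial times a polynomial in \<open>phi1\<close> and \<open>phi2\<close>; the shift \<open>K\<close> avoids negative powers.\<close>

lemma homogeneous_form:
  assumes G': "\<forall>m\<in>Poly_Mapping.keys G. deg m = d"
  shows "\<exists>\<mu> P. (\<forall>k\<in>supp2 P. \<forall>i. \<mu> i \<le> wt (r1 i) (r2 i) k) \<and>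
    (\<forall>x. (\<forall>i. x$i \<noteq> 0) \<longrightarrow> ieval G x = (\<Prod>i\<in>UNIV. x$i powi (- \<mu> i)) * eval2 P (phi1 x) (phi2 x))"
proof (cases "Poly_Mapping.keys G = {}")
  case True
  then have "ieval G x = 0" for x by (simp add: ieval_def)
  then show ?thesis
    by (intro exI[of _ "\<lambda>i. 0"] exI[of _ 0]) (simp add: supp2_eq_empty[THEN iffD2, OF refl])
next
  case False
  then obtain m0 where m0: "m0 \<in> Poly_Mapping.keys G" by blast
  note G = bspec[OF G']
  let ?z = "\<lambda>m i. int (Poly_Mapping.lookup m i) - int (Poly_Mapping.lookup m0 i)"
  define \<kappa>1 \<kappa>2 where "\<kappa>1 m = (\<Sum>i\<in>UNIV. S1 i * ?z m i)" and "\<kappa>2 m = (\<Sum>i\<in>UNIV. S2 i * ?z m i)" for m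
  have diff: "?z m i = \<kappa>1 m * r1 i + \<kappa>2 m * r2 i" if m: "m \<in> Poly_Mapping.keys G" for m i
    unfolding \<kappa>1_def \<kappa>2_def
  proof (rule kernel_dual)
    fix j
    have "deg m = deg m0" using G[OF m] G[OF m0] by simp
    from arg_cong[where f = "\<lambda>d. d$j", OF this] show "(\<Sum>i\<in>UNIV. A$j$i * ?z m i) = 0"
      by (simp add: deg_def right_diff_distrib sum_subtractf)
  qed
  define K where "K = (\<Sum>m\<in>Poly_Mapping.keys G. \<bar>\<kappa>1 m\<bar> + \<bar>\<kappa>2 m\<bar>)"
  have K: "\<kappa>1 m + K \<ge> 0" "\<kappa>2 m + K \<ge> 0" if "m \<in> Poly_Mapping.keys G" for m
  proof -
    have "\<bar>\<kappa>1 m\<bar> + \<bar>\<kappa>2 m\<bar> \<le> K" unfolding K_def by (rule member_le_sum[OF that]) simp_all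
    then show "\<kappa>1 m + K \<ge> 0" "\<kappa>2 m + K \<ge> 0" by linarith+
  qed
  define q where "q m = (nat (\<kappa>1 m + K), nat (\<kappa>2 m + K))" for m
  define P where "P = (\<Sum>m\<in>Poly_Mapping.keys G. monom (monom (Poly_Mapping.lookup G m) (fst (q m))) (snd (q m)))"
  define \<mu> where "\<mu> i = K * r1 i + K * r2 i - int (Poly_Mapping.lookup m0 i)" for i
  have wq: "wt (r1 i) (r2 i) (q m) - \<mu> i = int (Poly_Mapping.lookup m i)" if m: "m \<in> Poly_Mapping.keys G" for m i
  proof -
    have "wt (r1 i) (r2 i) (q m) = r1 i * (\<kappa>1 m + K) + r2 i * (\<kappa>2 m + K)"
      using K[OF m] by (simp add: wt_def q_def)
    then show ?thesis using diff[OF m, of i] unfolding \<mu>_def by (simp add: algebra_simps)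
  qed
  have "\<mu> i \<le> wt (r1 i) (r2 i) k" if k: "k \<in> supp2 P" for k i
  proof -
    have "cf P k = (\<Sum>m\<in>Poly_Mapping.keys G. if q m = k then Poly_Mapping.lookup G m else 0)"
      unfolding cf_def P_def coeff_sum coeff_monom
      by (intro sum.cong refl) (simp add: prod_eq_iff)
    then have "\<exists>m\<in>Poly_Mapping.keys G. q m = k" using supp2_nz[OF k] by (intro ccontr[of "\<exists>m\<in>_. _ m"]) (simp add: sum.neutral)
    then obtain m where m: "m \<in> Poly_Mapping.keys G" "q m = k" by (elim bexE) (rule that)
    show ?thesis using wq[OF m(1), of i] unfolding m(2) by linarith
  qed
  moreover have "ieval G x = (\<Prod>i\<in>UNIV. x$i powi (- \<mu> i)) * eval2 P (phi1 x) (phi2 x)" if x: "\<forall>i. x$i \<noteq> 0" for x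
  proof -
    have "mon m x = (\<Prod>i\<in>UNIV. x$i powi (- \<mu> i)) * (phi1 x ^ fst (q m) * phi2 x ^ snd (q m))"
      if m: "m \<in> Poly_Mapping.keys G" for m
    proof -
      have "mon m x = (\<Prod>i\<in>UNIV. x$i powi int (Poly_Mapping.lookup m i))" unfolding mon_def by simp
      also have "\<dots> = (\<Prod>i\<in>UNIV. x$i powi (- \<mu> i + wt (r1 i) (r2 i) (q m)))"
        unfolding wq[OF m, symmetric] by (simp only: diff_conv_add_uminus add.commute)
      also have "\<dots> = (\<Prod>i\<in>UNIV. x$i powi (- \<mu> i)) * (\<Prod>i\<in>UNIV. x$i powi wt (r1 i) (r2 i) (q m))"
        unfolding prod.distrib[symmetric] using x by (intro prod.cong refl power_int_add) simp
      finally show ?thesis unfolding prod_powi_wt[of x, OF spec[OF x]] .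
    qed
    then have "ieval G x = (\<Sum>m\<in>Poly_Mapping.keys G. (\<Prod>i\<in>UNIV. x$i powi (- \<mu> i)) *
        (of_int (Poly_Mapping.lookup G m) * phi1 x ^ fst (q m) * phi2 x ^ snd (q m)))"
      unfolding ieval_def by (intro sum.cong refl) (simp add: mult_ac)
    then show ?thesis unfolding sum_distrib_left[symmetric] P_def by simp
  qed
  ultimately show ?thesis by (intro exI[of _ \<mu>] exI[of _ P] conjI ballI allI impI)
qed

end

section \<open>The nondegenerate case: the discriminant from \<open>P0\<close>\<close>

locale gale_nd = gale A B for A :: "int^'n::finite^'m::finite" and B :: "int^2^'n" +
  assumes nondeg': "\<exists>L\<in>lines. (\<Sum>j\<in>L. r1 j) \<noteq> 0 \<or> (\<Sum>j\<in>L. r2 j) \<noteq> 0"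
begin

sublocale horn_nd_matrix r1 r2 B
  by unfold_locales (rule nondeg')

text \<open>The largest admissible shift, so that for every variable some monomial of
  \<open>D\<close> does not contain it.\<close>

definition hD :: "'n \<Rightarrow> int" where "hD i = hmin (r1 i) (r2 i) P0"
definition D :: "('n \<Rightarrow>\<^sub>0 nat) \<Rightarrow>\<^sub>0 int" where "D = hom hD P0"

lemma hD_le: "k \<in> supp2 P0 \<Longrightarrow> hD i \<le> wt (r1 i) (r2 i) k"
  unfolding hD_def by (rule hmin_le)

lemma ieval_D:
  "(\<And>i. x$i \<noteq> 0) \<Longrightarrow> ieval D x = (\<Prod>i\<in>UNIV. x$i powi (- hD i)) * eval2 P0 (phi1 x) (phi2 x)"
  unfolding D_def by (rule ieval_hom) (simp_all add: hD_le)

lemma ieval_D_0: "(\<And>i. x$i \<noteq> 0) \<Longrightarrow> ieval D x = 0 \<longleftrightarrow> eval2 P0 (phi1 x) (phi2 x) = 0"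
  by (simp add: ieval_D)

lemma vanishes_D: "vanishes D"
  unfolding vanishes_def
proof
  fix x assume x: "x \<in> disc_locus A"
  obtain l where l: "l \<in> good" "phi1 x = psi1 l" "phi2 x = psi2 l"
    using conjunct2[OF x[unfolded disc_locus_iff]] by (elim bexE conjE) (rule that)
  have "van P0" unfolding van_iff_dvd by simp
  then show "ieval D x = 0" unfolding ieval_D_0[of x, OF locus_torus[OF x]] l(2,3) using l(1) by (rule vanD)
qed

text \<open>Up to a monomial, \<open>G\<close> is P(\<open>phi1\<close>, \<open>phi2\<close>) with P
  a multiple of \<open>P0\<close>. Additivity of \<open>hmin\<close> ensures that the cofactor is
  again a polynomial and not only a Laurent polynomial.\<close>

lemma D_dvd_homogeneous:
  assumes G: "\<forall>m\<in>Poly_Mapping.keys G. deg m = d" and v: "vanishes G"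
  shows "D dvd G"
proof -
  obtain \<mu> P where \<mu>P: "\<forall>k\<in>supp2 P. \<forall>i. \<mu> i \<le> wt (r1 i) (r2 i) k"
    "\<forall>x. (\<forall>i. x$i \<noteq> 0) \<longrightarrow> ieval G x = (\<Prod>i\<in>UNIV. x$i powi (- \<mu> i)) * eval2 P (phi1 x) (phi2 x)"
    using homogeneous_form[OF G] by (elim exE conjE) (rule that)
  have "van P" unfolding van_def
  proof
    fix l assume l: "l \<in> good"
    have nz: "\<forall>i. lpt l $ i \<noteq> 0" using goodD[OF l] by (simp add: lpt_def)
    have "(\<Prod>i\<in>UNIV. lpt l$i powi (- \<mu> i)) * eval2 P (phi1 (lpt l)) (phi2 (lpt l)) = 0"
      using v lpt_locus[OF l] unfolding vanishes_def spec[OF \<mu>P(2), THEN mp, OF nz, symmetric] by (rule bspec)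
    then show "eval2 P (psi1 l) (psi2 l) = 0" using nz by (simp add: phi_lpt)
  qed
  then obtain H where H: "P = P0 * H" unfolding van_iff_dvd by (elim dvdE)
  have \<nu>: "\<mu> i - hD i \<le> wt (r1 i) (r2 i) k" if k: "k \<in> supp2 H" for k i
  proof -
    have Hnz: "H \<noteq> 0" using k supp2_eq_empty[of H] by blast
    have Pnz: "P \<noteq> 0" unfolding H using Hnz P0_nz by simp
    then obtain k' where k': "k' \<in> supp2 P" "wt (r1 i) (r2 i) k' = hmin (r1 i) (r2 i) P"
      using hmin_in[OF Pnz, of "r1 i" "r2 i"] by (elim bexE) (rule that)
    have "\<mu> i \<le> hmin (r1 i) (r2 i) P" using spec[OF bspec[OF \<mu>P(1) k'(1)], of i] unfolding k'(2) .
    also have "\<dots> = hD i + hmin (r1 i) (r2 i) H" unfolding hD_def H using row_nz P0_nz Hnz by (rule hmin_mult)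
    also have "\<dots> \<le> hD i + wt (r1 i) (r2 i) k" using hmin_le[OF k] by simp
    finally show ?thesis by simp
  qed
  have "G = D * hom (\<lambda>i. \<mu> i - hD i) H"
  proof (rule ieval_inject)
    fix x :: "complex^'n" assume x: "\<forall>i. x$i \<noteq> 0"
    have "(\<Prod>i\<in>UNIV. x$i powi (- \<mu> i)) = (\<Prod>i\<in>UNIV. x$i powi (- hD i)) * (\<Prod>i\<in>UNIV. x$i powi (- (\<mu> i - hD i)))"
      unfolding prod.distrib[symmetric] using x by (intro prod.cong refl) (simp add: power_int_add[symmetric] del: power_int_minus)
    then show "ieval G x = ieval (D * hom (\<lambda>i. \<mu> i - hD i) H) x"
      unfolding spec[OF \<mu>P(2), THEN mp, OF x] ieval_mult ieval_D[of x, OF spec[OF x]]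
      by (subst ieval_hom) (simp_all add: x \<nu> H mult_ac del: power_int_minus)
  qed
  then show ?thesis by simp
qed

lemma D_dvd:
  assumes v: "vanishes G" shows "D dvd G"
proof -
  have "D dvd (\<Sum>d\<in>deg ` Poly_Mapping.keys G. part G d)"
    by (intro dvd_sum D_dvd_homogeneous[of _ d for d] vanishes_part v ballI) (rule keys_part)
  then show ?thesis unfolding sum_part[symmetric] .
qed

end

lemma norm_smult: "norm (z *s v) = norm z * norm (v :: complex^'n::finite)"
  by (simp add: norm_vec_def L2_set_def norm_mult power_mult_distrib sum_distrib_left[symmetric] real_sqrt_mult)

context gale_nd
begin

lemma expo_wt_inj:
  assumes "k \<in> supp2 P0" "k' \<in> supp2 P0"
    and e: "expo (\<lambda>i. wt (r1 i) (r2 i) k - hD i) = expo (\<lambda>i. wt (r1 i) (r2 i) k' - hD i)"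
  shows "k = k'"
proof -
  have "(int (fst k) - int (fst k')) * r1 i + (int (snd k) - int (snd k')) * r2 i = 0" for i
  proof -
    have "nat (wt (r1 i) (r2 i) k - hD i) = nat (wt (r1 i) (r2 i) k' - hD i)"
      using arg_cong[where f = "\<lambda>m. Poly_Mapping.lookup m i", OF e] by simp
    then have "wt (r1 i) (r2 i) k = wt (r1 i) (r2 i) k'"
      using hD_le[OF assms(1), of i] hD_le[OF assms(2), of i] by linarith
    then show ?thesis by (simp add: wt_def algebra_simps)
  qed
  from indep[OF this] show ?thesis by (simp add: prod_eq_iff)
qed

lemma lookup_D:
  "Poly_Mapping.lookup D m = (\<Sum>k\<in>supp2 P0. if expo (\<lambda>i. wt (r1 i) (r2 i) k - hD i) = m then cf P0 k else 0)"
  unfolding D_def hom_def lookup_sum lookup_single when_def ..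

lemma keys_D: "Poly_Mapping.keys D = (\<lambda>k. expo (\<lambda>i. wt (r1 i) (r2 i) k - hD i)) ` supp2 P0"
proof (intro equalityI subsetI)
  fix m assume m: "m \<in> Poly_Mapping.keys D"
  show "m \<in> (\<lambda>k. expo (\<lambda>i. wt (r1 i) (r2 i) k - hD i)) ` supp2 P0"
  proof (rule ccontr)
    assume "\<not> ?thesis"
    then have "expo (\<lambda>i. wt (r1 i) (r2 i) k - hD i) \<noteq> m" if "k \<in> supp2 P0" for k using that by blast
    then have "Poly_Mapping.lookup D m = 0" unfolding lookup_D by (intro sum.neutral) simp
    then show False using m by (simp add: in_keys_iff)
  qed
next
  fix m assume "m \<in> (\<lambda>k. expo (\<lambda>i. wt (r1 i) (r2 i) k - hD i)) ` supp2 P0"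
  then obtain k where k: "k \<in> supp2 P0" "m = expo (\<lambda>i. wt (r1 i) (r2 i) k - hD i)" by (elim imageE) (rule that)
  have "Poly_Mapping.lookup D m = (\<Sum>k'\<in>supp2 P0. if k' = k then cf P0 k' else 0)"
    unfolding lookup_D k(2) by (intro sum.cong refl if_cong) (use expo_wt_inj[OF _ k(1)] in blast)
  also have "\<dots> = cf P0 k" using k(1) by simp
  finally show "m \<in> Poly_Mapping.keys D" using supp2_nz[OF k(1)] by (simp add: in_keys_iff)
qed

lemma newton_polygon_D: "newton_polygon D = bar_map B ` Q_B B"
proof -
  have "(\<lambda>m. \<chi> i. real (Poly_Mapping.lookup m i)) ` Poly_Mapping.keys D =
      (\<lambda>k. \<chi> i. of_int (wt (r1 i) (r2 i) k - hmin (r1 i) (r2 i) P0)) ` supp2 P0"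
    unfolding keys_D image_image
    by (intro image_cong refl) (simp add: vec_eq_iff hD_le flip: hD_def)
  then show ?thesis unfolding newton_polygon_def hull_supp_P0[symmetric] by (rule arg_cong)
qed

lemma D_nz: "\<exists>x. ieval D x \<noteq> 0"
proof (rule ccontr)
  assume "\<not> ?thesis"
  then have "D = 0" by (intro ieval_eq_0_imp_eq_0) blast
  then have "Poly_Mapping.keys D = {}" by simp
  then show False unfolding keys_D using P0_nz by simp
qed

lemma locus_nonempty: "\<exists>x. x \<in> disc_locus A"
  using good_nonempty lpt_locus by (elim bexE) (rule exI)

lemma not_vanishes_1: "\<not> vanishes 1"
  using locus_nonempty by (auto simp: vanishes_def)

lemma D_cancel:
  assumes "D * H = D" shows "H = 1"
proof (rule ieval_inject)
  fix x :: "complex^'n"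
  obtain y where y: "ieval D y \<noteq> 0" using D_nz by (rule exE)
  have "ieval D z * (ieval H z - 1) = 0" for z
    using arg_cong[where f = "\<lambda>p. ieval p z", OF assms] by (simp add: ieval_mult algebra_simps)
  from line_hol_mult_eq_0[OF line_dom_UNIV line_hol_ieval line_hol_diff[OF line_hol_ieval line_hol_const] this UNIV_I y UNIV_I]
  show "ieval H x = ieval 1 x" by simp
qed

lemma D_not_unit: "\<not> D dvd 1"
proof
  assume "D dvd 1"
  then obtain E where E: "1 = D * E" by (elim dvdE)
  have "vanishes (D * E)" using vanishes_D by (simp add: vanishes_def ieval_mult)
  then have "vanishes 1" unfolding E[symmetric] .
  then show False using not_vanishes_1 by blast
qed

text \<open>One factor vanishes on the locus, hence is a multiple of \<open>D\<close>, and
  cancelling \<open>D\<close> makes the other a unit.\<close>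

lemma irreducible_D: "irreducible D"
proof (rule irreducibleI)
  show "D \<noteq> 0" using D_nz by auto
  show "\<not> D dvd 1" by (rule D_not_unit)
  have main: "G dvd 1" if e: "D = F * G" and F: "vanishes F" for F G
  proof -
    obtain F' where F': "F = D * F'" using D_dvd[OF F] by (elim dvdE)
    have "D * (F' * G) = D" using e unfolding F' by (simp only: mult.assoc)
    from D_cancel[OF this] have "G * F' = 1" by (simp only: mult.commute)
    then show ?thesis by (metis dvd_triv_left)
  qed
  fix F G assume e: "D = F * G"
  have "vanishes (F * G)" using vanishes_D unfolding e .
  then show "F dvd 1 \<or> G dvd 1"
    using vanishes_mult main[OF e] main[OF e[unfolded mult.commute[of F]]] by blast
qed

text \<open>Whatever polynomial the choice in \<open>A_discriminant\<close> returns is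
  \<open>D\<close> up to sign.\<close>

lemma newton_polygon_unique:
  assumes D': "irreducible D'" and v: "vanishes D'"
  shows "newton_polygon D' = newton_polygon D"
proof -
  obtain H where H: "D' = D * H" using D_dvd[OF v] by (elim dvdE)
  have "H dvd 1" using irreducibleD[OF D' H] D_not_unit by blast
  then obtain H' where "1 = H * H'" by (elim dvdE)
  then have "H = 1 \<or> H = - 1" by (intro mpoly_int_unit_cases) (rule sym)
  then show ?thesis unfolding H by (elim disjE) (simp_all add: newton_polygon_uminus)
qed

text \<open>By the choice of \<open>hD i\<close> some monomial of \<open>D\<close> does not involve
  x_i, and setting x_i = 0 keeps exactly such monomials.\<close>

lemma D_nz_on_hyperplane: "\<exists>x. x$i = 0 \<and> ieval D x \<noteq> 0"
proof (rule ccontr)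
  assume "\<not> ?thesis"
  then have z: "ieval D x = 0" if "x$i = 0" for x using that by blast
  obtain k where k: "k \<in> supp2 P0" "wt (r1 i) (r2 i) k = hD i"
    unfolding hD_def using hmin_in[OF P0_nz, of "r1 i" "r2 i"] by (rule bexE)
  let ?X = "{m\<in>Poly_Mapping.keys D. Poly_Mapping.lookup m i = 0}"
  have "\<forall>m\<in>?X. (of_int (Poly_Mapping.lookup D m) :: complex) = 0"
  proof (rule mon_independent)
    fix x :: "complex^'n" assume "\<forall>i. x$i \<noteq> 0"
    define y where "y = (\<chi> j. if j = i then 0 else x$j)"
    have m1: "mon m y = mon m x" if m: "Poly_Mapping.lookup m i = 0" for m
      unfolding mon_def by (intro prod.cong refl) (simp add: y_def m)
    have m2: "mon m y = 0" if m: "Poly_Mapping.lookup m i \<noteq> 0" for m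
      unfolding mon_def by (rule prod_zero) (use m in \<open>auto simp: y_def intro!: exI[of _ i]\<close>)
    have "(\<Sum>m\<in>?X. of_int (Poly_Mapping.lookup D m) * mon m x) =
        (\<Sum>m\<in>Poly_Mapping.keys D. if Poly_Mapping.lookup m i = 0 then of_int (Poly_Mapping.lookup D m) * mon m x else 0)"
      by (rule sum.inter_filter) simp
    also have "\<dots> = ieval D y" unfolding ieval_def by (intro sum.cong refl) (simp add: m1 m2)
    also have "\<dots> = 0" by (rule z) (simp add: y_def)
    finally show "(\<Sum>m\<in>?X. of_int (Poly_Mapping.lookup D m) * mon m x) = 0" .
  qed simp
  moreover have "expo (\<lambda>i. wt (r1 i) (r2 i) k - hD i) \<in> ?X"
    unfolding keys_D using k by auto
  ultimately show False by (auto simp: in_keys_iff)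
qed

lemma continuous_ieval_line:
  "continuous_on S (\<lambda>p. ieval G (fst p + snd p *s v))"
  unfolding vector_scalar_mult_def
  by (intro continuous_intros continuous_on_add) 

text \<open>If every zero near \<open>x0\<close> had a vanishing coordinate, then moving each \<open>x\<close> along \<open>v\<close> to one of the
  coordinate hyperplanes would give a zero, so \<open>D\<close> would vanish on a whole hyperplane.\<close>

lemma torus_zeros_dense:
  assumes x0: "ieval D x0 = 0" and e: "e > 0"
  shows "\<exists>x. dist x x0 < e \<and> (\<forall>i. x$i \<noteq> 0) \<and> ieval D x = 0"
proof (rule ccontr)
  assume none: "\<not> ?thesis"
  have lin_add: "line_hol UNIV (\<lambda>v. ieval G (x0 + v))" for G
    unfolding ieval_def mon_def vector_add_component
    by (intro line_hol_sum line_hol_mult line_hol_prod line_hol_power line_hol_add line_hol_const line_hol_coord)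
  \<comment> \<open>A direction transversal to all coordinate hyperplanes along which
    \<open>D\<close> is not identically zero.\<close>
  have "\<exists>v\<in>UNIV. (\<Prod>q\<in>UNIV. case q of None \<Rightarrow> ieval D (x0 + v) | Some i \<Rightarrow> v$i) \<noteq> 0"
  proof (rule line_hol_prod_nonzero)
    fix q' :: "'n option"
    show "line_hol UNIV (\<lambda>v. case q' of None \<Rightarrow> ieval D (x0 + v) | Some i \<Rightarrow> v$i)"
      by (cases q') (simp_all add: lin_add)
    obtain y where y: "ieval D y \<noteq> 0" using D_nz by (rule exE)
    show "\<exists>v\<in>UNIV. (case q' of None \<Rightarrow> ieval D (x0 + v) | Some i \<Rightarrow> v$i) \<noteq> 0"
    proof (cases q')
      case None
      then show ?thesis using y by (intro bexI[of _ "y - x0"]) simp_all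
    next
      case (Some i)
      then show ?thesis by (intro bexI[of _ "\<chi> i. 1"]) simp_all
    qed
  qed simp_all
  then obtain v where "(\<Prod>q\<in>UNIV. case q of None \<Rightarrow> ieval D (x0 + v) | Some i \<Rightarrow> v$i) \<noteq> 0" by (rule bexE)
  then have v: "\<forall>q'. (case q' of None \<Rightarrow> ieval D (x0 + v) | Some i \<Rightarrow> v$i) \<noteq> 0" by simp
  have vD: "ieval D (x0 + v) \<noteq> 0" using spec[OF v, of None] by simp
  have vi: "v$i \<noteq> 0" for i using spec[OF v, of "Some i"] by simp
  define e' where "e' = e / (2 * (norm v + 1))"
  have e': "e' > 0" using e by (simp add: e'_def add_nonneg_pos)
  have "\<exists>d>0. \<forall>x\<in>UNIV. dist x x0 < d \<longrightarrow> (\<exists>z\<in>UNIV. dist z 0 < e' \<and> ieval D (x + z *s v) = 0)"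
  proof (rule root_near)
    show "continuous_on (UNIV \<times> UNIV) (\<lambda>p. ieval D (fst p + snd p *s v))" by (rule continuous_ieval_line)
    show "(\<lambda>z. ieval D (x + z *s v)) holomorphic_on UNIV" for x
      unfolding ieval_def mon_def vector_add_component vector_smult_component by (intro holomorphic_intros)
    show "ieval D (x0 + 0 *s v) = 0" using x0 by simp
    show "ieval D (x0 + 1 *s v) \<noteq> 0" using vD by simp
  qed (simp_all add: e' convex_connected)
  then obtain d where d: "d > 0" "\<forall>x\<in>UNIV. dist x x0 < d \<longrightarrow> (\<exists>z\<in>UNIV. dist z 0 < e' \<and> ieval D (x + z *s v) = 0)"
    by (elim exE conjE) (rule that)
  \<comment> \<open>\<open>D\<close> evaluated at the projection of x along v to the hyperplane x_i
    = 0. On this hyperplane \<open>f i\<close> agrees with \<open>D\<close>, so it is not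
    identically zero.\<close>
  define f where "f i x = ieval D (x + (- (x$i / v$i)) *s v)" for i x
  have half: "a / (2 * N) * N = a / 2" "a / N * N = a" if "N > 0" for a N :: real using that by simp_all
  have pos: "norm u + 1 > 0" for u :: "complex^'n" by (simp add: add_nonneg_pos)
  have norm_small: "norm (z *s v) < e / 2" if "norm z < e'" for z
  proof -
    have "norm (z *s v) = norm z * norm v" by (rule norm_smult)
    also have "\<dots> \<le> norm z * (norm v + 1)" by (intro mult_left_mono) simp_all
    also have "\<dots> < e' * (norm v + 1)" using that by (intro mult_strict_right_mono) (simp_all add: add_nonneg_pos)
    also have "\<dots> = e / 2" unfolding e'_def by (rule half(1)[OF pos])
    finally show ?thesis .
  qed
  have zero: "(\<Prod>i\<in>UNIV. f i x) = 0" if x: "dist x x0 < min d (e / 2)" for x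
  proof -
    have "dist x x0 < d" using x by simp
    then obtain z where z: "dist z 0 < e'" "ieval D (x + z *s v) = 0"
      using d(2) by (meson UNIV_I)
    have "dist (x + z *s v) x0 \<le> dist x x0 + norm (z *s v)"
      unfolding dist_norm by (metis add.commute add_diff_eq norm_triangle_ineq)
    also have "\<dots> < e" using x norm_small[of z] z(1) by simp
    finally have "dist (x + z *s v) x0 < e" .
    then obtain i where i: "(x + z *s v)$i = 0" using none z(2) by blast
    have "z = - (x$i / v$i)" using i vi[of i] by (simp add: field_simps add_eq_0_iff)
    then have "f i x = 0" using z(2) unfolding f_def by simp
    then show ?thesis by (intro prod_zero) auto
  qed
  have lf': "line_hol UNIV (f i)" for i
    unfolding f_def ieval_def mon_def vector_add_component vector_smult_component divide_inverse minus_mult_left[symmetric]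
      diff_conv_add_uminus[symmetric]
    by (intro line_hol_sum line_hol_mult line_hol_prod line_hol_power line_hol_diff line_hol_const line_hol_coord)
  have "\<exists>w\<in>UNIV. (\<Prod>i\<in>UNIV. f i w) \<noteq> 0"
  proof (rule line_hol_prod_nonzero)
    fix i
    obtain x where x: "x$i = 0 \<and> ieval D x \<noteq> 0" using D_nz_on_hyperplane by (rule exE)
    then have "f i x \<noteq> 0" by (simp add: f_def)
    then show "\<exists>x\<in>UNIV. f i x \<noteq> 0" by (intro bexI[of _ x]) simp_all
  qed (simp_all add: lf')
  then obtain w where w: "(\<Prod>i\<in>UNIV. f i w) \<noteq> 0" by (rule bexE)
  \<comment> \<open>The product vanishes on a ball around \<open>x0\<close>, and restriction to the
    line from \<open>x0\<close> to \<open>w\<close> carries this to \<open>w\<close>.\<close>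
  define g where "g s = (\<Prod>i\<in>UNIV. f i (x0 + s *s (w - x0)))" for s
  have P: "line_hol UNIV (\<lambda>x. \<Prod>i\<in>UNIV. f i x)" by (intro line_hol_prod lf')
  have "g holomorphic_on UNIV"
    using P[unfolded line_hol_def, THEN bspec, OF UNIV_I[of x0], THEN bspec, OF UNIV_I[of w]]
    unfolding g_def[abs_def] by (simp only: UNIV_I Collect_const if_True)
  define r where "r = min d (e / 2) / (norm (w - x0) + 1)"
  have r: "r > 0" using d(1) e by (simp add: r_def add_nonneg_pos)
  have "g s = 0" if s: "s \<in> ball 0 r" for s
    unfolding g_def
  proof (rule zero)
    have "dist (x0 + s *s (w - x0)) x0 = norm s * norm (w - x0)"
      unfolding dist_norm add_diff_cancel_left' by (rule norm_smult)
    also have "\<dots> \<le> norm s * (norm (w - x0) + 1)" by (intro mult_left_mono) simp_all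
    also have "\<dots> < r * (norm (w - x0) + 1)" using s by (intro mult_strict_right_mono) (simp_all add: add_nonneg_pos)
    also have "\<dots> = min d (e / 2)" unfolding r_def by (rule half(2)[OF pos])
    finally show "dist (x0 + s *s (w - x0)) x0 < min d (e / 2)" .
  qed
  then have "g 1 = 0"
    using \<open>g holomorphic_on UNIV\<close> r
    by (intro analytic_continuation[of g UNIV "ball 0 r" 0 1]) (auto simp: islimpt_ball)
  then show False using w by (simp add: g_def)
qed

end

context gale_nd
begin

text \<open>The root b moves continuously with a, and only finitely many first coordinates are
  spoiled by \<open>Bad\<close>. The bound \<open>e'\<close> keeps both coordinates away from
  0.\<close>

lemma torus_P0_zeros_approx:
  assumes y: "a \<noteq> 0" "b \<noteq> 0" "eval2 P0 a b = 0" and e: "e > 0"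
  shows "\<exists>a' b'. a' \<noteq> 0 \<and> b' \<noteq> 0 \<and> dist a' a < e \<and> dist b' b < e \<and> eval2 P0 a' b' = 0 \<and> (a', b') \<notin> Bad"
proof -
  define e' where "e' = min e (min (norm a) (norm b))"
  have e': "e' > 0" "e' \<le> e" "e' \<le> norm a" "e' \<le> norm b" using y e by (auto simp: e'_def)
  obtain b1 where b1: "eval2 P0 a b1 \<noteq> 0" using prime_fiber_nonzero[OF P0(1) degree_P0] by (rule exE)
  have "\<exists>d>0. \<forall>x\<in>UNIV. dist x a < d \<longrightarrow> (\<exists>z\<in>UNIV. dist z b < e' \<and> eval2 P0 x z = 0)"
  proof (rule root_near)
    show "continuous_on (UNIV \<times> UNIV) (\<lambda>p. eval2 P0 (fst p) (snd p))"
      unfolding eval2_sum_superset[OF finite_supp2 order.refl] by (intro continuous_intros)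
    show "eval2 P0 x holomorphic_on UNIV" for x
      unfolding eval2_sum_superset[OF finite_supp2 order.refl, abs_def] by (intro holomorphic_intros)
    show "eval2 P0 a b = 0" "eval2 P0 a b1 \<noteq> 0" by (fact y b1)+
  qed (simp_all add: e' convex_connected)
  then obtain d where d: "d > 0" "\<forall>x\<in>UNIV. dist x a < d \<longrightarrow> (\<exists>z\<in>UNIV. dist z b < e' \<and> eval2 P0 x z = 0)"
    by (elim exE conjE) (rule that)
  have "a islimpt ball a (min d e')" using d(1) e' by (simp add: islimpt_ball)
  then have "infinite (ball a (min d e'))" using islimpt_finite by (rule contrapos_pn)
  then have "infinite (ball a (min d e') - fst ` Bad)" using finite_Bad by (simp add: Diff_infinite_finite)
  from infinite_imp_nonempty[OF this] obtain a' where "a' \<in> ball a (min d e') - fst ` Bad"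
    unfolding ex_in_conv[symmetric] by (rule exE)
  then have a': "dist a' a < d" "dist a' a < e'" "a' \<notin> fst ` Bad" by (simp_all add: dist_commute)
  obtain b' where b': "dist b' b < e'" "eval2 P0 a' b' = 0"
    using bspec[OF d(2) UNIV_I, THEN mp, OF a'(1)] by (elim bexE conjE) (rule that)
  have "a' \<noteq> 0" using a'(2) e'(3) by (auto simp: dist_norm)
  moreover have "b' \<noteq> 0" using b'(1) e'(4) by (auto simp: dist_norm)
  moreover have "(a', b') \<notin> Bad" using a'(3) by (auto simp: image_iff)
  ultimately show ?thesis
    using a'(2) b' e'(2) by (intro exI[of _ a'] exI[of _ b'] conjI) simp_all
qed

text \<open>The image (\<open>phi1 x\<close>, \<open>phi2 x\<close>) is approximated by curve points
  off \<open>Bad\<close>, which the parametrization attains; the section \<open>sig\<close> lifts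
  them to points of the locus near \<open>x\<close>.\<close>

lemma torus_zero_in_closure:
  assumes x: "\<forall>i. x$i \<noteq> 0" and D: "ieval D x = 0"
  shows "x \<in> closure (disc_locus A)"
proof -
  let ?a = "phi1 x" and ?b = "phi2 x"
  have ab: "?a \<noteq> 0" "?b \<noteq> 0" using x by (simp_all add: phi_nz)
  have P: "eval2 P0 ?a ?b = 0" using D ieval_D_0 x by simp
  have "\<forall>n. \<exists>p. fst p \<noteq> 0 \<and> snd p \<noteq> 0 \<and> dist (fst p) ?a < inverse (real (Suc n)) \<and> dist (snd p) ?b < inverse (real (Suc n)) \<and>
      eval2 P0 (fst p) (snd p) = 0 \<and> p \<notin> Bad"
  proof
    fix n
    have "inverse (real (Suc n)) > 0" by simp
    from torus_P0_zeros_approx[OF ab P this] obtain a' b' where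
      "a' \<noteq> 0 \<and> b' \<noteq> 0 \<and> dist a' ?a < inverse (real (Suc n)) \<and> dist b' ?b < inverse (real (Suc n)) \<and> eval2 P0 a' b' = 0 \<and> (a', b') \<notin> Bad"
      by (elim exE)
    then show "\<exists>p. fst p \<noteq> 0 \<and> snd p \<noteq> 0 \<and> dist (fst p) ?a < inverse (real (Suc n)) \<and> dist (snd p) ?b < inverse (real (Suc n)) \<and>
      eval2 P0 (fst p) (snd p) = 0 \<and> p \<notin> Bad"
      by (intro exI[of _ "(a', b')"]) (unfold fst_conv snd_conv)
  qed
  from choice[OF this] obtain p where p: "\<forall>n. fst (p n) \<noteq> 0 \<and> snd (p n) \<noteq> 0 \<and> dist (fst (p n)) ?a < inverse (real (Suc n)) \<and>
      dist (snd (p n)) ?b < inverse (real (Suc n)) \<and> eval2 P0 (fst (p n)) (snd (p n)) = 0 \<and> p n \<notin> Bad" by (rule exE)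
  have l1: "(\<lambda>n. fst (p n)) \<longlonglongrightarrow> ?a"
    by (rule metric_tendsto_imp_tendsto[OF LIMSEQ_inverse_real_of_nat])
       (use p in \<open>auto intro!: always_eventually less_imp_le\<close>)
  have l2: "(\<lambda>n. snd (p n)) \<longlonglongrightarrow> ?b"
    by (rule metric_tendsto_imp_tendsto[OF LIMSEQ_inverse_real_of_nat])
       (use p in \<open>auto intro!: always_eventually less_imp_le\<close>)
  define s where "s n = (\<chi> i. x$i * sig (fst (p n) / ?a) (snd (p n) / ?b) i)" for n
  have "s n \<in> disc_locus A" for n
  proof -
    have nz: "fst (p n) / ?a \<noteq> 0" "snd (p n) / ?b \<noteq> 0" using spec[OF p, of n] ab by simp_all
    have ph: "phi1 (s n) = fst (p n)" "phi2 (s n) = snd (p n)" unfolding s_def phi_sig[OF nz] using ab by simp_all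
    let ?l = "vec2 (gr1 (fst (p n)) (snd (p n))) (gr2 (fst (p n)) (snd (p n)))"
    have P: "eval2 P0 (fst (p n)) (snd (p n)) = 0" and B: "(fst (p n), snd (p n)) \<notin> Bad" using spec[OF p, of n] by simp_all
    have g: "?l \<in> good" by (rule not_Bad_good[OF P B])
    have "\<forall>i. s n $ i \<noteq> 0" using x sig_nz[OF nz] by (simp add: s_def)
    moreover have "phi1 (s n) = psi1 ?l" "phi2 (s n) = psi2 ?l" unfolding ph log_gauss_inverse[OF P g] by (rule refl)+
    ultimately show ?thesis unfolding disc_locus_iff using g by (intro conjI bexI[of _ ?l])
  qed
  moreover have "s \<longlonglongrightarrow> x"
  proof (rule vec_tendstoI)
    fix i
    have "(\<lambda>n. x$i * ((fst (p n) / ?a) powi S1 i * (snd (p n) / ?b) powi S2 i)) \<longlonglongrightarrow> x$i * ((?a / ?a) powi S1 i * (?b / ?b) powi S2 i)"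
      by (intro tendsto_intros l1 l2) (use ab in simp_all)
    then show "(\<lambda>n. s n $ i) \<longlonglongrightarrow> x$i" using ab by (simp add: s_def sig_def)
  qed
  ultimately show ?thesis unfolding closure_sequential by (intro exI[of _ s] conjI allI)
qed

lemma zero_set_D: "mpoly_zero_set (int_to_cpoly D) = closure (disc_locus A)"
proof (intro equalityI subsetI)
  fix x assume "x \<in> mpoly_zero_set (int_to_cpoly D)"
  then have x: "ieval D x = 0" by (simp add: mpoly_zero_set_def mpoly_eval_int_to_cpoly)
  have "\<exists>y\<in>closure (disc_locus A). dist y x < e" if e: "e > 0" for e
  proof -
    obtain y where y: "dist y x < e \<and> (\<forall>i. y$i \<noteq> 0) \<and> ieval D y = 0" using torus_zeros_dense[OF x e] by (rule exE)
    then have "y \<in> closure (disc_locus A)" using torus_zero_in_closure by blast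
    then show ?thesis using y by (intro bexI[of _ y]) simp_all
  qed
  then have "x \<in> closure (closure (disc_locus A))" unfolding closure_approachable[of x "closure (disc_locus A)"] by blast
  then show "x \<in> closure (disc_locus A)" by simp
next
  fix x assume x: "x \<in> closure (disc_locus A)"
  have c: "closed {x. ieval D x = 0}"
    by (intro closed_Collect_eq continuous_on_ieval continuous_on_id continuous_on_const)
  have "closure (disc_locus A) \<subseteq> {x. ieval D x = 0}"
    by (rule closure_minimal[OF _ c]) (use vanishes_D in \<open>auto simp: vanishes_def\<close>)
  then have "x \<in> {x. ieval D x = 0}" using x by (rule subsetD)
  then show "x \<in> mpoly_zero_set (int_to_cpoly D)"
    by (simp add: mpoly_zero_set_def mpoly_eval_int_to_cpoly)
qed

lemma hypersurface: "is_hypersurface (closure (disc_locus A))"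
proof -
  have "\<exists>m\<in>Poly_Mapping.keys D. m \<noteq> 0"
  proof (rule ccontr)
    assume "\<not> ?thesis"
    then have "mon m x = 1" if "m \<in> Poly_Mapping.keys D" for m x using that by auto
    then have c: "ieval D x = ieval D y" for x y unfolding ieval_def by (intro sum.cong refl) simp
    obtain x where "x \<in> disc_locus A" using locus_nonempty by (rule exE)
    then have "ieval D x = 0" using vanishes_D unfolding vanishes_def by blast
    moreover obtain y where "ieval D y \<noteq> 0" using D_nz by (rule exE)
    ultimately show False using c[of x y] by simp
  qed
  then have "mpoly_nonconstant (int_to_cpoly D)" by (simp add: mpoly_nonconstant_def)
  then show ?thesis unfolding is_hypersurface_def using zero_set_D by (intro exI[of _ "int_to_cpoly D"] conjI)
qed

lemma newton_polygon_discriminant: "newton_polygon (A_discriminant A) = bar_map B ` Q_B B"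
proof -
  let ?P = "\<lambda>D. irreducible D \<and> mpoly_zero_set (int_to_cpoly D) = closure (disc_locus A)"
  have "\<exists>D. ?P D" by (intro exI[of _ D] conjI irreducible_D zero_set_D)
  from someI_ex[OF this] have P: "?P (A_discriminant A)" unfolding A_discriminant_def using hypersurface by simp
  have "vanishes (A_discriminant A)" unfolding vanishes_def
  proof
    fix x assume "x \<in> disc_locus A"
    then have "x \<in> mpoly_zero_set (int_to_cpoly (A_discriminant A))"
      unfolding conjunct2[OF P] by (rule subsetD[OF closure_subset])
    then show "ieval (A_discriminant A) x = 0" by (simp add: mpoly_zero_set_def mpoly_eval_int_to_cpoly)
  qed
  from newton_polygon_unique[OF conjunct1[OF P] this] show ?thesis unfolding newton_polygon_D .
qed

end

section \<open>The degenerate case: all line sums vanish\<close>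

locale gale_degenerate = gale A B for A :: "int^'n::finite^'m::finite" and B :: "int^2^'n" +
  assumes deg1: "L \<in> lines \<Longrightarrow> (\<Sum>j\<in>L. r1 j) = 0" and deg2: "L \<in> lines \<Longrightarrow> (\<Sum>j\<in>L. r2 j) = 0"
begin

lemma prod_lines: "(\<Prod>L\<in>lines. \<Prod>j\<in>L. f j) = (\<Prod>j\<in>UNIV. f j :: complex)"
proof -
  have "(\<Prod>j\<in>UNIV. f j) = (\<Prod>L\<in>lin ` UNIV. \<Prod>j\<in>{j\<in>UNIV. lin j = L}. f j)"
    by (rule prod.image_gen) simp
  also have "\<dots> = (\<Prod>L\<in>lines. \<Prod>j\<in>L. f j)"
    unfolding lines_def
  proof (rule prod.cong[OF refl])
    fix L assume "L \<in> range lin"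
    then obtain i where L: "L = lin i" by (elim imageE)
    have "{j\<in>UNIV. lin j = L} = L" unfolding L using lin_eq self_in_lin by blast
    then show "(\<Prod>j\<in>{j\<in>UNIV. lin j = L}. f j) = (\<Prod>j\<in>L. f j)" by simp
  qed
  finally show ?thesis by simp
qed

text \<open>On each line all ratios \<open>lf j l / lf j l'\<close> agree, so each line contributes a zeroth power.\<close>

lemma psi_const:
  assumes l: "l \<in> good" "l' \<in> good" shows "psi1 l = psi1 l'" "psi2 l = psi2 l'"
proof -
  define q where "q j = lf j l / lf j l'" for j
  have q: "q j = q i" if j: "j \<in> lin i" for i j
  proof -
    have c: "(of_int (r1 i) :: complex) * of_int (r2 j) = of_int (r2 i) * of_int (r1 j)"
      using j unfolding lin_def mem_Collect_eq of_int_mult[symmetric] by simp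
    have "lf j l * lf i l' - lf i l * lf j l' = (of_int (r1 j) * of_int (r2 i) - of_int (r1 i) * of_int (r2 j)) * (l$1 * l'$2 - l$2 * l'$1)"
      by (simp add: lf_def algebra_simps)
    also have "\<dots> = 0" unfolding c by simp
    finally show ?thesis using goodD[OF l(2)] by (simp add: q_def frac_eq_eq)
  qed
  have qnz: "q j \<noteq> 0" for j using goodD[OF l(1)] goodD[OF l(2)] by (simp add: q_def)
  have one: "(\<Prod>j\<in>UNIV. q j powi r j) = 1" if r: "\<And>L. L \<in> lines \<Longrightarrow> (\<Sum>j\<in>L. r j) = 0" for r
    unfolding prod_lines[symmetric]
  proof (rule prod.neutral, rule ballI)
    fix L assume L: "L \<in> lines"
    then obtain i where i: "L = lin i" unfolding lines_def by (elim imageE)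
    have "(\<Prod>j\<in>L. q j powi r j) = (\<Prod>j\<in>L. q i powi r j)" by (intro prod.cong refl) (simp add: q i)
    also have "\<dots> = q i powi (\<Sum>j\<in>L. r j)" by (rule prod_powi_sum[OF qnz])
    also have "\<dots> = 1" unfolding r[OF L] by simp
    finally show "(\<Prod>j\<in>L. q j powi r j) = 1" .
  qed
  have "psi1 l / psi1 l' = 1" "psi2 l / psi2 l' = 1"
    unfolding psi1_def psi2_def prod_dividef[symmetric] power_int_divide_distrib[symmetric] q_def[symmetric]
    by (intro one deg1 deg2; assumption)+
  then show "psi1 l = psi1 l'" "psi2 l = psi2 l'" using psi_nz[OF l(2)] by simp_all
qed

text \<open>The sum over a line that is not relevant is a positive multiple of a row, hence nonzero.
  So every line is relevant, and its sum 0 is filtered out.\<close>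

lemma edges_empty: "QB_edges B = {#}"
proof -
  have r0: "rsum L = 0" if "L \<in> lines" for L
    unfolding rsum deg1[OF that] deg2[OF that] by (simp add: complex_eq_iff)
  have rel: "on_relevant_line B i" for i
  proof (rule ccontr)
    assume "\<not> on_relevant_line B i"
    then have "\<not> opp (lin i)" unfolding on_rel .
    from sum_non_opp(2)[OF _ this, of "\<lambda>v. v"] obtain t :: real where "t > 0" "rsum (lin i) = of_real t * row_c B i"
      by (auto simp: scaleR_conv_of_real)
    then show False using r0[of "lin i"] row_c_nz[of i] by (simp add: lines_def)
  qed
  have "image_mset (\<lambda>L. \<Sum>j\<in>L. row_c B j) (mset_set (relevant_lines B)) = image_mset (\<lambda>L. 0) (mset_set (relevant_lines B))"
    by (rule image_mset_cong) (use r0 in \<open>auto simp: relevant_lines rsum_def[symmetric]\<close>)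
  then show ?thesis unfolding QB_edges_def by (auto simp: rel)
qed

lemma Q_B_degenerate: "bar_map B ` Q_B B = {0}"
proof -
  have "edge_list B = []" using edge_list(1)[of B] unfolding edges_empty by simp
  then have "Q_B B = convex hull {sum_list (take k []) | k. k \<le> length ([] :: complex list)}"
    unfolding Q_B_def edge_list_def[symmetric] Let_def by simp
  also have "{sum_list (take k []) | k. k \<le> length ([] :: complex list)} = {0}" by auto
  finally have Q: "Q_B B = {0}" by simp
  have "nu B i = 0" for i unfolding nu_def Q by (simp add: det2_def)
  then show ?thesis unfolding Q by (simp add: bar_map_def det2_def vec_eq_iff)
qed

text \<open>Here \<open>phi1\<close> and \<open>phi2\<close> are constant on the locus, so restricting a defining polynomial to a
  2-dimensional subtorus would give a holomorphic function of two variables with an isolated zero.\<close>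

lemma not_hypersurface: "\<not> is_hypersurface (closure (disc_locus A))"
proof
  assume "is_hypersurface (closure (disc_locus A))"
  then obtain p where p: "mpoly_zero_set p = closure (disc_locus A)" unfolding is_hypersurface_def by (elim exE conjE)
  obtain l where l: "l \<in> good" using good_nonempty by (elim bexE)
  define x0 where "x0 = lpt l"
  have x0: "x0$i \<noteq> 0" for i using goodD[OF l] by (simp add: x0_def lpt_def)
  \<comment> \<open>\<open>phi1\<close> and \<open>phi2\<close> are constant on the locus and
    continuous on the torus, so they keep their values at torus points of the closure.\<close>
  have phi_cl: "phi1 x = phi1 x0 \<and> phi2 x = phi2 x0" if x: "x \<in> closure (disc_locus A)" "\<And>i. x$i \<noteq> 0" for x
  proof -
    obtain s where s: "\<forall>n. s n \<in> disc_locus A" "s \<longlonglongrightarrow> x"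
      using x(1) unfolding closure_sequential by (elim exE conjE) (rule that)
    have c: "phi1 (s n) = phi1 x0 \<and> phi2 (s n) = phi2 x0" for n
    proof -
      obtain l' where "l' \<in> good" "phi1 (s n) = psi1 l'" "phi2 (s n) = psi2 l'"
        using conjunct2[OF spec[OF s(1), of n, unfolded disc_locus_iff]] by (elim bexE conjE) (rule that)
      then show ?thesis using psi_const[of l' l] l by (simp add: x0_def phi_lpt)
    qed
    have "(\<lambda>n. phi1 (s n)) \<longlonglongrightarrow> phi1 x" "(\<lambda>n. phi2 (s n)) \<longlonglongrightarrow> phi2 x"
      unfolding phi1_def phi2_def by (intro tendsto_intros s(2) x(2))+
    then show ?thesis using c by (simp add: LIMSEQ_const_iff)
  qed
  define pt where "pt a b = (\<chi> i. x0$i * sig a b i)" for a b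
  have zero_iff: "a = 1 \<and> b = 1" if ab: "a \<noteq> 0" "b \<noteq> 0" and z: "mpoly_eval p (pt a b) = 0" for a b
  proof -
    have "pt a b \<in> closure (disc_locus A)" using z unfolding p[symmetric] mpoly_zero_set_def by simp
    moreover have "pt a b $ i \<noteq> 0" for i using x0 sig_nz[OF ab] by (simp add: pt_def)
    ultimately have "phi1 (pt a b) = phi1 x0 \<and> phi2 (pt a b) = phi2 x0" by (rule phi_cl)
    then show ?thesis unfolding pt_def phi_sig[OF ab] using phi_nz[of x0, OF x0] by simp
  qed
  have "pt 1 1 = x0" by (simp add: pt_def sig_def vec_eq_iff)
  then have "pt 1 1 \<in> closure (disc_locus A)"
    using subsetD[OF closure_subset lpt_locus[OF l]] unfolding x0_def by (simp only:)
  then have z1: "mpoly_eval p (pt 1 1) = 0" unfolding p[symmetric] mpoly_zero_set_def by simp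
  have nz: "a \<noteq> 0" if "a \<in> ball 1 (1/2)" for a :: complex using that by (auto simp: dist_norm)
  have "\<exists>d>0. \<forall>a\<in>ball 1 (1/2). dist a 1 < d \<longrightarrow> (\<exists>b\<in>ball 1 (1/2). dist b 1 < 1 \<and> mpoly_eval p (pt a b) = 0)"
  proof (rule root_near)
    show "continuous_on (ball 1 (1/2) \<times> ball 1 (1/2)) (\<lambda>q. mpoly_eval p (pt (fst q) (snd q)))"
      unfolding mpoly_eval_mon pt_def mon_def sig_def vec_lambda_beta
      by (intro continuous_intros) (use nz in auto)
    show "(\<lambda>b. mpoly_eval p (pt a b)) holomorphic_on ball 1 (1/2)" if "a \<in> ball 1 (1/2)" for a
      unfolding mpoly_eval_mon pt_def mon_def sig_def vec_lambda_beta
      by (intro holomorphic_intros) (use nz that in auto)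
    show "5/4 \<in> ball (1::complex) (1/2)" by (simp add: dist_norm)
    show "mpoly_eval p (pt 1 (5/4)) \<noteq> 0" using zero_iff[of 1 "5/4"] by auto
  qed (simp_all add: z1 convex_connected)
  then obtain d where d: "d > 0" "\<forall>a\<in>ball 1 (1/2). dist a 1 < d \<longrightarrow> (\<exists>b\<in>ball 1 (1/2). dist b 1 < 1 \<and> mpoly_eval p (pt a b) = 0)"
    by (elim exE conjE) (rule that)
  \<comment> \<open>A parameter close to 1 but different from it; the zero found over it contradicts
    that (1, 1) is the only one.\<close>
  define a :: complex where "a = 1 + of_real (min (d / 2) (1 / 4))"
  have a: "a \<in> ball 1 (1/2)" "dist a 1 < d" "a \<noteq> 1" using d(1) by (auto simp: a_def dist_norm)
  obtain b where b: "b \<in> ball 1 (1/2)" "mpoly_eval p (pt a b) = 0"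
    using bspec[OF d(2) a(1), THEN mp, OF a(2)] by (elim bexE conjE) (rule that)
  from zero_iff[OF nz[OF a(1)] nz[OF b(1)] b(2)] a(3) show False by simp
qed

lemma newton_polygon_discriminant: "newton_polygon (A_discriminant A) = bar_map B ` Q_B B"
  unfolding A_discriminant_def Q_B_degenerate using not_hypersurface by (simp add: newton_polygon_1)

end

theorem theorem4p3:
  fixes A :: "int^'n::finite^'m::finite" and B :: "int^2^'n"
  assumes dims: "CARD('m) + 2 = CARD('n)"
    and rank_A: "rank (\<chi> j k. (of_int (A$j$k) :: rat)) = CARD('m)"
    and homog: "\<exists>w::rat^'m. \<forall>i. (\<Sum>j\<in>UNIV. w$j * of_int (A$j$i)) = 1"
    and B_ker: "\<forall>c::2. A *v column c B = 0"
    and B_span: "\<forall>z::int^'n. A *v z = 0 \<longrightarrow> (\<exists>c1 c2::int. z = c1 *s column 1 B + c2 *s column 2 B)"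
    and B_indep: "\<forall>c1 c2::int. c1 *s column 1 B + c2 *s column 2 B = 0 \<longrightarrow> c1 = 0 \<and> c2 = 0"
    and rows_nz: "\<forall>i. row i B \<noteq> 0"
  shows "newton_polygon (A_discriminant A) = bar_map B ` Q_B B"
proof -
  interpret gale A B by (rule gale.intro) (fact assms)+
  show ?thesis
  proof (cases "\<exists>L\<in>lines. (\<Sum>j\<in>L. r1 j) \<noteq> 0 \<or> (\<Sum>j\<in>L. r2 j) \<noteq> 0")
    case True
    then interpret gale_nd A B by unfold_locales
    show ?thesis by (rule newton_polygon_discriminant)
  next
    case False
    then interpret gale_degenerate A B by unfold_locales blast+
    show ?thesis by (rule newton_polygon_discriminant)
  qed
qed

end
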